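(* Let $X$ be a compact Hausdorff space and $H$ a subhoop of $C(X)_{\ge0}$ which is nonzero and separating (for all $x\ne y$ in $X$ there is $h\in H$ with $h(x)=0\ne h(y)$), and which is finitely presentable as an abstract cancellative hoop. Let $u_1,u_2\in H$ be units. For $i=1,2$ let $m_i=m_{u_i}$ be the state on $(H,u_i)$ given by $m_i(h)=\lim_{k\to\infty}\frac1k\sum_{t\le k}e_t(h)$ for any enumeration without repetitions $e_1,e_2,\dots$ of the discrete extremal states of $(H,u_i)$ by nondecreasing denominators (the finite average if there are finitely many), and let $\mu_i$ be the unique regular Borel measure on $X$ with $m_i(h)=\int_X h\,\mathrm d\mu_i$ for all $h\in H$. Then $\mu_1$ and $\mu_2$ are absolutely continuous with respect to each other. More precisely, letting $d$ be the topological dimension of $X$: (i) if $d=0$ then $\mathrm d\mu_2=\frac{u_1}{u_2}\,\mathrm d\mu_1$; (ii) if $d\ge1$ then $\mathrm d\mu_2=C\bigl(\frac{u_1}{u_2}\bigr)^{d+2}\mathrm d\mu_1$, where $C=\Bigl(\int_X\frac{u_1^{d+2}}{u_2^{d+1}}\,\mathrm d\mu_1\Bigr)^{-1}$.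
   Context: Cancellative hoop: algebra $(H,+,\dot-,0)$ with $(H,+,0)$ a commutative monoid and $x\dot-x=0$, $(x\dot-y)\dot-z=x\dot-(y+z)$, $x+(y\dot-x)=y+(x\dot-y)$, $(x+y)\dot-y=x$; order $x\le y$ iff $x\dot-y=0$. $C(X)_{\ge0}$ is the hoop of nonnegative continuous real functions on $X$ with pointwise addition and $f\dot-g=\max\{0,f-g\}$. Finitely presented: quotient of a finitely generated free cancellative hoop by finitely many equations. Unit: $u\in H$ such that every $h\le ku$ for some integer $k\ge1$. A state on $(H,u)$ is a monoid homomorphism $m:H\to\mathbb{R}_{\ge0}$ with $m(u)=1$; an extremal state is a state that is a hoop homomorphism to $\mathbb{R}_{\ge0}$; it is discrete if its image is $b^{-1}\mathbb{Z}_{\ge0}$ for some (unique) integer $b\ge1$, its denominator. (The limit defining $m_i$ exists, is independent of the enumeration, and is a state; states correspond bijectively to regular Borel measures on $X$.) *)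

theory Defs
  imports "HOL-Analysis.Analysis"
begin

section \<open>Cancellative hoops\<close>

record 'a hoop =
  hcarrier :: "'a set"
  hplus :: "'a \<Rightarrow> 'a \<Rightarrow> 'a" (infixl \<open>\<oplus>\<index>\<close> 65)
  hmonus :: "'a \<Rightarrow> 'a \<Rightarrow> 'a" (infixl \<open>\<ominus>\<index>\<close> 65)
  hzero :: "'a" (\<open>\<zero>\<index>\<close>)

locale cancellative_hoop =
  fixes H :: "'a hoop" (structure)
  assumes zero_closed: "\<zero> \<in> hcarrier H"
    and plus_closed: "\<lbrakk>x \<in> hcarrier H; y \<in> hcarrier H\<rbrakk> \<Longrightarrow> x \<oplus> y \<in> hcarrier H"
    and monus_closed: "\<lbrakk>x \<in> hcarrier H; y \<in> hcarrier H\<rbrakk> \<Longrightarrow> x \<ominus> y \<in> hcarrier H"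
    and plus_assoc: "\<lbrakk>x \<in> hcarrier H; y \<in> hcarrier H; z \<in> hcarrier H\<rbrakk>
      \<Longrightarrow> (x \<oplus> y) \<oplus> z = x \<oplus> (y \<oplus> z)"
    and plus_comm: "\<lbrakk>x \<in> hcarrier H; y \<in> hcarrier H\<rbrakk> \<Longrightarrow> x \<oplus> y = y \<oplus> x"
    and plus_zero: "x \<in> hcarrier H \<Longrightarrow> x \<oplus> \<zero> = x"
    and monus_self: "x \<in> hcarrier H \<Longrightarrow> x \<ominus> x = \<zero>"
    and monus_monus: "\<lbrakk>x \<in> hcarrier H; y \<in> hcarrier H; z \<in> hcarrier H\<rbrakk>
      \<Longrightarrow> (x \<ominus> y) \<ominus> z = x \<ominus> (y \<oplus> z)"
    and plus_monus_swap: "\<lbrakk>x \<in> hcarrier H; y \<in> hcarrier H\<rbrakk>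
      \<Longrightarrow> x \<oplus> (y \<ominus> x) = y \<oplus> (x \<ominus> y)"
    and plus_monus_cancel: "\<lbrakk>x \<in> hcarrier H; y \<in> hcarrier H\<rbrakk> \<Longrightarrow> (x \<oplus> y) \<ominus> y = x"

definition hoop_le :: "'a hoop \<Rightarrow> 'a \<Rightarrow> 'a \<Rightarrow> bool" where
  "hoop_le H x y \<longleftrightarrow> x \<ominus>\<^bsub>H\<^esub> y = \<zero>\<^bsub>H\<^esub>"

definition hoop_mult :: "'a hoop \<Rightarrow> nat \<Rightarrow> 'a \<Rightarrow> 'a" where
  "hoop_mult H k x = (((\<oplus>\<^bsub>H\<^esub>) x) ^^ k) \<zero>\<^bsub>H\<^esub>"

definition hoop_unit :: "'a hoop \<Rightarrow> 'a \<Rightarrow> bool" where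
  "hoop_unit H u \<longleftrightarrow> u \<in> hcarrier H \<and>
     (\<forall>h\<in>hcarrier H. \<exists>k\<ge>1. hoop_le H h (hoop_mult H k u))"

definition monoid_hom :: "'a hoop \<Rightarrow> 'b hoop \<Rightarrow> ('a \<Rightarrow> 'b) \<Rightarrow> bool" where
  "monoid_hom A B f \<longleftrightarrow> f \<in> hcarrier A \<rightarrow> hcarrier B \<and> f \<zero>\<^bsub>A\<^esub> = \<zero>\<^bsub>B\<^esub> \<and>
     (\<forall>x\<in>hcarrier A. \<forall>y\<in>hcarrier A. f (x \<oplus>\<^bsub>A\<^esub> y) = f x \<oplus>\<^bsub>B\<^esub> f y)"

definition hoop_hom :: "'a hoop \<Rightarrow> 'b hoop \<Rightarrow> ('a \<Rightarrow> 'b) \<Rightarrow> bool" where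
  "hoop_hom A B f \<longleftrightarrow> monoid_hom A B f \<and>
     (\<forall>x\<in>hcarrier A. \<forall>y\<in>hcarrier A. f (x \<ominus>\<^bsub>A\<^esub> y) = f x \<ominus>\<^bsub>B\<^esub> f y)"

definition hoop_isomorphic :: "'a hoop \<Rightarrow> 'b hoop \<Rightarrow> bool" where
  "hoop_isomorphic A B \<longleftrightarrow> (\<exists>f. hoop_hom A B f \<and> bij_betw f (hcarrier A) (hcarrier B))"

definition subhoop :: "'a set \<Rightarrow> 'a hoop \<Rightarrow> bool" where
  "subhoop S A \<longleftrightarrow> S \<subseteq> hcarrier A \<and> \<zero>\<^bsub>A\<^esub> \<in> S \<and>
     (\<forall>x\<in>S. \<forall>y\<in>S. x \<oplus>\<^bsub>A\<^esub> y \<in> S \<and> x \<ominus>\<^bsub>A\<^esub> y \<in> S)"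

definition restrict_hoop :: "'a hoop \<Rightarrow> 'a set \<Rightarrow> 'a hoop" where
  "restrict_hoop A S = A\<lparr>hcarrier := S\<rparr>"


section \<open>Finite presentability\<close>

definition hoop_congruence :: "'a hoop \<Rightarrow> 'a rel \<Rightarrow> bool" where
  "hoop_congruence A \<theta> \<longleftrightarrow> equiv (hcarrier A) \<theta> \<and>
     (\<forall>(x, x')\<in>\<theta>. \<forall>(y, y')\<in>\<theta>.
        (x \<oplus>\<^bsub>A\<^esub> y, x' \<oplus>\<^bsub>A\<^esub> y') \<in> \<theta> \<and> (x \<ominus>\<^bsub>A\<^esub> y, x' \<ominus>\<^bsub>A\<^esub> y') \<in> \<theta>)"

definition generated_congruence :: "'a hoop \<Rightarrow> 'a rel \<Rightarrow> 'a rel" where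
  "generated_congruence A R = \<Inter>{\<theta>. hoop_congruence A \<theta> \<and> R \<subseteq> \<theta>}"

definition quotient_hoop :: "'a hoop \<Rightarrow> 'a rel \<Rightarrow> 'a set hoop" where
  "quotient_hoop A \<theta> =
    \<lparr>hcarrier = hcarrier A // \<theta>,
     hplus = (\<lambda>P Q. \<Union>x\<in>P. \<Union>y\<in>Q. \<theta> `` {x \<oplus>\<^bsub>A\<^esub> y}),
     hmonus = (\<lambda>P Q. \<Union>x\<in>P. \<Union>y\<in>Q. \<theta> `` {x \<ominus>\<^bsub>A\<^esub> y}),
     hzero = \<theta> `` {\<zero>\<^bsub>A\<^esub>}\<rparr>"

datatype hterm = TVar nat | TZero | TPlus hterm hterm | TMonus hterm hterm

primrec tvars :: "hterm \<Rightarrow> nat set" where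
  "tvars (TVar i) = {i}"
| "tvars TZero = {}"
| "tvars (TPlus s t) = tvars s \<union> tvars t"
| "tvars (TMonus s t) = tvars s \<union> tvars t"

definition term_algebra :: "nat \<Rightarrow> hterm hoop" where
  "term_algebra n =
    \<lparr>hcarrier = {t. tvars t \<subseteq> {..<n}}, hplus = TPlus, hmonus = TMonus, hzero = TZero\<rparr>"

text \<open>The free cancellative hoop on \<open>n\<close> generators: terms in \<open>n\<close> variables modulo the least
  congruence whose quotient satisfies the axioms. This is the relation of being equal in every
  cancellative hoop under every assignment of the variables.\<close>

definition free_hoop :: "nat \<Rightarrow> hterm set hoop" where
  "free_hoop n = quotient_hoop (term_algebra n)
     (\<Inter>{\<theta>. hoop_congruence (term_algebra n) \<theta> \<and>
         cancellative_hoop (quotient_hoop (term_algebra n) \<theta>)})"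

definition finitely_presentable :: "'a hoop \<Rightarrow> bool" where
  "finitely_presentable H \<longleftrightarrow>
     (\<exists>n E. finite E \<and> E \<subseteq> hcarrier (free_hoop n) \<times> hcarrier (free_hoop n) \<and>
        hoop_isomorphic H (quotient_hoop (free_hoop n) (generated_congruence (free_hoop n) E)))"


section \<open>Hoops of functions\<close>

definition nonneg_real_hoop :: "real hoop" where
  "nonneg_real_hoop =
    \<lparr>hcarrier = {0..}, hplus = (+), hmonus = (\<lambda>x y. max 0 (x - y)), hzero = 0\<rparr>"

definition cont_hoop :: "('x::topological_space \<Rightarrow> real) hoop" where
  "cont_hoop =
    \<lparr>hcarrier = {f. continuous_on UNIV f \<and> (\<forall>x. 0 \<le> f x)},
     hplus = (\<lambda>f g x. f x + g x),
     hmonus = (\<lambda>f g x. max 0 (f x - g x)),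
     hzero = (\<lambda>x. 0)\<rparr>"

definition separating :: "('x \<Rightarrow> real) set \<Rightarrow> bool" where
  "separating S \<longleftrightarrow> (\<forall>x y. x \<noteq> y \<longrightarrow> (\<exists>h\<in>S. h x = 0 \<and> h y \<noteq> 0))"


section \<open>States\<close>

text \<open>States are functions on the carrier only. They are made extensional, so that equality of
  states, on which enumerations without repetitions depend, is equality on the carrier.\<close>

definition state :: "'a hoop \<Rightarrow> 'a \<Rightarrow> ('a \<Rightarrow> real) \<Rightarrow> bool" where
  "state H u m \<longleftrightarrow> m \<in> extensional (hcarrier H) \<and> monoid_hom H nonneg_real_hoop m \<and> m u = 1"

definition extremal_state :: "'a hoop \<Rightarrow> 'a \<Rightarrow> ('a \<Rightarrow> real) \<Rightarrow> bool" where
  "extremal_state H u m \<longleftrightarrow> state H u m \<and> hoop_hom H nonneg_real_hoop m"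

definition has_denominator :: "'a hoop \<Rightarrow> ('a \<Rightarrow> real) \<Rightarrow> nat \<Rightarrow> bool" where
  "has_denominator H m b \<longleftrightarrow> b \<ge> 1 \<and> m ` hcarrier H = range (\<lambda>j::nat. real j / real b)"

definition denominator :: "'a hoop \<Rightarrow> ('a \<Rightarrow> real) \<Rightarrow> nat" where
  "denominator H m = (THE b. has_denominator H m b)"

definition discrete_states :: "'a hoop \<Rightarrow> 'a \<Rightarrow> ('a \<Rightarrow> real) set" where
  "discrete_states H u = {m. extremal_state H u m \<and> (\<exists>b. has_denominator H m b)}"

definition index_set :: "'b set \<Rightarrow> nat set" where
  "index_set D = (if finite D then {1..card D} else {1..})"

definition denominator_enumeration :: "'a hoop \<Rightarrow> 'a \<Rightarrow> (nat \<Rightarrow> 'a \<Rightarrow> real) \<Rightarrow> bool" where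
  "denominator_enumeration H u e \<longleftrightarrow>
     bij_betw e (index_set (discrete_states H u)) (discrete_states H u) \<and>
     mono_on (index_set (discrete_states H u)) (\<lambda>t. denominator H (e t))"

definition cesaro_state :: "'a hoop \<Rightarrow> 'a \<Rightarrow> (nat \<Rightarrow> 'a \<Rightarrow> real) \<Rightarrow> 'a \<Rightarrow> real" where
  "cesaro_state H u e h =
     (if finite (discrete_states H u)
      then (\<Sum>t = 1..card (discrete_states H u). e t h) / real (card (discrete_states H u))
      else lim (\<lambda>k. (\<Sum>t = 1..k. e t h) / real k))"


section \<open>Regular Borel measures and topological dimension\<close>

text \<open>On a compact space a regular Borel measure is understood to be finite.\<close>

definition regular_borel_measure :: "'x::topological_space measure \<Rightarrow> bool" where
  "regular_borel_measure M \<longleftrightarrow> sets M = sets borel \<and> finite_measure M \<and>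
     (\<forall>B\<in>sets borel.
        emeasure M B = (SUP K\<in>{K. K \<subseteq> B \<and> compact K}. emeasure M K) \<and>
        emeasure M B = (INF U\<in>{U. B \<subseteq> U \<and> open U}. emeasure M U))"

text \<open>The Lebesgue covering dimension; the empty space has dimension \<open>-1\<close>.\<close>

definition covering_dim_le :: "'x topology \<Rightarrow> int \<Rightarrow> bool" where
  "covering_dim_le X n \<longleftrightarrow> n \<ge> -1 \<and>
     (\<forall>\<U>. finite \<U> \<and> (\<forall>U\<in>\<U>. openin X U) \<and> \<Union>\<U> = topspace X \<longrightarrow>
        (\<exists>\<V>. finite \<V> \<and> (\<forall>V\<in>\<V>. openin X V) \<and> \<Union>\<V> = topspace X \<and>
           (\<forall>V\<in>\<V>. \<exists>U\<in>\<U>. V \<subseteq> U) \<and>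
           (\<forall>x\<in>topspace X. int (card {V\<in>\<V>. x \<in> V}) \<le> n + 1)))"

definition has_topological_dimension :: "'x topology \<Rightarrow> int \<Rightarrow> bool" where
  "has_topological_dimension X n \<longleftrightarrow>
     covering_dim_le X n \<and> (\<forall>m<n. \<not> covering_dim_le X m)"

end

theory Submission
  imports Defs
begin

text \<open>A finite presentation turns \<open>H\<close> into the hoop of terms evaluated on a cone \<open>W\<close>, which is a finite
  union of rational polyhedral cones in \<open>\<real>\<^sup>n\<close>; the points of \<open>X\<close> are the rays of \<open>W\<close>, and \<open>D = d + 1\<close> is the
  dimension of \<open>W\<close>. A discrete extremal state of \<open>(H, u)\<close> of denominator \<open>b\<close> is the map
  \<open>h \<mapsto> h(v) / u(v)\<close> for a primitive integer vector \<open>v \<in> W\<close> with \<open>u(v) = b\<close>. If \<open>d = 0\<close> there are finitely many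
  such vectors and both averages run over the same ones. Otherwise, the number of those with \<open>u(v) \<le> N\<close>, and
  the sum of their weights \<open>h(v) / u(v)\<close>, grow like constants times \<open>N\<^sup>D\<close>, and \<open>m(h)\<close> is the quotient of the two
  constants. If \<open>u\<^sub>1\<close> is close to \<open>r u\<^sub>2\<close> on the support of \<open>h\<close>, then the condition \<open>u\<^sub>2(v) \<le> N\<close> is nearly
  \<open>u\<^sub>1(v) \<le> r N\<close> and the weights differ by the factor \<open>r\<close>, so the sum is multiplied by \<open>r\<^sup>D\<^sup>+\<^sup>1 = r\<^sup>d\<^sup>+\<^sup>2\<close>: this is
  the density, up to a constant not depending on \<open>h\<close>. Only the existence of the limits is used, never
  their values.\<close>

subsection \<open>Terms and finite presentations\<close>

text \<open>The pieces on which a term is linear depend on the term, so the cone is cut up anew for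
  every pair \<open>u\<close>, \<open>h\<close>. That the top dimension \<open>D\<close> is the same
  each time is read off from the covering dimension of the space; this is why that dimension is
  bounded from both sides by \<open>D - 1\<close>. The limits exist because lattice points in
  polyhedral regions can be counted up to an error of lower order, and because passing to primitive
  vectors only divides by a zeta value. Comparing units gives inequalities: if
  \<open>u1 / u2\<close> lies between \<alpha> and \<beta> wherever \<open>h\<close> is positive,
  the two sums for \<open>h\<close> dominate each other up to powers of \<alpha> and \<beta>. Such
  inequalities, taken locally with \<beta> / \<alpha> close to 1, determine the density. They are
  available for \<open>h\<close> in \<open>H\<close> only, so Urysohn functions have to be built
  inside \<open>H\<close>, with a unit in the role of the constant 1. The constant that remains is a
  quotient of two densities of primitive vectors; integrating \<open>u2\<close>, whose average for
  the unit \<open>u2\<close> is 1, turns it into the stated \<open>C\<close>.\<close>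

definition hoop_closed :: "'a hoop \<Rightarrow> bool" where
  "hoop_closed A \<longleftrightarrow> \<zero>\<^bsub>A\<^esub> \<in> hcarrier A \<and>
     (\<forall>x\<in>hcarrier A. \<forall>y\<in>hcarrier A. x \<oplus>\<^bsub>A\<^esub> y \<in> hcarrier A \<and> x \<ominus>\<^bsub>A\<^esub> y \<in> hcarrier A)"

definition hoop_kernel :: "'a hoop \<Rightarrow> ('a \<Rightarrow> 'b) \<Rightarrow> 'a rel" where
  "hoop_kernel A f = {(x, y). x \<in> hcarrier A \<and> y \<in> hcarrier A \<and> f x = f y}"

section \<open>Congruences, quotients and kernels\<close>

lemma hoop_congruenceD:
  assumes "hoop_congruence A \<theta>"
  shows "equiv (hcarrier A) \<theta>"
    and "(x, x') \<in> \<theta> \<Longrightarrow> (y, y') \<in> \<theta> \<Longrightarrow> (x \<oplus>\<^bsub>A\<^esub> y, x' \<oplus>\<^bsub>A\<^esub> y') \<in> \<theta>"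
    and "(x, x') \<in> \<theta> \<Longrightarrow> (y, y') \<in> \<theta> \<Longrightarrow> (x \<ominus>\<^bsub>A\<^esub> y, x' \<ominus>\<^bsub>A\<^esub> y') \<in> \<theta>"
  using assms by (auto simp: hoop_congruence_def)

lemma quotient_hoop_ops:
  assumes "hoop_congruence A \<theta>" "x \<in> hcarrier A" "y \<in> hcarrier A"
  shows "\<theta> `` {x} \<oplus>\<^bsub>quotient_hoop A \<theta>\<^esub> \<theta> `` {y} = \<theta> `` {x \<oplus>\<^bsub>A\<^esub> y}"
    and "\<theta> `` {x} \<ominus>\<^bsub>quotient_hoop A \<theta>\<^esub> \<theta> `` {y} = \<theta> `` {x \<ominus>\<^bsub>A\<^esub> y}"
proof -
  note e = hoop_congruenceD(1)[OF assms(1)]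
  show "\<theta> `` {x} \<oplus>\<^bsub>quotient_hoop A \<theta>\<^esub> \<theta> `` {y} = \<theta> `` {x \<oplus>\<^bsub>A\<^esub> y}"
    unfolding quotient_hoop_def hoop.simps
    by (rule UN_equiv_class2[OF e e _ assms(2,3)])
       (auto simp: congruent2_def intro!: equiv_class_eq[OF e] hoop_congruenceD(2)[OF assms(1)])
  show "\<theta> `` {x} \<ominus>\<^bsub>quotient_hoop A \<theta>\<^esub> \<theta> `` {y} = \<theta> `` {x \<ominus>\<^bsub>A\<^esub> y}"
    unfolding quotient_hoop_def hoop.simps
    by (rule UN_equiv_class2[OF e e _ assms(2,3)])
       (auto simp: congruent2_def intro!: equiv_class_eq[OF e] hoop_congruenceD(3)[OF assms(1)])
qed

lemma quotient_hoop_carrier: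
  "hcarrier (quotient_hoop A \<theta>) = hcarrier A // \<theta>"
  "\<zero>\<^bsub>quotient_hoop A \<theta>\<^esub> = \<theta> `` {\<zero>\<^bsub>A\<^esub>}"
  by (simp_all add: quotient_hoop_def)

lemma hoop_closed_quotient:
  assumes "hoop_congruence A \<theta>" "hoop_closed A"
  shows "hoop_closed (quotient_hoop A \<theta>)"
  using assms(2) unfolding hoop_closed_def quotient_hoop_carrier
  by (auto elim!: quotientE simp: quotient_hoop_ops[OF assms(1)] intro!: quotientI)

lemma hoop_homD:
  assumes "hoop_hom A B f"
  shows "x \<in> hcarrier A \<Longrightarrow> f x \<in> hcarrier B" "f \<zero>\<^bsub>A\<^esub> = \<zero>\<^bsub>B\<^esub>"
    and "x \<in> hcarrier A \<Longrightarrow> y \<in> hcarrier A \<Longrightarrow> f (x \<oplus>\<^bsub>A\<^esub> y) = f x \<oplus>\<^bsub>B\<^esub> f y"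
    and "x \<in> hcarrier A \<Longrightarrow> y \<in> hcarrier A \<Longrightarrow> f (x \<ominus>\<^bsub>A\<^esub> y) = f x \<ominus>\<^bsub>B\<^esub> f y"
  using assms by (auto simp: hoop_hom_def monoid_hom_def)

lemma hoop_congruence_kernel:
  assumes "hoop_closed A" "hoop_hom A B f"
  shows "hoop_congruence A (hoop_kernel A f)"
  using assms(1) unfolding hoop_congruence_def hoop_kernel_def hoop_closed_def
  by (auto intro!: equivI refl_onI symI transI simp: hoop_homD(3,4)[OF assms(2)])

lemma hoop_congruence_Inter:
  assumes "\<Theta> \<noteq> {}" "\<And>\<theta>. \<theta> \<in> \<Theta> \<Longrightarrow> hoop_congruence A \<theta>"
  shows "hoop_congruence A (\<Inter>\<Theta>)"
proof -
  have "equiv (hcarrier A) (\<Inter>\<Theta>)"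
  proof (rule equivI)
    show "\<Inter>\<Theta> \<subseteq> hcarrier A \<times> hcarrier A"
    proof -
      obtain \<theta> where "\<theta> \<in> \<Theta>" using assms(1) by blast
      then show ?thesis using equiv_type[OF hoop_congruenceD(1)[OF assms(2)]] by blast
    qed
    show "refl_on (hcarrier A) (\<Inter>\<Theta>)"
      using hoop_congruenceD(1)[OF assms(2)] unfolding equiv_def refl_on_def by blast
    show "sym (\<Inter>\<Theta>)"
      using hoop_congruenceD(1)[OF assms(2)] unfolding equiv_def sym_def by blast
    show "trans (\<Inter>\<Theta>)"
      using hoop_congruenceD(1)[OF assms(2)] unfolding equiv_def trans_def by blast
  qed
  moreover have "(x \<oplus>\<^bsub>A\<^esub> y, x' \<oplus>\<^bsub>A\<^esub> y') \<in> \<Inter>\<Theta>" "(x \<ominus>\<^bsub>A\<^esub> y, x' \<ominus>\<^bsub>A\<^esub> y') \<in> \<Inter>\<Theta>"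
    if "(x, x') \<in> \<Inter>\<Theta>" "(y, y') \<in> \<Inter>\<Theta>" for x x' y y'
    using that hoop_congruenceD(2,3)[OF assms(2)] by blast+
  ultimately show ?thesis
    unfolding hoop_congruence_def by blast
qed

text \<open>The axioms are equations, so they pass from \<open>B\<close> to the quotient of
  \<open>A\<close> by the kernel, which embeds into \<open>B\<close>. Only closure is asked of
  \<open>A\<close>, because it will be the term algebra, where the equations fail.\<close>

lemma cancellative_quotient_kernel:
  assumes A: "hoop_closed A" and B: "cancellative_hoop B" and f: "hoop_hom A B f"
  shows "cancellative_hoop (quotient_hoop A (hoop_kernel A f))"
proof -
  interpret B: cancellative_hoop B by fact
  let ?\<theta> = "hoop_kernel A f"
  note cong = hoop_congruence_kernel[OF A f]
  note e = hoop_congruenceD(1)[OF cong]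
  note ops = quotient_hoop_ops[OF cong]
  note cl = A[unfolded hoop_closed_def]
  note h = hoop_homD[OF f]
  have eq: "?\<theta> `` {x} = ?\<theta> `` {y}" if "x \<in> hcarrier A" "y \<in> hcarrier A" "f x = f y" for x y
    using that by (intro equiv_class_eq[OF e]) (simp add: hoop_kernel_def)
  note simps = ops h cl
  show ?thesis
  proof (unfold_locales, goal_cases)
    case 1 then show ?case using hoop_closed_quotient[OF cong A] by (simp add: hoop_closed_def)
  next
    case (2 x y) then show ?case using hoop_closed_quotient[OF cong A] by (simp add: hoop_closed_def)
  next
    case (3 x y) then show ?case using hoop_closed_quotient[OF cong A] by (simp add: hoop_closed_def)
  next
    case (4 x y z) then show ?case unfolding quotient_hoop_carrier
      by (elim quotientE; simp add: simps; intro eq; simp add: simps B.plus_assoc)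
  next
    case (5 x y) then show ?case unfolding quotient_hoop_carrier
      by (elim quotientE; simp add: simps; intro eq; simp add: simps B.plus_comm)
  next
    case (6 x) then show ?case unfolding quotient_hoop_carrier
      by (elim quotientE; simp add: simps; intro eq; simp add: simps B.plus_zero)
  next
    case (7 x) then show ?case unfolding quotient_hoop_carrier
      by (elim quotientE; simp add: simps; intro eq; simp add: simps B.monus_self)
  next
    case (8 x y z) then show ?case unfolding quotient_hoop_carrier
      by (elim quotientE; simp add: simps; intro eq; simp add: simps B.monus_monus)
  next
    case (9 x y) then show ?case unfolding quotient_hoop_carrier
      by (elim quotientE; simp add: simps; intro eq; simp add: simps B.plus_monus_swap)
  next
    case (10 x y) then show ?case unfolding quotient_hoop_carrier
      by (elim quotientE; simp add: simps; intro eq; simp add: simps B.plus_monus_cancel)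
  qed
qed

lemma cancellative_nonneg_real_hoop: "cancellative_hoop nonneg_real_hoop"
  by unfold_locales (auto simp: nonneg_real_hoop_def max_def)

section \<open>Evaluation of terms and the free hoop\<close>

primrec teval :: "hterm \<Rightarrow> (nat \<Rightarrow> real) \<Rightarrow> real" where
  "teval (TVar i) w = w i"
| "teval TZero w = 0"
| "teval (TPlus s t) w = teval s w + teval t w"
| "teval (TMonus s t) w = max 0 (teval s w - teval t w)"

lemma teval_nonneg: "(\<And>i. 0 \<le> w i) \<Longrightarrow> 0 \<le> teval t w"
  by (induction t) auto

lemma hoop_closed_term_algebra: "hoop_closed (term_algebra n)"
  by (simp add: hoop_closed_def term_algebra_def)

lemma hoop_hom_teval:
  assumes "\<And>i. 0 \<le> w i"
  shows "hoop_hom (term_algebra n) nonneg_real_hoop (\<lambda>t. teval t w)"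
  using teval_nonneg[of w, OF assms]
  by (auto simp: hoop_hom_def monoid_hom_def term_algebra_def nonneg_real_hoop_def)

definition free_congruence :: "nat \<Rightarrow> hterm rel" where
  "free_congruence n = \<Inter>{\<theta>. hoop_congruence (term_algebra n) \<theta> \<and>
         cancellative_hoop (quotient_hoop (term_algebra n) \<theta>)}"

lemma free_hoop_eq: "free_hoop n = quotient_hoop (term_algebra n) (free_congruence n)"
  by (simp add: free_hoop_def free_congruence_def)

text \<open>The free congruence is the intersection of this family. One member shows that the family
  is nonempty; moreover every evaluation kernel bounds the intersection from above, which makes
  evaluation well defined on the free hoop.\<close>

lemma kernel_teval_in_family:
  assumes "\<And>i. 0 \<le> w i"
  shows "hoop_kernel (term_algebra n) (\<lambda>t. teval t w) \<in> {\<theta>. hoop_congruence (term_algebra n) \<theta> \<and>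
         cancellative_hoop (quotient_hoop (term_algebra n) \<theta>)}"
  using hoop_congruence_kernel[OF hoop_closed_term_algebra hoop_hom_teval[OF assms]]
    cancellative_quotient_kernel[OF hoop_closed_term_algebra cancellative_nonneg_real_hoop
      hoop_hom_teval[OF assms]]
  by simp

lemma free_congruence: "hoop_congruence (term_algebra n) (free_congruence n)"
  unfolding free_congruence_def using kernel_teval_in_family[of "\<lambda>_. 0" n]
  by (intro hoop_congruence_Inter) auto

lemma free_congruence_teval:
  assumes "(s, t) \<in> free_congruence n" "\<And>i. 0 \<le> w i"
  shows "teval s w = teval t w"
  using assms(1) kernel_teval_in_family[of w n, OF assms(2)]
  unfolding free_congruence_def hoop_kernel_def by blast

abbreviation fclass :: "nat \<Rightarrow> hterm \<Rightarrow> hterm set" where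
  "fclass n t \<equiv> free_congruence n `` {t}"

lemma free_hoop_carrier:
  "P \<in> hcarrier (free_hoop n) \<longleftrightarrow> (\<exists>t. tvars t \<subseteq> {..<n} \<and> P = fclass n t)"
  by (auto simp: free_hoop_eq quotient_hoop_carrier quotient_def term_algebra_def)

lemma free_hoop_carrier_image: "hcarrier (free_hoop n) = fclass n ` {t. tvars t \<subseteq> {..<n}}"
  using free_hoop_carrier by blast

lemma free_hoop_ops:
  assumes "tvars s \<subseteq> {..<n}" "tvars t \<subseteq> {..<n}"
  shows "fclass n s \<oplus>\<^bsub>free_hoop n\<^esub> fclass n t = fclass n (TPlus s t)"
    and "fclass n s \<ominus>\<^bsub>free_hoop n\<^esub> fclass n t = fclass n (TMonus s t)"
  using quotient_hoop_ops[OF free_congruence[of n], of s t] assms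
  by (simp_all add: free_hoop_eq) (simp_all add: term_algebra_def)

lemma hoop_closed_free_hoop: "hoop_closed (free_hoop n)"
  unfolding free_hoop_eq by (intro hoop_closed_quotient free_congruence hoop_closed_term_algebra)

lemma free_hoop_zero: "\<zero>\<^bsub>free_hoop n\<^esub> = fclass n TZero"
  by (simp add: free_hoop_eq quotient_hoop_carrier term_algebra_def)

lemma fclass_self:
  assumes "tvars t \<subseteq> {..<n}"
  shows "t \<in> fclass n t"
  using equiv_class_self[OF hoop_congruenceD(1)[OF free_congruence]] assms
  by (simp add: term_algebra_def)

lemma fclass_mem:
  assumes "s \<in> fclass n t"
  shows "tvars s \<subseteq> {..<n}" "fclass n s = fclass n t"
proof -
  note e = hoop_congruenceD(1)[OF free_congruence[of n]]
  show "fclass n s = fclass n t" using assms equiv_class_eq[OF e] by auto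
  show "tvars s \<subseteq> {..<n}" using assms equiv_type[OF e] by (auto simp: term_algebra_def)
qed

text \<open>The evaluation of terms at a point satisfying the relations factors through the presented
  hoop; this is the only way in which freeness and the presentation enter the proof.\<close>

lemma presented_teval:
  assumes E: "E \<subseteq> hcarrier (free_hoop n) \<times> hcarrier (free_hoop n)"
    and w: "\<And>i. 0 \<le> w i"
    and rel: "\<And>s t. (fclass n s, fclass n t) \<in> E \<Longrightarrow> tvars s \<subseteq> {..<n} \<Longrightarrow> tvars t \<subseteq> {..<n} \<Longrightarrow>
      teval s w = teval t w"
    and st: "tvars s \<subseteq> {..<n}" "tvars t \<subseteq> {..<n}"
    and eq: "(fclass n s, fclass n t) \<in> generated_congruence (free_hoop n) E"
  shows "teval s w = teval t w"
proof -
  \<comment> \<open>A class is evaluated through an arbitrary representative, on which the value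
    does not depend.\<close>
  define g where "g P = teval (SOME t. t \<in> P) w" for P
  have g: "g (fclass n t) = teval t w" if "tvars t \<subseteq> {..<n}" for t
  proof -
    have "(SOME s. s \<in> fclass n t) \<in> fclass n t"
      using fclass_self[OF that] by (rule someI)
    then show ?thesis unfolding g_def using free_congruence_teval[OF _ w] by fastforce
  qed
  have "hoop_hom (free_hoop n) nonneg_real_hoop g"
    unfolding hoop_hom_def monoid_hom_def
    using teval_nonneg[of w, OF w]
    by (auto simp: free_hoop_carrier g free_hoop_ops free_hoop_zero nonneg_real_hoop_def)
  \<comment> \<open>The kernel of the evaluation is a congruence containing the relations, hence it
    contains the congruence that they generate.\<close>
  then have "hoop_congruence (free_hoop n) (hoop_kernel (free_hoop n) g)"
    by (intro hoop_congruence_kernel hoop_closed_free_hoop)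
  moreover have "E \<subseteq> hoop_kernel (free_hoop n) g"
  proof
    fix PQ assume PQ: "PQ \<in> E"
    with E have "fst PQ \<in> hcarrier (free_hoop n)" "snd PQ \<in> hcarrier (free_hoop n)" by auto
    then obtain s t where st: "PQ = (fclass n s, fclass n t)" "tvars s \<subseteq> {..<n}" "tvars t \<subseteq> {..<n}"
      unfolding free_hoop_carrier by (metis prod.collapse)
    then show "PQ \<in> hoop_kernel (free_hoop n) g"
      using rel[of s t] PQ by (auto simp: hoop_kernel_def g free_hoop_carrier)
  qed
  ultimately have "(fclass n s, fclass n t) \<in> hoop_kernel (free_hoop n) g"
    using eq unfolding generated_congruence_def by blast
  then show ?thesis by (simp add: hoop_kernel_def g st)
qed

lemma generated_congruence:
  assumes "hoop_closed A" "R \<subseteq> hcarrier A \<times> hcarrier A"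
  shows "hoop_congruence A (generated_congruence A R)" "R \<subseteq> generated_congruence A R"
proof -
  have "hoop_congruence A (hcarrier A \<times> hcarrier A)"
    using assms(1) by (auto simp: hoop_congruence_def hoop_closed_def intro!: equivI refl_onI symI transI)
  then show "hoop_congruence A (generated_congruence A R)"
    unfolding generated_congruence_def using assms(2) by (intro hoop_congruence_Inter) auto
  show "R \<subseteq> generated_congruence A R"
    unfolding generated_congruence_def by blast
qed

text \<open>This is all that is kept of finite presentability. The vector \<open>p x\<close> lists
  the values at \<open>x\<close> of the functions that correspond to the generators, so
  \<open>H\<close> consists of the terms evaluated along \<open>p\<close>. The last clause says that
  the finitely many equations \<open>E\<close> axiomatise \<open>H\<close>: an equation valid on the
  whole space follows at every nonnegative vector that satisfies \<open>E\<close>.\<close>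

lemma finitely_presentable_term_presentation:
  fixes H :: "('x::topological_space \<Rightarrow> real) set"
  assumes sub: "subhoop H cont_hoop" and fp: "finitely_presentable (restrict_hoop cont_hoop H)"
  obtains n E p where "finite E"
    and "\<And>s t. (s, t) \<in> E \<Longrightarrow> tvars s \<subseteq> {..<n} \<and> tvars t \<subseteq> {..<n}"
    and "\<And>x i. 0 \<le> p x i" and "\<And>x i. i \<ge> n \<Longrightarrow> p x i = 0"
    and "H = {\<lambda>x. teval t (p x) |t. tvars t \<subseteq> {..<n}}"
    and "\<And>x s t. (s, t) \<in> E \<Longrightarrow> teval s (p x) = teval t (p x)"
    and "\<And>w s t. (\<And>i. 0 \<le> w i) \<Longrightarrow> (\<And>s t. (s, t) \<in> E \<Longrightarrow> teval s w = teval t w) \<Longrightarrow>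
      tvars s \<subseteq> {..<n} \<Longrightarrow> tvars t \<subseteq> {..<n} \<Longrightarrow> (\<And>x. teval s (p x) = teval t (p x)) \<Longrightarrow>
      teval s w = teval t w"
proof -
  let ?A = "restrict_hoop cont_hoop H"
  obtain n R f where R: "finite R" "R \<subseteq> hcarrier (free_hoop n) \<times> hcarrier (free_hoop n)"
    and hom: "hoop_hom ?A (quotient_hoop (free_hoop n) (generated_congruence (free_hoop n) R)) f"
    and bij: "bij_betw f (hcarrier ?A) (hcarrier (quotient_hoop (free_hoop n) (generated_congruence (free_hoop n) R)))"
    using fp unfolding finitely_presentable_def hoop_isomorphic_def by blast
  let ?G = "generated_congruence (free_hoop n) R"
      and ?Q = "quotient_hoop (free_hoop n) (generated_congruence (free_hoop n) R)"
  note G = generated_congruence[OF hoop_closed_free_hoop R(2)]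
  note Ge = hoop_congruenceD(1)[OF G(1)]
  have cA: "hcarrier ?A = H" and oA: "\<And>f g. f \<oplus>\<^bsub>?A\<^esub> g = (\<lambda>x. f x + g x)"
    "\<And>f g. f \<ominus>\<^bsub>?A\<^esub> g = (\<lambda>x. max 0 (f x - g x))" "\<zero>\<^bsub>?A\<^esub> = (\<lambda>x. 0)"
    by (simp_all add: restrict_hoop_def cont_hoop_def)
  have HC: "(\<lambda>x. 0) \<in> H" "\<And>f g. f \<in> H \<Longrightarrow> g \<in> H \<Longrightarrow> (\<lambda>x. f x + g x) \<in> H"
    "\<And>f g. f \<in> H \<Longrightarrow> g \<in> H \<Longrightarrow> (\<lambda>x. max 0 (f x - g x)) \<in> H" "\<And>f x. f \<in> H \<Longrightarrow> 0 \<le> f x"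
    using sub by (auto simp: subhoop_def cont_hoop_def)
  define c where "c t = ?G `` {fclass n t}" for t
  have cQ: "hcarrier ?Q = {c t |t. tvars t \<subseteq> {..<n}}"
    unfolding quotient_hoop_carrier quotient_def c_def free_hoop_carrier_image by auto
  have cop: "c s \<oplus>\<^bsub>?Q\<^esub> c t = c (TPlus s t)" "c s \<ominus>\<^bsub>?Q\<^esub> c t = c (TMonus s t)"
    if "tvars s \<subseteq> {..<n}" "tvars t \<subseteq> {..<n}" for s t
  proof -
    have m: "fclass n s \<in> hcarrier (free_hoop n)" "fclass n t \<in> hcarrier (free_hoop n)"
      using free_hoop_carrier that by blast+
    show "c s \<oplus>\<^bsub>?Q\<^esub> c t = c (TPlus s t)" "c s \<ominus>\<^bsub>?Q\<^esub> c t = c (TMonus s t)"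
      unfolding c_def quotient_hoop_ops[OF G(1) m] free_hoop_ops[OF that] by simp_all
  qed
  have c0: "\<zero>\<^bsub>?Q\<^esub> = c TZero"
    by (simp add: quotient_hoop_carrier free_hoop_zero c_def)
  \<comment> \<open>The element of \<open>H\<close> presented by the term \<open>t\<close>.\<close>
  define h where "h t = inv_into H f (c t)" for t
  have hH: "h t \<in> H" and fh: "f (h t) = c t" if "tvars t \<subseteq> {..<n}" for t
  proof -
    have "f ` H = {c t |t. tvars t \<subseteq> {..<n}}"
      using bij unfolding bij_betw_def cA cQ by (rule conjunct2)
    then have "c t \<in> f ` H" using that by blast
    then show "h t \<in> H" "f (h t) = c t"
      unfolding h_def by (rule inv_into_into, rule f_inv_into_f)
  qed
  have inj: "inj_on f H" using bij unfolding bij_betw_def cA by (rule conjunct1)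
  note fops = hoop_homD[OF hom, unfolded cA oA]
  \<comment> \<open>Coordinates from \<open>n\<close> on are 0, so that vectors agreeing in the
    first \<open>n\<close> coordinates are equal as functions.\<close>
  define p where "p x i = (if i < n then h (TVar i) x else 0)" for x i
  have ht: "h t = (\<lambda>x. teval t (p x))" if "tvars t \<subseteq> {..<n}" for t
    using that
  proof (induction t)
    case (TVar i) then show ?case by (auto simp: p_def)
  next
    case TZero
    have "h TZero = (\<lambda>x. 0)"
      by (rule inj_onD[OF inj]) (auto simp: fh fops(2) c0 HC hH)
    then show ?case by simp
  next
    case (TPlus s t)
    have "h (TPlus s t) = (\<lambda>x. h s x + h t x)"
      using TPlus.prems by (intro inj_onD[OF inj]) (auto simp: fh fops cop HC hH)
    then show ?case using TPlus by simp
  next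
    case (TMonus s t)
    have "h (TMonus s t) = (\<lambda>x. max 0 (h s x - h t x))"
      using TMonus.prems by (intro inj_onD[OF inj]) (auto simp: fh fops cop HC hH)
    then show ?case using TMonus by simp
  qed
  \<comment> \<open>The relations in \<open>R\<close> are pairs of classes; each is replaced by a
    pair of representatives, which keeps the set finite.\<close>
  define E where "E = (\<lambda>(P, Q). (SOME s. s \<in> P, SOME t. t \<in> Q)) ` R"
  have ER: "tvars s \<subseteq> {..<n} \<and> tvars t \<subseteq> {..<n} \<and> (fclass n s, fclass n t) \<in> R" if "(s, t) \<in> E" for s t
  proof -
    obtain PQ where PQ': "PQ \<in> R" "(s, t) = (SOME s. s \<in> fst PQ, SOME t. t \<in> snd PQ)"
      using \<open>(s, t) \<in> E\<close> unfolding E_def case_prod_beta by (rule imageE)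
    define P Q where "P = fst PQ" and "Q = snd PQ"
    then have PQ: "(P, Q) \<in> R" "s = (SOME s. s \<in> P)" "t = (SOME t. t \<in> Q)"
      using PQ' by simp_all
    obtain s' t' where st': "tvars s' \<subseteq> {..<n}" "tvars t' \<subseteq> {..<n}" "P = fclass n s'" "Q = fclass n t'"
    proof -
      have "P \<in> hcarrier (free_hoop n)" "Q \<in> hcarrier (free_hoop n)" using PQ(1) R(2) by auto
      then show thesis unfolding free_hoop_carrier using that by blast
    qed
    have "s \<in> P" "t \<in> Q" unfolding PQ st' by (rule someI, rule fclass_self, rule st')+
    then show ?thesis using fclass_mem PQ(1) unfolding st' by simp
  qed
  show ?thesis
  proof (rule that[of E n p])
    show "finite E" using R(1) by (simp add: E_def)
    show "tvars s \<subseteq> {..<n} \<and> tvars t \<subseteq> {..<n}" if "(s, t) \<in> E" for s t using ER[OF that] by simp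
    show "0 \<le> p x i" for x i using hH HC(4) by (simp add: p_def)
    show "p x i = 0" if "i \<ge> n" for x i using that by (simp add: p_def)
    show "H = {\<lambda>x. teval t (p x) |t. tvars t \<subseteq> {..<n}}"
    proof (intro equalityI subsetI)
      fix g assume g: "g \<in> H"
      then have "f g \<in> hcarrier ?Q" using fops(1) by simp
      then obtain t where t: "tvars t \<subseteq> {..<n}" "f g = c t" unfolding cQ by blast
      then have "g = h t" using g by (intro inj_onD[OF inj]) (auto simp: fh hH)
      then show "g \<in> {\<lambda>x. teval t (p x) |t. tvars t \<subseteq> {..<n}}" using ht t by auto
    qed (use ht hH in force)
    show "teval s (p x) = teval t (p x)" if "(s, t) \<in> E" for s t x
    proof -
      have "(fclass n s, fclass n t) \<in> ?G" using ER[OF that] G(2) by auto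
      then have "c s = c t" unfolding c_def by (rule equiv_class_eq[OF Ge])
      then have "h s = h t" by (simp add: h_def)
      then show ?thesis using ht ER[OF that] by metis
    qed
    show "teval s w = teval t w" if w: "\<And>i. 0 \<le> w i" and rel: "\<And>s t. (s, t) \<in> E \<Longrightarrow> teval s w = teval t w"
      and st: "tvars s \<subseteq> {..<n}" "tvars t \<subseteq> {..<n}" and eq: "\<And>x. teval s (p x) = teval t (p x)" for w s t
    proof (rule presented_teval[OF R(2) w _ st])
      show "teval s w = teval t w" if "(fclass n s, fclass n t) \<in> R" "tvars s \<subseteq> {..<n}" "tvars t \<subseteq> {..<n}" for s t
      proof -
        let ?s = "SOME s'. s' \<in> fclass n s" and ?t = "SOME t'. t' \<in> fclass n t"
        have "(?s, ?t) \<in> E" unfolding E_def by (rule image_eqI[OF _ that(1)]) simp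
        then have "teval ?s w = teval ?t w" by (rule rel)
        moreover have "?s \<in> fclass n s" "?t \<in> fclass n t"
          by (rule someI, rule fclass_self, rule that)+
        ultimately show ?thesis
          using free_congruence_teval[where w = w, OF _ w] by (metis Image_singleton_iff)
      qed
      \<comment> \<open>Terms with equal values at all points denote the same function, so their
        classes coincide in the presented hoop and \<open>presented_teval\<close> applies.\<close>
      have "h s = h t" using ht st eq by auto
      then have "c s = c t" using fh st by metis
      moreover have "fclass n t \<in> hcarrier (free_hoop n)" using st free_hoop_carrier by blast
      ultimately show "(fclass n s, fclass n t) \<in> ?G"
        unfolding c_def by (intro eq_equiv_class[OF _ Ge])
    qed
  qed
qed

subsection \<open>Rational polyhedral cones\<close>

text \<open>Truncated subtraction of natural numbers agrees with \<open>teval\<close> at integral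
  vectors; the values there are natural numbers, to which divisibility arguments apply.\<close>

primrec neval :: "hterm \<Rightarrow> (nat \<Rightarrow> nat) \<Rightarrow> nat" where
  "neval (TVar i) v = v i"
| "neval TZero v = 0"
| "neval (TPlus s t) v = neval s v + neval t v"
| "neval (TMonus s t) v = neval s v - neval t v"

lemma teval_of_nat: "teval t (\<lambda>i. real (v i)) = real (neval t v)"
  by (induction t) (auto simp: max_def of_nat_diff)

lemma teval_scale:
  assumes "0 \<le> c"
  shows "teval t (\<lambda>i. c * w i) = c * teval t w"
proof (induction t)
  case (TMonus s t)
  have "max 0 (c * teval s w - c * teval t w) = c * max 0 (teval s w - teval t w)"
    using assms by (simp add: max_mult_distrib_left right_diff_distrib)
  then show ?case using TMonus by simp
qed (simp_all add: algebra_simps)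

lemma neval_scale: "neval t (\<lambda>i. k * v i) = k * neval t v"
  by (induction t) (simp_all add: algebra_simps diff_mult_distrib2)

definition lform :: "nat \<Rightarrow> (nat \<Rightarrow> int) \<Rightarrow> (nat \<Rightarrow> real) \<Rightarrow> real" where
  "lform n \<phi> w = (\<Sum>i<n. real_of_int (\<phi> i) * w i)"

lemma lform_add: "lform n (\<lambda>i. \<phi> i + \<psi> i) w = lform n \<phi> w + lform n \<psi> w"
  by (simp add: lform_def sum.distrib algebra_simps)

lemma lform_diff: "lform n (\<lambda>i. \<phi> i - \<psi> i) w = lform n \<phi> w - lform n \<psi> w"
  by (simp add: lform_def sum_subtractf algebra_simps)

lemma lform_unit: "j < n \<Longrightarrow> lform n (\<lambda>i. if i = j then 1 else 0) w = w j"
  by (simp add: lform_def if_distrib[of real_of_int] if_distrib[of "\<lambda>x. x * _"] cong: if_cong)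

definition same_signs :: "nat \<Rightarrow> (nat \<Rightarrow> int) set \<Rightarrow> (nat \<Rightarrow> real) \<Rightarrow> (nat \<Rightarrow> real) \<Rightarrow> bool" where
  "same_signs n \<Phi> w w' \<longleftrightarrow> (\<forall>\<phi>\<in>\<Phi>. sgn (lform n \<phi> w') = sgn (lform n \<phi> w))"

lemma same_signs_mono: "same_signs n \<Phi> w w' \<Longrightarrow> \<Phi>' \<subseteq> \<Phi> \<Longrightarrow> same_signs n \<Phi>' w w'"
  by (auto simp: same_signs_def)

text \<open>Piecewise linearity with respect to the cells of a hyperplane arrangement
  \<open>\<Phi>\<close>. The set \<open>\<Lambda>\<close> of linear pieces is carried along because,
  when it is finite, finitely many new hyperplanes suffice to compare two such functions.\<close>

definition linear_on_signs :: "nat \<Rightarrow> (nat \<Rightarrow> int) set \<Rightarrow> (nat \<Rightarrow> int) set \<Rightarrow> ((nat \<Rightarrow> real) \<Rightarrow> real) \<Rightarrow> bool" where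
  "linear_on_signs n \<Phi> \<Lambda> f \<longleftrightarrow>
    (\<forall>w. \<exists>l\<in>\<Lambda>. \<forall>w'. same_signs n \<Phi> w w' \<longrightarrow> f w' = lform n l w')"

lemma linear_on_signsE:
  assumes "linear_on_signs n \<Phi> \<Lambda> f"
  obtains l where "l \<in> \<Lambda>" "\<And>w'. same_signs n \<Phi> w w' \<Longrightarrow> f w' = lform n l w'"
  using assms unfolding linear_on_signs_def by meson

text \<open>For a truncated difference the arrangement is refined by all differences of linear
  pieces: on each new cell the sign of the relevant difference is constant and decides whether the
  result is that difference or 0.\<close>

lemma teval_linear_on_signs:
  assumes "tvars t \<subseteq> {..<n}"
  shows "\<exists>\<Phi> \<Lambda>. finite \<Phi> \<and> finite \<Lambda> \<and> linear_on_signs n \<Phi> \<Lambda> (teval t)"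
  using assms
proof (induction t)
  case (TVar j)
  let ?l = "\<lambda>i. if i = j then 1 else (0::int)"
  have "linear_on_signs n {} {?l} (teval (TVar j))"
    using TVar lform_unit[of j n] by (simp add: linear_on_signs_def)
  then show ?case by blast
next
  case TZero
  have "linear_on_signs n {} {\<lambda>i. 0} (teval TZero)"
    by (simp add: linear_on_signs_def lform_def)
  then show ?case by blast
next
  case (TPlus s t)
  then obtain \<Phi> \<Lambda> \<Phi>' \<Lambda>' where fin: "finite \<Phi>" "finite \<Lambda>" "finite \<Phi>'" "finite \<Lambda>'"
    and s: "linear_on_signs n \<Phi> \<Lambda> (teval s)" and t: "linear_on_signs n \<Phi>' \<Lambda>' (teval t)" by auto
  define \<Lambda>'' where "\<Lambda>'' = (\<lambda>(l, l') i. l i + l' i) ` (\<Lambda> \<times> \<Lambda>')"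
  have "linear_on_signs n (\<Phi> \<union> \<Phi>') \<Lambda>'' (teval (TPlus s t))"
    unfolding linear_on_signs_def
  proof
    fix w
    obtain l where l: "l \<in> \<Lambda>" "\<And>w'. same_signs n \<Phi> w w' \<Longrightarrow> teval s w' = lform n l w'"
      by (rule linear_on_signsE[OF s]) blast
    obtain l' where l': "l' \<in> \<Lambda>'" "\<And>w'. same_signs n \<Phi>' w w' \<Longrightarrow> teval t w' = lform n l' w'"
      by (rule linear_on_signsE[OF t]) blast
    show "\<exists>l\<in>\<Lambda>''. \<forall>w'. same_signs n (\<Phi> \<union> \<Phi>') w w' \<longrightarrow> teval (TPlus s t) w' = lform n l w'"
    proof (intro bexI allI impI)
      show "(\<lambda>i. l i + l' i) \<in> \<Lambda>''" using l(1) l'(1) by (auto simp: \<Lambda>''_def)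
      fix w' assume "same_signs n (\<Phi> \<union> \<Phi>') w w'"
      then have "same_signs n \<Phi> w w'" "same_signs n \<Phi>' w w'" by (auto intro: same_signs_mono)
      then show "teval (TPlus s t) w' = lform n (\<lambda>i. l i + l' i) w'"
        using l(2) l'(2) by (simp add: lform_add)
    qed
  qed
  moreover have "finite \<Lambda>''" "finite (\<Phi> \<union> \<Phi>')" using fin by (auto simp: \<Lambda>''_def)
  ultimately show ?case by blast
next
  case (TMonus s t)
  then obtain \<Phi> \<Lambda> \<Phi>' \<Lambda>' where fin: "finite \<Phi>" "finite \<Lambda>" "finite \<Phi>'" "finite \<Lambda>'"
    and s: "linear_on_signs n \<Phi> \<Lambda> (teval s)" and t: "linear_on_signs n \<Phi>' \<Lambda>' (teval t)" by auto
  define \<Delta> where "\<Delta> = (\<lambda>(l, l') i. l i - l' i) ` (\<Lambda> \<times> \<Lambda>')"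
  have "linear_on_signs n (\<Phi> \<union> \<Phi>' \<union> \<Delta>) (insert (\<lambda>i. 0) \<Delta>) (teval (TMonus s t))"
    unfolding linear_on_signs_def
  proof
    fix w
    obtain l where l: "l \<in> \<Lambda>" "\<And>w'. same_signs n \<Phi> w w' \<Longrightarrow> teval s w' = lform n l w'"
      by (rule linear_on_signsE[OF s]) blast
    obtain l' where l': "l' \<in> \<Lambda>'" "\<And>w'. same_signs n \<Phi>' w w' \<Longrightarrow> teval t w' = lform n l' w'"
      by (rule linear_on_signsE[OF t]) blast
    let ?d = "\<lambda>i. l i - l' i"
    have d: "?d \<in> \<Delta>" using l(1) l'(1) by (auto simp: \<Delta>_def)
    have ev: "teval (TMonus s t) w' = max 0 (lform n ?d w') \<and> sgn (lform n ?d w') = sgn (lform n ?d w)"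
      if "same_signs n (\<Phi> \<union> \<Phi>' \<union> \<Delta>) w w'" for w'
    proof -
      have "same_signs n \<Phi> w w'" "same_signs n \<Phi>' w w'" using that by (auto intro: same_signs_mono)
      moreover have "sgn (lform n ?d w') = sgn (lform n ?d w)"
        using that d unfolding same_signs_def by blast
      ultimately show ?thesis using l(2) l'(2) by (simp add: lform_diff)
    qed
    show "\<exists>l\<in>insert (\<lambda>i. 0) \<Delta>. \<forall>w'. same_signs n (\<Phi> \<union> \<Phi>' \<union> \<Delta>) w w' \<longrightarrow> teval (TMonus s t) w' = lform n l w'"
    proof (cases "0 < lform n ?d w")
      case True
      show ?thesis
      proof (intro bexI[of _ ?d] allI impI)
        fix w' assume "same_signs n (\<Phi> \<union> \<Phi>' \<union> \<Delta>) w w'"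
        note e = ev[OF this]
        then have "0 < lform n ?d w'" using True by (metis sgn_pos sgn_greater)
        then show "teval (TMonus s t) w' = lform n ?d w'" using e by simp
      qed (use d in simp)
    next
      case False
      show ?thesis
      proof (intro bexI[of _ "\<lambda>i. 0"] allI impI)
        fix w' assume "same_signs n (\<Phi> \<union> \<Phi>' \<union> \<Delta>) w w'"
        note e = ev[OF this]
        then have "\<not> 0 < lform n ?d w'" using False by (metis sgn_greater)
        then show "teval (TMonus s t) w' = lform n (\<lambda>i. 0) w'" using e by (simp add: lform_def)
      qed simp
    qed
  qed
  moreover have "finite (insert (\<lambda>i. 0) \<Delta>)" "finite (\<Phi> \<union> \<Phi>' \<union> \<Delta>)" using fin by (auto simp: \<Delta>_def)
  ultimately show ?case by (intro exI conjI)
qed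

text \<open>Gaussian elimination over the rationals, one equation at a time: \<open>I\<close> holds
  the free variables and \<open>c\<close> expresses every coordinate through them. That
  \<open>c\<close> is the identity on \<open>I\<close> makes the free coordinates parameters for
  themselves.\<close>

lemma integer_system_parametrization:
  fixes Z :: "(nat \<Rightarrow> int) set"
  assumes "finite Z"
  shows "\<exists>I c. I \<subseteq> {..<n} \<and> (\<forall>j i. c j i \<in> \<rat>) \<and> (\<forall>j\<in>I. \<forall>i\<in>I. c j i = (if i = j then 1 else 0)) \<and>
    (\<forall>w. (\<forall>\<phi>\<in>Z. lform n \<phi> w = 0) \<longleftrightarrow> (\<forall>j<n. w j = (\<Sum>i\<in>I. c j i * (w i :: real))))"
  using assms
proof (induction Z rule: finite_induct)
  case empty
  have "\<forall>j<n. w j = (\<Sum>i<n. (if i = j then 1 else 0) * w i)" for w :: "nat \<Rightarrow> real"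
    by (simp add: if_distrib[of "\<lambda>x. x * _"] cong: if_cong)
  then show ?case
    by (intro exI[of _ "{..<n}"] exI[of _ "\<lambda>j i. if i = j then 1 else 0"]) simp
next
  case (insert \<phi> Z)
  obtain I c where I: "I \<subseteq> {..<n}" and c: "\<And>j i. c j i \<in> \<rat>"
    and unit: "\<And>j i. j \<in> I \<Longrightarrow> i \<in> I \<Longrightarrow> c j i = (if i = j then 1 else 0)"
    and eq: "\<And>w. (\<forall>\<phi>\<in>Z. lform n \<phi> w = 0) \<longleftrightarrow> (\<forall>j<n. w j = (\<Sum>i\<in>I. c j i * (w i :: real)))"
  proof -
    from insert.IH obtain I c where "I \<subseteq> {..<n} \<and> (\<forall>j i. c j i \<in> \<rat>) \<and> (\<forall>j\<in>I. \<forall>i\<in>I. c j i = (if i = j then 1 else 0)) \<and>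
      (\<forall>w. (\<forall>\<phi>\<in>Z. lform n \<phi> w = 0) \<longleftrightarrow> (\<forall>j<n. w j = (\<Sum>i\<in>I. c j i * (w i :: real))))"
      by (elim exE)
    note h = this
      show thesis
        by (rule that[OF conjunct1[OF h] conjunct1[OF conjunct2[OF h], THEN spec, THEN spec]
          conjunct1[OF conjunct2[OF conjunct2[OF h]], THEN bspec, THEN bspec]
          conjunct2[OF conjunct2[OF conjunct2[OF h]], THEN spec]])
  qed
  have finI: "finite I" using I finite_subset by blast
  define d where "d i = (\<Sum>j<n. real_of_int (\<phi> j) * c j i)" for i
  have dQ: "d i \<in> \<rat>" for i unfolding d_def by (intro Rats_sum Rats_mult c) auto
  have lf: "lform n \<phi> w = (\<Sum>i\<in>I. d i * w i)" if "\<forall>j<n. w j = (\<Sum>i\<in>I. c j i * w i)" for w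
  proof -
    have "lform n \<phi> w = (\<Sum>j<n. \<Sum>i\<in>I. real_of_int (\<phi> j) * c j i * w i)"
      unfolding lform_def
    proof (intro sum.cong refl)
      fix j assume "j \<in> {..<n}"
      then have "w j = (\<Sum>i\<in>I. c j i * w i)" using that by blast
      then have "real_of_int (\<phi> j) * w j = real_of_int (\<phi> j) * (\<Sum>i\<in>I. c j i * w i)" by (rule arg_cong)
      then show "real_of_int (\<phi> j) * w j = (\<Sum>i\<in>I. real_of_int (\<phi> j) * c j i * w i)"
        by (simp add: sum_distrib_left mult.assoc)
    qed
    also have "\<dots> = (\<Sum>i\<in>I. d i * w i)" by (subst sum.swap) (simp add: d_def sum_distrib_right)
    finally show ?thesis .
  qed
  show ?case
  \<comment> \<open>Here \<open>d\<close> gives the new equation in the free variables. If it is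
    zero, the equation already holds; otherwise a variable \<open>k\<close> with nonzero coefficient
    is solved for and eliminated.\<close>
  proof (cases "\<forall>i\<in>I. d i = 0")
    case True
    have E: "(\<forall>\<phi>'\<in>insert \<phi> Z. lform n \<phi>' w = 0) \<longleftrightarrow> (\<forall>j<n. w j = (\<Sum>i\<in>I. c j i * w i))" for w :: "nat \<Rightarrow> real"
    proof -
      have "lform n \<phi> w = 0" if "\<forall>j<n. w j = (\<Sum>i\<in>I. c j i * w i)"
        unfolding lf[OF that] using True by (intro sum.neutral) simp
      then show ?thesis using eq[of w] by blast
    qed
    show ?thesis by (rule exI[of _ I], rule exI[of _ c], intro conjI allI ballI I c unit E)
  next
    case False
    then obtain k where k: "k \<in> I" "d k \<noteq> 0" by blast
    define I' where "I' = I - {k}"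
    define c' where "c' j i = c j i - c j k * d i / d k" for j i
    have rem: "(\<Sum>i\<in>I. f i) = f k + (\<Sum>i\<in>I'. f i)" for f :: "nat \<Rightarrow> real"
      unfolding I'_def using finI k by (intro sum.remove) auto
    have c'sum: "(\<Sum>i\<in>I'. c' j i * w i) = (\<Sum>i\<in>I'. c j i * w i) - c j k * (\<Sum>i\<in>I'. d i * w i) / d k"
      for j and w :: "nat \<Rightarrow> real"
      by (simp add: c'_def left_diff_distrib sum_subtractf sum_distrib_left sum_divide_distrib mult.assoc)
    have E: "(\<forall>\<phi>'\<in>insert \<phi> Z. lform n \<phi>' w = 0) \<longleftrightarrow> (\<forall>j<n. w j = (\<Sum>i\<in>I'. c' j i * w i))" for w :: "nat \<Rightarrow> real"
    proof
      assume "\<forall>\<phi>'\<in>insert \<phi> Z. lform n \<phi>' w = 0"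
      then have L: "\<forall>j<n. w j = (\<Sum>i\<in>I. c j i * w i)" and z: "lform n \<phi> w = 0" using eq[of w] by blast+
      have "d k * w k + (\<Sum>i\<in>I'. d i * w i) = 0" using lf[OF L] z rem[of "\<lambda>i. d i * w i"] by simp
      then have wk: "w k = - (\<Sum>i\<in>I'. d i * w i) / d k" using k by (simp add: field_simps)
      show "\<forall>j<n. w j = (\<Sum>i\<in>I'. c' j i * w i)"
      proof (intro allI impI)
        fix j assume "j < n"
        then have "w j = (\<Sum>i\<in>I. c j i * w i)" using L by blast
        also have "\<dots> = c j k * w k + (\<Sum>i\<in>I'. c j i * w i)" by (rule rem)
        also have "\<dots> = (\<Sum>i\<in>I'. c' j i * w i)" unfolding c'sum wk by simp
        finally show "w j = (\<Sum>i\<in>I'. c' j i * w i)" .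
      qed
    next
      assume R: "\<forall>j<n. w j = (\<Sum>i\<in>I'. c' j i * w i)"
      \<comment> \<open>Row \<open>k\<close> of \<open>c\<close> is a unit row, so the new
        parametrisation of the coordinate \<open>k\<close> is exactly the equation solved for
        \<open>w k\<close>.\<close>
      have "(\<Sum>i\<in>I'. c k i * w i) = 0" using unit k by (intro sum.neutral) (auto simp: I'_def)
      moreover have "w k = (\<Sum>i\<in>I'. c' k i * w i)" using R k I by blast
      ultimately have wk: "w k = - (\<Sum>i\<in>I'. d i * w i) / d k" unfolding c'sum using unit[OF k(1) k(1)] by simp
      have L: "\<forall>j<n. w j = (\<Sum>i\<in>I. c j i * w i)"
      proof (intro allI impI)
        fix j assume "j < n"
        then have "w j = (\<Sum>i\<in>I'. c' j i * w i)" using R by blast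
        also have "\<dots> = c j k * w k + (\<Sum>i\<in>I'. c j i * w i)" unfolding c'sum wk by simp
        also have "\<dots> = (\<Sum>i\<in>I. c j i * w i)" by (rule rem[symmetric])
        finally show "w j = (\<Sum>i\<in>I. c j i * w i)" .
      qed
      have "lform n \<phi> w = d k * w k + (\<Sum>i\<in>I'. d i * w i)" unfolding lf[OF L] by (rule rem)
      also have "\<dots> = 0" unfolding wk using k(2) by simp
      finally show "\<forall>\<phi>'\<in>insert \<phi> Z. lform n \<phi>' w = 0" using L eq[of w] by blast
    qed
    have c'Q: "c' j i \<in> \<rat>" for j i unfolding c'_def by (intro Rats_diff Rats_divide Rats_mult c dQ)
    have unit': "c' j i = (if i = j then 1 else 0)" if "j \<in> I'" "i \<in> I'" for j i
    proof -
      have "c j k = 0" "c j i = (if i = j then 1 else 0)" using that unit k by (auto simp: I'_def)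
      then show ?thesis by (simp add: c'_def)
    qed
    have I'n: "I' \<subseteq> {..<n}" using I by (auto simp: I'_def)
    show ?thesis by (rule exI[of _ I'], rule exI[of _ c'], intro conjI allI ballI I'n c'Q unit' E)
  qed
qed

lemma common_denominator:
  fixes S :: "real set"
  assumes "finite S" "S \<subseteq> \<rat>"
  shows "\<exists>m\<ge>(1::nat). \<forall>r\<in>S. real m * r \<in> \<int>"
  using assms
proof (induction S rule: finite_induct)
  case empty then show ?case by auto
next
  case (insert r S)
  then obtain m where m: "m \<ge> (1::nat)" "\<And>s. s \<in> S \<Longrightarrow> real m * s \<in> \<int>" by auto
  have "r \<in> \<rat>" using insert.prems by auto
  then obtain a b where ab: "b > (0::int)" "r = of_int a / of_int b" by (rule Rats_cases')
  define m' where "m' = m * nat b"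
  have b: "real (nat b) = of_int b" using ab(1) by simp
  have "real m' * r = of_int (int m * a)" using ab by (simp add: m'_def b)
  then have "real m' * r \<in> \<int>" by (metis Ints_of_int)
  moreover have "real m' * s \<in> \<int>" if "s \<in> S" for s
  proof -
    have "real m' * s = of_int b * (real m * s)" using b by (simp add: m'_def)
    then show ?thesis using m(2)[OF that] by (metis Ints_mult Ints_of_int)
  qed
  moreover have "m' \<ge> 1" using m(1) ab(1) by (simp add: m'_def)
  ultimately show ?case by blast
qed

text \<open>An open polyhedral cone in a linear subspace parametrised by the coordinates in
  \<open>I\<close>. When \<open>c\<close> is the identity on \<open>I\<close>, a nonempty stratum
  has dimension \<open>card I\<close>.\<close>

definition stratum :: "nat \<Rightarrow> nat set \<times> (nat \<Rightarrow> nat \<Rightarrow> real) \<times> (nat \<Rightarrow> real) set \<Rightarrow> (nat \<Rightarrow> real) set" where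
  "stratum n = (\<lambda>(I, c, \<Psi>). {w. (\<forall>j\<ge>n. w j = 0) \<and> (\<forall>j<n. w j = (\<Sum>i\<in>I. c j i * w i)) \<and>
     (\<forall>\<psi>\<in>\<Psi>. 0 < (\<Sum>i\<in>I. \<psi> i * w i))})"

text \<open>The homomorphisms of the presented hoop to the nonnegative reals, recorded by their
  values at the generators.\<close>

definition zero_cone :: "nat \<Rightarrow> (hterm \<times> hterm) set \<Rightarrow> (nat \<Rightarrow> real) set" where
  "zero_cone n E = {w. (\<forall>i. 0 \<le> w i) \<and> (\<forall>i\<ge>n. w i = 0) \<and> (\<forall>(s, t)\<in>E. teval s w = teval t w)}"

text \<open>The strata are those sign cells of one finite arrangement that meet the cone. The
  arrangement contains the coordinate hyperplanes and all differences of linear pieces of the terms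
  involved, so nonnegativity and the equations of \<open>E\<close> hold on a whole cell as soon as
  they hold at one of its points.\<close>

lemma zero_cone_stratification:
  assumes E: "finite E" "\<And>s t. (s, t) \<in> E \<Longrightarrow> tvars s \<subseteq> {..<n} \<and> tvars t \<subseteq> {..<n}"
    and T: "finite T" "\<And>t. t \<in> T \<Longrightarrow> tvars t \<subseteq> {..<n}"
  obtains \<S> where "finite \<S>" "\<Union>(stratum n ` \<S>) = zero_cone n E"
    and "\<And>S S'. S \<in> \<S> \<Longrightarrow> S' \<in> \<S> \<Longrightarrow> S \<noteq> S' \<Longrightarrow> stratum n S \<inter> stratum n S' = {}"
    and "\<And>S. S \<in> \<S> \<Longrightarrow> stratum n S \<noteq> {}"
    and "\<And>I c \<Psi>. (I, c, \<Psi>) \<in> \<S> \<Longrightarrow> I \<subseteq> {..<n} \<and> finite \<Psi> \<and> (\<forall>j i. c j i \<in> \<rat>) \<and>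
      (\<forall>j\<in>I. \<forall>i\<in>I. c j i = (if i = j then 1 else 0))"
    and "\<And>I c \<Psi> t. (I, c, \<Psi>) \<in> \<S> \<Longrightarrow> t \<in> T \<Longrightarrow>
      \<exists>\<tau>. \<forall>w\<in>stratum n (I, c, \<Psi>). teval t w = (\<Sum>i\<in>I. \<tau> i * w i)"
proof -
  define T' where "T' = T \<union> fst ` E \<union> snd ` E"
  have T': "finite T'" using E(1) T(1) by (simp add: T'_def)
  have T'v: "tvars t \<subseteq> {..<n}" if "t \<in> T'" for t
  proof -
    have "t \<in> T \<or> (\<exists>s. (t, s) \<in> E \<or> (s, t) \<in> E)" using that by (force simp: T'_def)
    then show ?thesis using E(2) T(2) by metis
  qed
  have "\<forall>t\<in>T'. \<exists>P. finite (fst P) \<and> finite (snd P) \<and> linear_on_signs n (fst P) (snd P) (teval t)"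
  proof
    fix t assume "t \<in> T'"
    then obtain \<Phi> \<Lambda> where "finite \<Phi>" "finite \<Lambda>" "linear_on_signs n \<Phi> \<Lambda> (teval t)"
      using teval_linear_on_signs[OF T'v] by blast
    then show "\<exists>P. finite (fst P) \<and> finite (snd P) \<and> linear_on_signs n (fst P) (snd P) (teval t)"
      by (intro exI[of _ "(\<Phi>, \<Lambda>)"]) simp
  qed
  from bchoice[OF this] obtain P where P: "\<And>t. t \<in> T' \<Longrightarrow> finite (fst (P t)) \<and> finite (snd (P t)) \<and>
    linear_on_signs n (fst (P t)) (snd (P t)) (teval t)" by blast
  define unit where "unit j = (\<lambda>i. if i = j then 1 else (0::int))" for j :: nat
  define \<Phi> where "\<Phi> = (\<Union>t\<in>T'. fst (P t)) \<union> unit ` {..<n} \<union>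
    (\<Union>s\<in>T'. \<Union>t\<in>T'. (\<lambda>(l, l') i. l i - l' i) ` (snd (P s) \<times> snd (P t)))"
  have fin\<Phi>: "finite \<Phi>" unfolding \<Phi>_def using T' P
      by (intro finite_UnI finite_UN_I finite_imageI finite_cartesian_product) auto
  have linear: "\<exists>l\<in>snd (P t). \<forall>w'. same_signs n \<Phi> w w' \<longrightarrow> teval t w' = lform n l w'" if "t \<in> T'" for t w
  proof -
    have "linear_on_signs n (fst (P t)) (snd (P t)) (teval t)" using P[OF that] by simp
    then obtain l where l: "l \<in> snd (P t)" "\<And>w'. same_signs n (fst (P t)) w w' \<Longrightarrow> teval t w' = lform n l w'"
      by (rule linear_on_signsE) blast
    have "fst (P t) \<subseteq> \<Phi>" using that by (auto simp: \<Phi>_def)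
    then show ?thesis using l same_signs_mono by blast
  qed
  define cls where "cls w = {w'. (\<forall>j\<ge>n. w' j = 0) \<and> same_signs n \<Phi> w w'}" for w
  define \<O> where "\<O> = cls ` zero_cone n E"
  have cls_self: "w \<in> cls w" if "w \<in> zero_cone n E" for w
    using that by (simp add: cls_def same_signs_def zero_cone_def)
  \<comment> \<open>A cell is determined by its vector of signs, and there are finitely many of
    these.\<close>
  have "finite \<O>"
  proof -
    define sv where "sv w = (\<lambda>\<phi>\<in>\<Phi>. sgn (lform n \<phi> w))" for w
    define of_sv where "of_sv s = {w'. (\<forall>j\<ge>n. w' j = 0) \<and> (\<forall>\<phi>\<in>\<Phi>. sgn (lform n \<phi> w') = s \<phi>)}"
        for s :: "(nat \<Rightarrow> int) \<Rightarrow> real"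
    have "cls w = of_sv (sv w)" for w by (simp add: cls_def of_sv_def sv_def same_signs_def)
    then have "\<O> \<subseteq> of_sv ` PiE \<Phi> (\<lambda>_. {-1, 0, 1})"
      unfolding \<O>_def by (auto simp: sv_def sgn_if)
    then show ?thesis by (rule finite_subset) (intro finite_imageI finite_PiE fin\<Phi>, simp)
  qed
  have sub: "cls w \<subseteq> zero_cone n E" if w: "w \<in> zero_cone n E" for w
  proof
    fix w' assume w': "w' \<in> cls w"
    have ss: "same_signs n \<Phi> w w'" using w' by (simp add: cls_def)
    have "0 \<le> w' i" for i
    proof (cases "i < n")
      case True
      have "unit i \<in> \<Phi>" using True by (auto simp: \<Phi>_def)
      then have "sgn (lform n (unit i) w') = sgn (lform n (unit i) w)" using ss by (simp add: same_signs_def)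
      then have "sgn (w' i) = sgn (w i)" using lform_unit[OF True] by (simp add: unit_def)
      moreover have "0 \<le> w i" using w by (simp add: zero_cone_def)
      ultimately show ?thesis by (metis sgn_less not_less)
    next
      case False
      then show ?thesis using w' by (simp add: cls_def)
    qed
    moreover have "teval s w' = teval t w'" if st: "(s, t) \<in> E" for s t
    proof -
      have m: "s \<in> T'" "t \<in> T'" using st by (force simp: T'_def)+
      obtain l where l: "l \<in> snd (P s)" "\<And>w'. same_signs n \<Phi> w w' \<Longrightarrow> teval s w' = lform n l w'"
        using linear[OF m(1)] by meson
      obtain l' where l': "l' \<in> snd (P t)" "\<And>w'. same_signs n \<Phi> w w' \<Longrightarrow> teval t w' = lform n l' w'"
        using linear[OF m(2)] by meson
      have "(\<lambda>i. l i - l' i) \<in> \<Phi>" unfolding \<Phi>_def using m l(1) l'(1)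
          by (intro UnI2 UN_I[of s] UN_I[of t] image_eqI[of _ _ "(l, l')"]) auto
      then have "sgn (lform n l w' - lform n l' w') = sgn (lform n l w - lform n l' w)"
        using ss unfolding same_signs_def lform_diff[symmetric] by blast
      moreover have "same_signs n \<Phi> w w" by (simp add: same_signs_def)
      then have "lform n l w = teval s w" "lform n l' w = teval t w" using l(2) l'(2) by simp_all
      moreover have "teval s w = teval t w" using w st by (auto simp: zero_cone_def)
      ultimately show ?thesis using l(2)[OF ss] l'(2)[OF ss] by (simp add: sgn_zero_iff)
    qed
    ultimately show "w' \<in> zero_cone n E" using w' by (auto simp: zero_cone_def cls_def)
  qed
  define good where "good Q S \<longleftrightarrow> stratum n S = Q \<and> (\<forall>I c \<Psi>. S = (I, c, \<Psi>) \<longrightarrow> I \<subseteq> {..<n} \<and> finite \<Psi> \<and> (\<forall>j i. c j i \<in> \<rat>) \<and>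
      (\<forall>j\<in>I. \<forall>i\<in>I. c j i = (if i = j then 1 else 0)) \<and>
      (\<forall>t\<in>T. \<exists>\<tau>. \<forall>w\<in>Q. teval t w = (\<Sum>i\<in>I. \<tau> i * w i)))" for Q S
  have ex: "\<forall>Q\<in>\<O>. \<exists>S. good Q S"
  proof
    fix Q assume "Q \<in> \<O>"
    then obtain w where w: "w \<in> zero_cone n E" "Q = cls w" by (auto simp: \<O>_def)
    \<comment> \<open>The forms that vanish at \<open>w\<close> vanish on its cell and span the
      equations of a subspace; the others become strict inequalities.\<close>
    define Z where "Z = {\<phi>\<in>\<Phi>. lform n \<phi> w = 0}"
    have "finite Z" using fin\<Phi> by (simp add: Z_def)
    obtain I c where I: "I \<subseteq> {..<n}" "\<And>j i. c j i \<in> \<rat>" "\<And>j i. j \<in> I \<Longrightarrow> i \<in> I \<Longrightarrow> c j i = (if i = j then 1 else 0)"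
      "\<And>w. (\<forall>\<phi>\<in>Z. lform n \<phi> w = 0) \<longleftrightarrow> (\<forall>j<n. w j = (\<Sum>i\<in>I. c j i * (w i :: real)))"
    proof -
      from integer_system_parametrization[OF \<open>finite Z\<close>, of n] obtain I c where
        "I \<subseteq> {..<n} \<and> (\<forall>j i. c j i \<in> \<rat>) \<and> (\<forall>j\<in>I. \<forall>i\<in>I. c j i = (if i = j then 1 else 0)) \<and>
        (\<forall>w. (\<forall>\<phi>\<in>Z. lform n \<phi> w = 0) \<longleftrightarrow> (\<forall>j<n. w j = (\<Sum>i\<in>I. c j i * (w i :: real))))"
        by (elim exE)
      note h = this
      show thesis
        by (rule that[OF conjunct1[OF h] conjunct1[OF conjunct2[OF h], THEN spec, THEN spec]
          conjunct1[OF conjunct2[OF conjunct2[OF h]], THEN bspec, THEN bspec]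
          conjunct2[OF conjunct2[OF conjunct2[OF h]], THEN spec]])
    qed
    define coef where "coef \<phi> i = (\<Sum>j<n. real_of_int (\<phi> j) * c j i)" for \<phi> :: "nat \<Rightarrow> int" and i
    have lf: "lform n \<phi> w' = (\<Sum>i\<in>I. coef \<phi> i * w' i)" if L: "\<forall>j<n. w' j = (\<Sum>i\<in>I. c j i * w' i)" for w' \<phi>
    proof -
      have "lform n \<phi> w' = (\<Sum>j<n. \<Sum>i\<in>I. real_of_int (\<phi> j) * c j i * w' i)"
        unfolding lform_def
      proof (intro sum.cong refl)
        fix j assume "j \<in> {..<n}"
        then have "w' j = (\<Sum>i\<in>I. c j i * w' i)" using L by blast
        then have "real_of_int (\<phi> j) * w' j = real_of_int (\<phi> j) * (\<Sum>i\<in>I. c j i * w' i)" by (rule arg_cong)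
        then show "real_of_int (\<phi> j) * w' j = (\<Sum>i\<in>I. real_of_int (\<phi> j) * c j i * w' i)"
          by (simp add: sum_distrib_left mult.assoc)
      qed
      also have "\<dots> = (\<Sum>i\<in>I. coef \<phi> i * w' i)" by (subst sum.swap) (simp add: coef_def sum_distrib_right)
      finally show ?thesis .
    qed
    \<comment> \<open>Multiplying by the sign at \<open>w\<close> turns the condition of having the
      same sign as at \<open>w\<close> into positivity.\<close>
    define \<Psi> where "\<Psi> = (\<lambda>\<phi> i. sgn (lform n \<phi> w) * coef \<phi> i) ` (\<Phi> - Z)"
    have sgn_iff: "sgn y = sgn x \<longleftrightarrow> 0 < sgn x * y" if "x \<noteq> 0" for x y :: real
      using that by (auto simp: sgn_if mult_less_0_iff zero_less_mult_iff split: if_splits)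
    have "w' \<in> stratum n (I, c, \<Psi>) \<longleftrightarrow> w' \<in> Q" for w'
    proof -
      have "(\<forall>j<n. w' j = (\<Sum>i\<in>I. c j i * w' i)) \<and> (\<forall>\<psi>\<in>\<Psi>. 0 < (\<Sum>i\<in>I. \<psi> i * w' i)) \<longleftrightarrow> same_signs n \<Phi> w w'"
      proof (cases "\<forall>j<n. w' j = (\<Sum>i\<in>I. c j i * w' i)")
        case True
        then have Z0: "\<forall>\<phi>\<in>Z. lform n \<phi> w' = 0" using I(4)[of w'] by blast
        have "(\<forall>\<psi>\<in>\<Psi>. 0 < (\<Sum>i\<in>I. \<psi> i * w' i)) \<longleftrightarrow> (\<forall>\<phi>\<in>\<Phi> - Z. 0 < sgn (lform n \<phi> w) * lform n \<phi> w')"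
          unfolding \<Psi>_def lf[OF True] by (simp add: sum_distrib_left mult.assoc)
        also have "\<dots> \<longleftrightarrow> (\<forall>\<phi>\<in>\<Phi> - Z. sgn (lform n \<phi> w') = sgn (lform n \<phi> w))"
          using sgn_iff by (intro ball_cong refl) (auto simp: Z_def)
        also have "\<dots> \<longleftrightarrow> same_signs n \<Phi> w w'"
          unfolding same_signs_def using Z0 by (auto simp: Z_def)
        finally show ?thesis using True by simp
      next
        case False
        then have "\<not> (\<forall>\<phi>\<in>Z. lform n \<phi> w' = 0)" using I(4)[of w'] by blast
        then obtain \<phi> where "\<phi> \<in> \<Phi>" "lform n \<phi> w = 0" "lform n \<phi> w' \<noteq> 0" by (auto simp: Z_def)
        then have "\<phi> \<in> \<Phi>" "sgn (lform n \<phi> w') \<noteq> sgn (lform n \<phi> w)" by (simp_all add: sgn_zero_iff)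
        then have "\<not> same_signs n \<Phi> w w'" unfolding same_signs_def by blast
        then show ?thesis using False by simp
      qed
      then show ?thesis by (simp add: stratum_def w(2) cls_def)
    qed
    then have strO: "stratum n (I, c, \<Psi>) = Q" by blast
    moreover have "\<exists>\<tau>. \<forall>w\<in>Q. teval t w = (\<Sum>i\<in>I. \<tau> i * w i)" if t: "t \<in> T" for t
    proof -
      obtain l where l: "l \<in> snd (P t)" "\<And>w'. same_signs n \<Phi> w w' \<Longrightarrow> teval t w' = lform n l w'"
        using linear[of t w] t unfolding T'_def by blast
      have "teval t w' = (\<Sum>i\<in>I. coef l i * w' i)" if "w' \<in> Q" for w'
      proof -
        have "same_signs n \<Phi> w w'" using that w(2) by (simp add: cls_def)
        moreover have "\<forall>j<n. w' j = (\<Sum>i\<in>I. c j i * w' i)"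
          using that unfolding strO[symmetric] stratum_def by simp
        ultimately show ?thesis using l(2) lf by simp
      qed
      then show ?thesis by blast
    qed
    moreover have "finite \<Psi>" using fin\<Phi> by (simp add: \<Psi>_def)
    ultimately have "good Q (I, c, \<Psi>)" unfolding good_def using I by simp
    then show "\<exists>S. good Q S" by blast
  qed
  from bchoice[OF ex] obtain f where f: "\<And>Q. Q \<in> \<O> \<Longrightarrow> good Q (f Q)" by blast
  have strf: "stratum n (f Q) = Q" if "Q \<in> \<O>" for Q using f[OF that] by (simp add: good_def)
  show thesis
  proof (rule that[of "f ` \<O>"])
    show "finite (f ` \<O>)" using \<open>finite \<O>\<close> by simp
    have "\<Union>(stratum n ` f ` \<O>) = \<Union>\<O>" using strf by auto
    also have "\<dots> = zero_cone n E" using sub cls_self by (auto simp: \<O>_def)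
    finally show "\<Union>(stratum n ` f ` \<O>) = zero_cone n E" .
    show "stratum n S \<inter> stratum n S' = {}" if S: "S \<in> f ` \<O>" "S' \<in> f ` \<O>" "S \<noteq> S'" for S S'
    proof (rule ccontr)
      assume ne: "stratum n S \<inter> stratum n S' \<noteq> {}"
      obtain w w' where w: "S = f (cls w)" "cls w \<in> \<O>" "S' = f (cls w')" "cls w' \<in> \<O>"
        using S(1,2) by (auto simp: \<O>_def)
      then obtain v where "v \<in> cls w" "v \<in> cls w'" using ne strf by auto
      then have "same_signs n \<Phi> w w'" "same_signs n \<Phi> w' w" by (auto simp: cls_def same_signs_def)
      then have "cls w = cls w'" by (auto simp: cls_def same_signs_def)
      then show False using w S(3) by simp
    qed
    show "stratum n S \<noteq> {}" if "S \<in> f ` \<O>" for S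
    proof -
      obtain w where "S = f (cls w)" "cls w \<in> \<O>" "w \<in> zero_cone n E" using \<open>S \<in> f ` \<O>\<close> by (auto simp: \<O>_def)
      then show ?thesis using strf cls_self by blast
    qed
    show "I \<subseteq> {..<n} \<and> finite \<Psi> \<and> (\<forall>j i. c j i \<in> \<rat>) \<and> (\<forall>j\<in>I. \<forall>i\<in>I. c j i = (if i = j then 1 else 0))"
      if "(I, c, \<Psi>) \<in> f ` \<O>" for I c \<Psi>
    proof -
      obtain Q where "Q \<in> \<O>" "(I, c, \<Psi>) = f Q" using \<open>(I, c, \<Psi>) \<in> f ` \<O>\<close> by blast
      then show ?thesis using f[of Q] unfolding good_def by metis
    qed
    show "\<exists>\<tau>. \<forall>w\<in>stratum n (I, c, \<Psi>). teval t w = (\<Sum>i\<in>I. \<tau> i * w i)"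
      if "(I, c, \<Psi>) \<in> f ` \<O>" "t \<in> T" for I c \<Psi> t
    proof -
      obtain Q where "Q \<in> \<O>" "(I, c, \<Psi>) = f Q" using \<open>(I, c, \<Psi>) \<in> f ` \<O>\<close> by blast
      then show ?thesis using f[of Q] \<open>t \<in> T\<close> unfolding good_def by metis
    qed
  qed
qed

subsection \<open>Lattice points in polyhedral regions\<close>

lemma card_nat_interval_le:
  fixes J :: "nat set"
  assumes "\<And>j. j \<in> J \<Longrightarrow> \<bar>real j - c\<bar> \<le> s" "0 \<le> s" "finite J"
  shows "real (card J) \<le> 2 * s + 1"
proof (cases "J = {}")
  case False
  have "J \<subseteq> {Min J..Max J}" using assms(3) by auto
  then have "card J \<le> Suc (Max J) - Min J" using card_mono[of "{Min J..Max J}" J] by simp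
  moreover have "Min J \<le> Max J" using False assms(3) by (meson Max_ge Min_in)
  moreover have "\<bar>real (Min J) - c\<bar> \<le> s" "\<bar>real (Max J) - c\<bar> \<le> s"
    using False assms by auto
  ultimately show ?thesis by linarith
qed (use assms in simp)

text \<open>Once the coordinates other than \<open>i0\<close> are fixed, the remaining one lies in
  an interval whose length does not depend on \<open>R\<close>. So a slab in a box has the growth of
  a box with one dimension less.\<close>

lemma card_slab_le:
  fixes I :: "nat set" and \<psi> :: "nat \<Rightarrow> real"
  assumes I: "finite I" "i0 \<in> I" and nz: "\<psi> i0 \<noteq> 0" and S: "0 \<le> S"
  shows "real (card {k \<in> PiE I (\<lambda>_. {..R::nat}). \<bar>(\<Sum>i\<in>I. \<psi> i * real (k i)) - c\<bar> \<le> S})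
    \<le> (2 * (S / \<bar>\<psi> i0\<bar>) + 1) * real (R + 1) ^ (card I - 1)"
proof -
  define T where "T = {k \<in> PiE I (\<lambda>_. {..R::nat}). \<bar>(\<Sum>i\<in>I. \<psi> i * real (k i)) - c\<bar> \<le> S}"
  define K where "K = PiE (I - {i0}) (\<lambda>_. {..R::nat})"
  define J where "J k' = {j \<in> {..R}. \<bar>(\<Sum>i\<in>I - {i0}. \<psi> i * real (k' i)) + \<psi> i0 * real j - c\<bar> \<le> S}" for k'
  define F where "F k = (restrict k (I - {i0}), k i0)" for k :: "nat \<Rightarrow> nat"
  have finK: "finite K" unfolding K_def using I by (intro finite_PiE) auto
  have finJ: "finite (J k')" for k' by (simp add: J_def)
  have "inj_on F T"
  proof (rule inj_onI)
    fix k l assume k: "k \<in> T" "l \<in> T" "F k = F l"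
    show "k = l"
    proof (rule PiE_ext)
      show "k \<in> PiE I (\<lambda>_. {..R})" "l \<in> PiE I (\<lambda>_. {..R})" using k by (auto simp: T_def)
      fix i assume "i \<in> I"
      then show "k i = l i"
        using k(3) unfolding F_def by (cases "i = i0") (auto dest: fun_cong[of _ _ i])
    qed
  qed
  moreover have "F ` T \<subseteq> Sigma K J"
  proof
    fix y assume "y \<in> F ` T"
    then obtain k where k: "k \<in> T" "y = F k" by blast
    have "(\<Sum>i\<in>I. \<psi> i * real (k i)) = \<psi> i0 * real (k i0) + (\<Sum>i\<in>I - {i0}. \<psi> i * real (k i))"
      using I by (simp add: sum.remove)
    then show "y \<in> Sigma K J"
      using k I by (auto simp: T_def F_def K_def J_def PiE_iff algebra_simps)
  qed
  ultimately have "card T \<le> card (Sigma K J)"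
    using finK finJ by (intro card_inj_on_le[of F]) auto
  also have "\<dots> = (\<Sum>k'\<in>K. card (J k'))" using finK finJ by simp
  finally have "real (card T) \<le> (\<Sum>k'\<in>K. real (card (J k')))"
    by (simp flip: of_nat_sum)
  also have "\<dots> \<le> (\<Sum>k'\<in>K. 2 * (S / \<bar>\<psi> i0\<bar>) + 1)"
  proof (rule sum_mono)
    fix k' assume "k' \<in> K"
    define c' where "c' = (c - (\<Sum>i\<in>I - {i0}. \<psi> i * real (k' i))) / \<psi> i0"
    have "\<bar>real j - c'\<bar> \<le> S / \<bar>\<psi> i0\<bar>" if "j \<in> J k'" for j
    proof -
      have "\<psi> i0 * (real j - c') = (\<Sum>i\<in>I - {i0}. \<psi> i * real (k' i)) + \<psi> i0 * real j - c"
        using nz by (simp add: c'_def field_simps)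
      then have "\<bar>\<psi> i0\<bar> * \<bar>real j - c'\<bar> \<le> S"
        using that by (simp add: J_def flip: abs_mult)
      then show ?thesis using nz by (simp add: field_simps)
    qed
    then show "real (card (J k')) \<le> 2 * (S / \<bar>\<psi> i0\<bar>) + 1"
      by (rule card_nat_interval_le) (use S finJ in auto)
  qed
  also have "\<dots> = (2 * (S / \<bar>\<psi> i0\<bar>) + 1) * real (card K)" by simp
  also have "card K = (R + 1) ^ (card I - 1)"
    unfolding K_def using I by (simp add: card_PiE)
  finally show ?thesis by (simp add: T_def)
qed

text \<open>Division with remainder is a bijection between vectors and pairs of residue and
  quotient. It serves twice: with a periodic \<open>P\<close>, to count lattice points in cubes, and
  with trivial \<open>P\<close>, to count the parts into which cubes are subdivided.\<close>

lemma card_periodic_refinement: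
  fixes I :: "nat set"
  assumes I: "finite I" and m: "m \<ge> (1::nat)" and A: "A \<subseteq> PiE I (\<lambda>_. UNIV)" "finite A"
    and per: "\<And>a b. (\<And>i. i \<in> I \<Longrightarrow> a i mod m = b i mod m) \<Longrightarrow> P a = P b"
  shows "card {a \<in> PiE I (\<lambda>_. UNIV). P a \<and> (\<lambda>i\<in>I. a i div m) \<in> A}
      = card {r \<in> PiE I (\<lambda>_. {..<m}). P r} * card A"
    and "finite {a \<in> PiE I (\<lambda>_. UNIV). P a \<and> (\<lambda>i\<in>I. a i div m) \<in> A}"
proof -
  let ?X = "{a \<in> PiE I (\<lambda>_. UNIV). P a \<and> (\<lambda>i\<in>I. a i div m) \<in> A}"
  let ?R = "{r \<in> PiE I (\<lambda>_. {..<m}). P r}"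
  define f where "f a = ((\<lambda>i\<in>I. a i mod m), (\<lambda>i\<in>I. a i div m))" for a :: "nat \<Rightarrow> nat"
  define g where "g = (\<lambda>(r, k). (\<lambda>i\<in>I. m * k i + r i) :: nat \<Rightarrow> nat)"
  have m0: "0 < m" using m by simp
  have finR: "finite ?R" using I by (intro finite_subset[OF _ finite_PiE[of I "\<lambda>_. {..<m}"]]) auto
  have bij: "bij_betw f ?X (?R \<times> A)"
  proof (rule bij_betw_byWitness[where f' = g])
    show "\<forall>a\<in>?X. g (f a) = a"
      by (auto simp: f_def g_def fun_eq_iff PiE_iff extensional_def)
    show "\<forall>y\<in>?R \<times> A. f (g y) = y"
    proof
      fix y assume "y \<in> ?R \<times> A"
      then obtain r k where y: "y = (r, k)" "r \<in> PiE I (\<lambda>_. {..<m})" "k \<in> PiE I (\<lambda>_. UNIV)"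
        using A by auto
      have "(\<lambda>i\<in>I. (m * k i + r i) mod m) = r"
        using y(2) by (intro ext) (auto simp: PiE_iff extensional_def)
      moreover have "(\<lambda>i\<in>I. (m * k i + r i) div m) = k"
        using y(2,3) m0 by (intro ext) (auto simp: PiE_iff extensional_def)
      ultimately show "f (g y) = y"
        by (simp add: f_def g_def y(1) cong: restrict_cong)
    qed
    show "f ` ?X \<subseteq> ?R \<times> A"
    proof
      fix y assume "y \<in> f ` ?X"
      then obtain a where a: "a \<in> ?X" "y = f a" by blast
      have "P (\<lambda>i\<in>I. a i mod m) = P a" by (rule per) simp
      then show "y \<in> ?R \<times> A" using a m0 by (auto simp: f_def)
    qed
    show "g ` (?R \<times> A) \<subseteq> ?X"
    proof
      fix a assume "a \<in> g ` (?R \<times> A)"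
      then obtain r k where y: "a = g (r, k)" "r \<in> PiE I (\<lambda>_. {..<m})" "P r" "k \<in> A" "k \<in> PiE I (\<lambda>_. UNIV)"
        using A by auto
      have "(\<lambda>i\<in>I. (m * k i + r i) div m) = k"
        using y(2,5) m0 by (intro ext) (auto simp: PiE_iff extensional_def)
      moreover have "P a = P r"
        using y(2) by (intro per) (auto simp: y(1) g_def PiE_iff)
      ultimately show "a \<in> ?X" using y by (simp add: g_def cong: restrict_cong)
    qed
  qed
  show "card ?X = card ?R * card A"
    using bij_betw_same_card[OF bij] by (simp add: card_cartesian_product)
  show "finite ?X" using bij_betw_finite[OF bij] finR A(2) by simp
qed

text \<open>\<open>\<Psi>\<close> lists the strict inequalities of a cone and
  \<open>\<upsilon>\<close> is a unit as a linear form: the region is the part of the cone where the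
  unit is at most 1. \<open>good\<close> will single out the parameter vectors that come from
  integral points of the ambient space; as the parametrisation is rational, this depends only on
  residues modulo a common denominator \<open>m\<close>.\<close>

locale lattice_region =
  fixes I :: "nat set" and \<Psi> :: "(nat \<Rightarrow> real) set" and \<upsilon> :: "nat \<Rightarrow> real" and m :: nat
    and good :: "(nat \<Rightarrow> nat) \<Rightarrow> bool" and B :: nat
  assumes finI: "finite I" and fin\<Psi>: "finite \<Psi>" and m: "m \<ge> 1"
    and good_periodic: "\<And>a b. (\<And>i. i \<in> I \<Longrightarrow> a i mod m = b i mod m) \<Longrightarrow> good a = good b"
    and region_bounded: "\<And>a i. (\<And>i. i \<in> I \<Longrightarrow> 0 \<le> a i) \<Longrightarrow> (\<And>\<psi>. \<psi> \<in> \<Psi> \<Longrightarrow> 0 < (\<Sum>i\<in>I. \<psi> i * a i)) \<Longrightarrow>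
      (\<Sum>i\<in>I. \<upsilon> i * a i) \<le> 1 \<Longrightarrow> i \<in> I \<Longrightarrow> a i \<le> real B"
begin

definition region :: "(nat \<Rightarrow> real) \<Rightarrow> bool" where
  "region a \<longleftrightarrow> (\<forall>\<psi>\<in>\<Psi>. 0 < (\<Sum>i\<in>I. \<psi> i * a i)) \<and> (\<Sum>i\<in>I. \<upsilon> i * a i) \<le> 1"

text \<open>Cubes of side \<open>m / N\<close>. When a lattice point, scaled by
  \<open>1 / N\<close>, is assigned to the cube of its quotients by \<open>m\<close>, each cube
  receives one point of every residue class, hence the same number of good points.\<close>

definition cell :: "nat \<Rightarrow> (nat \<Rightarrow> nat) \<Rightarrow> (nat \<Rightarrow> real) set" where
  "cell N k = {a. \<forall>i\<in>I. real m * real (k i) \<le> real N * a i \<and> real N * a i \<le> real m * (real (k i) + 1)}"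

text \<open>Together with \<open>meet\<close>, the inner and outer approximation by cubes that
  define Jordan content.\<close>

definition full :: "nat \<Rightarrow> (nat \<Rightarrow> nat) set" where
  "full N = {k \<in> PiE I (\<lambda>_. UNIV). \<forall>a\<in>cell N k. region a}"

definition meet :: "nat \<Rightarrow> (nat \<Rightarrow> nat) set" where
  "meet N = {k \<in> PiE I (\<lambda>_. UNIV). \<exists>a\<in>cell N k. region a}"

lemma cell_nonneg: "N \<ge> 1 \<Longrightarrow> a \<in> cell N k \<Longrightarrow> i \<in> I \<Longrightarrow> 0 \<le> a i"
proof -
  assume *: "N \<ge> 1" "a \<in> cell N k" "i \<in> I"
  then have "0 \<le> real m * real (k i)" "real m * real (k i) \<le> real N * a i" by (auto simp: cell_def)
  then have "0 \<le> real N * a i" by linarith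
  then show "0 \<le> a i" using *(1) by (simp add: zero_le_mult_iff)
qed

lemma meet_subset:
  assumes N: "N \<ge> 1"
  shows "meet N \<subseteq> PiE I (\<lambda>_. {..N * B})"
proof
  fix k assume "k \<in> meet N"
  then obtain a where k: "k \<in> PiE I (\<lambda>_. UNIV)" and a: "a \<in> cell N k" "region a"
    by (auto simp: meet_def)
  have "k i \<le> N * B" if i: "i \<in> I" for i
  proof -
    have "a i \<le> real B"
      using region_bounded[of a i] cell_nonneg[OF N a(1)] a(2) i by (auto simp: region_def)
    then have "real N * a i \<le> real N * real B" by (intro mult_left_mono) auto
    moreover have "real m * real (k i) \<le> real N * a i" using a(1) i by (auto simp: cell_def)
    moreover have "real (k i) \<le> real m * real (k i)" using m by (simp add: mult_le_cancel_right1)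
    ultimately have "real (k i) \<le> real (N * B)" by simp
    then show ?thesis using of_nat_le_iff by blast
  qed
  then show "k \<in> PiE I (\<lambda>_. {..N * B})" using k by (auto simp: PiE_iff)
qed

lemma finite_meet: "N \<ge> 1 \<Longrightarrow> finite (meet N)"
  using finite_subset[OF meet_subset] finite_PiE[OF finI, of "\<lambda>_. {..N * B}"] by simp

lemma corner_in_cell: "N \<ge> 1 \<Longrightarrow> (\<lambda>i. real m * real (k i) / real N) \<in> cell N k"
  by (auto simp: cell_def intro!: mult_left_mono)

lemma full_subset_meet:
  assumes "N \<ge> 1"
  shows "full N \<subseteq> meet N"
proof
  fix k assume "k \<in> full N"
  then show "k \<in> meet N"
    using corner_in_cell[OF assms, of k] unfolding full_def meet_def by blast
qed

lemma finite_full: "N \<ge> 1 \<Longrightarrow> finite (full N)"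
  using finite_subset[OF full_subset_meet finite_meet] .

lemma cell_refine:
  assumes M: "M \<ge> 1"
  shows "cell (M * N) k \<subseteq> cell N (\<lambda>i\<in>I. k i div M)"
proof
  fix a assume a: "a \<in> cell (M * N) k"
  show "a \<in> cell N (\<lambda>i\<in>I. k i div M)"
    unfolding cell_def
  proof (intro CollectI ballI)
    fix i assume i: "i \<in> I"
    have "real m * real (k i) \<le> real M * (real N * a i)" "real M * (real N * a i) \<le> real m * (real (k i) + 1)"
      using a i by (auto simp: cell_def algebra_simps)
    moreover have "M * (k i div M) \<le> k i" "k i + 1 \<le> M * (k i div M + 1)"
      using M dividend_less_times_div[of M "k i"] by auto
    then have "real (M * (k i div M)) \<le> real (k i)" "real (k i + 1) \<le> real (M * (k i div M + 1))"
      by (simp_all only: of_nat_le_iff)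
    then have "real M * real (k i div M) \<le> real (k i)" "real (k i) + 1 \<le> real M * (real (k i div M) + 1)"
      by (simp_all add: algebra_simps)
    then have "real m * (real M * real (k i div M)) \<le> real m * real (k i)"
      "real m * (real (k i) + 1) \<le> real m * (real M * (real (k i div M) + 1))"
      by (intro mult_left_mono; simp)+
    ultimately have "real M * (real m * real (k i div M)) \<le> real M * (real N * a i)"
      "real M * (real N * a i) \<le> real M * (real m * (real (k i div M) + 1))"
      by (simp_all add: algebra_simps)
    then show "real m * real ((\<lambda>i\<in>I. k i div M) i) \<le> real N * a i \<and>
        real N * a i \<le> real m * (real ((\<lambda>i\<in>I. k i div M) i) + 1)"
      using M i by simp
  qed
qed

text \<open>Parts of a full cube are full, and a part can meet the region only if the whole cube
  does. After normalisation, inner counts therefore grow and outer counts shrink along multiples of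
  a scale.\<close>

lemma card_refine:
  assumes "M \<ge> 1" "N \<ge> 1"
  shows "M ^ card I * card (full N) \<le> card (full (M * N))"
    and "card (meet (M * N)) \<le> M ^ card I * card (meet N)"
proof -
  have card: "card {a \<in> PiE I (\<lambda>_. UNIV). True \<and> (\<lambda>i\<in>I. a i div M) \<in> A} = M ^ card I * card A \<and>
      finite {a \<in> PiE I (\<lambda>_. UNIV). True \<and> (\<lambda>i\<in>I. a i div M) \<in> A}"
    if "A \<subseteq> PiE I (\<lambda>_. UNIV)" "finite A" for A
    using card_periodic_refinement[OF finI assms(1) that, of "\<lambda>_. True"] finI
    by (simp add: card_PiE)
  have f: "full N \<subseteq> PiE I (\<lambda>_. UNIV)" "meet N \<subseteq> PiE I (\<lambda>_. UNIV)" by (auto simp: full_def meet_def)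
  have "{a \<in> PiE I (\<lambda>_. UNIV). True \<and> (\<lambda>i\<in>I. a i div M) \<in> full N} \<subseteq> full (M * N)"
    using subsetD[OF cell_refine[OF assms(1)]] by (auto simp: full_def)
  from card_mono[OF finite_full this] assms show "M ^ card I * card (full N) \<le> card (full (M * N))"
    using card[OF f(1) finite_full[OF assms(2)]] by simp
  have "meet (M * N) \<subseteq> {a \<in> PiE I (\<lambda>_. UNIV). True \<and> (\<lambda>i\<in>I. a i div M) \<in> meet N}"
    using subsetD[OF cell_refine[OF assms(1)]] by (force simp: meet_def)
  from card_mono[OF _ this] show "card (meet (M * N)) \<le> M ^ card I * card (meet N)"
    using card[OF f(2) finite_meet[OF assms(2)]] by simp
qed

lemma linear_form_on_cell:
  assumes a: "a \<in> cell N k"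
  shows "\<bar>real N * (\<Sum>i\<in>I. \<psi> i * a i) - real m * (\<Sum>i\<in>I. \<psi> i * real (k i))\<bar> \<le> real m * (\<Sum>i\<in>I. \<bar>\<psi> i\<bar>)"
proof -
  have "real N * (\<Sum>i\<in>I. \<psi> i * a i) - real m * (\<Sum>i\<in>I. \<psi> i * real (k i))
      = (\<Sum>i\<in>I. \<psi> i * (real N * a i - real m * real (k i)))"
    by (simp add: sum_distrib_left sum_subtractf algebra_simps)
  also have "\<bar>\<dots>\<bar> \<le> (\<Sum>i\<in>I. \<bar>\<psi> i\<bar> * real m)"
  proof (rule order_trans[OF sum_abs], rule sum_mono)
    fix i assume "i \<in> I"
    then have "\<bar>real N * a i - real m * real (k i)\<bar> \<le> real m"
      using a by (auto simp: cell_def algebra_simps abs_le_iff)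
    then show "\<bar>\<psi> i * (real N * a i - real m * real (k i))\<bar> \<le> \<bar>\<psi> i\<bar> * real m"
      by (simp add: abs_mult mult_left_mono)
  qed
  also have "\<dots> = real m * (\<Sum>i\<in>I. \<bar>\<psi> i\<bar>)" by (subst mult.commute) (rule sum_distrib_right[symmetric])
  finally show ?thesis .
qed

text \<open>Corners near the hyperplane where the form takes the value \<open>c\<close>. The zero
  form is excluded: its slab could be the whole box and would not be of lower order.\<close>

definition slab :: "nat \<Rightarrow> (nat \<Rightarrow> real) \<Rightarrow> real \<Rightarrow> (nat \<Rightarrow> nat) set" where
  "slab N \<psi> c = {k \<in> PiE I (\<lambda>_. {..N * B}). (\<exists>i\<in>I. \<psi> i \<noteq> 0) \<and>
     \<bar>(\<Sum>i\<in>I. \<psi> i * real (k i)) - c\<bar> \<le> (\<Sum>i\<in>I. \<bar>\<psi> i\<bar>)}"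

lemma finite_slab: "finite (slab N \<psi> c)"
  unfolding slab_def using finI by (intro finite_subset[OF _ finite_PiE[of I "\<lambda>_. {..N * B}"]]) auto

lemma card_slab_bound: "\<exists>C\<ge>0. \<forall>N\<ge>1. \<forall>c. real (card (slab N \<psi> c)) \<le> C * (real N ^ card I / real N)"
proof (cases "\<exists>i\<in>I. \<psi> i \<noteq> 0")
  case False
  then have "slab N \<psi> c = {}" for N c by (auto simp: slab_def)
  then show ?thesis by (intro exI[of _ 0]) simp
next
  case True
  then obtain i0 where i0: "i0 \<in> I" "\<psi> i0 \<noteq> 0" by blast
  define S where "S = (\<Sum>i\<in>I. \<bar>\<psi> i\<bar>)"
  have S: "0 \<le> S" unfolding S_def by (intro sum_nonneg) auto
  define C where "C = (2 * (S / \<bar>\<psi> i0\<bar>) + 1) * real (B + 1) ^ (card I - 1)"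
  have cI: "card I \<ge> 1" using i0 finI by (metis One_nat_def Suc_leI card_gt_0_iff empty_iff)
  have "real (card (slab N \<psi> c)) \<le> C * (real N ^ card I / real N)" if N: "N \<ge> 1" for N c
  proof -
    have "slab N \<psi> c = {k \<in> PiE I (\<lambda>_. {..N * B}). \<bar>(\<Sum>i\<in>I. \<psi> i * real (k i)) - c\<bar> \<le> S}"
      using True by (auto simp: slab_def S_def)
    then have "real (card (slab N \<psi> c)) \<le> (2 * (S / \<bar>\<psi> i0\<bar>) + 1) * real (N * B + 1) ^ (card I - 1)"
      using card_slab_le[where \<psi> = \<psi> and R = "N * B" and c = c, OF finI i0 S] by simp
    also have "\<dots> \<le> (2 * (S / \<bar>\<psi> i0\<bar>) + 1) * (real (B + 1) * real N) ^ (card I - 1)"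
      using S N by (intro mult_left_mono power_mono) (auto simp: algebra_simps)
    also have "\<dots> = C * real N ^ (card I - 1)" by (simp add: C_def power_mult_distrib)
    also have "real N ^ (card I - 1) = real N ^ card I / real N"
      using N cI by (simp add: power_diff)
    finally show ?thesis .
  qed
  moreover have "0 \<le> C" using S by (simp add: C_def)
  ultimately show ?thesis by blast
qed

text \<open>A boundary cube contains a point inside and a point outside the region, so some linear
  form changes side on it. Being nonconstant on the cube, this form is not zero, and it varies too
  little across the cube for the corner to be far from the bounding hyperplane.\<close>

lemma boundary_subset:
  assumes N: "N \<ge> 1"
  shows "meet N - full N \<subseteq> (\<Union>\<psi>\<in>\<Psi>. slab N \<psi> 0) \<union> slab N \<upsilon> (real N / real m)"
proof
  fix k assume k: "k \<in> meet N - full N"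
  then have k': "k \<in> PiE I (\<lambda>_. {..N * B})" using meet_subset[OF N] by blast
  obtain a a' where a: "a \<in> cell N k" "region a" and a': "a' \<in> cell N k" "\<not> region a'"
    using k by (auto simp: meet_def full_def)
  have m0: "0 < real m" using m by simp
  have N0: "0 < real N" using N by simp
  have nz: "\<exists>i\<in>I. \<psi> i \<noteq> 0" if "(\<Sum>i\<in>I. \<psi> i * a i) \<noteq> (\<Sum>i\<in>I. \<psi> i * a' i)" for \<psi>
    using that by (metis (no_types, lifting) mult_zero_left sum.cong)
  from a' consider \<psi> where "\<psi> \<in> \<Psi>" "(\<Sum>i\<in>I. \<psi> i * a' i) \<le> 0" | "1 < (\<Sum>i\<in>I. \<upsilon> i * a' i)"
    by (auto simp: region_def not_less not_le)
  then show "k \<in> (\<Union>\<psi>\<in>\<Psi>. slab N \<psi> 0) \<union> slab N \<upsilon> (real N / real m)"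
  proof cases
    case (1 \<psi>)
    have p: "0 < (\<Sum>i\<in>I. \<psi> i * a i)" using a 1 by (auto simp: region_def)
    then have "0 \<le> real N * (\<Sum>i\<in>I. \<psi> i * a i)" "real N * (\<Sum>i\<in>I. \<psi> i * a' i) \<le> 0"
      using N0 1 by (auto simp: mult_le_0_iff)
    then have "\<bar>real m * (\<Sum>i\<in>I. \<psi> i * real (k i))\<bar> \<le> real m * (\<Sum>i\<in>I. \<bar>\<psi> i\<bar>)"
      using linear_form_on_cell[OF a(1), of \<psi>] linear_form_on_cell[OF a'(1), of \<psi>] by linarith
    then have "\<bar>\<Sum>i\<in>I. \<psi> i * real (k i)\<bar> \<le> (\<Sum>i\<in>I. \<bar>\<psi> i\<bar>)"
      using m0 by (simp add: abs_mult)
    then have "k \<in> slab N \<psi> 0" using k' nz[of \<psi>] p 1 by (simp add: slab_def)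
    then show ?thesis using 1 by blast
  next
    case 2
    have p: "(\<Sum>i\<in>I. \<upsilon> i * a i) \<le> 1" using a by (auto simp: region_def)
    then have "real N * (\<Sum>i\<in>I. \<upsilon> i * a i) \<le> real N" "real N \<le> real N * (\<Sum>i\<in>I. \<upsilon> i * a' i)"
      using N0 2 by (auto simp: mult_le_cancel_left1 mult_le_cancel_left2)
    then have "\<bar>real m * (\<Sum>i\<in>I. \<upsilon> i * real (k i)) - real N\<bar> \<le> real m * (\<Sum>i\<in>I. \<bar>\<upsilon> i\<bar>)"
      using linear_form_on_cell[OF a(1), of \<upsilon>] linear_form_on_cell[OF a'(1), of \<upsilon>] by linarith
    moreover have "real m * (\<Sum>i\<in>I. \<upsilon> i * real (k i)) - real N = real m * ((\<Sum>i\<in>I. \<upsilon> i * real (k i)) - real N / real m)"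
      using m0 by (simp add: algebra_simps)
    ultimately have "\<bar>(\<Sum>i\<in>I. \<upsilon> i * real (k i)) - real N / real m\<bar> \<le> (\<Sum>i\<in>I. \<bar>\<upsilon> i\<bar>)"
      using m0 by (simp add: abs_mult)
    then have "k \<in> slab N \<upsilon> (real N / real m)" using k' nz[of \<upsilon>] p 2 by (simp add: slab_def)
    then show ?thesis by blast
  qed
qed

lemma card_boundary:
  obtains C where "C \<ge> 0" "\<And>N. N \<ge> 1 \<Longrightarrow> real (card (meet N)) - real (card (full N)) \<le> C * (real N ^ card I / real N)"
proof -
  obtain c where c: "\<And>\<psi>. 0 \<le> c \<psi>"
    "\<And>\<psi> N x. N \<ge> 1 \<Longrightarrow> real (card (slab N \<psi> x)) \<le> c \<psi> * (real N ^ card I / real N)"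
    using card_slab_bound by metis
  define C where "C = (\<Sum>\<psi>\<in>\<Psi>. c \<psi>) + c \<upsilon>"
  show thesis
  proof (rule that[of C])
    show "C \<ge> 0" unfolding C_def using c by (intro add_nonneg_nonneg sum_nonneg) auto
    fix N :: nat assume N: "N \<ge> 1"
    have "card (meet N) - card (full N) = card (meet N - full N)"
      using card_Diff_subset[OF finite_full[OF N] full_subset_meet[OF N]] by simp
    also have "\<dots> \<le> card ((\<Union>\<psi>\<in>\<Psi>. slab N \<psi> 0) \<union> slab N \<upsilon> (real N / real m))"
      using fin\<Psi> finite_slab by (intro card_mono boundary_subset N) auto
    also have "\<dots> \<le> card (\<Union>\<psi>\<in>\<Psi>. slab N \<psi> 0) + card (slab N \<upsilon> (real N / real m))" by (rule card_Un_le)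
    also have "card (\<Union>\<psi>\<in>\<Psi>. slab N \<psi> 0) \<le> (\<Sum>\<psi>\<in>\<Psi>. card (slab N \<psi> 0))" by (rule card_UN_le[OF fin\<Psi>])
    finally have "real (card (meet N) - card (full N)) \<le>
        real ((\<Sum>\<psi>\<in>\<Psi>. card (slab N \<psi> 0)) + card (slab N \<upsilon> (real N / real m)))"
      by (simp only: of_nat_le_iff)
    also have "\<dots> = (\<Sum>\<psi>\<in>\<Psi>. real (card (slab N \<psi> 0))) + real (card (slab N \<upsilon> (real N / real m)))" by simp
    also have "\<dots> \<le> (\<Sum>\<psi>\<in>\<Psi>. c \<psi> * (real N ^ card I / real N)) + c \<upsilon> * (real N ^ card I / real N)"
      using c N by (intro add_mono sum_mono) auto
    also have "\<dots> = C * (real N ^ card I / real N)"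
      unfolding C_def by (simp only: sum_distrib_right distrib_right)
    finally show "real (card (meet N)) - real (card (full N)) \<le> C * (real N ^ card I / real N)" by linarith
  qed
qed

definition points :: "nat \<Rightarrow> (nat \<Rightarrow> nat) set" where
  "points N = {a \<in> PiE I (\<lambda>_. UNIV). good a \<and> (\<forall>\<psi>\<in>\<Psi>. 0 < (\<Sum>i\<in>I. \<psi> i * real (a i))) \<and>
     (\<Sum>i\<in>I. \<upsilon> i * real (a i)) \<le> real N}"

definition residues :: nat where
  "residues = card {r \<in> PiE I (\<lambda>_. {..<m}). good r}"

text \<open>Assigning a good point to the cube of its quotients by \<open>m\<close> is a map with
  fibres of size \<open>residues\<close>. All good points assigned to a full cube lie in the region,
  and every point of the region is assigned to a cube that meets it.\<close>

lemma card_points_bounds: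
  assumes N: "N \<ge> 1"
  shows "residues * card (full N) \<le> card (points N)" "card (points N) \<le> residues * card (meet N)"
    "finite (points N)"
proof -
  have N0: "0 < real N" using N by simp
  have reg: "region (\<lambda>i. real (a i) / real N) \<longleftrightarrow>
      (\<forall>\<psi>\<in>\<Psi>. 0 < (\<Sum>i\<in>I. \<psi> i * real (a i))) \<and> (\<Sum>i\<in>I. \<upsilon> i * real (a i)) \<le> real N" for a
  proof -
    have "(\<Sum>i\<in>I. \<psi> i * (real (a i) / real N)) = (\<Sum>i\<in>I. \<psi> i * real (a i)) / real N" for \<psi>
      by (simp add: sum_divide_distrib)
    then show ?thesis using N0 by (simp add: region_def zero_less_divide_iff divide_le_eq)
  qed
  have cell: "(\<lambda>i. real (a i) / real N) \<in> cell N (\<lambda>i\<in>I. a i div m)" for a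
    unfolding cell_def
  proof (intro CollectI ballI)
    fix i assume i: "i \<in> I"
    have "m * (a i div m) \<le> a i" "a i \<le> m * (a i div m + 1)"
      using m dividend_less_times_div[of m "a i"] by auto
    then have "real (m * (a i div m)) \<le> real (a i)" "real (a i) \<le> real (m * (a i div m + 1))"
      by (simp_all only: of_nat_le_iff)
    then have "real m * real (a i div m) \<le> real (a i)" "real (a i) \<le> real m * (real (a i div m) + 1)"
      by (simp_all add: algebra_simps)
    then show "real m * real ((\<lambda>i\<in>I. a i div m) i) \<le> real N * (real (a i) / real N) \<and>
        real N * (real (a i) / real N) \<le> real m * (real ((\<lambda>i\<in>I. a i div m) i) + 1)"
      using N0 i by simp
  qed
  have pts: "points N = {a \<in> PiE I (\<lambda>_. UNIV). good a \<and> region (\<lambda>i. real (a i) / real N)}"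
    by (auto simp: points_def reg)
  note c = card_periodic_refinement[OF finI m _ _ good_periodic]
  have f: "full N \<subseteq> PiE I (\<lambda>_. UNIV)" "meet N \<subseteq> PiE I (\<lambda>_. UNIV)" by (auto simp: full_def meet_def)
  have sub: "{a \<in> PiE I (\<lambda>_. UNIV). good a \<and> (\<lambda>i\<in>I. a i div m) \<in> full N} \<subseteq> points N"
    unfolding pts using cell by (auto simp: full_def)
  have sup: "points N \<subseteq> {a \<in> PiE I (\<lambda>_. UNIV). good a \<and> (\<lambda>i\<in>I. a i div m) \<in> meet N}"
    unfolding pts using cell by (auto simp: meet_def)
  show fin: "finite (points N)" by (rule finite_subset[OF sup c(2)[OF f(2) finite_meet[OF N]]])
  show "residues * card (full N) \<le> card (points N)"
    using card_mono[OF fin sub] c(1)[OF f(1) finite_full[OF N]] by (simp add: residues_def)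
  show "card (points N) \<le> residues * card (meet N)"
    using card_mono[OF c(2)[OF f(2) finite_meet[OF N]] sup] c(1)[OF f(2) finite_meet[OF N]]
    by (simp add: residues_def)
qed

lemma finite_points: "finite (points N)"
proof -
  have "points N \<subseteq> points (max 1 N)" by (auto simp: points_def)
  then show ?thesis using card_points_bounds(3)[of "max 1 N"] finite_subset by auto
qed

text \<open>A suitable multiple of \<open>a0\<close> satisfies all inequalities of the region
  strictly. There are finitely many of them, so they persist on a small enough cube around that
  point; this is what makes the limit positive.\<close>

lemma full_nonempty:
  assumes a0: "\<And>i. i \<in> I \<Longrightarrow> 0 \<le> a0 i" "\<And>\<psi>. \<psi> \<in> \<Psi> \<Longrightarrow> 0 < (\<Sum>i\<in>I. \<psi> i * a0 i)"
  shows "\<exists>N\<ge>1. full N \<noteq> {}"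
proof -
  \<comment> \<open>This factor brings the value of \<open>\<upsilon>\<close> strictly below 1,
    whatever its sign at \<open>a0\<close>.\<close>
  define t where "t = 1 / (\<bar>\<Sum>i\<in>I. \<upsilon> i * a0 i\<bar> + 1)"
  have t: "0 < t" by (simp add: t_def)
  define b where "b i = t * a0 i" for i
  have bs: "(\<Sum>i\<in>I. \<psi> i * b i) = t * (\<Sum>i\<in>I. \<psi> i * a0 i)" for \<psi>
    by (simp add: b_def sum_distrib_left algebra_simps)
  have b0: "\<And>i. i \<in> I \<Longrightarrow> 0 \<le> b i" using a0(1) t by (simp add: b_def)
  have b\<psi>: "\<And>\<psi>. \<psi> \<in> \<Psi> \<Longrightarrow> 0 < (\<Sum>i\<in>I. \<psi> i * b i)" using a0(2) t by (simp add: bs)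
  have b\<upsilon>: "(\<Sum>i\<in>I. \<upsilon> i * b i) < 1"
  proof -
    have "(\<Sum>i\<in>I. \<upsilon> i * a0 i) < \<bar>\<Sum>i\<in>I. \<upsilon> i * a0 i\<bar> + 1" by linarith
    then show ?thesis unfolding bs by (simp add: t_def divide_less_eq)
  qed
  have lim: "(\<lambda>N. 2 * real m * (\<Sum>i\<in>I. \<bar>\<psi> i\<bar>) / real N) \<longlonglongrightarrow> 0" for \<psi>
    by (rule lim_const_over_n)
  have "\<forall>\<^sub>F N in sequentially. \<forall>\<psi>\<in>\<Psi>. 2 * real m * (\<Sum>i\<in>I. \<bar>\<psi> i\<bar>) / real N < (\<Sum>i\<in>I. \<psi> i * b i)"
    using fin\<Psi> b\<psi> lim by (intro eventually_ball_finite ballI order_tendstoD(2)) auto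
  moreover have "\<forall>\<^sub>F N in sequentially. 2 * real m * (\<Sum>i\<in>I. \<bar>\<upsilon> i\<bar>) / real N < 1 - (\<Sum>i\<in>I. \<upsilon> i * b i)"
    using b\<upsilon> lim by (intro order_tendstoD(2)) auto
  moreover note eventually_ge_at_top[of 1]
  ultimately have "\<forall>\<^sub>F N in sequentially. N \<ge> 1 \<and> (\<forall>\<psi>\<in>\<Psi>. 2 * real m * (\<Sum>i\<in>I. \<bar>\<psi> i\<bar>) / real N < (\<Sum>i\<in>I. \<psi> i * b i)) \<and>
      2 * real m * (\<Sum>i\<in>I. \<bar>\<upsilon> i\<bar>) / real N < 1 - (\<Sum>i\<in>I. \<upsilon> i * b i)"
    by eventually_elim auto
  then obtain N where N: "N \<ge> 1" "\<And>\<psi>. \<psi> \<in> \<Psi> \<Longrightarrow> 2 * real m * (\<Sum>i\<in>I. \<bar>\<psi> i\<bar>) / real N < (\<Sum>i\<in>I. \<psi> i * b i)"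
    "2 * real m * (\<Sum>i\<in>I. \<bar>\<upsilon> i\<bar>) / real N < 1 - (\<Sum>i\<in>I. \<upsilon> i * b i)"
    by (auto simp: eventually_sequentially)
  have N0: "0 < real N" and m0: "0 < real m" using N(1) m by auto
  define k where "k = (\<lambda>i\<in>I. nat \<lfloor>real N * b i / real m\<rfloor>)"
  have "b \<in> cell N k"
    unfolding cell_def
  proof (intro CollectI ballI)
    fix i assume i: "i \<in> I"
    have "0 \<le> real N * b i / real m" using b0[OF i] by simp
    then have "real (k i) \<le> real N * b i / real m" "real N * b i / real m \<le> real (k i) + 1"
      using i by (auto simp: k_def)
    then show "real m * real (k i) \<le> real N * b i \<and> real N * b i \<le> real m * (real (k i) + 1)"
      using m0 by (simp add: field_simps)
  qed
  have close: "\<bar>(\<Sum>i\<in>I. \<psi> i * a i) - (\<Sum>i\<in>I. \<psi> i * b i)\<bar> \<le> 2 * real m * (\<Sum>i\<in>I. \<bar>\<psi> i\<bar>) / real N"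
    if "a \<in> cell N k" for a \<psi>
  proof -
    have "\<bar>real N * (\<Sum>i\<in>I. \<psi> i * a i) - real N * (\<Sum>i\<in>I. \<psi> i * b i)\<bar> \<le> 2 * real m * (\<Sum>i\<in>I. \<bar>\<psi> i\<bar>)"
      using linear_form_on_cell[OF that, of \<psi>] linear_form_on_cell[OF \<open>b \<in> cell N k\<close>, of \<psi>] by linarith
    then have "real N * \<bar>(\<Sum>i\<in>I. \<psi> i * a i) - (\<Sum>i\<in>I. \<psi> i * b i)\<bar> \<le> 2 * real m * (\<Sum>i\<in>I. \<bar>\<psi> i\<bar>)"
      by (simp add: right_diff_distrib[symmetric] abs_mult)
    then show ?thesis using N0 by (simp add: le_divide_eq mult.commute)
  qed
  have "region a" if "a \<in> cell N k" for a
    unfolding region_def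
  proof
    show "\<forall>\<psi>\<in>\<Psi>. 0 < (\<Sum>i\<in>I. \<psi> i * a i)"
    proof
      fix \<psi> assume "\<psi> \<in> \<Psi>"
      then show "0 < (\<Sum>i\<in>I. \<psi> i * a i)" using close[OF that, of \<psi>] N(2)[of \<psi>] by linarith
    qed
    show "(\<Sum>i\<in>I. \<upsilon> i * a i) \<le> 1" using close[OF that, of \<upsilon>] N(3) by linarith
  qed
  then have "k \<in> full N" by (simp add: full_def k_def)
  then show ?thesis using N(1) by blast
qed

text \<open>Comparing two scales at their product shows that every normalised inner count is at most
  every outer one, while at scale \<open>N\<close> they differ by at most a constant over
  \<open>N\<close>. Both therefore converge to the supremum of the inner counts, and the points are
  squeezed between them, up to the factor \<open>residues\<close>.\<close>

theorem card_points_limit: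
  obtains L where "(\<lambda>N. real (card (points N)) / real N ^ card I) \<longlonglongrightarrow> L"
    and "\<And>a0. (\<And>i. i \<in> I \<Longrightarrow> 0 \<le> a0 i) \<Longrightarrow> (\<And>\<psi>. \<psi> \<in> \<Psi> \<Longrightarrow> 0 < (\<Sum>i\<in>I. \<psi> i * a0 i)) \<Longrightarrow> good (\<lambda>i. 0) \<Longrightarrow> L > 0"
proof -
  define f where "f N = real (card (full N)) / real N ^ card I" for N
  define g where "g N = real (card (meet N)) / real N ^ card I" for N
  obtain C where C: "C \<ge> 0" "\<And>N. N \<ge> 1 \<Longrightarrow> real (card (meet N)) - real (card (full N)) \<le> C * (real N ^ card I / real N)"
    using card_boundary by blast
  have fg: "f N \<le> g M" if "N \<ge> 1" "M \<ge> 1" for N M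
  proof -
    have "f N \<le> f (M * N)"
    proof -
      have "real (M ^ card I * card (full N)) \<le> real (card (full (M * N)))"
        using card_refine(1)[OF that(2,1)] by (rule of_nat_mono)
      then show ?thesis using that by (simp add: f_def field_simps power_mult_distrib)
    qed
    also have "\<dots> \<le> g (M * N)"
      unfolding f_def g_def using that
      by (intro divide_right_mono of_nat_mono card_mono finite_meet full_subset_meet) auto
    also have "\<dots> = g (N * M)" by (simp add: mult.commute)
    also have "\<dots> \<le> g M"
    proof -
      have "real (card (meet (N * M))) \<le> real (N ^ card I * card (meet M))"
        using card_refine(2)[OF that(1,2)] by (rule of_nat_mono)
      then show ?thesis using that by (simp add: g_def field_simps power_mult_distrib)
    qed
    finally show ?thesis .
  qed
  define L where "L = (SUP N\<in>{1..}. f N)"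
  have bdd: "bdd_above (f ` {1..})" using fg by (intro bdd_aboveI2[of _ _ "g 1"]) auto
  have fL: "f N \<le> L" if "N \<ge> 1" for N unfolding L_def using bdd that by (intro cSUP_upper) auto
  have Lg: "L \<le> g N" if "N \<ge> 1" for N unfolding L_def using fg that by (intro cSUP_least) auto
  have gf: "g N - f N \<le> C / real N" if "N \<ge> 1" for N
  proof -
    have "g N - f N = (real (card (meet N)) - real (card (full N))) / real N ^ card I"
      by (simp add: f_def g_def diff_divide_distrib)
    also have "\<dots> \<le> C * (real N ^ card I / real N) / real N ^ card I"
      using C(2)[OF that] by (intro divide_right_mono) auto
    also have "\<dots> = C / real N" using that by simp
    finally show ?thesis .
  qed
  have limC: "(\<lambda>N. C / real N) \<longlonglongrightarrow> 0" by (rule lim_const_over_n)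
  have "(\<lambda>N. L - C / real N) \<longlonglongrightarrow> L - 0" "(\<lambda>N. L + C / real N) \<longlonglongrightarrow> L + 0"
    by (intro tendsto_intros limC)+
  then have lims: "(\<lambda>N. real residues * (L - C / real N)) \<longlonglongrightarrow> real residues * L"
    "(\<lambda>N. real residues * (L + C / real N)) \<longlonglongrightarrow> real residues * L"
    by (auto intro: tendsto_mult_left)
  have low: "\<forall>\<^sub>F N in sequentially. real residues * (L - C / real N) \<le> real (card (points N)) / real N ^ card I"
    using eventually_ge_at_top[of 1]
  proof eventually_elim
    case (elim N)
    have "real residues * (L - C / real N) \<le> real residues * f N"
      using gf[OF elim] Lg[OF elim] by (intro mult_left_mono) auto
    also have "\<dots> = real (residues * card (full N)) / real N ^ card I" by (simp add: f_def)
    also have "\<dots> \<le> real (card (points N)) / real N ^ card I"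
      by (intro divide_right_mono of_nat_mono card_points_bounds elim) auto
    finally show ?case .
  qed
  have up: "\<forall>\<^sub>F N in sequentially. real (card (points N)) / real N ^ card I \<le> real residues * (L + C / real N)"
    using eventually_ge_at_top[of 1]
  proof eventually_elim
    case (elim N)
    have "real (card (points N)) / real N ^ card I \<le> real (residues * card (meet N)) / real N ^ card I"
      by (intro divide_right_mono of_nat_mono card_points_bounds elim) auto
    also have "\<dots> = real residues * g N" by (simp add: g_def)
    also have "\<dots> \<le> real residues * (L + C / real N)"
      using gf[OF elim] fL[OF elim] by (intro mult_left_mono) auto
    finally show ?case .
  qed
  show thesis
  proof (rule that)
    show "(\<lambda>N. real (card (points N)) / real N ^ card I) \<longlonglongrightarrow> real residues * L"
      by (rule tendsto_sandwich[OF low up lims])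
    fix a0 :: "nat \<Rightarrow> real"
    assume a0: "\<And>i. i \<in> I \<Longrightarrow> 0 \<le> a0 i" "\<And>\<psi>. \<psi> \<in> \<Psi> \<Longrightarrow> 0 < (\<Sum>i\<in>I. \<psi> i * a0 i)" and g0: "good (\<lambda>i. 0)"
    obtain N where N: "N \<ge> 1" "full N \<noteq> {}" using full_nonempty[of a0] a0 by blast
    then have "0 < f N" using finite_full[OF N(1)] by (simp add: f_def card_gt_0_iff)
    then have "0 < L" using fL[OF N(1)] by linarith
    \<comment> \<open>At least the zero residue class is good, so full cubes do contain good
      points.\<close>
    moreover have "good (\<lambda>i\<in>I. 0)" using g0 good_periodic[of "\<lambda>i\<in>I. 0" "\<lambda>i. 0"] by simp
    then have "residues > 0"
      unfolding residues_def card_gt_0_iff using finI m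
      by (auto intro!: finite_subset[OF _ finite_PiE[of I "\<lambda>_. {..<m}"]] exI[of _ "\<lambda>i\<in>I. 0"])
    ultimately show "0 < real residues * L" by simp
  qed
qed

end

subsection \<open>Primitive points and averages along enumerations\<close>

text \<open>A telescoping estimate that starts with equality at \<open>N = 2\<close>. What matters
  is that the bound is below 1, for it becomes a contraction factor.\<close>

lemma sum_inverse_squares_from_2: "(\<Sum>k=2..N. 1 / (real k)\<^sup>2) \<le> 3 / 4"
proof -
  have "(\<Sum>k=2..N. 1 / (real k)\<^sup>2) \<le> 3 / 4 - 1 / real N" if "N \<ge> 2" for N
    using that
  proof (induction N rule: nat_induct_at_least)
    case base then show ?case by simp
  next
    case (Suc n)
    have "1 / (real (Suc n))\<^sup>2 \<le> 1 / (real n * real (Suc n))"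
      using Suc.hyps by (intro divide_left_mono) (auto simp: power2_eq_square)
    also have "\<dots> = 1 / real n - 1 / real (Suc n)"
      using Suc.hyps by (simp add: field_simps)
    finally show ?case using Suc by simp
  qed
  then show ?thesis
    by (cases "N \<ge> 2") (auto intro: order_trans[of _ "3 / 4 - 1 / real N"] simp del: le_divide_eq_numeral1)
qed

lemma nat_div_ratio_le: "real (N div k) / real N \<le> 1 / real k"
proof (cases "N = 0 \<or> k = 0")
  case False
  have "real (N div k) \<le> real N / real k" by (rule of_nat_div_le_of_nat)
  then show ?thesis using False by (simp add: field_simps)
qed auto

lemma nat_div_ratio_tendsto: "(\<lambda>N. real (N div k) / real N) \<longlonglongrightarrow> 1 / real k"
proof (cases "k = 0")
  case False
  have low: "1 / real k - 1 / real N \<le> real (N div k) / real N" if "N \<ge> 1" for N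
  proof -
    have "real N / real k - real (N div k) \<le> 1"
      using floor_divide_of_nat_eq[of N k, where 'a = real] floor_correct[of "real N / real k"]
      by simp
    then have "(real N / real k - 1) / real N \<le> real (N div k) / real N"
      by (intro divide_right_mono) auto
    moreover have "(real N / real k - 1) / real N = 1 / real k - 1 / real N"
      using that False by (simp add: field_simps)
    ultimately show ?thesis by simp
  qed
  have "(\<lambda>N. 1 / real k - 1 / real N) \<longlonglongrightarrow> 1 / real k - 0"
    by (intro tendsto_intros lim_1_over_n)
  then have lim: "(\<lambda>N. 1 / real k - 1 / real N) \<longlonglongrightarrow> 1 / real k" by simp
  have "\<forall>\<^sub>F N in sequentially. 1 / real k - 1 / real N \<le> real (N div k) / real N"
    using eventually_ge_at_top[of 1] by eventually_elim (rule low)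
  moreover have "\<forall>\<^sub>F N in sequentially. real (N div k) / real N \<le> 1 / real k"
    by (simp add: nat_div_ratio_le)
  ultimately show ?thesis by (rule tendsto_sandwich[OF _ _ lim tendsto_const])
qed simp

lemma summable_inverse_power:
  assumes "D \<ge> 2"
  shows "summable (\<lambda>k. (1 / real k) ^ D)"
  using inverse_power_summable[OF assms, where 'a=real] by (simp add: power_divide inverse_eq_divide)

text \<open>If \<open>\<bar>q\<bar>\<close> is eventually at most \<open>A\<close>, the recursion
  improves this to \<open>3 / 4 * A\<close> up to an arbitrarily small error: for most
  \<open>k\<close> the index \<open>N div k\<close> is still large, and the remaining
  \<open>k\<close> contribute only a tail of the convergent series of inverse squares. Iteration
  gives the limit 0.\<close>

lemma tendsto_zero_by_contraction:
  fixes q \<eta> :: "nat \<Rightarrow> real"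
  assumes bound: "\<And>N. \<bar>q N\<bar> \<le> C" and \<eta>: "\<eta> \<longlonglongrightarrow> 0"
    and le: "\<And>N. N \<ge> 1 \<Longrightarrow> \<bar>q N\<bar> \<le> \<eta> N + (\<Sum>k=2..N. 1 / (real k)\<^sup>2 * \<bar>q (N div k)\<bar>)"
  shows "q \<longlonglongrightarrow> 0"
proof -
  have C: "0 \<le> C" using bound[of 0] by linarith
  \<comment> \<open>These are the terms with \<open>N div k < M\<close>. Each fixed \<open>k\<close>
    drops out once \<open>N\<close> is large, and the series is dominated, so limit and sum may be
    exchanged.\<close>
  have tail: "(\<lambda>N. \<Sum>k=2..N. if N < M * k then C / (real k)\<^sup>2 else 0) \<longlonglongrightarrow> 0" for M
  proof -
    let ?a = "\<lambda>k N. if N < M * k \<and> k \<le> N \<and> 2 \<le> k then C / (real k)\<^sup>2 else 0"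
    have "(\<lambda>N. \<Sum>k. ?a k N) \<longlonglongrightarrow> (\<Sum>k. 0)"
    proof (rule tannerys_theorem[where M = "\<lambda>k. C * (1 / real k) ^ 2", THEN conjunct2, THEN conjunct2])
      show "(\<lambda>N. ?a k N) \<longlonglongrightarrow> 0" for k
        by (rule tendsto_eventually, rule eventually_mono[OF eventually_ge_at_top[of "M * k"]]) auto
      show "\<forall>\<^sub>F (k, N) in sequentially \<times>\<^sub>F sequentially. norm (?a k N) \<le> C * (1 / real k) ^ 2"
        using C by (intro always_eventually) (auto simp: power_divide)
      show "summable (\<lambda>k. C * (1 / real k) ^ 2)"
        by (intro summable_mult summable_inverse_power) simp
    qed simp
    moreover have "(\<Sum>k. ?a k N) = (\<Sum>k=2..N. if N < M * k then C / (real k)\<^sup>2 else 0)" for N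
      by (subst suminf_finite[where N = "{2..N}"]) (auto intro!: sum.cong)
    ultimately show ?thesis by simp
  qed
  have step: "\<forall>\<^sub>F N in sequentially. \<bar>q N\<bar> \<le> 3 / 4 * A + e"
    if ev: "\<forall>\<^sub>F N in sequentially. \<bar>q N\<bar> \<le> A" and A: "0 \<le> A" and e: "0 < e" for A e
  proof -
    obtain M where M: "\<And>N. N \<ge> M \<Longrightarrow> \<bar>q N\<bar> \<le> A"
      using ev by (auto simp: eventually_sequentially)
    have "\<forall>\<^sub>F N in sequentially. \<eta> N < e / 2"
      using \<eta> e by (intro order_tendstoD) auto
    moreover have "\<forall>\<^sub>F N in sequentially. (\<Sum>k=2..N. if N < M * k then C / (real k)\<^sup>2 else 0) < e / 2"
      using tail[of M] e by (intro order_tendstoD) auto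
    ultimately show ?thesis using eventually_ge_at_top[of 1]
    proof eventually_elim
      case (elim N)
      have "(\<Sum>k=2..N. 1 / (real k)\<^sup>2 * \<bar>q (N div k)\<bar>)
          \<le> (\<Sum>k=2..N. 1 / (real k)\<^sup>2 * A + (if N < M * k then C / (real k)\<^sup>2 else 0))"
      proof (rule sum_mono)
        fix k assume k: "k \<in> {2..N}"
        show "1 / (real k)\<^sup>2 * \<bar>q (N div k)\<bar> \<le> 1 / (real k)\<^sup>2 * A + (if N < M * k then C / (real k)\<^sup>2 else 0)"
        proof (cases "N < M * k")
          case True
          have "1 / (real k)\<^sup>2 * \<bar>q (N div k)\<bar> \<le> 1 / (real k)\<^sup>2 * C"
            by (intro mult_left_mono bound) auto
          moreover have "0 \<le> 1 / (real k)\<^sup>2 * A" using A by simp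
          ultimately show ?thesis using True by simp
        next
          case False
          then have "M \<le> N div k" using k by (simp add: less_eq_div_iff_mult_less_eq)
          then have "1 / (real k)\<^sup>2 * \<bar>q (N div k)\<bar> \<le> 1 / (real k)\<^sup>2 * A"
            by (intro mult_left_mono M) auto
          then show ?thesis using False by simp
        qed
      qed
      also have "\<dots> = A * (\<Sum>k=2..N. 1 / (real k)\<^sup>2) + (\<Sum>k=2..N. if N < M * k then C / (real k)\<^sup>2 else 0)"
        by (simp add: sum.distrib sum_distrib_left mult.commute)
      also have "\<dots> \<le> A * (3 / 4) + e / 2"
        using elim by (intro add_mono mult_left_mono sum_inverse_squares_from_2 A) auto
      finally show ?case using le[of N] elim by linarith
    qed
  qed
  \<comment> \<open>The summand \<open>4 * e\<close> is the fixed point of sending \<open>A\<close>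
    to \<open>3 / 4 * A + e\<close>.\<close>
  have iter: "\<forall>\<^sub>F N in sequentially. \<bar>q N\<bar> \<le> (3 / 4) ^ j * C + 4 * e" if e: "0 < e" for j e
  proof (induction j)
    case 0
    have "\<bar>q N\<bar> \<le> C + 4 * e" for N using bound[of N] e by linarith
    then show ?case by simp
  next
    case (Suc j)
    from step[OF Suc _ e] C e show ?case by (simp add: algebra_simps)
  qed
  show ?thesis
  proof (rule tendstoI)
    fix e :: real assume e: "0 < e"
    have "(\<lambda>j. (3 / 4) ^ j * C) \<longlonglongrightarrow> 0 * C"
      by (intro tendsto_intros LIMSEQ_power_zero) simp
    then have "\<forall>\<^sub>F j in sequentially. (3 / 4) ^ j * C < e / 4"
      using e by (intro order_tendstoD) auto
    then obtain j where j: "(3 / 4) ^ j * C < e / 4"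
      by (auto simp: eventually_sequentially)
    have "\<forall>\<^sub>F N in sequentially. \<bar>q N\<bar> \<le> (3 / 4) ^ j * C + 4 * (e / 8)"
      by (rule iter) (use e in simp)
    then show "\<forall>\<^sub>F N in sequentially. dist (q N) 0 < e"
      by eventually_elim (use j e in \<open>simp add: dist_real_def\<close>)
  qed
qed

text \<open>Passing from all lattice points to primitive ones: the limit gets divided by \<open>\<zeta>(D)\<close>. Instead of
  Moebius inversion one can use that \<open>\<zeta>(D) - 1 < 1\<close>, which makes the recursion a contraction.\<close>

lemma div_sum_asymptotics:
  fixes P T :: "nat \<Rightarrow> real"
  assumes D: "D \<ge> 2" and P: "\<And>N. 0 \<le> P N" and T: "\<And>N. T N = (\<Sum>k=1..N. P (N div k))"
    and lim: "(\<lambda>N. T N / real N ^ D) \<longlonglongrightarrow> \<tau>"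
  shows "(\<lambda>N. P N / real N ^ D) \<longlonglongrightarrow> \<tau> / (\<Sum>k. (1 / real k) ^ D)" "(\<Sum>k. (1 / real k) ^ D) > 0"
proof -
  define Z where "Z = (\<Sum>k. (1 / real k) ^ D)"
  define \<rho> where "\<rho> = \<tau> / Z"
  define p where "p N = P N / real N ^ D" for N
  \<comment> \<open>The factor with which \<open>p (N div k)\<close> enters
    \<open>T N / N ^ D\<close>; it tends to the \<open>k\<close>-th term of the zeta series and
    never exceeds it.\<close>
  define c where "c N k = (real (N div k) / real N) ^ D" for N k
  show Z: "(\<Sum>k. (1 / real k) ^ D) > 0"
    using summable_inverse_power[OF D] by (rule suminf_pos2[where i = 1]) auto
  have c_le: "c N k \<le> (1 / real k) ^ D" "0 \<le> c N k" for N k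
    unfolding c_def by (auto intro: power_mono nat_div_ratio_le)
  have c_le2: "c N k \<le> 1 / (real k)\<^sup>2" if "k \<ge> 2" for N k
  proof -
    have "c N k \<le> (1 / real k) ^ D" by (rule c_le)
    also have "\<dots> \<le> (1 / real k) ^ 2" using D that by (intro power_decreasing) auto
    finally show ?thesis by (simp add: power_divide)
  qed
  have csum: "(\<lambda>N. \<Sum>k=1..N. c N k) \<longlonglongrightarrow> Z"
  proof -
    have "(\<lambda>N. \<Sum>k. c N k) \<longlonglongrightarrow> Z"
      unfolding Z_def
    proof (rule tannerys_theorem[where M = "\<lambda>k. (1 / real k) ^ D", THEN conjunct2, THEN conjunct2])
      show "(\<lambda>N. c N k) \<longlonglongrightarrow> (1 / real k) ^ D" for k
        unfolding c_def by (intro tendsto_power nat_div_ratio_tendsto)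
      show "\<forall>\<^sub>F (k, N) in sequentially \<times>\<^sub>F sequentially. norm (c N k) \<le> (1 / real k) ^ D"
        using c_le by (intro always_eventually) auto
    qed (use summable_inverse_power[OF D] in auto)
    moreover have "(\<Sum>k. c N k) = (\<Sum>k=1..N. c N k)" for N
    proof (rule suminf_finite)
      fix k assume "k \<notin> {1..N}"
      then have "N div k = 0" by (cases "k = 0") auto
      then show "c N k = 0" using D by (simp add: c_def)
    qed simp
    ultimately show ?thesis by simp
  qed
  have tN: "T N / real N ^ D = (\<Sum>k=1..N. c N k * p (N div k))" if "N \<ge> 1" for N
  proof -
    have "P (N div k) / real N ^ D = c N k * p (N div k)" if "k \<in> {1..N}" for k
    proof -
      have "N div k \<noteq> 0" using that by (simp add: div_eq_0_iff)
      then show ?thesis by (simp add: c_def p_def power_divide)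
    qed
    then show ?thesis unfolding T sum_divide_distrib by (intro sum.cong) auto
  qed
  have split1: "(\<Sum>k=1..N. f k) = f 1 + (\<Sum>k=2..N. f k)" if "N \<ge> 1" for N and f :: "nat \<Rightarrow> real"
    using that by (subst sum.atLeast_Suc_atMost) (auto simp: numeral_2_eq_2)
  have p0: "0 \<le> p N" for N unfolding p_def using P by simp
  obtain B where B: "\<And>N. \<bar>T N / real N ^ D\<bar> \<le> B"
    using convergent_imp_Bseq[OF convergentI[OF lim]] by (auto simp: Bseq_def)
  have pB: "p N \<le> B" for N
  proof (cases "N \<ge> 1")
    case True
    have "0 \<le> (\<Sum>k=2..N. P (N div k))" by (intro sum_nonneg P)
    then have "P N \<le> T N" using split1[OF True, of "\<lambda>k. P (N div k)"] by (simp add: T)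
    then have "p N \<le> T N / real N ^ D" unfolding p_def by (intro divide_right_mono) auto
    then show ?thesis using B[of N] by linarith
  next
    case False
    then show ?thesis using B[of 0] D by (simp add: p_def zero_power not_less_eq_eq)
  qed
  \<comment> \<open>\<open>\<rho>\<close> is chosen so that \<open>T N / N ^ D\<close> and the same
    weighted sum of the constant \<open>\<rho>\<close> have equal limits. The difference then obeys
    the contraction estimate, where \<open>D \<ge> 2\<close> bounds the factors by inverse
    squares.\<close>
  have "(\<lambda>N. p N - \<rho>) \<longlonglongrightarrow> 0"
  proof (rule tendsto_zero_by_contraction)
    show "\<bar>p N - \<rho>\<bar> \<le> B + \<bar>\<rho>\<bar>" for N using p0[of N] pB[of N] by linarith
    have "(\<lambda>N. \<bar>T N / real N ^ D - \<rho> * (\<Sum>k=1..N. c N k)\<bar>) \<longlonglongrightarrow> \<bar>\<tau> - \<rho> * Z\<bar>"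
      by (intro tendsto_intros lim csum)
    then show "(\<lambda>N. \<bar>T N / real N ^ D - \<rho> * (\<Sum>k=1..N. c N k)\<bar>) \<longlonglongrightarrow> 0"
      using Z by (simp add: \<rho>_def Z_def)
    show "\<bar>p N - \<rho>\<bar> \<le> \<bar>T N / real N ^ D - \<rho> * (\<Sum>k=1..N. c N k)\<bar> +
        (\<Sum>k=2..N. 1 / (real k)\<^sup>2 * \<bar>p (N div k) - \<rho>\<bar>)" if N: "N \<ge> 1" for N
    proof -
      have c1: "c N 1 = 1" using N by (simp add: c_def)
      have "T N / real N ^ D - \<rho> * (\<Sum>k=1..N. c N k) = (\<Sum>k=1..N. c N k * (p (N div k) - \<rho>))"
        unfolding tN[OF N] by (simp add: sum_distrib_left sum_subtractf algebra_simps)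
      also have "\<dots> = p N - \<rho> + (\<Sum>k=2..N. c N k * (p (N div k) - \<rho>))"
        using c1 by (subst split1[OF N]) simp
      finally have "p N - \<rho> = (T N / real N ^ D - \<rho> * (\<Sum>k=1..N. c N k)) - (\<Sum>k=2..N. c N k * (p (N div k) - \<rho>))"
        by simp
      moreover have "\<bar>\<Sum>k=2..N. c N k * (p (N div k) - \<rho>)\<bar> \<le> (\<Sum>k=2..N. 1 / (real k)\<^sup>2 * \<bar>p (N div k) - \<rho>\<bar>)"
      proof (rule order_trans[OF sum_abs], rule sum_mono)
        fix k assume "k \<in> {2..N}"
        then have "c N k * \<bar>p (N div k) - \<rho>\<bar> \<le> 1 / (real k)\<^sup>2 * \<bar>p (N div k) - \<rho>\<bar>"
          by (intro mult_right_mono c_le2) auto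
        then show "\<bar>c N k * (p (N div k) - \<rho>)\<bar> \<le> 1 / (real k)\<^sup>2 * \<bar>p (N div k) - \<rho>\<bar>"
          by (simp add: abs_mult c_le(2))
      qed
      ultimately show ?thesis by linarith
    qed
  qed
  then show "(\<lambda>N. P N / real N ^ D) \<longlonglongrightarrow> \<tau> / (\<Sum>k. (1 / real k) ^ D)"
    unfolding p_def \<rho>_def Z_def by (rule LIM_zero_cancel)
qed

section \<open>Averages along an enumeration with nondecreasing denominators\<close>

lemma initial_segment_eq:
  fixes S :: "nat set"
  assumes "finite S" "0 \<notin> S" "\<And>s t. t \<in> S \<Longrightarrow> 1 \<le> s \<Longrightarrow> s \<le> t \<Longrightarrow> s \<in> S"
  shows "S = {1..card S}"
proof (cases "S = {}")
  case False
  have "S = {1..Max S}"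
  proof (intro equalityI subsetI)
    fix s assume "s \<in> S"
    then show "s \<in> {1..Max S}" using assms(1,2) by (auto simp: Suc_le_eq intro: gr0I)
  next
    fix s assume "s \<in> {1..Max S}"
    then show "s \<in> S" using assms(3)[OF Max_in[OF assms(1) False]] by simp
  qed
  then show ?thesis by (metis card_atLeastAtMost diff_Suc_1)
qed simp

text \<open>If the \<open>k\<close>-th member has denominator \<open>N\<close>, then
  \<open>{1..k}\<close> lies between the complete levels for \<open>N - 1\<close> and
  \<open>N\<close>, however ties are ordered. The resulting bounds \<open>p (N - 1) / c N\<close>
  and \<open>p N / c (N - 1)\<close> have the same limit, because a shift of \<open>N\<close> by one
  does not affect growth of order \<open>N ^ D\<close>.\<close>

lemma cesaro_by_levels:
  fixes x :: "nat \<Rightarrow> real" and den :: "nat \<Rightarrow> nat"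
  assumes x: "\<And>t. t \<ge> 1 \<Longrightarrow> 0 \<le> x t"
    and mono: "\<And>s t. 1 \<le> s \<Longrightarrow> s \<le> t \<Longrightarrow> den s \<le> den t"
    and fin: "\<And>N. finite {t. 1 \<le> t \<and> den t \<le> N}"
    and P: "(\<lambda>N. (\<Sum>t | 1 \<le> t \<and> den t \<le> N. x t) / real N ^ D) \<longlonglongrightarrow> a"
    and Q: "(\<lambda>N. real (card {t. 1 \<le> t \<and> den t \<le> N}) / real N ^ D) \<longlonglongrightarrow> b" and b: "b > 0"
  shows "(\<lambda>k. (\<Sum>t=1..k. x t) / real k) \<longlonglongrightarrow> a / b"
proof -
  define L where "L N = {t. 1 \<le> t \<and> den t \<le> N}" for N
  define p where "p N = (\<Sum>t\<in>L N. x t)" for N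
  define c where "c N = real (card (L N))" for N
  have Leq: "L N = {1..card (L N)}" for N
    using fin mono by (intro initial_segment_eq) (auto simp: L_def intro: order_trans)
  have finL: "finite (L N)" for N using fin by (simp add: L_def)
  have lim_den: "filterlim den at_top sequentially"
    unfolding filterlim_at_top
  proof
    fix M
    have "\<forall>\<^sub>F k in sequentially. k \<notin> L M \<and> k \<ge> 1"
      using eventually_gt_at_top[of "card (L M)"]
    proof eventually_elim
      case (elim k)
      then have "k \<notin> {1..card (L M)}" by simp
      then show ?case using Leq[of M] elim by (metis Suc_leI gr0I not_less0 One_nat_def)
    qed
    then show "\<forall>\<^sub>F k in sequentially. M \<le> den k"
      by eventually_elim (auto simp: L_def)
  qed
  have pl: "(\<lambda>N. p N / real N ^ D) \<longlonglongrightarrow> a" and cl: "(\<lambda>N. c N / real N ^ D) \<longlonglongrightarrow> b"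
    using P Q by (simp_all add: p_def c_def L_def)
  have shift: "(\<lambda>N. f (N - 1) / real N ^ D) \<longlonglongrightarrow> l" if "(\<lambda>N. f N / real N ^ D) \<longlonglongrightarrow> l"
    for f :: "nat \<Rightarrow> real" and l
  proof (rule LIMSEQ_imp_Suc)
    have "(\<lambda>n. real n / (1 + real n)) \<longlonglongrightarrow> 1" using LIMSEQ_n_over_Suc_n by simp
    then have "(\<lambda>n. f n / real n ^ D * (real n / (1 + real n)) ^ D) \<longlonglongrightarrow> l * 1 ^ D"
      by (intro tendsto_intros that)
    moreover have "\<forall>\<^sub>F n in sequentially. f n / real n ^ D * (real n / (1 + real n)) ^ D
        = f (Suc n - 1) / real (Suc n) ^ D"
      using eventually_gt_at_top[of 0] by eventually_elim (simp add: power_divide)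
    ultimately show "(\<lambda>n. f (Suc n - 1) / real (Suc n) ^ D) \<longlonglongrightarrow> l"
      by (simp add: tendsto_cong)
  qed
  have rat: "(\<lambda>N. (f N / real N ^ D) / (g N / real N ^ D)) \<longlonglongrightarrow> a / b"
    if "(\<lambda>N. f N / real N ^ D) \<longlonglongrightarrow> a" "(\<lambda>N. g N / real N ^ D) \<longlonglongrightarrow> b" for f g :: "nat \<Rightarrow> real"
    using that b by (intro tendsto_intros) auto
  have canc: "\<forall>\<^sub>F N in sequentially. (f N / real N ^ D) / (g N / real N ^ D) = f N / g N" for f g :: "nat \<Rightarrow> real"
    using eventually_gt_at_top[of 0] by eventually_elim simp
  have up: "(\<lambda>N. p N / c (N - 1)) \<longlonglongrightarrow> a / b"
    by (rule Lim_transform_eventually[OF rat[OF pl shift[OF cl]] canc])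
  have low: "(\<lambda>N. p (N - 1) / c N) \<longlonglongrightarrow> a / b"
    by (rule Lim_transform_eventually[OF rat[OF shift[OF pl] cl] canc])
  have "\<forall>\<^sub>F N in sequentially. 0 < c (N - 1) / real N ^ D"
    using shift[OF cl] b by (intro order_tendstoD)
  then have cpos: "\<forall>\<^sub>F N in sequentially. 0 < c (N - 1) \<and> 1 \<le> N"
    using eventually_ge_at_top[of 1] by eventually_elim (auto simp: zero_less_divide_iff)
  have bounds: "\<forall>\<^sub>F k in sequentially. p (den k - 1) / c (den k) \<le> (\<Sum>t=1..k. x t) / real k \<and>
      (\<Sum>t=1..k. x t) / real k \<le> p (den k) / c (den k - 1)"
    using eventually_compose_filterlim[OF cpos lim_den]
      eventually_ge_at_top[of 1]
  proof eventually_elim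
    case (elim k)
    have k: "k \<in> L (den k)" "k \<notin> L (den k - 1)" using elim by (auto simp: L_def)
    then have k2: "k \<le> card (L (den k))" "card (L (den k - 1)) < k"
      using Leq[of "den k"] Leq[of "den k - 1"] elim by (metis atLeastAtMost_iff, metis atLeastAtMost_iff not_less)
    have x': "0 \<le> x t" if "t \<in> L N" for t N using that x by (simp add: L_def)
    have "{1..k} \<subseteq> L (den k)" using Leq[of "den k"] k2 by (metis atLeastatMost_subset_iff order_refl)
    then have S1: "(\<Sum>t=1..k. x t) \<le> p (den k)"
      unfolding p_def by (intro sum_mono2 finL) (auto intro: x')
    have "L (den k - 1) \<subseteq> {1..k}" using Leq[of "den k - 1"] k2
      by (metis atLeastatMost_subset_iff less_imp_le order_refl)
    then have S2: "p (den k - 1) \<le> (\<Sum>t=1..k. x t)"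
      unfolding p_def by (intro sum_mono2) (auto intro: x)
    have pnn: "0 \<le> p N" for N unfolding p_def by (intro sum_nonneg) (auto intro: x')
    have "0 \<le> (\<Sum>t=1..k. x t)" by (intro sum_nonneg x) auto
    then show ?case using S1 S2 k2 elim pnn
      by (intro conjI frac_le) (auto simp: c_def)
  qed
  have "\<forall>\<^sub>F k in sequentially. p (den k - 1) / c (den k) \<le> (\<Sum>t=1..k. x t) / real k"
    "\<forall>\<^sub>F k in sequentially. (\<Sum>t=1..k. x t) / real k \<le> p (den k) / c (den k - 1)"
    using bounds by (auto simp only: eventually_conj_iff)
  moreover have "(\<lambda>k. p (den k - 1) / c (den k)) \<longlonglongrightarrow> a / b" "(\<lambda>k. p (den k) / c (den k - 1)) \<longlonglongrightarrow> a / b"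
    by (rule filterlim_compose[OF low lim_den], rule filterlim_compose[OF up lim_den])
  ultimately show ?thesis by (rule tendsto_sandwich)
qed

subsection \<open>Comparison of regular measures\<close>

text \<open>Constants and real multiples need not be in \<open>H\<close>. The positive function
  \<open>u\<close> takes the place of the constant 1, and integer multiples that of scaling.\<close>

locale separating_function_hoop =
  fixes H :: "('x::t2_space \<Rightarrow> real) set" and u :: "'x \<Rightarrow> real"
  assumes compact_space: "compact (UNIV :: 'x set)"
    and H_cont: "f \<in> H \<Longrightarrow> continuous_on UNIV f"
    and H_nonneg: "f \<in> H \<Longrightarrow> 0 \<le> f x"
    and H_zero: "(\<lambda>x. 0) \<in> H"
    and H_add: "f \<in> H \<Longrightarrow> g \<in> H \<Longrightarrow> (\<lambda>x. f x + g x) \<in> H"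
    and H_monus: "f \<in> H \<Longrightarrow> g \<in> H \<Longrightarrow> (\<lambda>x. max 0 (f x - g x)) \<in> H"
    and H_sep: "x \<noteq> y \<Longrightarrow> \<exists>h\<in>H. h x = 0 \<and> h y \<noteq> 0"
    and u_in: "u \<in> H" and u_pos: "0 < u x"
begin

lemma H_min:
  assumes "f \<in> H" "g \<in> H"
  shows "(\<lambda>x. min (f x) (g x)) \<in> H"
proof -
  have "(\<lambda>x. max 0 (f x - max 0 (f x - g x))) \<in> H" by (intro H_monus assms)
  moreover have "(\<lambda>x. max 0 (f x - max 0 (f x - g x))) = (\<lambda>x. min (f x) (g x))"
    using H_nonneg[OF assms(1)] H_nonneg[OF assms(2)] by (auto simp: fun_eq_iff max_def min_def)
  ultimately show ?thesis by simp
qed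

lemma H_sum: "finite I \<Longrightarrow> (\<And>i. i \<in> I \<Longrightarrow> f i \<in> H) \<Longrightarrow> (\<lambda>x. \<Sum>i\<in>I. f i x) \<in> H"
  by (induction I rule: finite_induct) (auto intro: H_zero H_add)

lemma H_mult_nat: "f \<in> H \<Longrightarrow> (\<lambda>x. real k * f x) \<in> H"
  using H_sum[of "{..<k}" "\<lambda>_. f"] by simp

lemma open_less: "continuous_on UNIV f \<Longrightarrow> continuous_on UNIV g \<Longrightarrow> open {x. (f x :: real) < g x}"
  for f g :: "'x \<Rightarrow> real"
  by (rule open_Collect_less)

text \<open>Finitely many functions of \<open>H\<close> that vanish at \<open>y\<close> have
  positivity sets covering \<open>K\<close>; their sum is bounded below on \<open>K\<close>, so an
  integer multiple of it exceeds \<open>2 * u\<close>. The factor 2 leaves room for the subtraction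
  of \<open>u\<close> in the Urysohn construction.\<close>

lemma H_positive_on_compact:
  assumes K: "compact K" and y: "y \<notin> K"
  obtains g where "g \<in> H" "g y = 0" "\<And>x. x \<in> K \<Longrightarrow> 2 * u x \<le> g x"
proof -
  have "\<forall>x\<in>K. \<exists>h. h \<in> H \<and> h y = 0 \<and> 0 < h x"
    using H_sep y H_nonneg by (metis less_eq_real_def)
  then obtain h where h: "\<And>x. x \<in> K \<Longrightarrow> h x \<in> H \<and> h x y = 0 \<and> 0 < h x x"
    by metis
  have "\<And>x. x \<in> K \<Longrightarrow> open {z. 0 < h x z}"
    using h by (intro open_less H_cont continuous_on_const) auto
  moreover have "K \<subseteq> (\<Union>x\<in>K. {z. 0 < h x z})" using h by auto
  ultimately obtain K' where K': "K' \<subseteq> K" "finite K'" "K \<subseteq> (\<Union>x\<in>K'. {z. 0 < h x z})"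
    using compactE_image[OF K, of K "\<lambda>x. {z. 0 < h x z}"] by metis
  define g where "g z = (\<Sum>x\<in>K'. h x z)" for z
  have g: "g \<in> H" "g y = 0"
    unfolding g_def using K' h by (auto intro!: H_sum sum.neutral simp: subset_iff)
  have gpos: "0 < g x" if x: "x \<in> K" for x
  proof -
    obtain z where z: "z \<in> K'" "0 < h z x" using K'(3) x by auto
    show ?thesis unfolding g_def
    proof (rule sum_pos2[where i = z])
      show "0 \<le> h i x" if "i \<in> K'" for i using that h K'(1) H_nonneg by blast
    qed (use z K'(2) in auto)
  qed
  have "\<exists>k. \<forall>x\<in>K. 2 * u x \<le> real k * g x"
  proof (cases "K = {}")
    case False
    have "continuous_on K (\<lambda>x. 2 * u x / g x)"
      using gpos by (intro continuous_intros continuous_on_subset[OF H_cont] g u_in) force+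
    then obtain x0 where x0: "\<And>x. x \<in> K \<Longrightarrow> 2 * u x / g x \<le> 2 * u x0 / g x0"
      using continuous_attains_sup[OF K False] by blast
    obtain k :: nat where k: "2 * u x0 / g x0 \<le> real k" using real_arch_simple by blast
    have "2 * u x \<le> real k * g x" if "x \<in> K" for x
      using order_trans[OF x0[OF that] k] gpos[OF that] by (simp add: field_simps)
    then show ?thesis by blast
  qed simp
  then obtain k where "\<And>x. x \<in> K \<Longrightarrow> 2 * u x \<le> real k * g x" by blast
  then show thesis using that[of "\<lambda>x. real k * g x"] g H_mult_nat[OF g(1)] by auto
qed

text \<open>For \<open>y\<close> outside \<open>U\<close> the function
  \<open>max 0 (g y x - u x)\<close> is at least \<open>u\<close> on \<open>K\<close> and vanishes
  in a whole neighbourhood of \<open>y\<close>. Finitely many such neighbourhoods cover the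
  complement of \<open>U\<close>, and the minimum of \<open>u\<close> with the corresponding
  functions is as required.\<close>

lemma H_urysohn:
  assumes K: "compact K" and U: "open U" "K \<subseteq> U"
  obtains f where "f \<in> H" "\<And>x. f x \<le> u x" "\<And>x. x \<in> K \<Longrightarrow> f x = u x" "\<And>x. x \<notin> U \<Longrightarrow> f x = 0"
proof -
  have "\<forall>y\<in>-U. \<exists>g. g \<in> H \<and> g y = 0 \<and> (\<forall>x\<in>K. 2 * u x \<le> g x)"
  proof
    fix y assume "y \<in> -U"
    then have "y \<notin> K" using U by auto
    from H_positive_on_compact[OF K this] show "\<exists>g. g \<in> H \<and> g y = 0 \<and> (\<forall>x\<in>K. 2 * u x \<le> g x)"
      by metis
  qed
  then obtain g where g: "\<And>y. y \<in> -U \<Longrightarrow> g y \<in> H \<and> g y y = 0 \<and> (\<forall>x\<in>K. 2 * u x \<le> g y x)"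
    by metis
  have cU: "compact (-U)" using compact_space U(1)
    by (metis compact_Int_closed closed_Compl Int_UNIV_left)
  have "\<And>y. y \<in> -U \<Longrightarrow> open {z. g y z < u z}"
    using g by (intro open_less H_cont u_in) auto
  moreover have "-U \<subseteq> (\<Union>y\<in>-U. {z. g y z < u z})" using g u_pos by fastforce
  ultimately obtain Y where Y: "Y \<subseteq> -U" "finite Y" "-U \<subseteq> (\<Union>y\<in>Y. {z. g y z < u z})"
    using compactE_image[OF cU, of "-U" "\<lambda>y. {z. g y z < u z}"] by metis
  have "\<exists>f. f \<in> H \<and> (\<forall>x. f x \<le> u x) \<and> (\<forall>x\<in>K. f x = u x) \<and> (\<forall>y\<in>Y. \<forall>z. g y z < u z \<longrightarrow> f z = 0)"
    using Y(2,1)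
  proof (induction Y rule: finite_induct)
    case empty then show ?case using u_in by auto
  next
    case (insert y Y)
    then obtain f where f: "f \<in> H" "\<And>x. f x \<le> u x" "\<And>x. x \<in> K \<Longrightarrow> f x = u x"
      "\<And>y z. y \<in> Y \<Longrightarrow> g y z < u z \<Longrightarrow> f z = 0" by auto
    have gy: "g y \<in> H" "\<And>x. x \<in> K \<Longrightarrow> 2 * u x \<le> g y x" using g insert.prems by auto
    let ?f = "\<lambda>x. min (f x) (max 0 (g y x - u x))"
    have "?f \<in> H" by (intro H_min H_monus f gy u_in)
    moreover have "?f x \<le> u x" for x using f(2)[of x] by simp
    moreover have "?f x = u x" if "x \<in> K" for x
      using f(3)[OF that] gy(2)[OF that] u_pos[of x] by simp
    moreover have "?f z = 0" if "y' \<in> insert y Y" "g y' z < u z" for y' z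
    proof (cases "y' = y")
      case True
      then show ?thesis using that H_nonneg[OF f(1), of z] by simp
    next
      case False
      then have "f z = 0" using that by (auto intro: f(4))
      then show ?thesis by simp
    qed
    ultimately show ?case by blast
  qed
  then obtain f where f: "f \<in> H" "\<And>x. f x \<le> u x" "\<And>x. x \<in> K \<Longrightarrow> f x = u x"
    "\<And>y z. y \<in> Y \<Longrightarrow> g y z < u z \<Longrightarrow> f z = 0" by auto
  show thesis
  proof (rule that[OF f(1-3)])
    fix x assume "x \<notin> U"
    then show "f x = 0" using Y(3) f(4) by blast
  qed
qed

end

text \<open>Inner and outer regularity in one condition, a form that passes directly to measures
  with bounded density.\<close>

definition approximable :: "'x::topological_space measure \<Rightarrow> bool" where
  "approximable M \<longleftrightarrow> (\<forall>B\<in>sets borel. \<forall>e>0. \<exists>K U. compact K \<and> open U \<and> K \<subseteq> B \<and> B \<subseteq> U \<and>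
     measure M (U - K) < e)"

lemma approximableE:
  assumes "approximable M" "B \<in> sets borel" "0 < e"
  obtains K U where "compact K" "open U" "K \<subseteq> B" "B \<subseteq> U" "measure M (U - K) < e"
proof -
  from assms have "\<exists>K U. compact K \<and> open U \<and> K \<subseteq> B \<and> B \<subseteq> U \<and> measure M (U - K) < e"
    unfolding approximable_def by simp
  then show thesis using that by metis
qed

lemma regular_approximable:
  fixes M :: "'x::t2_space measure"
  assumes M: "regular_borel_measure M"
  shows "approximable M"
  unfolding approximable_def
proof (intro ballI allI impI)
  fix B :: "'x set" and e :: real assume B: "B \<in> sets borel" and e: "0 < e"
  interpret finite_measure M using M by (simp add: regular_borel_measure_def)
  have sets: "sets M = sets borel" using M by (simp add: regular_borel_measure_def)
  have inner: "\<exists>K. compact K \<and> K \<subseteq> B \<and> measure M B - e / 2 < measure M K"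
  proof (rule ccontr)
    assume "\<not> ?thesis"
    then have le: "measure M K \<le> measure M B - e / 2" if "compact K" "K \<subseteq> B" for K
      using that by (meson not_less)
    from le[of "{}"] have "0 \<le> measure M B - e / 2" by simp
    have "emeasure M B = (SUP K\<in>{K. K \<subseteq> B \<and> compact K}. emeasure M K)"
      using M B unfolding regular_borel_measure_def by blast
    also have "\<dots> \<le> ennreal (measure M B - e / 2)"
    proof (rule SUP_least)
      fix K assume "K \<in> {K. K \<subseteq> B \<and> compact K}"
      then have "measure M K \<le> measure M B - e / 2" using le by blast
      then show "emeasure M K \<le> ennreal (measure M B - e / 2)"
        unfolding emeasure_eq_measure by (rule ennreal_leI)
    qed
    finally have "emeasure M B \<le> ennreal (measure M B - e / 2)" .
    then show False using \<open>0 \<le> measure M B - e / 2\<close> e by (simp add: emeasure_eq_measure)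
  qed
  have outer: "\<exists>U. open U \<and> B \<subseteq> U \<and> measure M U < measure M B + e / 2"
  proof (rule ccontr)
    assume "\<not> ?thesis"
    then have le: "measure M B + e / 2 \<le> measure M U" if "open U" "B \<subseteq> U" for U
      using that by (meson not_less)
    have "ennreal (measure M B + e / 2) \<le> (INF U\<in>{U. B \<subseteq> U \<and> open U}. emeasure M U)"
    proof (rule INF_greatest)
      fix U assume "U \<in> {U. B \<subseteq> U \<and> open U}"
      then have "measure M B + e / 2 \<le> measure M U" using le by blast
      then show "ennreal (measure M B + e / 2) \<le> emeasure M U"
        unfolding emeasure_eq_measure by (rule ennreal_leI)
    qed
    also have "\<dots> = emeasure M B"
      using M B unfolding regular_borel_measure_def by (metis (lifting))
    finally have "ennreal (measure M B + e / 2) \<le> emeasure M B" .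
    then show False using e by (simp add: emeasure_eq_measure)
  qed
  obtain K U where KU: "compact K" "K \<subseteq> B" "measure M B - e / 2 < measure M K"
    "open U" "B \<subseteq> U" "measure M U < measure M B + e / 2" using inner outer by blast
  have "measure M (U - K) = measure M U - measure M K"
    using KU by (intro finite_measure_Diff) (auto simp: sets compact_imp_closed)
  then show "\<exists>K U. compact K \<and> open U \<and> K \<subseteq> B \<and> B \<subseteq> U \<and> measure M (U - K) < e"
    using KU by (intro exI[of _ K] exI[of _ U]) auto
qed

lemma measure_density_integral:
  fixes g :: "'a \<Rightarrow> real"
  assumes "integrable M g" "\<And>x. 0 \<le> g x" "B \<in> sets M"
  shows "measure (density M (\<lambda>x. ennreal (g x))) B = (\<integral>x. indicator B x * g x \<partial>M)"
proof -
  have "emeasure (density M (\<lambda>x. ennreal (g x))) B = (\<integral>\<^sup>+x. ennreal (g x) * indicator B x \<partial>M)"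
    using assms by (intro emeasure_density) auto
  also have "\<dots> = (\<integral>\<^sup>+x. ennreal (indicator B x * g x) \<partial>M)"
    by (intro nn_integral_cong) (auto split: split_indicator)
  also have "\<dots> = ennreal (\<integral>x. indicator B x * g x \<partial>M)"
    using integrable_mult_indicator[OF assms(3,1)] assms(2) by (intro nn_integral_eq_integral) auto
  finally show ?thesis
    using assms(2) by (simp add: measure_def integral_nonneg_AE)
qed

context separating_function_hoop
begin

lemma integrable_continuous:
  fixes g :: "'x \<Rightarrow> real"
  assumes M: "regular_borel_measure M" and g: "continuous_on UNIV g"
  shows "integrable M g"
proof -
  interpret finite_measure M using M by (simp add: regular_borel_measure_def)
  have "bounded (range g)" using compact_space g by (intro compact_imp_bounded compact_continuous_image)
  then obtain C where "\<And>x. norm (g x) \<le> C" unfolding bounded_iff by auto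
  moreover have "g \<in> borel_measurable M"
    using M borel_measurable_continuous_onI[OF g] measurable_cong_sets[of M borel borel borel]
    by (auto simp: regular_borel_measure_def)
  ultimately show ?thesis by (intro integrable_const_bound[of _ C]) auto
qed

lemma finite_measure_density:
  fixes g :: "'x \<Rightarrow> real"
  assumes M: "regular_borel_measure M" and g: "continuous_on UNIV g" "\<And>x. 0 \<le> g x"
  shows "finite_measure (density M (\<lambda>x. ennreal (g x)))"
proof
  have "emeasure (density M (\<lambda>x. ennreal (g x))) (space M) = (\<integral>\<^sup>+x. ennreal (g x) \<partial>M)"
    using integrable_continuous[OF M g(1)]
    by (subst emeasure_density) (auto intro!: nn_integral_cong)
  also have "\<dots> < \<infinity>"
    using integrable_continuous[OF M g(1)] g(2)
    by (subst nn_integral_eq_integral) auto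
  finally show "emeasure (density M (\<lambda>x. ennreal (g x))) (space (density M (\<lambda>x. ennreal (g x)))) \<noteq> \<infinity>"
    by simp
qed

lemma approximable_density:
  fixes g :: "'x \<Rightarrow> real"
  assumes M: "regular_borel_measure M" and g: "continuous_on UNIV g" "\<And>x. 0 \<le> g x"
  shows "approximable (density M (\<lambda>x. ennreal (g x)))"
  unfolding approximable_def
proof (intro ballI allI impI)
  fix B :: "'x set" and e :: real assume B: "B \<in> sets borel" and e: "0 < e"
  interpret finite_measure M using M by (simp add: regular_borel_measure_def)
  have sets: "sets M = sets borel" using M by (simp add: regular_borel_measure_def)
  have "bounded (range g)" using compact_space g by (intro compact_imp_bounded compact_continuous_image)
  then obtain C where C: "\<And>x. norm (g x) \<le> C" unfolding bounded_iff by auto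
  have C0: "0 \<le> C" using C order_trans[OF norm_ge_zero] by blast
  have "0 < e / (C + 1)" using e C0 by simp
  then obtain K U where KU: "compact K" "open U" "K \<subseteq> B" "B \<subseteq> U" "measure M (U - K) < e / (C + 1)"
    using approximableE[OF regular_approximable[OF M] B] by metis
  have UK: "U - K \<in> sets M" using KU by (simp add: sets compact_imp_closed borel_closed)
  have "measure (density M (\<lambda>x. ennreal (g x))) (U - K) = (\<integral>x. indicator (U - K) x * g x \<partial>M)"
    by (intro measure_density_integral integrable_continuous M g UK)
  also have "\<dots> \<le> (\<integral>x. C * indicator (U - K) x \<partial>M)"
  proof (rule integral_mono)
    show "integrable M (\<lambda>x. indicator (U - K) x * g x)"
      using integrable_mult_indicator[OF UK integrable_continuous[OF M g(1)]] by simp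
    show "integrable M (\<lambda>x. C * indicator (U - K) x)"
      using UK by (intro integrable_mult_right) (simp add: emeasure_eq_measure)
    show "indicator (U - K) x * g x \<le> C * indicator (U - K) x" for x
      using C[of x] by (auto split: split_indicator)
  qed
  also have "\<dots> = C * measure M (U - K)" using UK by simp
  also have "\<dots> \<le> C * (e / (C + 1))" using KU(5) C0 by (intro mult_left_mono) auto
  also have "\<dots> < e" using C0 e by (simp add: field_simps)
  finally show "\<exists>K U. compact K \<and> open U \<and> K \<subseteq> B \<and> B \<subseteq> U \<and>
      measure (density M (\<lambda>x. ennreal (g x))) (U - K) < e"
    using KU by blast
qed

text \<open>Domination of integrals over \<open>H\<close> need only be known locally, up to a factor arbitrarily
  close to one.\<close>

lemma density_le_of_local_domination:
  assumes \<nu>: "regular_borel_measure \<nu>" and \<mu>: "regular_borel_measure \<mu>"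
    and w1: "continuous_on UNIV w1" "\<And>x. 0 \<le> w1 x"
    and w2: "continuous_on UNIV w2" "\<And>x. 0 \<le> w2 x"
    and loc: "\<And>\<theta> x0. 1 < \<theta> \<Longrightarrow> \<exists>V. open V \<and> x0 \<in> V \<and>
      (\<forall>h\<in>H. (\<forall>x. x \<notin> V \<longrightarrow> h x = 0) \<longrightarrow> (\<integral>x. h x * w1 x \<partial>\<nu>) \<le> \<theta> * (\<integral>x. h x * w2 x \<partial>\<mu>))"
    and B: "B \<in> sets borel"
  shows "measure (density \<nu> (\<lambda>x. ennreal (u x * w1 x))) B \<le> measure (density \<mu> (\<lambda>x. ennreal (u x * w2 x))) B"
proof -
  define \<nu>' where "\<nu>' = density \<nu> (\<lambda>x. ennreal (u x * w1 x))"
  define \<mu>' where "\<mu>' = density \<mu> (\<lambda>x. ennreal (u x * w2 x))"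
  have uw: "continuous_on UNIV (\<lambda>x. u x * w1 x)" "\<And>x. 0 \<le> u x * w1 x"
    "continuous_on UNIV (\<lambda>x. u x * w2 x)" "\<And>x. 0 \<le> u x * w2 x"
    using w1 w2 H_cont[OF u_in] u_pos by (auto intro!: continuous_intros simp: less_imp_le)
  have sets_\<nu>: "sets \<nu> = sets borel" and sets_\<mu>: "sets \<mu> = sets borel"
    using \<nu> \<mu> by (auto simp: regular_borel_measure_def)
  have sets: "sets \<nu>' = sets borel" "sets \<mu>' = sets borel"
    using sets_\<nu> sets_\<mu> by (simp_all add: \<nu>'_def \<mu>'_def)
  interpret \<nu>': finite_measure \<nu>' unfolding \<nu>'_def by (intro finite_measure_density \<nu> uw)
  interpret \<mu>': finite_measure \<mu>' unfolding \<mu>'_def by (intro finite_measure_density \<mu> uw)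
  have ap: "approximable \<nu>'" "approximable \<mu>'"
    unfolding \<nu>'_def \<mu>'_def by (intro approximable_density \<nu> \<mu> uw)+
  have main: "measure \<nu>' B \<le> \<theta> * measure \<mu>' B" if \<theta>: "1 < \<theta>" for \<theta>
  proof -
    define good where "good V \<longleftrightarrow> open V \<and>
      (\<forall>h\<in>H. (\<forall>x. x \<notin> V \<longrightarrow> h x = 0) \<longrightarrow> (\<integral>x. h x * w1 x \<partial>\<nu>) \<le> \<theta> * (\<integral>x. h x * w2 x \<partial>\<mu>))" for V
    \<comment> \<open>A Urysohn function equal to \<open>u\<close> on \<open>K\<close> and supported
      in \<open>U \<inter> V\<close> is inserted between the two sides. Its height is
      \<open>u\<close> and not 1, which is why the measures carry the extra density
      \<open>u\<close>.\<close>
    have KU: "measure \<nu>' K \<le> \<theta> * measure \<mu>' U"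
      if V: "good V" and K: "compact K" "K \<subseteq> V" and U: "open U" "K \<subseteq> U" for K U V
    proof -
      obtain f where f: "f \<in> H" "\<And>x. f x \<le> u x" "\<And>x. x \<in> K \<Longrightarrow> f x = u x" "\<And>x. x \<notin> U \<inter> V \<Longrightarrow> f x = 0"
        using H_urysohn[OF K(1), of "U \<inter> V"] V K U unfolding good_def by (metis Int_subset_iff open_Int)
      have Ks: "K \<in> sets \<nu>" "U \<in> sets \<mu>" using K U sets_\<nu> sets_\<mu> by (auto simp: compact_imp_closed)
      have "measure \<nu>' K = (\<integral>x. indicator K x * (u x * w1 x) \<partial>\<nu>)"
        unfolding \<nu>'_def by (intro measure_density_integral integrable_continuous \<nu> uw Ks)
      also have "\<dots> \<le> (\<integral>x. f x * w1 x \<partial>\<nu>)"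
      proof (rule integral_mono)
        show "integrable \<nu> (\<lambda>x. indicator K x * (u x * w1 x))"
          using integrable_mult_indicator[OF Ks(1) integrable_continuous[OF \<nu> uw(1)]] by simp
        show "integrable \<nu> (\<lambda>x. f x * w1 x)"
          by (intro integrable_continuous \<nu> continuous_on_mult H_cont f w1)
        show "indicator K x * (u x * w1 x) \<le> f x * w1 x" for x
          using f(3)[of x] H_nonneg[OF f(1), of x] w1(2)[of x] by (simp split: split_indicator)
      qed
      finally have 1: "measure \<nu>' K \<le> (\<integral>x. f x * w1 x \<partial>\<nu>)" .
      have 2: "(\<integral>x. f x * w1 x \<partial>\<nu>) \<le> \<theta> * (\<integral>x. f x * w2 x \<partial>\<mu>)"
        using V f(1) f(4) unfolding good_def by blast
      have "(\<integral>x. f x * w2 x \<partial>\<mu>) \<le> (\<integral>x. indicator U x * (u x * w2 x) \<partial>\<mu>)"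
      proof (rule integral_mono)
        show "integrable \<mu> (\<lambda>x. indicator U x * (u x * w2 x))"
          using integrable_mult_indicator[OF Ks(2) integrable_continuous[OF \<mu> uw(3)]] by simp
        show "integrable \<mu> (\<lambda>x. f x * w2 x)"
          by (intro integrable_continuous \<mu> continuous_on_mult H_cont f w2)
        show "f x * w2 x \<le> indicator U x * (u x * w2 x)" for x
          using f(2)[of x] f(4)[of x] w2(2)[of x]
          by (simp split: split_indicator add: mult_right_mono)
      qed
      also have "\<dots> = measure \<mu>' U"
        unfolding \<mu>'_def by (intro measure_density_integral[symmetric] integrable_continuous \<mu> uw Ks)
      finally have "\<theta> * (\<integral>x. f x * w2 x \<partial>\<mu>) \<le> \<theta> * measure \<mu>' U"
        using \<theta> by (intro mult_left_mono) auto
      then show ?thesis using 1 2 by linarith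
    qed
    have BV: "measure \<nu>' B \<le> \<theta> * measure \<mu>' B" if V: "good V" and B: "B \<in> sets borel" "B \<subseteq> V" for B V
    proof (rule field_le_epsilon)
      fix e :: real assume e: "0 < e"
      \<comment> \<open>Errors occur in both measures, the second one multiplied by
        \<open>\<theta>\<close>; together they amount to \<open>e\<close>.\<close>
      define d where "d = e / (\<theta> + 1)"
      have "0 < d" "(1 + \<theta>) * d = e" using e \<theta> by (simp_all add: d_def add.commute)
      then have d: "0 < d" "d + \<theta> * d = e" by (simp_all add: algebra_simps)
      obtain K U' where K: "compact K" "open U'" "K \<subseteq> B" "B \<subseteq> U'" "measure \<nu>' (U' - K) < d"
        using approximableE[OF ap(1) B(1) d(1)] .
      obtain K' U where U: "compact K'" "open U" "K' \<subseteq> B" "B \<subseteq> U" "measure \<mu>' (U - K') < d"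
        using approximableE[OF ap(2) B(1) d(1)] .
      have m: "K \<in> sets borel" "K' \<in> sets borel" "U \<in> sets borel" "U' \<in> sets borel"
        using K U by (auto simp: compact_imp_closed)
      have "measure \<nu>' B = measure \<nu>' K + measure \<nu>' (B - K)"
        using \<nu>'.finite_measure_Diff[of B K] m B K by (simp add: sets)
      also have "measure \<nu>' (B - K) \<le> measure \<nu>' (U' - K)"
        using m K by (intro \<nu>'.finite_measure_mono) (auto simp: sets)
      finally have 1: "measure \<nu>' B \<le> measure \<nu>' K + d" using K by simp
      have 2: "measure \<nu>' K \<le> \<theta> * measure \<mu>' U" using KU[OF V K(1) _ U(2)] K U B by auto
      have "measure \<mu>' U = measure \<mu>' B + measure \<mu>' (U - B)"
        using \<mu>'.finite_measure_Diff[of U B] m B U by (simp add: sets)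
      also have "measure \<mu>' (U - B) \<le> measure \<mu>' (U - K')"
        using m U by (intro \<mu>'.finite_measure_mono) (auto simp: sets)
      finally have "\<theta> * measure \<mu>' U \<le> \<theta> * (measure \<mu>' B + d)" using U \<theta> by simp
      then show "measure \<nu>' B \<le> \<theta> * measure \<mu>' B + e" using 1 2 d(2) by (simp add: algebra_simps)
    qed
    have "\<forall>x0. \<exists>V. good V \<and> x0 \<in> V" using loc[OF \<theta>] unfolding good_def by blast
    then have "UNIV \<subseteq> \<Union>{V. good V}" by blast
    then obtain \<V> where \<V>: "\<V> \<subseteq> {V. good V}" "finite \<V>" "UNIV \<subseteq> \<Union>\<V>"
      using compactE[OF compact_space, of "{V. good V}"] unfolding good_def by blast
    \<comment> \<open>Domination on the small open sets becomes global by cutting \<open>B\<close>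
      into disjoint Borel pieces along a finite cover.\<close>
    have "\<forall>B\<in>sets borel. B \<subseteq> \<Union>\<V> \<longrightarrow> measure \<nu>' B \<le> \<theta> * measure \<mu>' B"
      using \<V>(2,1)
    proof (induction \<V> rule: finite_induct)
      case empty then show ?case by auto
    next
      case (insert V \<V>)
      show ?case
      proof (intro ballI impI)
        fix B assume B: "B \<in> sets borel" "B \<subseteq> \<Union>(insert V \<V>)"
        have V: "good V" "V \<in> sets borel" using insert.prems by (auto simp: good_def)
        have "measure M B = measure M (B \<inter> V) + measure M (B - V)"
          if "finite_measure M" "sets M = sets borel" for M
        proof -
          interpret finite_measure M by fact
          have "measure M ((B \<inter> V) \<union> (B - V)) = measure M (B \<inter> V) + measure M (B - V)"
            using B(1) V(2) that(2) by (intro finite_measure_Union) auto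
          then show ?thesis by (simp add: Int_Diff_Un)
        qed
        then have "measure \<nu>' B = measure \<nu>' (B \<inter> V) + measure \<nu>' (B - V)"
          "measure \<mu>' B = measure \<mu>' (B \<inter> V) + measure \<mu>' (B - V)"
          using \<nu>'.finite_measure_axioms \<mu>'.finite_measure_axioms sets by auto
        moreover have "measure \<nu>' (B \<inter> V) \<le> \<theta> * measure \<mu>' (B \<inter> V)"
          using B V by (intro BV) auto
        moreover have "measure \<nu>' (B - V) \<le> \<theta> * measure \<mu>' (B - V)"
        proof -
          have "B - V \<in> sets borel" "B - V \<subseteq> \<Union>\<V>" using B V by auto
          then show ?thesis using insert.IH insert.prems by auto
        qed
        ultimately show "measure \<nu>' B \<le> \<theta> * measure \<mu>' B" by (simp add: algebra_simps)
      qed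
    qed
    then show ?thesis using \<V>(3) B by auto
  qed
  have "measure \<nu>' B \<le> measure \<mu>' B"
  proof (rule field_le_epsilon)
    fix e :: real assume e: "0 < e"
    have m0: "0 \<le> measure \<mu>' B" by simp
    have "measure \<nu>' B \<le> (1 + e / (measure \<mu>' B + 1)) * measure \<mu>' B"
      using e m0 by (intro main) (simp add: add_nonneg_pos)
    also have "\<dots> = measure \<mu>' B + e * (measure \<mu>' B / (measure \<mu>' B + 1))" by (simp add: algebra_simps)
    also have "\<dots> \<le> measure \<mu>' B + e * 1"
      using e m0 by (intro add_left_mono mult_left_mono) (auto simp: divide_le_eq not_less[symmetric] add_nonneg_pos)
    finally show "measure \<nu>' B \<le> measure \<mu>' B + e" by simp
  qed
  then show ?thesis by (simp add: \<nu>'_def \<mu>'_def)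
qed

text \<open>Near a point the continuous positive function \<open>R\<close> varies by a factor
  arbitrarily close to 1. There the two inequalities of \<open>dom\<close> compare \<nu> with the
  measure of density \<open>R\<close> in both directions, up to such a factor; local domination
  removes it, and dividing by the weight \<open>u\<close> leaves the equality of measures.\<close>

lemma regular_measure_eq_density:
  assumes \<nu>: "regular_borel_measure \<nu>" and \<mu>: "regular_borel_measure \<mu>"
    and R: "continuous_on UNIV R" "\<And>x. 0 < R x"
    and dom: "\<And>h a b. h \<in> H \<Longrightarrow> 0 < a \<Longrightarrow> 0 < b \<Longrightarrow> (\<And>x. 0 < h x \<Longrightarrow> a \<le> R x \<and> R x \<le> b) \<Longrightarrow>
      (\<integral>x. h x \<partial>\<nu>) \<le> b * (\<integral>x. h x \<partial>\<mu>) \<and> a * (\<integral>x. h x \<partial>\<mu>) \<le> (\<integral>x. h x \<partial>\<nu>)"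
  shows "\<nu> = density \<mu> (\<lambda>x. ennreal (R x))"
proof -
  have sets_\<nu>: "sets \<nu> = sets borel" and sets_\<mu>: "sets \<mu> = sets borel"
    using \<nu> \<mu> by (auto simp: regular_borel_measure_def)
  have R0: "0 \<le> R x" for x using R(2)[of x] by simp
  have loc: "\<exists>V. open V \<and> x0 \<in> V \<and> (\<forall>h\<in>H. (\<forall>x. x \<notin> V \<longrightarrow> h x = 0) \<longrightarrow>
      (\<integral>x. h x * 1 \<partial>\<nu>) \<le> \<theta> * (\<integral>x. h x * R x \<partial>\<mu>) \<and> (\<integral>x. h x * R x \<partial>\<mu>) \<le> \<theta> * (\<integral>x. h x * 1 \<partial>\<nu>))"
    if \<theta>: "1 < \<theta>" for \<theta> x0
  proof -
    \<comment> \<open>The square root makes the bounds \<open>R x0 / s\<close> and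
      \<open>s * R x0\<close> differ by the factor \<open>\<theta>\<close> exactly.\<close>
    define s where "s = sqrt \<theta>"
    have s: "1 < s" "s * s = \<theta>" using \<theta> by (auto simp: s_def)
    define a b where "a = R x0 / s" and "b = s * R x0"
    have ab: "0 < a" "0 < b" "b = \<theta> * a" using s R(2)[of x0] by (auto simp: a_def b_def)
    let ?V = "{x. a < R x} \<inter> {x. R x < b}"
    have "open ?V" by (intro open_Int open_less R continuous_on_const)
    moreover have "x0 \<in> ?V" using s R(2)[of x0] by (auto simp: a_def b_def divide_less_eq)
    moreover have "(\<integral>x. h x * 1 \<partial>\<nu>) \<le> \<theta> * (\<integral>x. h x * R x \<partial>\<mu>) \<and> (\<integral>x. h x * R x \<partial>\<mu>) \<le> \<theta> * (\<integral>x. h x * 1 \<partial>\<nu>)"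
      if h: "h \<in> H" "\<forall>x. x \<notin> ?V \<longrightarrow> h x = 0" for h
    proof -
      have "a \<le> R x \<and> R x \<le> b" if "0 < h x" for x
      proof -
        have "x \<in> ?V" using h(2) that by force
        then show ?thesis by simp
      qed
      note d = dom[OF h(1) ab(1,2) this]
      have pt: "a * h x \<le> h x * R x" "h x * R x \<le> b * h x" for x
      proof -
        have "a * h x \<le> h x * R x \<and> h x * R x \<le> b * h x"
        proof (cases "x \<in> ?V")
          case True
          then show ?thesis using H_nonneg[OF h(1), of x]
            by (simp add: mult.commute[of _ "h x"] mult_left_mono)
        next
          case False
          then have "h x = 0" using h(2) by blast
          then show ?thesis by simp
        qed
        then show "a * h x \<le> h x * R x" "h x * R x \<le> b * h x" by simp_all
      qed
      have i: "integrable \<mu> h" "integrable \<mu> (\<lambda>x. h x * R x)"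
        by (intro integrable_continuous[OF \<mu>] continuous_on_mult R H_cont[OF h(1)])+
      have i1: "a * (\<integral>x. h x \<partial>\<mu>) \<le> (\<integral>x. h x * R x \<partial>\<mu>)"
        using integral_mono[OF integrable_mult_right[OF i(1), of a] i(2)] pt by simp
      have i2: "(\<integral>x. h x * R x \<partial>\<mu>) \<le> b * (\<integral>x. h x \<partial>\<mu>)"
        using integral_mono[OF i(2) integrable_mult_right[OF i(1), of b]] pt by simp
      have "(\<integral>x. h x \<partial>\<nu>) \<le> \<theta> * (a * (\<integral>x. h x \<partial>\<mu>))" using d ab(3) by simp
      also have "\<dots> \<le> \<theta> * (\<integral>x. h x * R x \<partial>\<mu>)" using i1 \<theta> by (intro mult_left_mono) auto
      finally have 1: "(\<integral>x. h x \<partial>\<nu>) \<le> \<theta> * (\<integral>x. h x * R x \<partial>\<mu>)" .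
      have "(\<integral>x. h x * R x \<partial>\<mu>) \<le> \<theta> * (a * (\<integral>x. h x \<partial>\<mu>))" using i2 ab(3) by simp
      also have "\<dots> \<le> \<theta> * (\<integral>x. h x \<partial>\<nu>)" using d \<theta> by (intro mult_left_mono) auto
      finally show ?thesis using 1 by simp
    qed
    ultimately show ?thesis by blast
  qed
  let ?N = "density \<nu> (\<lambda>x. ennreal (u x * 1))" and ?M = "density \<mu> (\<lambda>x. ennreal (u x * R x))"
  have uc: "continuous_on UNIV u" using H_cont[OF u_in] .
  have le1: "measure ?N B \<le> measure ?M B" if "B \<in> sets borel" for B
  proof (rule density_le_of_local_domination[OF \<nu> \<mu> continuous_on_const _ R(1) R0 _ that])
    fix \<theta> :: real and x0 :: 'x assume "1 < \<theta>"
    from loc[OF this, of x0] show "\<exists>V. open V \<and> x0 \<in> V \<and> (\<forall>h\<in>H. (\<forall>x. x \<notin> V \<longrightarrow> h x = 0) \<longrightarrow>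
        (\<integral>x. h x * 1 \<partial>\<nu>) \<le> \<theta> * (\<integral>x. h x * R x \<partial>\<mu>))" by meson
  qed simp
  have le2: "measure ?M B \<le> measure ?N B" if "B \<in> sets borel" for B
  proof (rule density_le_of_local_domination[OF \<mu> \<nu> R(1) R0 continuous_on_const _ _ that])
    fix \<theta> :: real and x0 :: 'x assume "1 < \<theta>"
    from loc[OF this, of x0] show "\<exists>V. open V \<and> x0 \<in> V \<and> (\<forall>h\<in>H. (\<forall>x. x \<notin> V \<longrightarrow> h x = 0) \<longrightarrow>
        (\<integral>x. h x * R x \<partial>\<mu>) \<le> \<theta> * (\<integral>x. h x * 1 \<partial>\<nu>))" by meson
  qed simp
  have fin: "finite_measure ?N" "finite_measure ?M"
    using u_pos R0
    by (auto intro!: finite_measure_density \<nu> \<mu> continuous_on_mult continuous_on_const uc R(1) simp: less_imp_le)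
  have NM: "?N = ?M"
  proof (rule measure_eqI)
    show "sets ?N = sets ?M" by (simp add: sets_\<nu> sets_\<mu>)
    fix B assume "B \<in> sets ?N"
    then have "B \<in> sets borel" by (simp add: sets_\<nu>)
    then show "emeasure ?N B = emeasure ?M B"
      using le1 le2 finite_measure.emeasure_eq_measure[OF fin(1)] finite_measure.emeasure_eq_measure[OF fin(2)]
      by (simp add: antisym)
  qed
  have meas: "f \<in> borel_measurable \<nu>" "f \<in> borel_measurable \<mu>" if "continuous_on UNIV f" for f :: "'x \<Rightarrow> real"
    using borel_measurable_continuous_onI[OF that] sets_\<nu> sets_\<mu> by (simp_all cong: measurable_cong_sets)
  have [measurable]: "u \<in> borel_measurable \<nu>" "u \<in> borel_measurable \<mu>" "R \<in> borel_measurable \<mu>"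
    by (rule meas[OF uc] meas[OF R(1)])+
  have mu: "(\<lambda>x. ennreal (inverse (u x))) \<in> borel_measurable \<nu>" "(\<lambda>x. ennreal (inverse (u x))) \<in> borel_measurable \<mu>"
    "(\<lambda>x. ennreal (u x * 1)) \<in> borel_measurable \<nu>" "(\<lambda>x. ennreal (u x * R x)) \<in> borel_measurable \<mu>"
    by measurable
  have ne: "u x \<noteq> 0" "0 \<le> u x" for x using u_pos[of x] by auto
  \<comment> \<open>The measures agree after weighting by \<open>u\<close>; since \<open>u\<close>
    is positive, the weight can be divided out.\<close>
  have "\<nu> = density \<nu> (\<lambda>x. 1)" by (simp add: density_1)
  also have "\<dots> = density ?N (\<lambda>x. ennreal (inverse (u x)))"
    using mu ne by (subst density_density_eq) (auto simp: ennreal_mult'[symmetric])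
  also have "\<dots> = density ?M (\<lambda>x. ennreal (inverse (u x)))" using NM by simp
  also have "\<dots> = density \<mu> (\<lambda>x. ennreal (u x * R x) * ennreal (inverse (u x)))"
    using mu by (subst density_density_eq) auto
  also have "\<dots> = density \<mu> (\<lambda>x. ennreal (R x))"
  proof -
    have "ennreal (u x * R x) * ennreal (inverse (u x)) = ennreal (R x)" for x
      using ne[of x] R0[of x] by (simp add: ennreal_mult'[symmetric])
    then show ?thesis by simp
  qed
  finally show ?thesis .
qed

end

subsection \<open>Covering dimension\<close>

lemma homogeneous_system_nontrivial_solution:
  fixes c :: "'i \<Rightarrow> 'k \<Rightarrow> real"
  assumes "finite I" "finite K" "card I < card K"
  shows "\<exists>l. (\<exists>k\<in>K. l k \<noteq> 0) \<and> (\<forall>i\<in>I. (\<Sum>k\<in>K. c i k * l k) = 0)"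
  using assms
proof (induction I arbitrary: K c rule: finite_induct)
  case empty
  then have "K \<noteq> {}" by auto
  then show ?case by (intro exI[of _ "\<lambda>_. 1"]) auto
next
  case (insert i I)
  show ?case
  proof (cases "\<exists>k0\<in>K. c i k0 \<noteq> 0")
    case False
    have "card I < card K" using insert.prems insert.hyps by simp
    from insert.IH[OF insert.prems(1) this, of c] obtain l
      where l: "\<exists>k\<in>K. l k \<noteq> 0" "\<And>j. j \<in> I \<Longrightarrow> (\<Sum>k\<in>K. c j k * l k) = 0" by blast
    moreover have "(\<Sum>k\<in>K. c i k * l k) = 0" using False by (intro sum.neutral) auto
    ultimately show ?thesis by blast
  next
    case True
    then obtain k0 where k0: "k0 \<in> K" "c i k0 \<noteq> 0" by blast
    define K' where "K' = K - {k0}"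
    have K': "finite K'" "card I < card K'"
      using insert.prems insert.hyps k0 by (auto simp: K'_def)
    define c' where "c' j k = c j k - c j k0 * c i k / c i k0" for j k
    obtain l where l: "\<exists>k\<in>K'. l k \<noteq> 0" "\<And>j. j \<in> I \<Longrightarrow> (\<Sum>k\<in>K'. c' j k * l k) = 0"
      using insert.IH[OF K', of c'] by blast
    define s where "s = - (\<Sum>k\<in>K'. c i k * l k) / c i k0"
    define l' where "l' = l(k0 := s)"
    have sum: "(\<Sum>k\<in>K. c j k * l' k) = c j k0 * s + (\<Sum>k\<in>K'. c j k * l k)" for j
    proof -
      have "(\<Sum>k\<in>K. c j k * l' k) = c j k0 * l' k0 + (\<Sum>k\<in>K'. c j k * l' k)"
        unfolding K'_def using insert.prems k0 by (intro sum.remove) auto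
      also have "(\<Sum>k\<in>K'. c j k * l' k) = (\<Sum>k\<in>K'. c j k * l k)"
        by (intro sum.cong) (auto simp: l'_def K'_def)
      finally show ?thesis by (simp add: l'_def)
    qed
    have "(\<Sum>k\<in>K. c j k * l' k) = 0" if j: "j \<in> insert i I" for j
    proof (cases "j = i")
      case True
      then show ?thesis using k0 by (simp add: sum s_def)
    next
      case False
      then have "0 = (\<Sum>k\<in>K'. c' j k * l k)" using l(2) j by simp
      also have "\<dots> = (\<Sum>k\<in>K'. c j k * l k) - c j k0 / c i k0 * (\<Sum>k\<in>K'. c i k * l k)"
        by (simp add: c'_def left_diff_distrib sum_subtractf sum_distrib_left mult.assoc)
      finally show ?thesis by (simp add: sum s_def)
    qed
    moreover have "\<exists>k\<in>K. l' k \<noteq> 0" using l(1) by (auto simp: K'_def l'_def)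
    ultimately show ?thesis by blast
  qed
qed

text \<open>A polynomial equation in \<open>\<tau>\<close>. The exponents start at 1, so
  \<open>e\<close> alone forms the constant coefficient, and a nonzero \<open>l j\<close> makes the
  polynomial nonzero whatever \<open>e\<close> is.\<close>

lemma finite_powers_relation:
  fixes l :: "nat \<Rightarrow> real"
  assumes J: "J \<subseteq> {..<n}" and nz: "\<exists>j\<in>J. l j \<noteq> 0"
  shows "finite {\<tau>. (\<Sum>j\<in>J. l j * \<tau> ^ Suc j) = e}"
proof -
  define c where "c i = (case i of 0 \<Rightarrow> - e | Suc j \<Rightarrow> if j \<in> J then l j else 0)" for i
  have "(\<Sum>i\<le>n. c i * \<tau> ^ i) = (\<Sum>j\<in>J. l j * \<tau> ^ Suc j) - e" for \<tau>
  proof -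
    have "(\<Sum>i\<le>n. c i * \<tau> ^ i) = c 0 * \<tau> ^ 0 + (\<Sum>j<n. c (Suc j) * \<tau> ^ Suc j)"
      by (simp add: sum.atMost_shift)
    also have "(\<Sum>j<n. c (Suc j) * \<tau> ^ Suc j) = (\<Sum>j\<in>J. l j * \<tau> ^ Suc j)"
      using J by (intro sum.mono_neutral_cong_right) (auto simp: c_def)
    finally show ?thesis by (simp add: c_def)
  qed
  moreover have "\<exists>i\<le>n. c i \<noteq> 0"
  proof -
    obtain j where "j \<in> J" "l j \<noteq> 0" using nz by blast
    then show ?thesis using J by (intro exI[of _ "Suc j"]) (auto simp: c_def)
  qed
  ultimately show ?thesis using polyfun_finite_roots[of c n] by simp
qed

lemma open_Collect_finite_ball:
  assumes "finite A" "\<And>i. i \<in> A \<Longrightarrow> open {x. P i x}"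
  shows "open {x. \<forall>i\<in>A. P i x}"
proof -
  have "{x. \<forall>i\<in>A. P i x} = (\<Inter>i\<in>A. {x. P i x})" by auto
  then show ?thesis using assms by (auto intro: open_INT)
qed

locale compact_in_coordinates =
  fixes q :: "'x::t2_space \<Rightarrow> nat \<Rightarrow> real" and n :: nat
  assumes compact_space: "compact (UNIV :: 'x set)"
    and q_cont: "i < n \<Longrightarrow> continuous_on UNIV (\<lambda>x. q x i)"
    and q_inj: "(\<And>i. i < n \<Longrightarrow> q x i = q y i) \<Longrightarrow> x = y"
begin

text \<open>The coordinates give a continuous distance \<open>\<delta>\<close> that separates
  points. On the compact complement of an open set, the distance from an outside point has a
  positive minimum, and halving these radii on a finite subcover yields a uniform number.\<close>

lemma lebesgue_number:
  assumes op: "\<And>U. U \<in> \<U> \<Longrightarrow> open U" and cov: "\<Union>\<U> = (UNIV :: 'x set)"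
  obtains e where "e > 0" "\<And>x. \<exists>U\<in>\<U>. \<forall>y. (\<forall>i<n. \<bar>q x i - q y i\<bar> < e) \<longrightarrow> y \<in> U"
proof -
  define \<delta> where "\<delta> x y = (\<Sum>i<n. \<bar>q x i - q y i\<bar>)" for x y
  have cont: "continuous_on S (\<delta> x)" for S x
    unfolding \<delta>_def
    by (intro continuous_on_sum continuous_on_rabs continuous_on_diff continuous_on_const
        continuous_on_subset[OF q_cont]) auto
  have pos: "0 < \<delta> x y" if "x \<noteq> y" for x y
  proof -
    obtain i where i: "i < n" "q x i \<noteq> q y i" using q_inj[of x y] \<open>x \<noteq> y\<close> by blast
    show ?thesis unfolding \<delta>_def by (rule sum_pos2[where i = i]) (use i in auto)
  qed
  have tri: "\<delta> x y \<le> \<delta> x z + \<delta> z y" for x y z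
    unfolding \<delta>_def sum.distrib[symmetric] by (intro sum_mono) auto
  have "\<exists>r U. 0 < r \<and> U \<in> \<U> \<and> (\<forall>y. \<delta> x y < r \<longrightarrow> y \<in> U)" for x
  proof -
    have "x \<in> \<Union>\<U>" unfolding cov ..
    then obtain U where U: "U \<in> \<U>" "x \<in> U" by (rule UnionE)
    have comp: "compact (- U)" using compact_space op[OF U(1)]
      by (metis compact_Int_closed closed_Compl Int_UNIV_left)
    show ?thesis
    proof (cases "- U = {}")
      case True
      then show ?thesis using U by (intro exI[of _ 1] exI[of _ U]) auto
    next
      case False
      obtain z where z: "z \<in> - U" "\<And>y. y \<in> - U \<Longrightarrow> \<delta> x z \<le> \<delta> x y"
        using continuous_attains_inf[OF comp False cont] by blast
      have "0 < \<delta> x z" using z(1) U(2) by (intro pos) auto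
      moreover have "y \<in> U" if "\<delta> x y < \<delta> x z" for y using z(2)[of y] that by force
      ultimately show ?thesis using U(1) by blast
    qed
  qed
  then obtain r V where rV: "\<And>x. 0 < r x" "\<And>x. V x \<in> \<U>" "\<And>x y. \<delta> x y < r x \<Longrightarrow> y \<in> V x"
    by metis
  have op': "open {y. \<delta> x y < r x / 2}" for x
    by (intro open_Collect_less cont continuous_on_const)
  have cov': "UNIV \<subseteq> (\<Union>x\<in>UNIV. {y. \<delta> x y < r x / 2})"
  proof
    fix x :: 'x
    have "\<delta> x x = 0" by (simp add: \<delta>_def)
    then show "x \<in> (\<Union>x\<in>UNIV. {y. \<delta> x y < r x / 2})" using rV(1)[of x] by (intro UN_I[of x]) auto
  qed
  obtain F where "F \<subseteq> UNIV" and F: "finite F" "UNIV \<subseteq> (\<Union>x\<in>F. {y. \<delta> x y < r x / 2})"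
    using compactE_image[OF compact_space op' cov'] .
  have Fne: "F \<noteq> {}" using F(2) by auto
  \<comment> \<open>Turns a bound on each coordinate into a bound on the sum
    \<open>\<delta>\<close>; the added 1 covers the case \<open>n = 0\<close>.\<close>
  define e where "e = Min ((\<lambda>x. r x / 2) ` F) / (real n + 1)"
  have m: "0 < Min ((\<lambda>x. r x / 2) ` F)" using F(1) Fne rV(1) by (subst Min_gr_iff) auto
  show thesis
  proof (rule that[of e])
    show "e > 0" using m by (simp add: e_def)
    fix x
    have "x \<in> (\<Union>x\<in>F. {y. \<delta> x y < r x / 2})" using F(2) by (rule subsetD) simp
    then obtain z where z: "z \<in> F" "\<delta> z x < r z / 2" by (elim UN_E) simp
    have "y \<in> V z" if y: "\<forall>i<n. \<bar>q x i - q y i\<bar> < e" for y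
    proof (rule rV(3))
      have "\<delta> x y \<le> (\<Sum>i<n. e)" unfolding \<delta>_def using y by (intro sum_mono) (auto simp: less_imp_le)
      also have "\<dots> \<le> (real n + 1) * e" using \<open>e > 0\<close> by (simp add: algebra_simps)
      also have "\<dots> = Min ((\<lambda>x. r x / 2) ` F)" by (simp add: e_def)
      also have "\<dots> \<le> r z / 2" using F(1) z(1) by (intro Min_le) auto
      finally show "\<delta> z y < r z" using tri[of z y x] z(2) by linarith
    qed
    then show "\<exists>U\<in>\<U>. \<forall>y. (\<forall>i<n. \<bar>q x i - q y i\<bar> < e) \<longrightarrow> y \<in> U" using rV(2) by blast
  qed
qed

text \<open>A generically shifted cubical grid: the \<open>\<tau>\<close>-shift makes every point of the compact set have
  fewer than \<open>D\<close> integral coordinates, and points with the same number of integral coordinates lie in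
  disjoint small neighbourhoods of faces of the grid.\<close>

lemma covering_dim_le_of_planes:
  fixes Ls :: "(nat set \<times> (nat \<Rightarrow> nat \<Rightarrow> real)) set"
  assumes finLs: "finite Ls" and D: "D \<ge> 1"
    and Ls: "\<And>I c. (I, c) \<in> Ls \<Longrightarrow> finite I \<and> card I \<le> D"
    and plane: "\<And>x. \<exists>(I, c)\<in>Ls. \<forall>j<n. q x j = (\<Sum>i\<in>I. c j i * q x i)"
    and norm: "\<And>x. (\<Sum>j<n. q x j) = 1"
  shows "covering_dim_le (euclidean :: 'x topology) (int D - 1)"
proof -
  define inL where "inL L w \<longleftrightarrow> (\<forall>j<n. w j = (\<Sum>i\<in>fst L. snd L j i * w i)) \<and> (\<Sum>j<n. w j) = 1"
    for L :: "nat set \<times> (nat \<Rightarrow> nat \<Rightarrow> real)" and w :: "nat \<Rightarrow> real"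
  \<comment> \<open>Planes without a normalised vector are dropped, since nontriviality of the
    relations below is checked at such a vector.\<close>
  define Ls' where "Ls' = {L \<in> Ls. \<exists>w. inL L w}"
  have relation: "\<exists>l e. (\<exists>j\<in>J. l j \<noteq> 0) \<and> (\<forall>w. inL L w \<longrightarrow> (\<Sum>j\<in>J. l j * w j) = e)"
    if L: "L \<in> Ls'" and J: "J \<subseteq> {..<n}" "card J = D" for L J
  proof -
    obtain I c where Lc: "L = (I, c)" by (cases L)
    have I: "finite I" "card I \<le> D" using L Ls[of I c] by (auto simp: Ls'_def Lc)
    have finJ: "finite J" using J(1) finite_subset by blast
    have nJ: "n \<notin> J" using J(1) by auto
    \<comment> \<open>The index \<open>n\<close> stands for the sum of all coordinates, which is
      constantly 1. Together with the coordinates in \<open>J\<close> this makes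
      \<open>D + 1\<close> functionals on a space of dimension at most \<open>D\<close>, so they are
      dependent.\<close>
    define a where "a i k = (if k = n then - (\<Sum>j<n. c j i) else c k i)" for i k
    have "finite (insert n J)" "card I < card (insert n J)" using finJ nJ I J by auto
    then obtain l where l: "\<exists>k\<in>insert n J. l k \<noteq> 0" "\<And>i. i \<in> I \<Longrightarrow> (\<Sum>k\<in>insert n J. a i k * l k) = 0"
      using homogeneous_system_nontrivial_solution[OF I(1), of "insert n J" a] by blast
    have rel: "(\<Sum>j\<in>J. l j * w j) = l n" if w: "inL L w" for w
    proof -
      have w1: "w j = (\<Sum>i\<in>I. c j i * w i)" if "j < n" for j
        using w that unfolding inL_def Lc fst_conv snd_conv by blast
      have "1 = (\<Sum>j<n. w j)" using w unfolding inL_def by (metis (no_types))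
      also have "\<dots> = (\<Sum>j<n. \<Sum>i\<in>I. c j i * w i)" by (intro sum.cong refl w1) simp
      also have "\<dots> = (\<Sum>i\<in>I. (\<Sum>j<n. c j i) * w i)" by (subst sum.swap) (simp add: sum_distrib_right)
      finally have e1: "(\<Sum>i\<in>I. (\<Sum>j<n. c j i) * w i) = 1" by simp
      have "(\<Sum>j\<in>J. l j * w j) = (\<Sum>j\<in>J. \<Sum>i\<in>I. l j * (c j i * w i))"
      proof (intro sum.cong refl)
        fix j assume "j \<in> J"
        then have "j < n" using J(1) by auto
        then show "l j * w j = (\<Sum>i\<in>I. l j * (c j i * w i))"
          unfolding sum_distrib_left[symmetric] by (subst w1) simp_all
      qed
      also have "\<dots> = (\<Sum>i\<in>I. (\<Sum>j\<in>J. c j i * l j) * w i)"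
        by (subst sum.swap) (simp add: sum_distrib_right sum_distrib_left mult_ac)
      also have "\<dots> = (\<Sum>i\<in>I. (\<Sum>j<n. c j i) * l n * w i)"
      proof (intro sum.cong refl)
        fix i assume "i \<in> I"
        have "(\<Sum>k\<in>J. a i k * l k) = (\<Sum>j\<in>J. c j i * l j)"
          using nJ by (intro sum.cong) (auto simp: a_def)
        then have "(\<Sum>j\<in>J. c j i * l j) = (\<Sum>j<n. c j i) * l n"
          using l(2)[OF \<open>i \<in> I\<close>] nJ finJ by (simp add: a_def)
        then show "(\<Sum>j\<in>J. c j i * l j) * w i = (\<Sum>j<n. c j i) * l n * w i" by simp
      qed
      also have "\<dots> = l n * (\<Sum>i\<in>I. (\<Sum>j<n. c j i) * w i)" by (simp add: sum_distrib_left algebra_simps)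
      finally show ?thesis by (simp add: e1)
    qed
    obtain w0 where w0: "inL L w0" using L by (auto simp: Ls'_def)
    \<comment> \<open>If only the coefficient at \<open>n\<close> were nonzero, the relation would
      read \<open>0 = l n\<close> at \<open>w0\<close>.\<close>
    have "\<exists>j\<in>J. l j \<noteq> 0"
    proof (rule ccontr)
      assume "\<not> ?thesis"
      then have z: "\<And>j. j \<in> J \<Longrightarrow> l j = 0" by blast
      then have "l n = 0" using rel[OF w0] by (simp add: sum.neutral)
      then show False using l(1) z by auto
    qed
    then show ?thesis using rel by blast
  qed
  define \<J> where "\<J> = {J. J \<subseteq> {..<n} \<and> card J = D}"
  define Rel where "Rel L J l e \<longleftrightarrow> (\<exists>j\<in>J. l j \<noteq> 0) \<and> (\<forall>w. inL L w \<longrightarrow> (\<Sum>j\<in>J. l j * w j) = e)"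
    for L J and l :: "nat \<Rightarrow> real" and e
  have "\<forall>L J. \<exists>l e. L \<in> Ls' \<longrightarrow> J \<in> \<J> \<longrightarrow> Rel L J l e"
  proof (intro allI)
    fix L J
    have "L \<in> Ls' \<Longrightarrow> J \<in> \<J> \<Longrightarrow> \<exists>l e. Rel L J l e"
      unfolding Rel_def \<J>_def mem_Collect_eq by (intro relation) simp_all
    then show "\<exists>l e. L \<in> Ls' \<longrightarrow> J \<in> \<J> \<longrightarrow> Rel L J l e" by blast
  qed
  then obtain l0 where "\<forall>L. \<forall>J. \<exists>e. L \<in> Ls' \<longrightarrow> J \<in> \<J> \<longrightarrow> Rel L J (l0 L J) e"
    by (metis (lifting))
  then obtain e0 where "\<forall>L J. L \<in> Ls' \<longrightarrow> J \<in> \<J> \<longrightarrow> Rel L J (l0 L J) (e0 L J)"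
    by metis
  have le: "\<exists>j\<in>J. l0 L J j \<noteq> 0" "inL L w \<Longrightarrow> (\<Sum>j\<in>J. l0 L J j * w j) = e0 L J"
    if "L \<in> Ls'" "J \<in> \<J>" for L J w
  proof -
    have "Rel L J (l0 L J) (e0 L J)"
      using \<open>\<forall>L J. L \<in> Ls' \<longrightarrow> J \<in> \<J> \<longrightarrow> Rel L J (l0 L J) (e0 L J)\<close> that by blast
    then show "\<exists>j\<in>J. l0 L J j \<noteq> 0" "inL L w \<Longrightarrow> (\<Sum>j\<in>J. l0 L J j * w j) = e0 L J"
      unfolding Rel_def by simp_all
  qed
  have fin\<J>: "finite \<J>" unfolding \<J>_def by (rule finite_subset[of _ "Pow {..<n}"]) auto
  have cover: "\<exists>\<V>. finite \<V> \<and> (\<forall>V\<in>\<V>. open V) \<and> \<Union>\<V> = (UNIV :: 'x set) \<and> (\<forall>V\<in>\<V>. \<exists>U\<in>\<U>. V \<subseteq> U) \<and>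
      (\<forall>x. card {V\<in>\<V>. x \<in> V} \<le> D)"
    if \<U>: "\<And>U. U \<in> \<U> \<Longrightarrow> open U" "\<Union>\<U> = (UNIV :: 'x set)" for \<U>
  proof -
    obtain e where e: "e > 0" "\<And>x. \<exists>U\<in>\<U>. \<forall>y. (\<forall>i<n. \<bar>q x i - q y i\<bar> < e) \<longrightarrow> y \<in> U"
      using lebesgue_number[OF \<U>] by blast
    \<comment> \<open>The shifts for which \<open>D\<close> coordinates of a point can be integral
      at once: the affine relation on the plane then becomes a polynomial equation for
      \<open>\<tau>\<close>. Only countably many equations arise, each with finitely many
      solutions.\<close>
    define bad where "bad = (\<Union>L\<in>Ls'. \<Union>J\<in>\<J>. \<Union>a\<in>PiE J (\<lambda>_. UNIV :: int set).
        {\<tau>. (\<Sum>j\<in>J. l0 L J j * \<tau> ^ Suc j) = e0 L J / e - (\<Sum>j\<in>J. l0 L J j * real_of_int (a j))})"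
    have "countable bad"
      unfolding bad_def
    proof (intro countable_UN)
      show "countable Ls'" using finLs by (simp add: Ls'_def countable_finite)
      show "countable \<J>" using fin\<J> by (rule countable_finite)
      show "countable (PiE J (\<lambda>_. UNIV :: int set))" if "J \<in> \<J>" for J
        using that by (intro countable_PiE) (auto simp: \<J>_def intro: finite_subset)
      show "countable {\<tau>. (\<Sum>j\<in>J. l0 L J j * \<tau> ^ Suc j) = e0 L J / e - (\<Sum>j\<in>J. l0 L J j * real_of_int (a j))}"
        if "L \<in> Ls'" "J \<in> \<J>" for L J a
        using finite_powers_relation[of J n "l0 L J"] le(1)[OF that] that(2)
        by (intro countable_finite) (simp add: \<J>_def)
    qed
    then obtain \<tau> where \<tau>: "\<tau> \<notin> bad"
    proof -
      have "bad \<noteq> UNIV" using \<open>countable bad\<close> uncountable_UNIV_real by auto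
      then show thesis using that by auto
    qed
    \<comment> \<open>Rescaling by the Lebesgue number \<open>e\<close> makes sets of width below 1
      in \<open>y\<close> fit into members of the given cover.\<close>
    define y where "y x i = q x i / e - \<tau> ^ Suc i" for x i
    have few: "card {i. i < n \<and> y x i \<in> \<int>} < D" for x
    proof (rule ccontr)
      assume "\<not> ?thesis"
      then have "D \<le> card {i. i < n \<and> y x i \<in> \<int>}" by simp
      from obtain_subset_with_card_n[OF this]
      obtain J where J: "J \<subseteq> {i. i < n \<and> y x i \<in> \<int>}" "card J = D" by metis
      have J': "J \<in> \<J>" using J by (auto simp: \<J>_def)
      obtain I c where Ic: "(I, c) \<in> Ls" "\<forall>j<n. q x j = (\<Sum>i\<in>I. c j i * q x i)"
        using plane[of x] by blast
      define L where "L = (I, c)"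
      have "inL L (q x)" unfolding inL_def L_def fst_conv snd_conv using Ic(2) norm[of x] by (rule conjI)
      then have L: "L \<in> Ls'" "inL L (q x)" using Ic(1) by (auto simp: Ls'_def L_def)
      define a where "a = (\<lambda>j\<in>J. \<lfloor>y x j\<rfloor>)"
      have a: "real_of_int (a j) = y x j" if "j \<in> J" for j
        using that J(1) by (auto simp: a_def elim!: Ints_cases)
      have "(\<Sum>j\<in>J. l0 L J j * \<tau> ^ Suc j) + (\<Sum>j\<in>J. l0 L J j * real_of_int (a j))
          = (\<Sum>j\<in>J. l0 L J j * q x j) / e"
        unfolding sum.distrib[symmetric] sum_divide_distrib
        by (intro sum.cong) (auto simp: a y_def algebra_simps)
      also have "\<dots> = e0 L J / e" using le(2)[OF L(1) J' L(2)] by simp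
      finally have "(\<Sum>j\<in>J. l0 L J j * \<tau> ^ Suc j) = e0 L J / e - (\<Sum>j\<in>J. l0 L J j * real_of_int (a j))"
        by linarith
      moreover have "a \<in> PiE J (\<lambda>_. UNIV)" by (simp add: a_def)
      ultimately have "\<tau> \<in> bad" unfolding bad_def using L(1) J' by blast
      then show False using \<tau> by simp
    qed
    have ycont: "continuous_on UNIV (\<lambda>x. y x i)" if "i < n" for i
      unfolding y_def using e(1) by (intro continuous_on_diff continuous_on_divide continuous_on_const q_cont that) auto
    have "\<exists>B::int. \<forall>x. \<forall>i<n. \<lfloor>y x i\<rfloor> \<in> {-B..B}"
    proof -
      have "\<exists>b::int. \<forall>x. \<bar>\<lfloor>y x i\<rfloor>\<bar> \<le> b" if "i < n" for i
      proof -
        have "bounded (range (\<lambda>x. y x i))"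
          using ycont[OF that] compact_space by (intro compact_imp_bounded compact_continuous_image)
        then obtain b where "\<And>x. \<bar>y x i\<bar> \<le> b" unfolding bounded_iff by auto
        then have "\<bar>\<lfloor>y x i\<rfloor>\<bar> \<le> \<lceil>b\<rceil> + 1" for x
            by (smt (verit) ceiling_mono floor_le_ceiling le_floor_iff of_int_minus ceiling_correct floor_correct)
        then show ?thesis by blast
      qed
      then obtain b where b: "\<And>i x. i < n \<Longrightarrow> \<bar>\<lfloor>y x i\<rfloor>\<bar> \<le> b i" by metis
      have "\<lfloor>y x i\<rfloor> \<in> {- (\<Sum>i<n. \<bar>b i\<bar>)..(\<Sum>i<n. \<bar>b i\<bar>)}" if "i < n" for x i
      proof -
        have "\<bar>b i\<bar> \<le> (\<Sum>i<n. \<bar>b i\<bar>)" using that by (intro member_le_sum) auto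
        then show ?thesis using b[OF that, of x] by auto
      qed
      then show ?thesis by blast
    qed
    then obtain B :: int where B: "\<And>x i. i < n \<Longrightarrow> \<lfloor>y x i\<rfloor> \<in> {-B..B}" by blast
    \<comment> \<open>A neighbourhood of the open face where exactly the coordinates in
      \<open>I\<close> are integral, with values \<open>a\<close>: each coordinate in
      \<open>I\<close> is nearer to its integer than any other coordinate is to any integer.\<close>
    define V where "V I a = {x. (\<forall>i\<in>I. \<bar>y x i - real_of_int (a i)\<bar> < 1 / 2) \<and>
      (\<forall>j\<in>{..<n} - I. real_of_int (a j) < y x j \<and> y x j < real_of_int (a j) + 1 \<and>
        (\<forall>i\<in>I. \<bar>y x i - real_of_int (a i)\<bar> < y x j - real_of_int (a j) \<and>
          \<bar>y x i - real_of_int (a i)\<bar> < real_of_int (a j) + 1 - y x j))}" for I and a :: "nat \<Rightarrow> int"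
    define Idx where "Idx = {I. I \<subseteq> {..<n} \<and> card I < D} \<times> PiE {..<n} (\<lambda>_. {-B..B})"
    define \<V> where "\<V> = (\<lambda>(I, a). V I a) ` Idx"
    have finIdx: "finite Idx" unfolding Idx_def
      by (intro finite_cartesian_product finite_subset[of "{I. I \<subseteq> {..<n} \<and> card I < D}" "Pow {..<n}"] finite_PiE) auto
    have openV: "open (V I a)" if I: "I \<subseteq> {..<n}" for I a
    proof -
      have finI: "finite I" using I finite_subset by blast
      have c: "continuous_on UNIV (\<lambda>x. y x i)" if "i \<in> I" for i using that I by (intro ycont) auto
      show ?thesis unfolding V_def using finI
        by (intro open_Collect_conj open_Collect_finite_ball open_Collect_less continuous_on_rabs
            continuous_on_diff continuous_on_const continuous_on_add c ycont finite_Diff) auto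
    qed
    have near: "\<bar>y x i - y x' i\<bar> < 1" if "x \<in> V I a" "x' \<in> V I a" "i < n" for x x' I a i
    proof (cases "i \<in> I")
      case True
      then have "\<bar>y x i - real_of_int (a i)\<bar> < 1 / 2" "\<bar>y x' i - real_of_int (a i)\<bar> < 1 / 2"
        using that(1,2) unfolding V_def mem_Collect_eq by blast+
      then show ?thesis by linarith
    next
      case False
      then have "i \<in> {..<n} - I" using that(3) by simp
      then have "real_of_int (a i) < y x i" "y x i < real_of_int (a i) + 1"
        "real_of_int (a i) < y x' i" "y x' i < real_of_int (a i) + 1"
        using that(1,2) unfolding V_def mem_Collect_eq by blast+
      then show ?thesis by linarith
    qed
    have dist: "\<bar>y x i - real_of_int (a i)\<bar> < \<bar>y x j - real_of_int z\<bar>"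
      if "x \<in> V I a" "i \<in> I" "j \<in> {..<n} - I" for x I a i j z
    proof -
      have *: "\<bar>y x i - real_of_int (a i)\<bar> < y x j - real_of_int (a j)"
        "\<bar>y x i - real_of_int (a i)\<bar> < real_of_int (a j) + 1 - y x j"
        "real_of_int (a j) < y x j" "y x j < real_of_int (a j) + 1"
        using that unfolding V_def mem_Collect_eq by blast+
      have "z \<le> a j \<or> a j + 1 \<le> z" by linarith
      then have "real_of_int z \<le> real_of_int (a j) \<or> real_of_int (a j) + 1 \<le> real_of_int z" by linarith
      then show ?thesis using * by linarith
    qed
    \<comment> \<open>Two different sets \<open>I\<close>, \<open>I'\<close> of equal size each
      contain an index outside the other; of these two coordinates, each would have to be strictly
      nearer to an integer than the other.\<close>
    have unique: "(I, a) = (I', a')"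
      if x: "x \<in> V I a" "x \<in> V I' a'" and I: "(I, a) \<in> Idx" "(I', a') \<in> Idx" and card: "card I = card I'"
      for x I a I' a'
    proof -
      have fin: "finite I" "finite I'" using I by (auto simp: Idx_def intro: finite_subset)
      have "I = I'"
      proof (rule ccontr)
        assume "I \<noteq> I'"
        then have "\<not> I \<subseteq> I'" "\<not> I' \<subseteq> I" using card fin by (metis card_subset_eq)+
        then obtain i j where "i \<in> I" "i \<notin> I'" "j \<in> I'" "j \<notin> I" by blast
        then have "\<bar>y x i - real_of_int (a i)\<bar> < \<bar>y x j - real_of_int (a' j)\<bar>"
          "\<bar>y x j - real_of_int (a' j)\<bar> < \<bar>y x i - real_of_int (a i)\<bar>"
          using dist[OF x(1), of i j "a' j"] dist[OF x(2), of j i "a i"] I by (auto simp: Idx_def)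
        then show False by linarith
      qed
      moreover have "a i = a' i" if i: "i < n" for i
      proof (cases "i \<in> I")
        case True
        then have "\<bar>y x i - real_of_int (a i)\<bar> < 1 / 2" "\<bar>y x i - real_of_int (a' i)\<bar> < 1 / 2"
          using x \<open>I = I'\<close> unfolding V_def mem_Collect_eq by blast+
        then show ?thesis by linarith
      next
        case False
        then have "i \<in> {..<n} - I" using i by simp
        then have "real_of_int (a i) < y x i" "y x i < real_of_int (a i) + 1"
          "real_of_int (a' i) < y x i" "y x i < real_of_int (a' i) + 1"
          using x \<open>I = I'\<close> unfolding V_def mem_Collect_eq by blast+
        then show ?thesis by linarith
      qed
      then have "a = a'" using I by (intro PiE_ext[of a "{..<n}" "\<lambda>_. {-B..B}"]) (auto simp: Idx_def)
      ultimately show ?thesis by simp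
    qed
    have mem: "\<exists>(I, a)\<in>Idx. x \<in> V I a" for x
    proof -
      define I where "I = {i. i < n \<and> y x i \<in> \<int>}"
      define a where "a = (\<lambda>i\<in>{..<n}. \<lfloor>y x i\<rfloor>)"
      have "(I, a) \<in> Idx" using few[of x] B by (auto simp: Idx_def I_def a_def)
      moreover have "x \<in> V I a"
      proof -
        have 1: "y x i = real_of_int (a i)" if "i \<in> I" for i
          using that by (auto simp: I_def a_def elim!: Ints_cases)
        have 2: "real_of_int (a j) < y x j \<and> y x j < real_of_int (a j) + 1" if "j \<in> {..<n} - I" for j
        proof -
          have "y x j \<noteq> real_of_int \<lfloor>y x j\<rfloor>" using that
              by (metis (mono_tags, lifting) DiffE I_def Ints_of_int lessThan_iff mem_Collect_eq)
          then have "real_of_int \<lfloor>y x j\<rfloor> < y x j" using of_int_floor_le[of "y x j"] by linarith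
          then show ?thesis using that floor_correct[of "y x j"] by (simp add: a_def)
        qed
        have "\<bar>y x i - real_of_int (a i)\<bar> = 0" if "i \<in> I" for i using 1[OF that] by simp
        then show ?thesis unfolding V_def mem_Collect_eq using 2 by (intro conjI ballI; simp)
      qed
      ultimately show ?thesis by blast
    qed
    show ?thesis
    proof (intro exI[of _ \<V>] conjI ballI allI)
      show "finite \<V>" using finIdx by (simp add: \<V>_def)
      show "open V'" if "V' \<in> \<V>" for V' using that openV by (auto simp: \<V>_def Idx_def)
      show "\<Union>\<V> = UNIV"
      proof (intro equalityI subsetI UNIV_I)
        fix x
        obtain I a where "(I, a) \<in> Idx" "x \<in> V I a" using mem[of x] by blast
        then show "x \<in> \<Union>\<V>" unfolding \<V>_def by blast
      qed
      show "\<exists>U\<in>\<U>. V' \<subseteq> U" if "V' \<in> \<V>" for V'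
      proof -
        obtain I a where V': "V' = V I a" using \<open>V' \<in> \<V>\<close> by (auto simp: \<V>_def)
        show ?thesis
        proof (cases "V' = {}")
          case True
          then show ?thesis using e(2) by blast
        next
          case False
          then obtain x where x: "x \<in> V I a" using V' by blast
          obtain U where U: "U \<in> \<U>" "\<forall>x'. (\<forall>i<n. \<bar>q x i - q x' i\<bar> < e) \<longrightarrow> x' \<in> U" using e(2) by blast
          have "x' \<in> U" if x': "x' \<in> V I a" for x'
          proof -
            have "\<bar>q x i - q x' i\<bar> < e" if "i < n" for i
            proof -
              have "q x i / e - q x' i / e = y x i - y x' i" by (simp add: y_def)
              then have "\<bar>(q x i - q x' i) / e\<bar> < 1" using near[OF x x' that] by (simp add: diff_divide_distrib)
              then show ?thesis using e(1) by (simp add: abs_divide)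
            qed
            then show ?thesis using U(2) by blast
          qed
          then show ?thesis using U(1) V' by blast
        qed
      qed
      show "card {V' \<in> \<V>. x \<in> V'} \<le> D" for x
      proof -
        define S where "S = {(I, a) \<in> Idx. x \<in> V I a}"
        have finS: "finite S" using finIdx by (rule finite_subset[rotated]) (auto simp: S_def)
        have "{V' \<in> \<V>. x \<in> V'} = (\<lambda>(I, a). V I a) ` S" by (auto simp: \<V>_def S_def)
        then have "card {V' \<in> \<V>. x \<in> V'} \<le> card S" using card_image_le[OF finS] by simp
        \<comment> \<open>A point lies in at most one set for each size of \<open>I\<close>, and the
          sizes are below \<open>D\<close>.\<close>
        also have "\<dots> \<le> card {..<D}"
        proof (rule card_inj_on_le[of "\<lambda>(I, a). card I"])
          show "inj_on (\<lambda>(I, a). card I) S"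
          proof (rule inj_onI)
            fix s s' assume s: "s \<in> S" "s' \<in> S" "(case s of (I, a) \<Rightarrow> card I) = (case s' of (I, a) \<Rightarrow> card I)"
            then show "s = s'" using unique[of x "fst s" "snd s" "fst s'" "snd s'"]
              by (auto simp: S_def)
          qed
          show "(\<lambda>(I, a). card I) ` S \<subseteq> {..<D}" by (auto simp: S_def Idx_def)
        qed simp
        finally show ?thesis by simp
      qed
    qed
  qed
  show ?thesis
    unfolding covering_dim_le_def
  proof (intro conjI allI impI)
    show "- 1 \<le> int D - 1" by simp
    fix \<U> :: "'x set set"
    assume "finite \<U> \<and> (\<forall>U\<in>\<U>. openin euclidean U) \<and> \<Union>\<U> = topspace euclidean"
    then have "\<And>U. U \<in> \<U> \<Longrightarrow> open U" "\<Union>\<U> = UNIV" by auto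
    from cover[OF this] show "\<exists>\<V>. finite \<V> \<and> (\<forall>V\<in>\<V>. openin euclidean V) \<and> \<Union>\<V> = topspace euclidean \<and>
        (\<forall>V\<in>\<V>. \<exists>U\<in>\<U>. V \<subseteq> U) \<and> (\<forall>x\<in>topspace euclidean. int (card {V \<in> \<V>. x \<in> V}) \<le> int D - 1 + 1)"
      by simp
  qed
qed

text \<open>Lebesgue's covering theorem for a cube in \<open>X\<close> with opposite faces in \<open>A i\<close> and \<open>B i\<close>, by
  Kuhn's combinatorial lemma.\<close>

lemma not_covering_dim_le_of_cube:
  fixes A B :: "nat \<Rightarrow> 'x set" and pt :: "(nat \<Rightarrow> real) \<Rightarrow> 'x"
  assumes AB: "\<And>i. i < d \<Longrightarrow> closed (A i)" "\<And>i. i < d \<Longrightarrow> closed (B i)" "\<And>i. i < d \<Longrightarrow> A i \<inter> B i = {}"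
    and ptA: "\<And>t i. (\<And>j. j < d \<Longrightarrow> 0 \<le> t j \<and> t j \<le> 1) \<Longrightarrow> i < d \<Longrightarrow> t i = 0 \<Longrightarrow> pt t \<in> A i"
    and ptB: "\<And>t i. (\<And>j. j < d \<Longrightarrow> 0 \<le> t j \<and> t j \<le> 1) \<Longrightarrow> i < d \<Longrightarrow> t i = 1 \<Longrightarrow> pt t \<in> B i"
    and C: "0 \<le> C" and lip: "\<And>t t' r i. (\<And>j. j < d \<Longrightarrow> 0 \<le> t j \<and> t j \<le> 1) \<Longrightarrow> (\<And>j. j < d \<Longrightarrow> 0 \<le> t' j \<and> t' j \<le> 1) \<Longrightarrow>
      0 \<le> r \<Longrightarrow> (\<And>j. j < d \<Longrightarrow> \<bar>t j - t' j\<bar> \<le> r) \<Longrightarrow> i < n \<Longrightarrow> \<bar>q (pt t) i - q (pt t') i\<bar> \<le> C * r"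
    and k: "k < int d"
  shows "\<not> covering_dim_le (euclidean :: 'x topology) k"
proof
  assume dim: "covering_dim_le (euclidean :: 'x topology) k"
  \<comment> \<open>\<open>F l\<close> is where the label \<open>l\<close> is forbidden, in the
    sense of the boundary conditions of Kuhn's lemma. At every point the least \<open>l\<close> with
    \<open>l = d\<close> or the point outside \<open>A l\<close> is permitted, so the complements
    form a cover.\<close>
  define F where "F l = (if l < d then A l else {}) \<union> (\<Union>j<min l d. B j)" for l
  have closedF: "closed (F l)" for l
    unfolding F_def using AB by (intro closed_Un closed_UN) (auto split: if_splits)
  define \<U> where "\<U> = (\<lambda>l. - F l) ` {..d}"
  have "\<Union>\<U> = UNIV"
  proof (intro equalityI subsetI UNIV_I)
    fix x
    define l where "l = (LEAST l. l = d \<or> x \<notin> A l)"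
    have l: "l = d \<or> x \<notin> A l" unfolding l_def by (rule LeastI[of _ d]) simp
    have ld: "l \<le> d" unfolding l_def by (rule Least_le) simp
    have below: "x \<in> A j" if "j < l" for j using not_less_Least[of j "\<lambda>l. l = d \<or> x \<notin> A l"] that by (auto simp: l_def)
    have "x \<notin> B j" if "j < l" for j using below[OF that] AB(3)[of j] that ld by auto
    then have "x \<notin> F l" using l by (auto simp: F_def)
    then show "x \<in> \<Union>\<U>" using ld by (auto simp: \<U>_def)
  qed
  moreover have "finite \<U>" "\<forall>U\<in>\<U>. openin euclidean U" using closedF by (auto simp: \<U>_def)
  ultimately have "finite \<U> \<and> (\<forall>U\<in>\<U>. openin euclidean U) \<and> \<Union>\<U> = topspace euclidean" by simp
  from dim[unfolded covering_dim_le_def, THEN conjunct2, rule_format, OF this]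
  obtain \<V> where "finite \<V>" "\<forall>V\<in>\<V>. openin euclidean V" "\<Union>\<V> = topspace euclidean"
    "\<forall>V\<in>\<V>. \<exists>U\<in>\<U>. V \<subseteq> U" "\<forall>x\<in>topspace euclidean. int (card {V \<in> \<V>. x \<in> V}) \<le> k + 1"
    by (elim exE conjE)
  then have \<V>: "finite \<V>" "\<And>V. V \<in> \<V> \<Longrightarrow> open V" "\<Union>\<V> = UNIV"
    "\<And>V. V \<in> \<V> \<Longrightarrow> \<exists>U\<in>\<U>. V \<subseteq> U" "\<And>x. int (card {V\<in>\<V>. x \<in> V}) \<le> k + 1"
    by simp_all
  have "\<forall>V\<in>\<V>. \<exists>l. l \<le> d \<and> V \<subseteq> - F l"
  proof
    fix V assume "V \<in> \<V>"
    then obtain U where "U \<in> \<U>" "V \<subseteq> U" using \<V>(4) by blast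
    then show "\<exists>l. l \<le> d \<and> V \<subseteq> - F l" unfolding \<U>_def by blast
  qed
  from bchoice[OF this] obtain c where c: "\<And>V. V \<in> \<V> \<Longrightarrow> c V \<le> d" "\<And>V. V \<in> \<V> \<Longrightarrow> V \<subseteq> - F (c V)"
    by blast
  \<comment> \<open>Members of the refinement are merged by label. A point in all the
    \<open>G l\<close> lies in \<open>d + 1\<close> distinct members of \<open>\<V>\<close>.\<close>
  define G where "G l = \<Union>{V \<in> \<V>. c V = l}" for l
  have GF: "G l \<subseteq> - F l" for l using c(2) by (auto simp: G_def)
  have openG: "open (G l)" for l using \<V>(2) by (auto simp: G_def)
  have covG: "\<Union>(G ` {..d}) = UNIV"
  proof (intro equalityI subsetI UNIV_I)
    fix x
    have "x \<in> \<Union>\<V>" unfolding \<V>(3) ..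
    then obtain V where "V \<in> \<V>" "x \<in> V" by (rule UnionE)
    then show "x \<in> \<Union>(G ` {..d})" using c(1) by (auto simp: G_def)
  qed
  obtain e where e: "e > 0" "\<And>x. \<exists>U\<in>G ` {..d}. \<forall>y. (\<forall>i<n. \<bar>q x i - q y i\<bar> < e) \<longrightarrow> y \<in> U"
    using lebesgue_number[of "G ` {..d}"] openG covG by blast
  have "\<forall>x. \<exists>l\<le>d. \<forall>y. (\<forall>i<n. \<bar>q x i - q y i\<bar> < e) \<longrightarrow> y \<in> G l" using e(2) by blast
  then obtain lb where lb: "\<And>x. lb x \<le> d" "\<And>x y. (\<And>i. i < n \<Longrightarrow> \<bar>q x i - q y i\<bar> < e) \<Longrightarrow> y \<in> G (lb x)" by metis
  have lbF: "x \<notin> F (lb x)" for x using lb(2)[of x x] GF e(1) by auto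
  obtain p0 :: nat where p0: "C / e < real p0" using reals_Archimedean2 by blast
  \<comment> \<open>The grid is so fine that, by the Lipschitz bound, the vertices of one simplex
    are mapped within the Lebesgue number of each other.\<close>
  define p where "p = max 1 p0"
  have p: "p \<ge> 1" "C / real p < e"
  proof -
    have "C / e < real p" using p0 by (auto simp: p_def)
    then show "C / real p < e" using e(1) by (simp add: field_simps p_def)
  qed (simp add: p_def)
  define tt where "tt x j = real (x j) / real p" for x :: "nat \<Rightarrow> nat" and j :: nat
  have tt01: "0 \<le> tt x j \<and> tt x j \<le> 1" if "\<And>j. x j \<le> p" for x j
    using that[of j] p(1) by (simp add: tt_def divide_le_eq)
  \<comment> \<open>Zeros before position \<open>lb\<close> and a 1 there make the reduced label
    equal to \<open>lb\<close>. The later entries are free and chosen to satisfy the boundary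
    conditions.\<close>
  define lab where "lab x j = (if j < lb (pt (tt x)) then 0 else if j = lb (pt (tt x)) then 1
      else if x j = 0 then 0 else (1::nat))" for x j
  have lab0: "lab x j = 0" if x: "\<And>j. x j \<le> p" and j: "j < d" "x j = 0" for x j
  proof -
    have "pt (tt x) \<in> A j" using tt01[OF x] j by (intro ptA) (auto simp: tt_def)
    then have "lb (pt (tt x)) \<noteq> j" using lbF[of "pt (tt x)"] j by (auto simp: F_def)
    then show ?thesis using j by (auto simp: lab_def)
  qed
  have lab1: "lab x j = 1" if x: "\<And>j. x j \<le> p" and j: "j < d" "x j = p" for x j
  proof -
    have "pt (tt x) \<in> B j" using tt01[OF x] j p(1) by (intro ptB) (auto simp: tt_def)
    then have "\<not> j < lb (pt (tt x))" using lbF[of "pt (tt x)"] j by (auto simp: F_def)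
    then show ?thesis using j p(1) by (auto simp: lab_def)
  qed
  have red: "reduced d (lab x) = lb (pt (tt x))" for x
    by (rule reduced_labelling_unique) (use lb(1) in \<open>auto simp: lab_def\<close>)
  have "odd (card {s. ksimplex p d s \<and> (reduced d \<circ> lab) ` s = {..d}})"
  proof (rule kuhn_combinatorial)
    show "0 < p" using p(1) by simp
    show "\<forall>x j. (\<forall>j. x j \<le> p) \<and> j < d \<and> x j = 0 \<longrightarrow> lab x j = 0"
      by (intro allI impI, elim conjE, rule lab0) simp_all
    show "\<forall>x j. (\<forall>j. x j \<le> p) \<and> j < d \<and> x j = p \<longrightarrow> lab x j = 1"
      by (intro allI impI, elim conjE, rule lab1) simp_all
  qed
  then have "card {s. ksimplex p d s \<and> (reduced d \<circ> lab) ` s = {..d}} \<noteq> 0" by (rule odd_pos[THEN gr_implies_not0])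
  then have "{s. ksimplex p d s \<and> (reduced d \<circ> lab) ` s = {..d}} \<noteq> {}" unfolding card_eq_0_iff by blast
  then obtain s where s: "ksimplex p d s" "(reduced d \<circ> lab) ` s = {..d}" by blast
  obtain base upd where "kuhn_simplex p d base upd s" using s(1) by (auto elim: ksimplex.cases)
  then interpret ks: kuhn_simplex p d base upd s .
  have le_p: "x j \<le> p" if "x \<in> s" for x j using ks.s_le_p[OF that] by simp
  define z where "z = pt (tt base)"
  \<comment> \<open>All labels occur on the simplex, and its base vertex is close to every vertex,
    so it inherits all of them.\<close>
  have "z \<in> G l" if "l \<le> d" for l
  proof -
    obtain x where x: "x \<in> s" "lb (pt (tt x)) = l"
    proof -
      have "l \<in> (reduced d \<circ> lab) ` s" unfolding s(2) using \<open>l \<le> d\<close> by simp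
      then obtain x where x: "l = (reduced d \<circ> lab) x" "x \<in> s" by (rule imageE)
      have "lb (pt (tt x)) = l" unfolding x(1) comp_apply red ..
      then show thesis by (rule that[OF x(2)])
    qed
    obtain i where xi: "x = ks.enum i" using x(1) by (auto simp: ks.s_eq)
    have step: "\<bar>tt x j - tt base j\<bar> \<le> 1 / real p" for j
    proof -
      have "\<bar>real (x j) - real (base j)\<bar> \<le> 1" by (simp add: xi ks.enum_def)
      then have "\<bar>real (x j) - real (base j)\<bar> / real p \<le> 1 / real p" by (intro divide_right_mono) auto
      then show ?thesis by (simp add: tt_def diff_divide_distrib[symmetric] abs_divide)
    qed
    have "\<bar>q (pt (tt x)) i - q z i\<bar> < e" if "i < n" for i
    proof -
      have "\<bar>q (pt (tt x)) i - q z i\<bar> \<le> C * (1 / real p)"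
        unfolding z_def using tt01 le_p x(1) ks.base_in_s step that by (intro lip) auto
      then show ?thesis using p(2) by simp
    qed
    then show ?thesis using lb(2)[of "pt (tt x)" z] x(2) by simp
  qed
  then have "\<forall>l\<le>d. \<exists>V. V \<in> \<V> \<and> c V = l \<and> z \<in> V" by (auto simp: G_def)
  then obtain W where W: "\<And>l. l \<le> d \<Longrightarrow> W l \<in> \<V> \<and> c (W l) = l \<and> z \<in> W l" by metis
  have "card {..d} \<le> card {V\<in>\<V>. z \<in> V}"
  proof (rule card_inj_on_le[of W])
    show "inj_on W {..d}" using W by (metis atMost_iff inj_onI)
    show "W ` {..d} \<subseteq> {V \<in> \<V>. z \<in> V}" using W by auto
  qed (use \<V>(1) in auto)
  then show False using \<V>(5)[of z] k by simp
qed

end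

subsection \<open>Points as rays and discrete states as primitive vectors\<close>

primrec tmult :: "nat \<Rightarrow> hterm \<Rightarrow> hterm" where
  "tmult 0 t = TZero"
| "tmult (Suc k) t = TPlus t (tmult k t)"

lemma tvars_tmult: "tvars (tmult k t) \<subseteq> tvars t"
  by (induction k) auto

lemma teval_tmult: "teval (tmult k t) w = real k * teval t w"
  by (induction k) (simp_all add: algebra_simps)

lemma neval_tmult: "neval (tmult k t) v = k * neval t v"
  by (induction k) simp_all

text \<open>Bezout's identity with natural coefficients: the truncated difference in a term does not
  cut anything off, because the difference is a gcd.\<close>

lemma neval_attains_Gcd: "\<exists>t. tvars t \<subseteq> {..<n} \<and> neval t v = Gcd (v ` {..<n})"
proof (induction n)
  case 0
  show ?case by (intro exI[of _ TZero]) simp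
next
  case (Suc n)
  then obtain t where t: "tvars t \<subseteq> {..<n}" "neval t v = Gcd (v ` {..<n})" by blast
  have G: "Gcd (v ` {..<Suc n}) = gcd (v n) (Gcd (v ` {..<n}))"
    by (simp add: lessThan_Suc)
  show ?case
  proof (cases "v n = 0")
    case True
    then show ?thesis using t unfolding G by (intro exI[of _ t]) auto
  next
    case False
    then obtain x y where xy: "v n * x = Gcd (v ` {..<n}) * y + gcd (v n) (Gcd (v ` {..<n}))"
      using bezout_nat by blast
    let ?t = "TMonus (tmult x (TVar n)) (tmult y t)"
    have "neval ?t v = gcd (v n) (Gcd (v ` {..<n}))"
      using xy by (simp add: neval_tmult t(2) mult.commute)
    moreover have "tvars ?t \<subseteq> {..<Suc n}"
      using tvars_tmult[of x "TVar n"] tvars_tmult[of y t] t(1) by auto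
    ultimately show ?thesis unfolding G by blast
  qed
qed

lemma dvd_neval: "tvars t \<subseteq> {..<n} \<Longrightarrow> Gcd (v ` {..<n}) dvd neval t v"
  by (induction t) (auto intro: Gcd_dvd dvd_diff_nat)

lemma has_denominator_unique:
  assumes "has_denominator A m b" "has_denominator A m b'"
  shows "b = b'"
proof -
  have le: "b \<le> b'" if "b \<ge> 1" "b' \<ge> 1" "range (\<lambda>j::nat. real j / real b) = range (\<lambda>j::nat. real j / real b')"
      for b b' :: nat
  proof -
    have "real 1 / real b \<in> range (\<lambda>j::nat. real j / real b')" unfolding that(3)[symmetric] by (rule rangeI)
    then obtain j :: nat where "real 1 / real b = real j / real b'" by blast
    then have "real b' = real (j * b)" using that by (simp add: field_simps)
    then have "b' = j * b" by (simp only: of_nat_eq_iff)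
    moreover from this have "j \<ge> 1" using that(2) by (cases j) auto
    ultimately show ?thesis by simp
  qed
  show ?thesis
    using assms le[of b b'] le[of b' b] unfolding has_denominator_def by (intro antisym) simp_all
qed

text \<open>The form in which the hypotheses are used. The vector \<open>p x\<close> determines a
  ray for each point \<open>x\<close>; by \<open>p_complete\<close>, an equation of terms valid at
  all points of the space holds on the whole cone.\<close>

locale term_presentation =
  fixes n :: nat and E :: "(hterm \<times> hterm) set" and p :: "'x::t2_space \<Rightarrow> nat \<Rightarrow> real"
  assumes compact_space: "compact (UNIV :: 'x set)"
    and E_fin: "finite E"
    and E_vars: "\<And>s t. (s, t) \<in> E \<Longrightarrow> tvars s \<subseteq> {..<n} \<and> tvars t \<subseteq> {..<n}"
    and p_nonneg: "\<And>x i. 0 \<le> p x i"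
    and p_supp: "\<And>x i. i \<ge> n \<Longrightarrow> p x i = 0"
    and p_cont: "\<And>i. continuous_on UNIV (\<lambda>x. p x i)"
    and p_rel: "\<And>x s t. (s, t) \<in> E \<Longrightarrow> teval s (p x) = teval t (p x)"
    and p_complete: "\<And>w s t. (\<And>i. 0 \<le> w i) \<Longrightarrow> (\<And>s t. (s, t) \<in> E \<Longrightarrow> teval s w = teval t w) \<Longrightarrow>
      tvars s \<subseteq> {..<n} \<Longrightarrow> tvars t \<subseteq> {..<n} \<Longrightarrow> (\<And>x. teval s (p x) = teval t (p x)) \<Longrightarrow>
      teval s w = teval t w"
    and p_nonzero: "\<And>x. \<exists>i. p x i \<noteq> 0"
    and p_sep: "\<And>x y. x \<noteq> y \<Longrightarrow> \<exists>t. tvars t \<subseteq> {..<n} \<and> teval t (p x) = 0 \<and> teval t (p y) \<noteq> 0"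
begin

abbreviation W :: "(nat \<Rightarrow> real) set" where "W \<equiv> zero_cone n E"

lemma W_D: "w \<in> W \<Longrightarrow> 0 \<le> w i" "w \<in> W \<Longrightarrow> i \<ge> n \<Longrightarrow> w i = 0"
  "w \<in> W \<Longrightarrow> (s, t) \<in> E \<Longrightarrow> teval s w = teval t w"
  by (auto simp: zero_cone_def)

lemma W_I: "(\<And>i. 0 \<le> w i) \<Longrightarrow> (\<And>i. i \<ge> n \<Longrightarrow> w i = 0) \<Longrightarrow>
    (\<And>s t. (s, t) \<in> E \<Longrightarrow> teval s w = teval t w) \<Longrightarrow> w \<in> W"
  unfolding zero_cone_def by auto

lemma p_in_W: "p x \<in> W"
  using p_nonneg p_supp p_rel by (intro W_I)

lemma W_scale: "w \<in> W \<Longrightarrow> 0 \<le> c \<Longrightarrow> (\<lambda>i. c * w i) \<in> W"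
  using W_D by (intro W_I) (simp_all add: teval_scale)

lemma W_teval_eq:
  assumes "w \<in> W" "tvars s \<subseteq> {..<n}" "tvars t \<subseteq> {..<n}" "\<And>x. teval s (p x) = teval t (p x)"
  shows "teval s w = teval t w"
  by (rule p_complete[OF W_D(1)[OF assms(1)] W_D(3)[OF assms(1)] assms(2-4)])

lemma W_teval_le:
  assumes w: "w \<in> W" and "tvars s \<subseteq> {..<n}" "tvars t \<subseteq> {..<n}" and le: "\<And>x. teval s (p x) \<le> teval t (p x)"
  shows "teval s w \<le> teval t w"
proof -
  have "teval (TMonus s t) w = teval TZero w"
    using assms(2,3) le by (intro W_teval_eq[OF w]) simp_all
  then show ?thesis by simp
qed

lemma teval_cont: "continuous_on UNIV (\<lambda>x. teval t (p x))"
  by (induction t) (simp_all add: p_cont continuous_on_add continuous_on_max continuous_on_diff)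

text \<open>On a compact space a positive term bounds every coordinate up to an integer factor. This
  inequality is an equation of terms, so it holds at \<open>w\<close> too, where it forces the
  coordinates to vanish.\<close>

lemma W_zero_of_null_term:
  assumes w: "w \<in> W" and t: "tvars t \<subseteq> {..<n}" "teval t w = 0" and pos: "\<And>x. 0 < teval t (p x)"
  shows "w i = 0"
proof (cases "i < n")
  case True
  have "continuous_on UNIV (\<lambda>x. p x i / teval t (p x))"
    using pos by (intro continuous_on_divide p_cont teval_cont ballI) (simp add: less_imp_neq[symmetric]
        pos[THEN less_imp_neq, symmetric])
  from continuous_attains_sup[OF compact_space _ this]
  obtain x0 where x0: "\<And>x. p x i / teval t (p x) \<le> p x0 i / teval t (p x0)" by auto
  obtain k :: nat where k: "p x0 i / teval t (p x0) \<le> real k" using real_arch_simple by blast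
  have "p x i \<le> real k * teval t (p x)" for x
    using order_trans[OF x0[of x] k] pos[of x] by (simp add: divide_le_eq)
  then have "teval (TVar i) w \<le> teval (tmult k t) w"
    using True t(1) tvars_tmult[of k t] by (intro W_teval_le[OF w]) (auto simp: teval_tmult)
  then show ?thesis using W_D(1)[OF w, of i] t(2) by (simp add: teval_tmult)
next
  case False
  then show ?thesis using W_D(2)[OF w] by simp
qed

text \<open>A Hoelder--Yosida argument: every nonzero point of the cone is, up to scaling, evaluation at a
  point of the compact space.\<close>

lemma W_ray:
  assumes w: "w \<in> W" and nz: "w i0 \<noteq> 0"
  obtains x c where "c > 0" "w = (\<lambda>i. c * p x i)"
proof -
  \<comment> \<open>Otherwise compactness yields a finite sum of terms that is zero at
    \<open>w\<close> but positive on the whole space, which is possible only for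
    \<open>w = 0\<close>.\<close>
  have "\<exists>x. \<forall>t. tvars t \<subseteq> {..<n} \<longrightarrow> teval t w = 0 \<longrightarrow> teval t (p x) = 0"
  proof (rule ccontr)
    assume "\<not> ?thesis"
    then have "\<forall>x. \<exists>t. tvars t \<subseteq> {..<n} \<and> teval t w = 0 \<and> teval t (p x) \<noteq> 0" by blast
    from choice[OF this] obtain f where f: "\<And>x. tvars (f x) \<subseteq> {..<n}" "\<And>x. teval (f x) w = 0"
      "\<And>x. teval (f x) (p x) \<noteq> 0" by blast
    have nn: "0 \<le> teval t (p x)" for t x by (rule teval_nonneg[OF p_nonneg])
    have op: "open {z. 0 < teval (f x) (p z)}" for x
      by (intro open_Collect_less continuous_on_const teval_cont)
    have cov: "UNIV \<subseteq> (\<Union>x\<in>UNIV. {z. 0 < teval (f x) (p z)})"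
    proof
      fix x
      have "0 < teval (f x) (p x)" using nn[of "f x" x] f(3)[of x] by simp
      then show "x \<in> (\<Union>x\<in>UNIV. {z. 0 < teval (f x) (p z)})" by blast
    qed
    obtain F where "F \<subseteq> UNIV" and F: "finite F" "UNIV \<subseteq> (\<Union>x\<in>F. {z. 0 < teval (f x) (p z)})"
      using compactE_image[OF compact_space op cov] .
    have "\<exists>t. tvars t \<subseteq> {..<n} \<and> teval t w = 0 \<and> (\<forall>z. (\<exists>x\<in>F. 0 < teval (f x) (p z)) \<longrightarrow> 0 < teval t (p z))"
      using F(1)
    proof (induction F rule: finite_induct)
      case empty
      show ?case by (intro exI[of _ TZero]) simp
    next
      case (insert x F)
      then obtain t where t: "tvars t \<subseteq> {..<n}" "teval t w = 0"
        "\<And>z. \<exists>x\<in>F. 0 < teval (f x) (p z) \<Longrightarrow> 0 < teval t (p z)" by blast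
      have "0 < teval (TPlus (f x) t) (p z)" if "\<exists>y\<in>insert x F. 0 < teval (f y) (p z)" for z
      proof (cases "0 < teval (f x) (p z)")
        case True
        then show ?thesis using nn[of t z] by simp
      next
        case False
        then have "\<exists>y\<in>F. 0 < teval (f y) (p z)" using that by blast
        then show ?thesis using t(3)[of z] nn[of "f x" z] by simp
      qed
      then show ?case using t(1,2) f(1,2) by (intro exI[of _ "TPlus (f x) t"]) simp
    qed
    then obtain t where t: "tvars t \<subseteq> {..<n}" "teval t w = 0"
      "\<And>z. \<exists>x\<in>F. 0 < teval (f x) (p z) \<Longrightarrow> 0 < teval t (p z)" by blast
    have "0 < teval t (p z)" for z
    proof (rule t(3))
      have "z \<in> (\<Union>x\<in>F. {z. 0 < teval (f x) (p z)})" using F(2) by (rule subsetD) simp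
      then show "\<exists>x\<in>F. 0 < teval (f x) (p z)" by (elim UN_E) auto
    qed
    then have "w i0 = 0" by (rule W_zero_of_null_term[OF w t(1,2)])
    then show False using nz by simp
  qed
  then obtain x where x: "\<And>t. tvars t \<subseteq> {..<n} \<Longrightarrow> teval t w = 0 \<Longrightarrow> teval t (p x) = 0" by blast
  \<comment> \<open>If the ratios of two coordinates differed, a rational number between them would
    give a term that is zero at \<open>w\<close> but not at \<open>p x\<close>.\<close>
  have le: "w i * p x j \<le> w j * p x i" if ij: "i < n" "j < n" for i j
  proof (rule ccontr)
    assume "\<not> ?thesis"
    then have gt: "w j * p x i < w i * p x j" by simp
    have nn: "0 \<le> w i" "0 \<le> w j" "0 \<le> p x i" "0 \<le> p x j" using W_D(1)[OF w] p_nonneg by auto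
    have wi: "0 < w i"
    proof (rule ccontr)
      assume "\<not> 0 < w i"
      then have "w i = 0" using nn by simp
      then show False using gt mult_nonneg_nonneg[OF nn(2,3)] by simp
    qed
    have pj: "0 < p x j"
    proof (rule ccontr)
      assume "\<not> 0 < p x j"
      then have "p x j = 0" using nn by simp
      then show False using gt mult_nonneg_nonneg[OF nn(2,3)] by simp
    qed
    \<comment> \<open>The upper end of the interval for that rational number. If
      \<open>p x i\<close> is 0, the ratio is infinite and any larger number will do.\<close>
    define U where "U = (if p x i = 0 then w j / w i + 1 else p x j / p x i)"
    have "w j / w i < U"
      using gt wi nn(3) by (auto simp: U_def field_simps)
    then obtain r where r: "r \<in> \<rat>" "w j / w i < r" "r < U" using Rats_dense_in_real by blast
    have r0: "0 < r" using r(2) divide_nonneg_nonneg[OF nn(2,1)] by linarith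
    from r(1) obtain a b :: nat where ab: "b \<noteq> 0" "\<bar>r\<bar> = real a / real b" by (rule Rats_abs_nat_div_natE) blast
    then have rab: "r = real a / real b" using r0 by simp
    have b0: "0 < real b" using ab(1) by simp
    have "real b * w j \<le> real a * w i"
    proof -
      have "w j < r * w i" using r(2) wi by (simp add: divide_less_eq)
      then show ?thesis using b0 by (simp add: rab field_simps)
    qed
    then have "teval (TMonus (tmult b (TVar j)) (tmult a (TVar i))) w = 0" by (simp add: teval_tmult)
    moreover have "tvars (TMonus (tmult b (TVar j)) (tmult a (TVar i))) \<subseteq> {..<n}"
      using tvars_tmult[of b "TVar j"] tvars_tmult[of a "TVar i"] ij by auto
    ultimately have "teval (TMonus (tmult b (TVar j)) (tmult a (TVar i))) (p x) = 0" using x by blast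
    then have "real b * p x j \<le> real a * p x i" by (simp add: teval_tmult)
    then have le: "p x j \<le> r * p x i" using b0 by (simp add: rab field_simps)
    show False
    proof (cases "p x i = 0")
      case True
      then show False using le pj by simp
    next
      case False
      then have "r * p x i < p x j" using r(3) nn(3) by (simp add: U_def less_divide_eq)
      then show False using le by simp
    qed
  qed
  have eq: "w i * p x j = w j * p x i" if "i < n" "j < n" for i j
    using le[OF that] le[OF that(2,1)] by simp
  obtain j where j: "p x j \<noteq> 0" using p_nonzero by blast
  have jn: "j < n" using p_supp[of j x] j by (cases "j < n") auto
  define c where "c = w j / p x j"
  have wc: "w i = c * p x i" for i
  proof (cases "i < n")
    case True
    then show ?thesis using eq[OF True jn] j by (simp add: c_def field_simps)
  next
    case False
    then show ?thesis using W_D(2)[OF w, of i] p_supp[of i x] by simp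
  qed
  have "c \<noteq> 0" using wc[of i0] nz by auto
  moreover have "0 \<le> c" unfolding c_def by (intro divide_nonneg_nonneg W_D(1)[OF w] p_nonneg)
  ultimately show thesis using wc by (intro that[of c x]) auto
qed

text \<open>Separation provides a function that vanishes at one point and not at the other; zeros
  are unaffected by scaling, so it distinguishes rays and not just vectors.\<close>

lemma p_ray_inj:
  assumes "0 < c" "\<And>i. p y i = c * p x i"
  shows "x = y"
proof (rule ccontr)
  assume "x \<noteq> y"
  then obtain t where t: "teval t (p x) = 0" "teval t (p y) \<noteq> 0" using p_sep by blast
  have "p y = (\<lambda>i. c * p x i)" using assms(2) by auto
  then have "teval t (p y) = c * teval t (p x)" using teval_scale[of c t "p x"] assms(1) by simp
  then show False using t by simp
qed

definition funs :: "('x \<Rightarrow> real) set" where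
  "funs = {\<lambda>x. teval t (p x) |t. tvars t \<subseteq> {..<n}}"

lemma funsI: "tvars t \<subseteq> {..<n} \<Longrightarrow> (\<lambda>x. teval t (p x)) \<in> funs"
  by (auto simp: funs_def)

lemma funsE:
  assumes "h \<in> funs"
  obtains t where "tvars t \<subseteq> {..<n}" "h = (\<lambda>x. teval t (p x))"
  using assms by (auto simp: funs_def)

abbreviation A :: "('x \<Rightarrow> real) hoop" where "A \<equiv> restrict_hoop cont_hoop funs"

lemma A_simps: "hcarrier A = funs" "f \<oplus>\<^bsub>A\<^esub> g = (\<lambda>x. f x + g x)"
  "f \<ominus>\<^bsub>A\<^esub> g = (\<lambda>x. max 0 (f x - g x))" "\<zero>\<^bsub>A\<^esub> = (\<lambda>x. 0)"
  by (simp_all add: restrict_hoop_def cont_hoop_def)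

lemma nonneg_hoop_simps: "hcarrier nonneg_real_hoop = {0..}" "a \<oplus>\<^bsub>nonneg_real_hoop\<^esub> b = a + b"
  "a \<ominus>\<^bsub>nonneg_real_hoop\<^esub> b = max 0 (a - b)" "\<zero>\<^bsub>nonneg_real_hoop\<^esub> = 0"
  by (simp_all add: nonneg_real_hoop_def)

text \<open>The homogeneous extension of a function in \<open>funs\<close> to the cone. By
  completeness of the presentation, the representing term does not matter on
  \<open>W\<close>.\<close>

definition ev :: "('x \<Rightarrow> real) \<Rightarrow> (nat \<Rightarrow> real) \<Rightarrow> real" where
  "ev h w = teval (SOME t. tvars t \<subseteq> {..<n} \<and> h = (\<lambda>x. teval t (p x))) w"

lemma ev_term:
  assumes "w \<in> W" "tvars t \<subseteq> {..<n}"
  shows "ev (\<lambda>x. teval t (p x)) w = teval t w"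
proof -
  let ?P = "\<lambda>s. tvars s \<subseteq> {..<n} \<and> (\<lambda>x. teval t (p x)) = (\<lambda>x. teval s (p x))"
  have "?P t" using assms(2) by simp
  then have P: "?P (SOME s. ?P s)" by (rule someI)
  have "teval (SOME s. ?P s) w = teval t w"
    by (rule W_teval_eq[OF assms(1) conjunct1[OF P] assms(2) fun_cong[OF conjunct2[OF P], symmetric]])
  then show ?thesis unfolding ev_def .
qed

lemma ev_ops:
  assumes w: "w \<in> W" and f: "f \<in> funs" and g: "g \<in> funs"
  shows "ev (\<lambda>x. f x + g x) w = ev f w + ev g w"
    and "ev (\<lambda>x. max 0 (f x - g x)) w = max 0 (ev f w - ev g w)"
    and "(\<lambda>x. f x + g x) \<in> funs" "(\<lambda>x. max 0 (f x - g x)) \<in> funs"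
proof -
  obtain s where s: "tvars s \<subseteq> {..<n}" "f = (\<lambda>x. teval s (p x))" using f by (rule funsE)
  obtain t where t: "tvars t \<subseteq> {..<n}" "g = (\<lambda>x. teval t (p x))" using g by (rule funsE)
  have e: "(\<lambda>x. f x + g x) = (\<lambda>x. teval (TPlus s t) (p x))" "(\<lambda>x. max 0 (f x - g x)) = (\<lambda>x. teval (TMonus s t) (p x))"
    unfolding s(2) t(2) by simp_all
  have v: "tvars (TPlus s t) \<subseteq> {..<n}" "tvars (TMonus s t) \<subseteq> {..<n}" using s t by auto
  have ef: "ev f w = teval s w" "ev g w = teval t w"
    unfolding s(2) t(2) by (rule ev_term[OF w s(1)], rule ev_term[OF w t(1)])
  show "ev (\<lambda>x. f x + g x) w = ev f w + ev g w" "ev (\<lambda>x. max 0 (f x - g x)) w = max 0 (ev f w - ev g w)"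
    unfolding e ef ev_term[OF w v(1)] ev_term[OF w v(2)] by (rule teval.simps)+
  show "(\<lambda>x. f x + g x) \<in> funs" "(\<lambda>x. max 0 (f x - g x)) \<in> funs"
    unfolding e by (rule funsI[OF v(1)], rule funsI[OF v(2)])
qed

lemma funs_zero: "(\<lambda>x. 0) \<in> funs"
  using funsI[of TZero] by simp

lemma ev_zero: "w \<in> W \<Longrightarrow> ev (\<lambda>x. 0) w = 0"
  using ev_term[of w TZero] by simp

section \<open>Units, primitive vectors and their states\<close>

definition is_unit :: "hterm \<Rightarrow> nat \<Rightarrow> bool" where
  "is_unit u k \<longleftrightarrow> tvars u \<subseteq> {..<n} \<and> (\<forall>w\<in>W. \<forall>i. w i \<le> real k * teval u w)"

text \<open>The unit property bounds the finitely many generators; the sum of the constants serves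
  for all of them, and the inequality carries over to the cone. This uniform bound is what makes the
  part of the cone where the unit is at most 1 bounded.\<close>

lemma hoop_unit_is_unit:
  assumes "hoop_unit A h"
  obtains u k where "h = (\<lambda>x. teval u (p x))" "is_unit u k"
proof -
  have h: "h \<in> funs" using assms by (simp add: hoop_unit_def A_simps)
  then obtain u where u: "tvars u \<subseteq> {..<n}" "h = (\<lambda>x. teval u (p x))" by (rule funsE)
  have mult: "hoop_mult A k h = (\<lambda>x. real k * h x)" for k
    by (induction k) (simp_all add: hoop_mult_def A_simps algebra_simps)
  have "\<forall>i. \<exists>k. i < n \<longrightarrow> (\<forall>x. p x i \<le> real k * h x)"
  proof
    fix i
    show "\<exists>k. i < n \<longrightarrow> (\<forall>x. p x i \<le> real k * h x)"
    proof (cases "i < n")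
      case True
      then have "(\<lambda>x. p x i) \<in> funs" using funsI[of "TVar i"] by simp
      then obtain k where "hoop_le A (\<lambda>x. p x i) (hoop_mult A k h)"
        using assms by (auto simp: hoop_unit_def A_simps)
      then have "(\<lambda>x. max 0 (p x i - real k * h x)) = (\<lambda>x. 0)" by (simp add: hoop_le_def mult A_simps)
      then have "max 0 (p x i - real k * h x) = 0" for x by (rule fun_cong)
      then have "p x i \<le> real k * h x" for x
        using max.cobounded2[of "p x i - real k * h x" 0] by (simp only: diff_le_0_iff_le)
      then show ?thesis by blast
    qed simp
  qed
  from choice[OF this] obtain k where k: "\<And>i x. i < n \<Longrightarrow> p x i \<le> real (k i) * h x" by blast
  define K where "K = (\<Sum>i<n. k i)"
  have h0: "0 \<le> h x" for x unfolding u(2) by (rule teval_nonneg[OF p_nonneg])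
  have pK: "p x i \<le> real K * h x" for x i
  proof (cases "i < n")
    case True
    have "k i \<le> K" unfolding K_def using True by (intro member_le_sum) auto
    then have "real (k i) * h x \<le> real K * h x" using h0 by (intro mult_right_mono) auto
    then show ?thesis using k[OF True, of x] by linarith
  next
    case False
    then show ?thesis using p_supp[of i x] h0[of x] by simp
  qed
  have "w i \<le> real K * teval u w" if w: "w \<in> W" for w i
  proof (cases "i < n")
    case True
    have "teval (TVar i) w \<le> teval (tmult K u) w"
      using True u(1) tvars_tmult[of K u] pK[unfolded u(2)] by (intro W_teval_le[OF w]) (auto simp: teval_tmult)
    then show ?thesis by (simp add: teval_tmult)
  next
    case False
    have "0 \<le> teval u w" by (rule teval_nonneg[OF W_D(1)[OF w]])
    then show ?thesis using W_D(2)[OF w, of i] False by simp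
  qed
  then have "is_unit u K" using u(1) by (simp add: is_unit_def)
  then show thesis using u(2) that by blast
qed

lemma unit_pos:
  assumes "is_unit u k" "w \<in> W" "w i \<noteq> 0"
  shows "0 < teval u w"
proof (rule ccontr)
  assume "\<not> 0 < teval u w"
  then have "teval u w \<le> 0" by simp
  then have "real k * teval u w \<le> 0" by (simp add: mult_nonneg_nonpos)
  then have "w i \<le> 0" using assms(1,2) unfolding is_unit_def by (metis order_trans)
  then show False using W_D(1)[OF assms(2), of i] assms(3) by simp
qed

definition Prim :: "(nat \<Rightarrow> nat) set" where
  "Prim = {v. (\<lambda>i. real (v i)) \<in> W \<and> Gcd (v ` {..<n}) = 1}"

lemma Prim_nonzero:
  assumes "v \<in> Prim"
  obtains i where "i < n" "v i \<noteq> 0"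
proof -
  have "\<exists>i<n. v i \<noteq> 0"
  proof (rule ccontr)
    assume "\<not> ?thesis"
    then have "v ` {..<n} \<subseteq> {0}" by auto
    then have "Gcd (v ` {..<n}) = 0" by (simp add: Gcd_0_iff)
    moreover have "Gcd (v ` {..<n}) = 1" using assms by (simp add: Prim_def)
    ultimately show False by (metis zero_neq_one)
  qed
  then show thesis using that by blast
qed

lemma Prim_unit_pos:
  assumes "is_unit u k" "v \<in> Prim"
  shows "neval u v \<ge> 1"
proof -
  obtain i where "v i \<noteq> 0" using Prim_nonzero[OF assms(2)] by blast
  then have "0 < teval u (\<lambda>i. real (v i))" using assms by (intro unit_pos[of u k _ i]) (auto simp: Prim_def)
  then show ?thesis by (simp add: teval_of_nat)
qed

definition st :: "hterm \<Rightarrow> (nat \<Rightarrow> nat) \<Rightarrow> ('x \<Rightarrow> real) \<Rightarrow> real" where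
  "st u v = (\<lambda>h\<in>funs. ev h (\<lambda>i. real (v i)) / real (neval u v))"

lemma st_term:
  assumes "v \<in> Prim" "tvars t \<subseteq> {..<n}"
  shows "st u v (\<lambda>x. teval t (p x)) = real (neval t v) / real (neval u v)"
  using assms funsI[OF assms(2)] ev_term[of "\<lambda>i. real (v i)" t]
  by (simp add: st_def Prim_def teval_of_nat)

text \<open>That every multiple of \<open>1 / neval u v\<close> occurs is due to primitivity: some
  term attains the gcd 1 at \<open>v\<close>.\<close>

lemma st_has_denominator:
  assumes u: "is_unit u k" and v: "v \<in> Prim"
  shows "has_denominator A (st u v) (neval u v)"
  unfolding has_denominator_def A_simps
proof
  show "1 \<le> neval u v" by (rule Prim_unit_pos[OF assms])
  show "st u v ` funs = range (\<lambda>j. real j / real (neval u v))"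
  proof (intro equalityI subsetI)
    fix y assume "y \<in> st u v ` funs"
    then obtain h where "h \<in> funs" "y = st u v h" by blast
    then show "y \<in> range (\<lambda>j. real j / real (neval u v))" using st_term[OF v] by (auto elim!: funsE)
  next
    fix y assume "y \<in> range (\<lambda>j. real j / real (neval u v))"
    then obtain j where y: "y = real j / real (neval u v)" by blast
    obtain t where t: "tvars t \<subseteq> {..<n}" "neval t v = Gcd (v ` {..<n})" using neval_attains_Gcd by blast
    have "neval (tmult j t) v = j" using t(2) v by (simp add: neval_tmult Prim_def)
    moreover have tv: "tvars (tmult j t) \<subseteq> {..<n}" using tvars_tmult[of j t] t(1) by blast
    ultimately have "y = st u v (\<lambda>x. teval (tmult j t) (p x))" using st_term[OF v tv] y by simp
    then show "y \<in> st u v ` funs" using funsI[OF tv] by blast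
  qed
qed

lemma st_denominator:
  assumes "is_unit u k" "v \<in> Prim"
  shows "denominator A (st u v) = neval u v"
  unfolding denominator_def
proof (rule the_equality)
  show "has_denominator A (st u v) (neval u v)" by (rule st_has_denominator[OF assms])
  then show "b = neval u v" if "has_denominator A (st u v) b" for b
    using has_denominator_unique[OF that] by blast
qed

lemma st_extremal:
  assumes u: "is_unit u k" and v: "v \<in> Prim"
  shows "extremal_state A (\<lambda>x. teval u (p x)) (st u v)"
proof -
  have w: "(\<lambda>i. real (v i)) \<in> W" using v by (simp add: Prim_def)
  have b: "0 < real (neval u v)" using Prim_unit_pos[OF assms] by simp
  have ut: "tvars u \<subseteq> {..<n}" using u by (simp add: is_unit_def)
  have val: "st u v h = ev h (\<lambda>i. real (v i)) / real (neval u v)" if "h \<in> funs" for h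
    using that by (simp add: st_def)
  have nn: "0 \<le> st u v h" if "h \<in> funs" for h
    using that by (elim funsE) (simp add: st_term[OF v])
  have mon: "monoid_hom A nonneg_real_hoop (st u v)"
    unfolding monoid_hom_def A_simps nonneg_hoop_simps
    using nn ev_ops[OF w] ev_zero[OF w] funs_zero by (auto simp: val add_divide_distrib)
  have "hoop_hom A nonneg_real_hoop (st u v)"
    unfolding hoop_hom_def
  proof (intro conjI mon ballI)
    fix f g assume "f \<in> hcarrier A" "g \<in> hcarrier A"
    then have fg: "f \<in> funs" "g \<in> funs" by (simp_all add: A_simps)
    have "max 0 (ev f (\<lambda>i. real (v i)) - ev g (\<lambda>i. real (v i))) / real (neval u v)
        = max 0 (ev f (\<lambda>i. real (v i)) / real (neval u v) - ev g (\<lambda>i. real (v i)) / real (neval u v))"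
      using b by (cases "0 \<le> ev f (\<lambda>i. real (v i)) - ev g (\<lambda>i. real (v i))")
        (simp_all add: diff_divide_distrib[symmetric] divide_nonneg_pos divide_nonpos_pos max_absorb1 max_absorb2)
    then show "st u v (f \<ominus>\<^bsub>A\<^esub> g) = st u v f \<ominus>\<^bsub>nonneg_real_hoop\<^esub> st u v g"
      unfolding A_simps nonneg_hoop_simps using ev_ops[OF w fg] fg by (simp add: val)
  qed
  moreover have "st u v (\<lambda>x. teval u (p x)) = 1" using b by (simp add: st_term[OF v ut])
  moreover have "st u v \<in> extensional (hcarrier A)" by (simp add: st_def A_simps)
  ultimately show ?thesis using mon by (simp add: extremal_state_def state_def)
qed

lemma st_inj:
  assumes u: "is_unit u k"
  shows "inj_on (st u) Prim"
proof (rule inj_onI)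
  fix v v' assume v: "v \<in> Prim" and v': "v' \<in> Prim" and eq: "st u v = st u v'"
  have b: "neval u v = neval u v'" "neval u v \<ge> 1"
    using st_denominator[OF u v] st_denominator[OF u v'] eq Prim_unit_pos[OF u v] by simp_all
  show "v = v'"
  proof
    fix i
    show "v i = v' i"
    proof (cases "i < n")
      case True
      then have t: "tvars (TVar i) \<subseteq> {..<n}" by simp
      have "real (v i) / real (neval u v) = real (v' i) / real (neval u v')"
        using st_term[OF v t, of u] st_term[OF v' t, of u] unfolding eq by simp
      then show ?thesis using b by simp
    next
      case False
      then show ?thesis using v v' W_D(2)[of "\<lambda>i. real (v i)" i] W_D(2)[of "\<lambda>i. real (v' i)" i] by (simp add: Prim_def)
    qed
  qed
qed

text \<open>The values of the state at the generators form a vector of the cone, since a hoop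
  homomorphism respects the relations. Multiplied by the denominator it becomes integral, and it is
  primitive because the smallest positive value is attained.\<close>

lemma discrete_state_is_st:
  assumes u: "is_unit u k" and m: "m \<in> discrete_states A (\<lambda>x. teval u (p x))"
  shows "m \<in> st u ` Prim"
proof -
  obtain b where ext: "extremal_state A (\<lambda>x. teval u (p x)) m" and b: "has_denominator A m b"
    using m by (auto simp: discrete_states_def)
  have hom: "hoop_hom A nonneg_real_hoop m" and mu: "m (\<lambda>x. teval u (p x)) = 1" and mext: "m \<in> extensional funs"
    using ext by (simp_all add: extremal_state_def state_def A_simps)
  note hD = hoop_homD[OF hom, unfolded A_simps nonneg_hoop_simps]
  have ut: "tvars u \<subseteq> {..<n}" using u by (simp add: is_unit_def)
  define w where "w i = (if i < n then m (\<lambda>x. p x i) else 0)" for i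
  have mt: "m (\<lambda>x. teval t (p x)) = teval t w" if "tvars t \<subseteq> {..<n}" for t
    using that
  proof (induction t)
    case (TVar i) then show ?case by (simp add: w_def)
  next
    case TZero then show ?case using hD(2) by simp
  next
    case (TPlus s t)
    then have st: "tvars s \<subseteq> {..<n}" "tvars t \<subseteq> {..<n}" by auto
    have "m (\<lambda>x. teval s (p x) + teval t (p x)) = m (\<lambda>x. teval s (p x)) + m (\<lambda>x. teval t (p x))"
      by (rule hD(3)[OF funsI[OF st(1)] funsI[OF st(2)]])
    then show ?case using TPlus.IH st by simp
  next
    case (TMonus s t)
    then have st: "tvars s \<subseteq> {..<n}" "tvars t \<subseteq> {..<n}" by auto
    have "m (\<lambda>x. max 0 (teval s (p x) - teval t (p x))) = max 0 (m (\<lambda>x. teval s (p x)) - m (\<lambda>x. teval t (p x)))"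
      by (rule hD(4)[OF funsI[OF st(1)] funsI[OF st(2)]])
    then show ?case using TMonus.IH st by simp
  qed
  have wW: "w \<in> W"
  proof (rule W_I)
    show "0 \<le> w i" for i
    proof (cases "i < n")
      case True
      then have "(\<lambda>x. p x i) \<in> funs" using funsI[of "TVar i"] by simp
      then show ?thesis using hD(1)[of "\<lambda>x. p x i"] by (simp add: w_def)
    qed (simp add: w_def)
    show "w i = 0" if "i \<ge> n" for i using that by (simp add: w_def)
    show "teval s w = teval t w" if st: "(s, t) \<in> E" for s t
    proof -
      have "(\<lambda>x. teval s (p x)) = (\<lambda>x. teval t (p x))" using p_rel[OF st] by auto
      then show ?thesis using mt[of s] mt[of t] E_vars[OF st] by simp
    qed
  qed
  have b1: "b \<ge> 1" and img: "m ` funs = range (\<lambda>j::nat. real j / real b)"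
    using b by (simp_all add: has_denominator_def A_simps)
  have b0: "0 < real b" using b1 by simp
  have "\<forall>i. \<exists>j::nat. real b * w i = real j"
  proof
    fix i
    show "\<exists>j::nat. real b * w i = real j"
    proof (cases "i < n")
      case True
      then have "(\<lambda>x. p x i) \<in> funs" using funsI[of "TVar i"] by simp
      then have "w i \<in> m ` funs" using True by (auto simp: w_def)
      then obtain j :: nat where "w i = real j / real b" unfolding img by blast
      then show ?thesis using b0 by (intro exI[of _ j]) simp
    next
      case False
      then show ?thesis by (intro exI[of _ 0]) (simp add: w_def)
    qed
  qed
  from choice[OF this] obtain v :: "nat \<Rightarrow> nat" where v: "\<And>i. real b * w i = real (v i)" by blast
  have vw: "(\<lambda>i. real (v i)) = (\<lambda>i. real b * w i)" using v by simp
  have vt: "real (neval t v) = real b * teval t w" for t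
    unfolding teval_of_nat[symmetric] vw by (rule teval_scale) simp
  \<comment> \<open>The gcd divides the value of every term at \<open>v\<close>, and some term takes
    the value 1 there.\<close>
  have "Gcd (v ` {..<n}) = 1"
  proof -
    have "real 1 / real b \<in> m ` funs" unfolding img by (rule rangeI)
    then obtain h where h: "h \<in> funs" "real 1 / real b = m h" by blast
    from h(1) obtain t where t: "tvars t \<subseteq> {..<n}" "h = (\<lambda>x. teval t (p x))" by (rule funsE)
    have "real b * teval t w = 1" using h(2) mt[OF t(1)] t(2) b0 by (simp add: field_simps)
    then have "real (neval t v) = 1" using vt by simp
    then have "neval t v = 1" by simp
    then show ?thesis using dvd_neval[OF t(1), of v] by simp
  qed
  then have vP: "v \<in> Prim" using W_scale[OF wW, of "real b"] vw by (simp add: Prim_def)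
  have "teval u w = 1" using mt[OF ut] mu by simp
  then have ub: "real (neval u v) = real b" using vt[of u] by simp
  have "m = st u v"
  proof (rule extensionalityI[OF mext])
    show "st u v \<in> extensional funs" by (simp add: st_def)
    fix h assume "h \<in> funs"
    then obtain t where t: "tvars t \<subseteq> {..<n}" "h = (\<lambda>x. teval t (p x))" by (rule funsE)
    show "m h = st u v h"
      unfolding t(2) st_term[OF vP t(1)] mt[OF t(1)] ub vt[of t] using b0 by simp
  qed
  then show ?thesis using vP by blast
qed

lemma discrete_states_eq:
  assumes u: "is_unit u k"
  shows "bij_betw (st u) Prim (discrete_states A (\<lambda>x. teval u (p x)))"
proof -
  have "st u ` Prim = discrete_states A (\<lambda>x. teval u (p x))"
  proof (intro equalityI subsetI)
    fix m assume "m \<in> st u ` Prim"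
    then obtain v where "v \<in> Prim" "m = st u v" by blast
    then show "m \<in> discrete_states A (\<lambda>x. teval u (p x))"
      using st_extremal[OF u] st_has_denominator[OF u] unfolding discrete_states_def by blast
  qed (rule discrete_state_is_st[OF u])
  then show ?thesis using st_inj[OF u] by (simp add: bij_betw_def)
qed

end

subsection \<open>The dimension of the space\<close>

text \<open>\<open>T\<close> collects the terms that are to be linear on every stratum; a larger
  \<open>T\<close> requires a finer stratification.\<close>

locale stratified_presentation = term_presentation n E p
  for n :: nat and E :: "(hterm \<times> hterm) set" and p :: "'x::t2_space \<Rightarrow> nat \<Rightarrow> real" +
  fixes T :: "hterm set" and \<S> :: "(nat set \<times> (nat \<Rightarrow> nat \<Rightarrow> real) \<times> (nat \<Rightarrow> real) set) set"
  assumes S_fin: "finite \<S>" and S_union: "\<Union>(stratum n ` \<S>) = zero_cone n E"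
    and S_disj: "\<And>S S'. S \<in> \<S> \<Longrightarrow> S' \<in> \<S> \<Longrightarrow> S \<noteq> S' \<Longrightarrow> stratum n S \<inter> stratum n S' = {}"
    and S_nonempty: "\<And>S. S \<in> \<S> \<Longrightarrow> stratum n S \<noteq> {}"
    and S_props: "\<And>I c \<Psi>. (I, c, \<Psi>) \<in> \<S> \<Longrightarrow> I \<subseteq> {..<n} \<and> finite \<Psi> \<and> (\<forall>j i. c j i \<in> \<rat>) \<and>
      (\<forall>j\<in>I. \<forall>i\<in>I. c j i = (if i = j then 1 else 0))"
    and S_linear: "\<And>I c \<Psi> t. (I, c, \<Psi>) \<in> \<S> \<Longrightarrow> t \<in> T \<Longrightarrow>
      \<exists>\<tau>. \<forall>w\<in>stratum n (I, c, \<Psi>). teval t w = (\<Sum>i\<in>I. \<tau> i * w i)"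
begin

definition D :: nat where "D = Max ((\<lambda>S. card (fst S)) ` \<S>)"

lemma stratum_subset_W: "S \<in> \<S> \<Longrightarrow> w \<in> stratum n S \<Longrightarrow> w \<in> W"
  using S_union by blast

lemma W_stratum:
  assumes "w \<in> W"
  obtains I c \<Psi> where "(I, c, \<Psi>) \<in> \<S>" "w \<in> stratum n (I, c, \<Psi>)"
proof -
  have "w \<in> \<Union>(stratum n ` \<S>)" using assms S_union by simp
  then obtain S where "S \<in> \<S>" "w \<in> stratum n S" by blast
  then show thesis using that by (cases S) blast
qed

text \<open>On a stratum, the inverse of restriction to the free coordinates
  \<open>I\<close>.\<close>

definition extend :: "nat set \<Rightarrow> (nat \<Rightarrow> nat \<Rightarrow> real) \<Rightarrow> (nat \<Rightarrow> real) \<Rightarrow> nat \<Rightarrow> real" where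
  "extend I c a = (\<lambda>j. if j < n then \<Sum>i\<in>I. c j i * a i else 0)"

lemma extend_on:
  assumes "(I, c, \<Psi>) \<in> \<S>" "i \<in> I"
  shows "extend I c a i = a i"
proof -
  have I: "I \<subseteq> {..<n}" "finite I" and unit: "\<And>j. j \<in> I \<Longrightarrow> c i j = (if j = i then 1 else 0)"
    using S_props[OF assms(1)] assms(2) by (auto intro: finite_subset)
  have "(\<Sum>j\<in>I. c i j * a j) = (\<Sum>j\<in>I. if j = i then a j else 0)"
    by (intro sum.cong) (auto simp: unit)
  then show ?thesis using I assms(2) by (auto simp: extend_def)
qed

lemma extend_in_stratum:
  assumes "(I, c, \<Psi>) \<in> \<S>" "\<And>\<psi>. \<psi> \<in> \<Psi> \<Longrightarrow> 0 < (\<Sum>i\<in>I. \<psi> i * a i)"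
  shows "extend I c a \<in> stratum n (I, c, \<Psi>)"
proof -
  have eq: "(\<Sum>i\<in>I. f i * extend I c a i) = (\<Sum>i\<in>I. f i * a i)" for f :: "nat \<Rightarrow> real"
    using extend_on[OF assms(1)] by (intro sum.cong) auto
  show ?thesis unfolding stratum_def using assms(2) by (simp add: eq) (simp add: extend_def)
qed

lemma stratum_extend:
  assumes "w \<in> stratum n (I, c, \<Psi>)"
  shows "w = extend I c w"
proof
  fix j
  show "w j = extend I c w j"
    using assms unfolding stratum_def extend_def by (cases "j < n") auto
qed

lemma card_le_D: "S \<in> \<S> \<Longrightarrow> card (fst S) \<le> D"
  unfolding D_def using S_fin by (intro Max_ge) auto

lemma D_pos: "D \<ge> 1"
proof -
  \<comment> \<open>Types are inhabited, so the space has a point, and the cone a nonzero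
    ray.\<close>
  obtain x :: 'x where True by blast
  obtain i where i: "p x i \<noteq> 0" using p_nonzero by blast
  obtain I c \<Psi> where S: "(I, c, \<Psi>) \<in> \<S>" "p x \<in> stratum n (I, c, \<Psi>)" using W_stratum[OF p_in_W] .
  have "I \<noteq> {}"
  proof
    assume "I = {}"
    then have "p x i = 0" using fun_cong[OF stratum_extend[OF S(2)], of i] by (simp add: extend_def)
    then show False using i by simp
  qed
  moreover have "finite I" using S_props[OF S(1)] finite_subset by blast
  ultimately have "card I \<ge> 1" by (simp add: Suc_le_eq card_gt_0_iff)
  then show ?thesis using card_le_D[OF S(1)] by simp
qed

text \<open>If all free coordinates of a point of the stratum are 0, there can be no strict
  inequalities, and the stratum is a whole linear subspace. It would then contain a vector with a
  negative coordinate, which the cone does not.\<close>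

lemma top_stratum:
  obtains I c \<Psi> w i where "(I, c, \<Psi>) \<in> \<S>" "card I = D" "w \<in> stratum n (I, c, \<Psi>)" "i \<in> I" "0 < w i"
proof -
  have "\<S> \<noteq> {}" using W_stratum[OF p_in_W] by blast
  then have "D \<in> (\<lambda>S. card (fst S)) ` \<S>" unfolding D_def using S_fin by (intro Max_in) auto
  then obtain S where S: "S \<in> \<S>" "D = card (fst S)" by (rule imageE)
  obtain I c \<Psi> where Sc: "S = (I, c, \<Psi>)" by (cases S)
  have S': "(I, c, \<Psi>) \<in> \<S>" "card I = D" using S Sc by auto
  obtain w where w: "w \<in> stratum n (I, c, \<Psi>)" using S_nonempty[OF S'(1)] by blast
  have "I \<noteq> {}" using S'(2) D_pos by auto
  then obtain i0 where i0: "i0 \<in> I" by blast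
  show thesis
  proof (cases "\<exists>i\<in>I. w i \<noteq> 0")
    case True
    then obtain i where i: "i \<in> I" "w i \<noteq> 0" by blast
    then have "0 < w i" using W_D(1)[OF stratum_subset_W[OF S'(1) w], of i] by simp
    then show thesis using that S' w i(1) by blast
  next
    case False
    have "\<Psi> = {}"
    proof (rule ccontr)
      assume "\<Psi> \<noteq> {}"
      then obtain \<psi> where "\<psi> \<in> \<Psi>" by blast
      then have "0 < (\<Sum>i\<in>I. \<psi> i * w i)" using w unfolding stratum_def by simp
      moreover have "(\<Sum>i\<in>I. \<psi> i * w i) = 0" using False by (intro sum.neutral) simp
      ultimately show False by simp
    qed
    then have "extend I c (\<lambda>i. -1) \<in> stratum n (I, c, \<Psi>)" using S'(1) by (intro extend_in_stratum) simp_all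
    then have "0 \<le> extend I c (\<lambda>i. -1) i0" using W_D(1)[OF stratum_subset_W[OF S'(1)]] by blast
    then show thesis using extend_on[OF S'(1) i0, of "\<lambda>i. -1"] by simp
  qed
qed

definition total :: "'x \<Rightarrow> real" where "total x = (\<Sum>j<n. p x j)"

lemma total_pos: "0 < total x"
proof -
  obtain i where i: "p x i \<noteq> 0" using p_nonzero by blast
  then have "i < n" using p_supp[of i x] by (cases "i < n") auto
  moreover have "0 < p x i" using i p_nonneg[of x i] by simp
  ultimately show ?thesis unfolding total_def
    by (intro sum_pos2[where i = i]) (auto simp: p_nonneg)
qed

lemma total_cont: "continuous_on UNIV total"
  unfolding total_def by (intro continuous_on_sum p_cont)

sublocale coords: compact_in_coordinates "\<lambda>x i. p x i / total x" n
proof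
  show "compact (UNIV :: 'x set)" by (rule compact_space)
  show "continuous_on UNIV (\<lambda>x. p x i / total x)" for i
    using total_pos by (intro continuous_on_divide p_cont total_cont) (auto simp: less_imp_neq[symmetric] intro:
        less_imp_neq[THEN not_sym])
  fix x y assume eq: "\<And>i. i < n \<Longrightarrow> p x i / total x = p y i / total y"
  have "p y i = total y / total x * p x i" for i
  proof (cases "i < n")
    case True
    then show ?thesis using eq[OF True] total_pos[of x] total_pos[of y] by (simp add: field_simps)
  next
    case False
    then show ?thesis using p_supp[of i] by simp
  qed
  then show "x = y" using total_pos[of x] total_pos[of y] by (intro p_ray_inj[of "total y / total x"]) auto
qed

lemma covering_dim_upper: "covering_dim_le (euclidean :: 'x topology) (int D - 1)"
proof (rule coords.covering_dim_le_of_planes)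
  let ?Ls = "(\<lambda>S. (fst S, fst (snd S))) ` \<S>"
  show "finite ?Ls" using S_fin by simp
  show "D \<ge> 1" by (rule D_pos)
  show "finite I \<and> card I \<le> D" if "(I, c) \<in> ?Ls" for I c
  proof -
    obtain \<Psi> where S: "(I, c, \<Psi>) \<in> \<S>" using \<open>(I, c) \<in> ?Ls\<close> by auto
    then show ?thesis using S_props[OF S] card_le_D[OF S] finite_subset by auto
  qed
  show "\<exists>(I, c)\<in>?Ls. \<forall>j<n. p x j / total x = (\<Sum>i\<in>I. c j i * (p x i / total x))" for x
  proof -
    obtain I c \<Psi> where S: "(I, c, \<Psi>) \<in> \<S>" "p x \<in> stratum n (I, c, \<Psi>)" using W_stratum[OF p_in_W] .
    have "p x j / total x = (\<Sum>i\<in>I. c j i * (p x i / total x))" if "j < n" for j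
    proof -
      have "p x j = (\<Sum>i\<in>I. c j i * p x i)"
        using fun_cong[OF stratum_extend[OF S(2)], of j] that by (simp add: extend_def)
      then have "p x j / total x = (\<Sum>i\<in>I. c j i * p x i) / total x" by (rule arg_cong)
      then show ?thesis by (simp add: sum_divide_distrib)
    qed
    moreover have "(I, c) \<in> ?Ls" using S(1) by force
    ultimately show ?thesis by blast
  qed
  show "(\<Sum>j<n. p x j / total x) = 1" for x
    using total_pos[of x] by (simp add: sum_divide_distrib[symmetric] total_def)
qed

text \<open>A top stratum contains a cube of dimension \<open>D - 1\<close> transversal to the rays:
  the coordinate \<open>i0\<close> is kept fixed and the other free coordinates move. Opposite faces
  are kept apart by the forms \<open>f l\<close>, whose sign depends only on the ray.\<close>

lemma covering_dim_lower:
  assumes k: "k < int (D - 1)"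
  shows "\<not> covering_dim_le (euclidean :: 'x topology) k"
proof -
  obtain I c \<Psi> w0 i0 where S: "(I, c, \<Psi>) \<in> \<S>" "card I = D" "w0 \<in> stratum n (I, c, \<Psi>)" "i0 \<in> I" "0 < w0 i0"
    by (rule top_stratum)
  have finI: "finite I" and In: "I \<subseteq> {..<n}" and fin\<Psi>: "finite \<Psi>" using S_props[OF S(1)] finite_subset by auto
  have i0n: "i0 < n" using In S(4) by auto
  have w0\<psi>: "0 < (\<Sum>i\<in>I. \<psi> i * w0 i)" if "\<psi> \<in> \<Psi>" for \<psi>
    using S(3) that unfolding stratum_def by simp
  define d where "d = D - 1"
  have "card (I - {i0}) = d" using S finI by (simp add: d_def)
  then obtain g where g: "bij_betw g {..<d} (I - {i0})"
    using ex_bij_betw_nat_finite[of "I - {i0}"] finI by (auto simp: atLeast0LessThan)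
  define gi where "gi = the_inv_into {..<d} g"
  have gi: "gi (g l) = l" if "l < d" for l
    unfolding gi_def using g that by (intro the_inv_into_f_f) (auto simp: bij_betw_def)
  have gi_less: "gi i < d" if "i \<in> I - {i0}" for i
    using the_inv_into_into[of g "{..<d}" i "{..<d}"] g that by (auto simp: bij_betw_def gi_def)
  have gI: "g l \<in> I" "g l \<noteq> i0" if "l < d" for l using bij_betwE[OF g] that by auto
  \<comment> \<open>Moving the free coordinates by at most \<open>\<delta>\<close> does not violate
    any strict inequality; the inserted 1 covers the case that there are none.\<close>
  define \<delta> where "\<delta> = Min (insert 1 ((\<lambda>\<psi>. (\<Sum>i\<in>I. \<psi> i * w0 i) / ((\<Sum>i\<in>I. \<bar>\<psi> i\<bar>) + 1)) ` \<Psi>))"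
  have abs0: "0 \<le> (\<Sum>i\<in>I. \<bar>\<psi> i\<bar>)" for \<psi> :: "nat \<Rightarrow> real" by (intro sum_nonneg) simp
  have \<delta>: "0 < \<delta>"
    unfolding \<delta>_def using fin\<Psi> w0\<psi> abs0 by (subst Min_gr_iff) (auto intro!: divide_pos_pos add_nonneg_pos)
  have \<delta>\<psi>: "\<delta> * (\<Sum>i\<in>I. \<bar>\<psi> i\<bar>) < (\<Sum>i\<in>I. \<psi> i * w0 i)" if "\<psi> \<in> \<Psi>" for \<psi>
  proof -
    have "\<delta> \<le> (\<Sum>i\<in>I. \<psi> i * w0 i) / ((\<Sum>i\<in>I. \<bar>\<psi> i\<bar>) + 1)"
      unfolding \<delta>_def using fin\<Psi> that by (intro Min_le) auto
    then have "\<delta> * ((\<Sum>i\<in>I. \<bar>\<psi> i\<bar>) + 1) \<le> (\<Sum>i\<in>I. \<psi> i * w0 i)"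
      using abs0[of \<psi>] by (subst (asm) le_divide_eq) (auto split: if_splits)
    then show ?thesis using \<delta> by (simp add: algebra_simps)
  qed
  define a where "a t i = w0 i + (if i = i0 then 0 else \<delta> * t (gi i))" for t i
  define wt where "wt t = extend I c (a t)" for t
  define cube where "cube t \<longleftrightarrow> (\<forall>j<d. 0 \<le> t j \<and> t j \<le> (1::real))" for t
  have wtW: "wt t \<in> W" if t: "cube t" for t
  proof -
    have "0 < (\<Sum>i\<in>I. \<psi> i * a t i)" if \<psi>: "\<psi> \<in> \<Psi>" for \<psi>
    proof -
      have "(\<Sum>i\<in>I. \<psi> i * a t i) = (\<Sum>i\<in>I. \<psi> i * w0 i) + (\<Sum>i\<in>I. \<psi> i * (if i = i0 then 0 else \<delta> * t (gi i)))"
        by (simp add: a_def algebra_simps sum.distrib)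
      moreover have "\<bar>\<Sum>i\<in>I. \<psi> i * (if i = i0 then 0 else \<delta> * t (gi i))\<bar> \<le> (\<Sum>i\<in>I. \<delta> * \<bar>\<psi> i\<bar>)"
      proof (rule order_trans[OF sum_abs], rule sum_mono)
        fix i assume i: "i \<in> I"
        show "\<bar>\<psi> i * (if i = i0 then 0 else \<delta> * t (gi i))\<bar> \<le> \<delta> * \<bar>\<psi> i\<bar>"
        proof (cases "i = i0")
          case False
          then have "0 \<le> t (gi i)" "t (gi i) \<le> 1" using t gi_less[of i] i by (auto simp: cube_def)
          then have "\<bar>\<psi> i\<bar> * (\<delta> * t (gi i)) \<le> \<bar>\<psi> i\<bar> * (\<delta> * 1)" using \<delta> by (intro mult_left_mono) auto
          then show ?thesis using False \<delta> \<open>0 \<le> t (gi i)\<close> by (simp add: abs_mult mult.commute)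
        qed (use \<delta> in simp)
      qed
      ultimately show ?thesis using \<delta>\<psi>[OF \<psi>] by (simp add: sum_distrib_left[symmetric])
    qed
    then show ?thesis unfolding wt_def by (intro stratum_subset_W[OF S(1)] extend_in_stratum[OF S(1)])
  qed
  have wt_i0: "wt t i0 = w0 i0" for t
    unfolding wt_def extend_on[OF S(1,4)] by (simp add: a_def)
  have wt_g: "wt t (g l) = w0 (g l) + \<delta> * t l" if "l < d" for t l
    unfolding wt_def extend_on[OF S(1) gI(1)[OF that]] by (simp add: a_def gI(2)[OF that] gi[OF that])
  \<comment> \<open>The point of the space whose ray passes through \<open>wt t\<close>; it exists
    because \<open>i0\<close> keeps the vector nonzero.\<close>
  define pt where "pt t = (SOME x. \<exists>c>0. wt t = (\<lambda>i. c * p x i))" for t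
  have pt: "\<exists>c>0. wt t = (\<lambda>i. c * p (pt t) i)" if "cube t" for t
  proof -
    have "\<exists>x. \<exists>c>0. wt t = (\<lambda>i. c * p x i)"
      using W_ray[OF wtW[OF that], of i0] wt_i0 S(5) by (metis less_irrefl)
    then show ?thesis unfolding pt_def by (rule someI_ex)
  qed
  define tot where "tot t = (\<Sum>j<n. wt t j)" for t
  have tot_ge: "w0 i0 \<le> tot t" if "cube t" for t
  proof -
    have "wt t i0 \<le> tot t" unfolding tot_def
      using i0n W_D(1)[OF wtW[OF that]] by (intro member_le_sum) auto
    then show ?thesis by (simp add: wt_i0)
  qed
  define Sbar where "Sbar = (\<Sum>j<n. \<Sum>i\<in>I. \<bar>c j i\<bar> * (\<bar>w0 i\<bar> + \<delta>)) + 1"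
  have Sbar: "0 < Sbar" unfolding Sbar_def using \<delta> by (intro add_nonneg_pos sum_nonneg) auto
  have tot_le: "tot t \<le> Sbar" if t: "cube t" for t
  proof -
    have "tot t \<le> (\<Sum>j<n. \<Sum>i\<in>I. \<bar>c j i\<bar> * (\<bar>w0 i\<bar> + \<delta>))"
      unfolding tot_def
    proof (rule sum_mono)
      fix j assume "j \<in> {..<n}"
      then have "wt t j = (\<Sum>i\<in>I. c j i * a t i)" by (simp add: wt_def extend_def)
      also have "\<dots> \<le> (\<Sum>i\<in>I. \<bar>c j i\<bar> * (\<bar>w0 i\<bar> + \<delta>))"
      proof (rule sum_mono)
        fix i assume i: "i \<in> I"
        have "\<bar>a t i\<bar> \<le> \<bar>w0 i\<bar> + \<delta>"
        proof (cases "i = i0")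
          case False
          then have "0 \<le> t (gi i)" "t (gi i) \<le> 1" using t gi_less[of i] i by (auto simp: cube_def)
          then have "0 \<le> \<delta> * t (gi i)" "\<delta> * t (gi i) \<le> \<delta> * 1" using \<delta>
              by (auto intro!: mult_left_mono simp del: mult_1_right)
          then show ?thesis using False by (simp add: a_def)
        qed (use \<delta> in \<open>simp add: a_def\<close>)
        then have "\<bar>c j i\<bar> * \<bar>a t i\<bar> \<le> \<bar>c j i\<bar> * (\<bar>w0 i\<bar> + \<delta>)" by (intro mult_left_mono) auto
        then show "c j i * a t i \<le> \<bar>c j i\<bar> * (\<bar>w0 i\<bar> + \<delta>)" by (metis abs_ge_self abs_mult order_trans)
      qed
      finally show "wt t j \<le> (\<Sum>i\<in>I. \<bar>c j i\<bar> * (\<bar>w0 i\<bar> + \<delta>))" .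
    qed
    then show ?thesis by (simp add: Sbar_def)
  qed
  \<comment> \<open>A lower bound for \<open>f l\<close> relative to the coordinate sum on the face
    with parameter 1. The sum occurs so that both sides scale alike along a ray.\<close>
  define \<eta> where "\<eta> = \<delta> * w0 i0 / Sbar"
  have \<eta>: "0 < \<eta>" unfolding \<eta>_def using \<delta> Sbar S(5) by simp
  \<comment> \<open>Compares the coordinates \<open>g l\<close> and \<open>i0\<close> of the ray
    with those of \<open>w0\<close>; up to a positive factor it is the cube parameter
    \<open>t l\<close>.\<close>
  define f where "f l x = p x (g l) * w0 i0 - w0 (g l) * p x i0" for l x
  have f_cont: "continuous_on UNIV (f l)" for l
    unfolding f_def by (intro continuous_on_diff continuous_on_mult continuous_on_const p_cont)
  have fpt: "\<exists>b>0. b * f l (pt t) = \<delta> * t l * w0 i0 \<and> b * total (pt t) = tot t \<and> (\<forall>i. wt t i = b * p (pt t) i)"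
    if t: "cube t" and l: "l < d" for t l
  proof -
    obtain b where b: "b > 0" "wt t = (\<lambda>i. b * p (pt t) i)" using pt[OF t] by blast
    have bi: "b * p (pt t) i = wt t i" for i using fun_cong[OF b(2), of i] by simp
    have "b * f l (pt t) = wt t (g l) * w0 i0 - w0 (g l) * wt t i0"
      unfolding bi[symmetric] by (simp add: f_def algebra_simps)
    also have "\<dots> = \<delta> * t l * w0 i0" by (simp add: wt_g[OF l] wt_i0 algebra_simps)
    finally show ?thesis using b(1) bi by (intro exI[of _ b]) (simp add: total_def tot_def sum_distrib_left)
  qed
  define K where "K = (\<Sum>j<n. \<Sum>i\<in>I. \<bar>c j i\<bar> * \<delta>)"
  have K: "0 \<le> K" unfolding K_def using \<delta> by (intro sum_nonneg) auto
  \<comment> \<open>The coordinates of \<open>wt\<close> and their sum are Lipschitz with constant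
    \<open>K\<close>, and the sum is at least \<open>w0 i0\<close>; numerator and denominator of the
    normalised coordinate contribute one term each.\<close>
  define C where "C = 2 * K / w0 i0"
  show ?thesis
  proof (rule coords.not_covering_dim_le_of_cube[where A = "\<lambda>l. {x. f l x \<le> 0}" and B = "\<lambda>l. {x. \<eta> * total x \<le> f l x}"
        and d = d and C = C and pt = pt])
    show "closed {x. f l x \<le> 0}" for l by (intro closed_Collect_le f_cont continuous_on_const)
    show "closed {x. \<eta> * total x \<le> f l x}" for l
      by (intro closed_Collect_le f_cont continuous_on_mult continuous_on_const total_cont)
    show "{x. f l x \<le> 0} \<inter> {x. \<eta> * total x \<le> f l x} = {}" for l
    proof (intro equals0I)
      fix x assume "x \<in> {x. f l x \<le> 0} \<inter> {x. \<eta> * total x \<le> f l x}"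
      then have "\<eta> * total x \<le> 0" by simp
      moreover have "0 < \<eta> * total x" using \<eta> total_pos by (rule mult_pos_pos)
      ultimately show False by simp
    qed
    show "0 \<le> C" using K S(5) by (simp add: C_def)
    show "k < int d" using k by (simp add: d_def)
    show "pt t \<in> {x. f l x \<le> 0}" if t: "\<And>j. j < d \<Longrightarrow> 0 \<le> t j \<and> t j \<le> 1" and l: "l < d" "t l = 0" for t l
    proof -
      have "cube t" using t by (simp add: cube_def)
      from fpt[OF this l(1)] obtain b where "b > 0" "b * f l (pt t) = 0" using l(2) by auto
      then show ?thesis by simp
    qed
    show "pt t \<in> {x. \<eta> * total x \<le> f l x}" if t: "\<And>j. j < d \<Longrightarrow> 0 \<le> t j \<and> t j \<le> 1" and l: "l < d" "t l = 1" for t l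
    proof -
      have ct: "cube t" using t by (simp add: cube_def)
      from fpt[OF ct l(1)] obtain b where b: "b > 0" "b * f l (pt t) = \<delta> * w0 i0" "b * total (pt t) = tot t"
          using l(2) by auto
      have "b * (\<eta> * total (pt t)) = \<eta> * tot t" using b(3) by (simp add: algebra_simps)
      also have "\<dots> \<le> \<eta> * Sbar" using tot_le[OF ct] \<eta> by (intro mult_left_mono) auto
      also have "\<dots> = b * f l (pt t)" using Sbar b(2) by (simp add: \<eta>_def)
      finally show ?thesis using b(1) by simp
    qed
    show "\<bar>p (pt t) i / total (pt t) - p (pt t') i / total (pt t')\<bar> \<le> C * r"
      if t: "\<And>j. j < d \<Longrightarrow> 0 \<le> t j \<and> t j \<le> 1" and t': "\<And>j. j < d \<Longrightarrow> 0 \<le> t' j \<and> t' j \<le> 1"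
        and r: "0 \<le> r" "\<And>j. j < d \<Longrightarrow> \<bar>t j - t' j\<bar> \<le> r" and i: "i < n" for t t' r i
    proof -
      have ct: "cube t" "cube t'" using t t' by (simp_all add: cube_def)
      have quot: "p (pt s) i / total (pt s) = wt s i / tot s" if "cube s" for s
      proof -
        obtain b where b: "b > 0" "wt s = (\<lambda>i. b * p (pt s) i)" using pt[OF \<open>cube s\<close>] by blast
        have bi: "wt s i = b * p (pt s) i" for i using fun_cong[OF b(2), of i] .
        have "tot s = b * total (pt s)" unfolding tot_def total_def bi by (simp add: sum_distrib_left)
        then show ?thesis using b(1) by (simp add: bi)
      qed
      have diff: "\<bar>wt t j - wt t' j\<bar> \<le> (\<Sum>i\<in>I. \<bar>c j i\<bar> * \<delta>) * r" if "j < n" for j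
      proof -
        have "wt t j - wt t' j = (\<Sum>i\<in>I. c j i * (a t i - a t' i))"
          using that by (simp add: wt_def extend_def sum_subtractf[symmetric] algebra_simps)
        also have "\<bar>\<dots>\<bar> \<le> (\<Sum>i\<in>I. \<bar>c j i\<bar> * \<delta> * r)"
        proof (rule order_trans[OF sum_abs], rule sum_mono)
          fix i assume iI: "i \<in> I"
          have "\<bar>a t i - a t' i\<bar> \<le> \<delta> * r"
          proof (cases "i = i0")
            case True
            then show ?thesis using \<delta> r(1) by (simp add: a_def)
          next
            case False
            have "a t i - a t' i = \<delta> * (t (gi i) - t' (gi i))" using False by (simp add: a_def algebra_simps)
            then have "\<bar>a t i - a t' i\<bar> = \<delta> * \<bar>t (gi i) - t' (gi i)\<bar>" using \<delta> by (simp add: abs_mult)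
            also have "\<dots> \<le> \<delta> * r" using r(2)[OF gi_less[of i]] False iI \<delta> by (intro mult_left_mono) auto
            finally show ?thesis .
          qed
          then have "\<bar>c j i\<bar> * \<bar>a t i - a t' i\<bar> \<le> \<bar>c j i\<bar> * (\<delta> * r)" by (rule mult_left_mono) simp
          then show "\<bar>c j i * (a t i - a t' i)\<bar> \<le> \<bar>c j i\<bar> * \<delta> * r" by (simp add: abs_mult mult.assoc)
        qed
        finally show ?thesis by (simp add: sum_distrib_right)
      qed
      have Kj: "(\<Sum>i\<in>I. \<bar>c j i\<bar> * \<delta>) \<le> K" if "j < n" for j
      proof -
        have "(\<lambda>j. \<Sum>i\<in>I. \<bar>c j i\<bar> * \<delta>) j \<le> (\<Sum>j<n. \<Sum>i\<in>I. \<bar>c j i\<bar> * \<delta>)"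
          using that \<delta> by (intro member_le_sum) (auto intro!: sum_nonneg)
        then show ?thesis by (simp add: K_def)
      qed
      have d1: "\<bar>wt t i - wt t' i\<bar> \<le> K * r"
        using diff[OF i] mult_right_mono[OF Kj[OF i] r(1)] by linarith
      have d2: "\<bar>tot t - tot t'\<bar> \<le> K * r"
      proof -
        have "\<bar>tot t - tot t'\<bar> \<le> (\<Sum>j<n. \<bar>wt t j - wt t' j\<bar>)"
          unfolding tot_def sum_subtractf[symmetric] by (rule sum_abs)
        also have "\<dots> \<le> (\<Sum>j<n. (\<Sum>i\<in>I. \<bar>c j i\<bar> * \<delta>) * r)" using diff by (intro sum_mono) simp
        also have "\<dots> = K * r" by (simp add: K_def sum_distrib_right)
        finally show ?thesis .
      qed
      let ?\<kappa> = "w0 i0"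
      have \<kappa>: "0 < ?\<kappa>" "?\<kappa> \<le> tot t" "?\<kappa> \<le> tot t'" using S(5) tot_ge ct by auto
      have w'le: "0 \<le> wt t' i" "wt t' i \<le> tot t'"
        using W_D(1)[OF wtW[OF ct(2)]] i unfolding tot_def by (auto intro!: member_le_sum)
      have "wt t i / tot t - wt t' i / tot t' =
          (wt t i - wt t' i) / tot t + wt t' i / tot t' * ((tot t' - tot t) / tot t)"
        using \<kappa> by (simp add: field_simps)
      also have "\<bar>\<dots>\<bar> \<le> \<bar>(wt t i - wt t' i) / tot t\<bar> + \<bar>wt t' i / tot t' * ((tot t' - tot t) / tot t)\<bar>"
        by (rule abs_triangle_ineq)
      also have "\<bar>(wt t i - wt t' i) / tot t\<bar> \<le> K * r / ?\<kappa>"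
        unfolding abs_divide using d1 \<kappa> by (intro frac_le) auto
      also have "\<bar>wt t' i / tot t' * ((tot t' - tot t) / tot t)\<bar> \<le> 1 * (K * r / ?\<kappa>)"
        unfolding abs_mult abs_divide
      proof (rule mult_mono)
        show "\<bar>wt t' i\<bar> / \<bar>tot t'\<bar> \<le> 1" using w'le \<kappa> by simp
        show "\<bar>tot t' - tot t\<bar> / \<bar>tot t\<bar> \<le> K * r / ?\<kappa>" using d2 \<kappa> by (intro frac_le) auto
      qed (use K r \<kappa> in auto)
      finally have "\<bar>wt t i / tot t - wt t' i / tot t'\<bar> \<le> C * r" by (simp add: C_def)
      then show ?thesis unfolding quot[OF ct(1)] quot[OF ct(2)] .
    qed
  qed
qed

theorem topological_dimension: "has_topological_dimension (euclidean :: 'x topology) (int (D - 1))"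
proof -
  have eq: "int (D - 1) = int D - 1" using D_pos by linarith
  show ?thesis
    unfolding has_topological_dimension_def
  proof (intro conjI allI impI)
    show "covering_dim_le (euclidean :: 'x topology) (int (D - 1))" unfolding eq by (rule covering_dim_upper)
  qed (rule covering_dim_lower)
qed

end

lemma has_topological_dimension_unique:
  assumes "has_topological_dimension X k" "has_topological_dimension X l"
  shows "k = l"
proof -
  have "\<not> k < l" "\<not> l < k" using assms unfolding has_topological_dimension_def by blast+
  then show ?thesis by simp
qed

lemma (in term_presentation) stratification:
  assumes "finite T" "\<And>t. t \<in> T \<Longrightarrow> tvars t \<subseteq> {..<n}"
  obtains \<S> where "stratified_presentation n E p T \<S>"
proof (rule zero_cone_stratification[OF E_fin E_vars assms])
  fix \<S> assume S: "finite \<S>" "\<Union>(stratum n ` \<S>) = zero_cone n E"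
    "\<And>S S'. S \<in> \<S> \<Longrightarrow> S' \<in> \<S> \<Longrightarrow> S \<noteq> S' \<Longrightarrow> stratum n S \<inter> stratum n S' = {}"
    "\<And>S. S \<in> \<S> \<Longrightarrow> stratum n S \<noteq> {}"
    "\<And>I c \<Psi>. (I, c, \<Psi>) \<in> \<S> \<Longrightarrow> I \<subseteq> {..<n} \<and> finite \<Psi> \<and> (\<forall>j i. c j i \<in> \<rat>) \<and>
      (\<forall>j\<in>I. \<forall>i\<in>I. c j i = (if i = j then 1 else 0))"
    "\<And>I c \<Psi> t. (I, c, \<Psi>) \<in> \<S> \<Longrightarrow> t \<in> T \<Longrightarrow>
      \<exists>\<tau>. \<forall>w\<in>stratum n (I, c, \<Psi>). teval t w = (\<Sum>i\<in>I. \<tau> i * w i)"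
  have "stratified_presentation n E p T \<S>"
    by (intro stratified_presentation.intro stratified_presentation_axioms.intro term_presentation_axioms S)
  then show thesis by (rule that)
qed

subsection \<open>Asymptotic counts in the cone\<close>

lemma teval_bounded: "\<exists>K::nat. \<forall>w b. (\<forall>i. 0 \<le> w i \<and> w i \<le> b) \<longrightarrow> teval t w \<le> real K * b"
proof (induction t)
  case (TVar i)
  show ?case by (intro exI[of _ 1]) simp
next
  case TZero
  show ?case by (intro exI[of _ 0]) simp
next
  case (TPlus s t)
  then obtain K K' where K: "\<And>w b. \<forall>i. 0 \<le> w i \<and> w i \<le> b \<Longrightarrow> teval s w \<le> real K * b"
    "\<And>w b. \<forall>i. 0 \<le> w i \<and> w i \<le> b \<Longrightarrow> teval t w \<le> real K' * b" by blast
  have "teval (TPlus s t) w \<le> real (K + K') * b" if "\<forall>i. 0 \<le> w i \<and> w i \<le> b" for w b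
    using K(1)[OF that] K(2)[OF that] by (simp add: algebra_simps)
  then show ?case by blast
next
  case (TMonus s t)
  then obtain K where K: "\<And>w b. \<forall>i. 0 \<le> w i \<and> w i \<le> b \<Longrightarrow> teval s w \<le> real K * b" by blast
  have "teval (TMonus s t) w \<le> real K * b" if w: "\<forall>i. 0 \<le> w i \<and> w i \<le> b" for w b
  proof -
    have "0 \<le> teval t w" by (rule teval_nonneg) (use w in blast)
    moreover have "0 \<le> b" using w by (meson order_trans)
    then have "0 \<le> real K * b" by simp
    ultimately show ?thesis using K[OF w] by simp
  qed
  then show ?case by blast
qed

text \<open>For strata of dimension \<open>c\<close> in a cone of dimension \<open>D\<close>: only
  those of full dimension contribute to the limit.\<close>

lemma tendsto_divide_higher_power:
  fixes a :: "nat \<Rightarrow> real"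
  assumes "(\<lambda>N. a N / real N ^ c) \<longlonglongrightarrow> L" "c \<le> D"
  shows "(\<lambda>N. a N / real N ^ D) \<longlonglongrightarrow> (if c = D then L else 0)"
proof (cases "c = D")
  case True
  then show ?thesis using assms(1) by simp
next
  case False
  have "(\<lambda>N. 1 / real N) \<longlonglongrightarrow> 0" by (rule lim_1_over_n)
  then have "(\<lambda>N. a N / real N ^ c * (1 / real N) ^ (D - c)) \<longlonglongrightarrow> L * 0 ^ (D - c)"
    by (intro tendsto_mult tendsto_power assms(1))
  moreover have "a N / real N ^ c * (1 / real N) ^ (D - c) = a N / real N ^ D" for N
  proof -
    have "real N ^ D = real N ^ c * real N ^ (D - c)" using assms(2) by (simp add: power_add[symmetric])
    moreover have "(1 / real N) ^ (D - c) = 1 / real N ^ (D - c)" by (rule power_one_over)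
    ultimately show ?thesis by simp
  qed
  ultimately show ?thesis using False assms(2) by (simp add: zero_power)
qed

lemma convergent_by_approximation:
  fixes f :: "nat \<Rightarrow> real"
  assumes g: "\<And>M. M \<ge> (1::nat) \<Longrightarrow> convergent (g M)"
    and fg: "\<And>M N. M \<ge> 1 \<Longrightarrow> \<bar>f N - g M N\<bar> \<le> C / real M"
  shows "convergent f"
proof (rule Cauchy_convergent, rule metric_CauchyI)
  fix e :: real assume e: "0 < e"
  obtain M0 :: nat where M0: "4 * C / e < real M0" using reals_Archimedean2 by blast
  define M where "M = max 1 M0"
  have M: "M \<ge> 1" "4 * C / e < real M" using M0 by (auto simp: M_def)
  then have CM: "C / real M < e / 4" using e by (simp add: field_simps)
  from metric_CauchyD[OF convergent_Cauchy[OF g[OF M(1)]], of "e / 4"] e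
  obtain N0 where N0: "\<And>m n. m \<ge> N0 \<Longrightarrow> n \<ge> N0 \<Longrightarrow> dist (g M m) (g M n) < e / 4" by auto
  have "dist (f m) (f n) < e" if "m \<ge> N0" "n \<ge> N0" for m n
    using N0[OF that] fg[OF M(1), of m] fg[OF M(1), of n] CM unfolding dist_real_def by linarith
  then show "\<exists>N0. \<forall>m\<ge>N0. \<forall>n\<ge>N0. dist (f m) (f n) < e" by blast
qed

context term_presentation
begin

definition prim_level :: "hterm \<Rightarrow> nat \<Rightarrow> (nat \<Rightarrow> nat) set" where
  "prim_level u N = {v \<in> Prim. neval u v \<le> N}"

definition prim_sum :: "hterm \<Rightarrow> hterm \<Rightarrow> nat \<Rightarrow> real" where
  "prim_sum u h N = (\<Sum>v\<in>prim_level u N. real (neval h v) / real (neval u v))"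

end

context stratified_presentation
begin

text \<open>Integral points of the stratum correspond to good vectors of free coordinates. As
  \<open>u\<close> and \<open>h\<close> are linear on the stratum, bounding \<open>u\<close> and
  adding the condition \<open>j * u < M * h\<close> keeps the region polyhedral.\<close>

lemma stratum_count:
  fixes j M :: nat
  assumes S: "(I, c, \<Psi>) \<in> \<S>" and uT: "u \<in> T" and hT: "h \<in> T" and u: "is_unit u k"
  defines "X \<equiv> \<lambda>N. {v. (\<lambda>i. real (v i)) \<in> stratum n (I, c, \<Psi>) \<and> neval u v \<le> N \<and> j * neval u v < M * neval h v}"
  obtains L where "(\<lambda>N. real (card (X N)) / real N ^ card I) \<longlonglongrightarrow> L" "\<And>N. finite (X N)"
    "\<And>w. w \<in> stratum n (I, c, \<Psi>) \<Longrightarrow> real j * teval u w < real M * teval h w \<Longrightarrow> L > 0"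
proof -
  have fin\<Psi>: "finite \<Psi>" and cQ: "\<And>j i. c j i \<in> \<rat>" and finI: "finite I"
    using S_props[OF S] finite_subset by auto
  obtain \<tau>u where \<tau>u: "\<And>w. w \<in> stratum n (I, c, \<Psi>) \<Longrightarrow> teval u w = (\<Sum>i\<in>I. \<tau>u i * w i)"
    using S_linear[OF S uT] by blast
  obtain \<tau>h where \<tau>h: "\<And>w. w \<in> stratum n (I, c, \<Psi>) \<Longrightarrow> teval h w = (\<Sum>i\<in>I. \<tau>h i * w i)"
    using S_linear[OF S hT] by blast
  \<comment> \<open>The threshold condition as one further strict inequality of the cone.\<close>
  define \<psi>0 where "\<psi>0 i = real M * \<tau>h i - real j * \<tau>u i" for i
  have \<psi>0: "(\<Sum>i\<in>I. \<psi>0 i * w i) = real M * teval h w - real j * teval u w" if "w \<in> stratum n (I, c, \<Psi>)" for w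
    unfolding \<tau>u[OF that] \<tau>h[OF that] \<psi>0_def
    by (simp add: left_diff_distrib sum_subtractf sum_distrib_left mult.assoc)
  \<comment> \<open>The dependent coordinates must be integral too. The coefficients are rational,
    so this is periodic modulo a common denominator.\<close>
  define good where "good a \<longleftrightarrow> (\<forall>l<n. (\<Sum>i\<in>I. c l i * real (a i)) \<in> \<int>)" for a :: "nat \<Rightarrow> nat"
  have "finite ((\<lambda>(l, i). c l i) ` ({..<n} \<times> I))" "(\<lambda>(l, i). c l i) ` ({..<n} \<times> I) \<subseteq> \<rat>"
    using finI cQ by auto
  from common_denominator[OF this] obtain m where m: "m \<ge> (1::nat)"
    and mr: "\<forall>r\<in>(\<lambda>(l, i). c l i) ` ({..<n} \<times> I). real m * r \<in> \<int>" by blast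
  have mc: "real m * c l i \<in> \<int>" if "l < n" "i \<in> I" for l i
    using bspec[OF mr, of "c l i"] that by force
  have periodic: "good b" if ab: "\<And>i. i \<in> I \<Longrightarrow> a i mod m = b i mod m" and a: "good a" for a b
    unfolding good_def
  proof (intro allI impI)
    fix l assume l: "l < n"
    have "(\<Sum>i\<in>I. c l i * real (b i)) - (\<Sum>i\<in>I. c l i * real (a i)) =
        (\<Sum>i\<in>I. (real m * c l i) * of_int (int (b i div m) - int (a i div m)))"
      unfolding sum_subtractf[symmetric]
    proof (intro sum.cong refl)
      fix i assume i: "i \<in> I"
      have "real (b i) = real m * real (b i div m) + real (b i mod m)"
        "real (a i) = real m * real (a i div m) + real (a i mod m)"
        by (simp_all flip: of_nat_mult of_nat_add)
      then have "real (b i) - real (a i) = real m * (real (b i div m) - real (a i div m))"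
        using ab[OF i] by (simp add: algebra_simps)
      then show "c l i * real (b i) - c l i * real (a i) = real m * c l i * of_int (int (b i div m) - int (a i div m))"
        by (simp add: right_diff_distrib[symmetric] mult.assoc mult.left_commute)
    qed
    also have "\<dots> \<in> \<int>" by (intro Ints_sum Ints_mult[OF mc[OF l] Ints_of_int])
    finally have "(\<Sum>i\<in>I. c l i * real (b i)) - (\<Sum>i\<in>I. c l i * real (a i)) \<in> \<int>" .
    moreover have "(\<Sum>i\<in>I. c l i * real (a i)) \<in> \<int>" using a l by (simp add: good_def)
    ultimately have "((\<Sum>i\<in>I. c l i * real (b i)) - (\<Sum>i\<in>I. c l i * real (a i))) + (\<Sum>i\<in>I. c l i * real (a i)) \<in> \<int>"
      by (rule Ints_add)
    then show "(\<Sum>i\<in>I. c l i * real (b i)) \<in> \<int>" by simp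
  qed
  have exst: "extend I c a \<in> stratum n (I, c, \<Psi>)" "teval u (extend I c a) = (\<Sum>i\<in>I. \<tau>u i * a i)"
    if "\<And>\<psi>. \<psi> \<in> insert \<psi>0 \<Psi> \<Longrightarrow> 0 < (\<Sum>i\<in>I. \<psi> i * a i)" for a
  proof -
    show st: "extend I c a \<in> stratum n (I, c, \<Psi>)" by (rule extend_in_stratum[OF S that]) simp
    show "teval u (extend I c a) = (\<Sum>i\<in>I. \<tau>u i * a i)"
      unfolding \<tau>u[OF st] using extend_on[OF S] by (intro sum.cong) auto
  qed
  interpret lr: lattice_region I "insert \<psi>0 \<Psi>" \<tau>u m good k
  proof
    show "finite I" "finite (insert \<psi>0 \<Psi>)" "m \<ge> 1" using finI fin\<Psi> m by auto
    show "good a = good b" if "\<And>i. i \<in> I \<Longrightarrow> a i mod m = b i mod m" for a b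
      using periodic[of a b] periodic[of b a] that by auto
    show "a i \<le> real k" if a: "\<And>\<psi>. \<psi> \<in> insert \<psi>0 \<Psi> \<Longrightarrow> 0 < (\<Sum>i\<in>I. \<psi> i * a i)"
      and le: "(\<Sum>i\<in>I. \<tau>u i * a i) \<le> 1" and i: "i \<in> I" for a i
    proof -
      have e: "teval u (extend I c a) = (\<Sum>i\<in>I. \<tau>u i * a i)" by (rule exst(2)) (rule a)
      have "extend I c a i \<le> real k * teval u (extend I c a)"
        using u stratum_subset_W[OF S exst(1)[of a, OF a]] unfolding is_unit_def by blast
      also have "\<dots> \<le> real k * 1" unfolding e using le by (intro mult_left_mono) auto
      finally show ?thesis using extend_on[OF S i] by simp
    qed
  qed
  have bij: "bij_betw (\<lambda>v. restrict v I) (X N) (lr.points N)" for N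
  proof (rule bij_betw_byWitness[where f' = "\<lambda>a l. nat \<lfloor>extend I c (\<lambda>i. real (a i)) l\<rfloor>"])
    have r: "extend I c (\<lambda>i. real (restrict v I i)) = extend I c (\<lambda>i. real (v i))" for v
      unfolding extend_def by (intro ext if_cong sum.cong refl) auto
    show "\<forall>v\<in>X N. (\<lambda>l. nat \<lfloor>extend I c (\<lambda>i. real (restrict v I i)) l\<rfloor>) = v"
    proof
      fix v assume "v \<in> X N"
      then have "(\<lambda>i. real (v i)) \<in> stratum n (I, c, \<Psi>)" by (simp add: X_def)
      then have "(\<lambda>i. real (v i)) = extend I c (\<lambda>i. real (v i))" by (rule stratum_extend)
      then have "extend I c (\<lambda>i. real (v i)) l = real (v l)" for l by (rule fun_cong[THEN sym])
      then show "(\<lambda>l. nat \<lfloor>extend I c (\<lambda>i. real (restrict v I i)) l\<rfloor>) = v" unfolding r by auto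
    qed
    have pts: "extend I c (\<lambda>i. real (a i)) \<in> stratum n (I, c, \<Psi>)"
      "real (nat \<lfloor>extend I c (\<lambda>i. real (a i)) l\<rfloor>) = extend I c (\<lambda>i. real (a i)) l"
      if a: "a \<in> lr.points N" for a l
    proof -
      show st: "extend I c (\<lambda>i. real (a i)) \<in> stratum n (I, c, \<Psi>)"
        using a unfolding lr.points_def by (intro exst) blast
      have "extend I c (\<lambda>i. real (a i)) l \<in> \<int>"
        using a unfolding lr.points_def good_def extend_def by auto
      moreover have "0 \<le> extend I c (\<lambda>i. real (a i)) l" by (rule W_D(1)[OF stratum_subset_W[OF S st]])
      ultimately show "real (nat \<lfloor>extend I c (\<lambda>i. real (a i)) l\<rfloor>) = extend I c (\<lambda>i. real (a i)) l"
        by (auto elim!: Ints_cases)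
    qed
    show "\<forall>a\<in>lr.points N. restrict (\<lambda>l. nat \<lfloor>extend I c (\<lambda>i. real (a i)) l\<rfloor>) I = a"
    proof
      fix a assume a: "a \<in> lr.points N"
      show "restrict (\<lambda>l. nat \<lfloor>extend I c (\<lambda>i. real (a i)) l\<rfloor>) I = a"
      proof (rule PiE_ext)
        show "a \<in> PiE I (\<lambda>_. UNIV)" using a by (simp add: lr.points_def)
        show "restrict (\<lambda>l. nat \<lfloor>extend I c (\<lambda>i. real (a i)) l\<rfloor>) I i = a i" if "i \<in> I" for i
          using that extend_on[OF S that, of "\<lambda>i. real (a i)"] by simp
      qed simp
    qed
    show "(\<lambda>v. restrict v I) ` X N \<subseteq> lr.points N"
    proof
      fix a assume "a \<in> (\<lambda>v. restrict v I) ` X N"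
      then obtain v where v: "v \<in> X N" "a = restrict v I" by blast
      have st: "(\<lambda>i. real (v i)) \<in> stratum n (I, c, \<Psi>)" using v(1) by (simp add: X_def)
      have sums: "(\<Sum>i\<in>I. f i * real (a i)) = (\<Sum>i\<in>I. f i * real (v i))" for f :: "nat \<Rightarrow> real"
        unfolding v(2) by (intro sum.cong) auto
      have "good a"
        unfolding good_def sums
      proof (intro allI impI)
        fix l assume "l < n"
        then have "(\<Sum>i\<in>I. c l i * real (v i)) = real (v l)"
          using fun_cong[OF stratum_extend[OF st], of l] by (simp add: extend_def)
        then show "(\<Sum>i\<in>I. c l i * real (v i)) \<in> \<int>" by simp
      qed
      moreover have "\<forall>\<psi>\<in>insert \<psi>0 \<Psi>. 0 < (\<Sum>i\<in>I. \<psi> i * real (a i))"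
      proof
        fix \<psi> assume "\<psi> \<in> insert \<psi>0 \<Psi>"
        then consider "\<psi> = \<psi>0" | "\<psi> \<in> \<Psi>" by blast
        then show "0 < (\<Sum>i\<in>I. \<psi> i * real (a i))"
        proof cases
          case 1
          have "j * neval u v < M * neval h v" using v(1) by (simp add: X_def)
          then have "real (j * neval u v) < real (M * neval h v)" by (simp only: of_nat_less_iff)
          then show ?thesis unfolding sums 1 \<psi>0[OF st] teval_of_nat by simp
        next
          case 2
          then show ?thesis unfolding sums using st by (simp add: stratum_def)
        qed
      qed
      moreover have "(\<Sum>i\<in>I. \<tau>u i * real (a i)) \<le> real N"
        unfolding sums \<tau>u[OF st, symmetric] teval_of_nat using v(1) by (simp add: X_def)
      moreover have "a \<in> PiE I (\<lambda>_. UNIV)" by (simp add: v(2))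
      ultimately show "a \<in> lr.points N" by (simp add: lr.points_def)
    qed
    show "(\<lambda>a l. nat \<lfloor>extend I c (\<lambda>i. real (a i)) l\<rfloor>) ` lr.points N \<subseteq> X N"
    proof
      fix v assume "v \<in> (\<lambda>a l. nat \<lfloor>extend I c (\<lambda>i. real (a i)) l\<rfloor>) ` lr.points N"
      then obtain a where a: "a \<in> lr.points N" and v: "v = (\<lambda>l. nat \<lfloor>extend I c (\<lambda>i. real (a i)) l\<rfloor>)" by blast
      have rv: "(\<lambda>i. real (v i)) = extend I c (\<lambda>i. real (a i))" unfolding v pts(2)[OF a] ..
      note st = pts(1)[OF a, folded rv]
      have "real (neval u v) = teval u (\<lambda>i. real (v i))" by (rule teval_of_nat[symmetric])
      also have "\<dots> = (\<Sum>i\<in>I. \<tau>u i * real (a i))"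
        unfolding rv using a unfolding lr.points_def by (intro exst(2)) blast
      also have "\<dots> \<le> real N" using a by (simp add: lr.points_def)
      finally have 1: "neval u v \<le> N" by simp
      have "0 < (\<Sum>i\<in>I. \<psi>0 i * real (a i))" using a by (simp add: lr.points_def)
      also have "\<dots> = (\<Sum>i\<in>I. \<psi>0 i * real (v i))"
        unfolding v pts(2)[OF a] using extend_on[OF S, of _ "\<lambda>i. real (a i)"] by (intro sum.cong) auto
      also have "\<dots> = real M * real (neval h v) - real j * real (neval u v)"
        unfolding \<psi>0[OF st] teval_of_nat ..
      finally have "real (j * neval u v) < real (M * neval h v)" by simp
      then have 2: "j * neval u v < M * neval h v" by (simp only: of_nat_less_iff)
      show "v \<in> X N" unfolding X_def using st 1 2 by simp
    qed
  qed
  have card: "card (X N) = card (lr.points N)" "finite (X N)" for N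
    using bij_betw_same_card[OF bij] bij_betw_finite[OF bij] lr.finite_points by auto
  show thesis
  proof (rule lr.card_points_limit)
    fix L assume L: "(\<lambda>N. real (card (lr.points N)) / real N ^ card I) \<longlonglongrightarrow> L"
      "\<And>a0. (\<And>i. i \<in> I \<Longrightarrow> 0 \<le> a0 i) \<Longrightarrow> (\<And>\<psi>. \<psi> \<in> insert \<psi>0 \<Psi> \<Longrightarrow> 0 < (\<Sum>i\<in>I. \<psi> i * a0 i)) \<Longrightarrow> good (\<lambda>i. 0) \<Longrightarrow> L > 0"
    show thesis
    proof (rule that)
      show "(\<lambda>N. real (card (X N)) / real N ^ card I) \<longlonglongrightarrow> L" unfolding card(1) by (rule L(1))
      show "finite (X N)" for N by (rule card(2))
      show "L > 0" if w: "w \<in> stratum n (I, c, \<Psi>)" "real j * teval u w < real M * teval h w" for w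
      proof (rule L(2))
        show "0 \<le> w i" for i by (rule W_D(1)[OF stratum_subset_W[OF S w(1)]])
        show "0 < (\<Sum>i\<in>I. \<psi> i * w i)" if "\<psi> \<in> insert \<psi>0 \<Psi>" for \<psi>
        proof (cases "\<psi> = \<psi>0")
          case True
          then show ?thesis using w(2) by (simp add: \<psi>0[OF w(1)])
        next
          case False
          then show ?thesis using w(1) that by (simp add: stratum_def)
        qed
        show "good (\<lambda>i. 0)" by (simp add: good_def)
      qed
    qed
  qed
qed

definition level :: "hterm \<Rightarrow> nat \<Rightarrow> (nat \<Rightarrow> nat) set" where
  "level u N = {v. (\<lambda>i. real (v i)) \<in> W \<and> 1 \<le> neval u v \<and> neval u v \<le> N}"

text \<open>The counts of the disjoint strata add up. The limit is positive if the condition holds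
  at all nonzero points, because a top stratum then contributes a positive amount.\<close>

lemma superlevel_count:
  fixes j M :: nat
  assumes uT: "u \<in> T" and hT: "h \<in> T" and u: "is_unit u k"
  defines "X \<equiv> \<lambda>N. {v. (\<lambda>i. real (v i)) \<in> W \<and> neval u v \<le> N \<and> j * neval u v < M * neval h v}"
  obtains L where "(\<lambda>N. real (card (X N)) / real N ^ D) \<longlonglongrightarrow> L" "\<And>N. finite (X N)"
    "(\<forall>w i. w \<in> W \<longrightarrow> w i > 0 \<longrightarrow> real j * teval u w < real M * teval h w) \<longrightarrow> L > 0"
proof -
  define Y where "Y S N = {v. (\<lambda>i. real (v i)) \<in> stratum n S \<and> neval u v \<le> N \<and> j * neval u v < M * neval h v}" for S N
  have "\<forall>S\<in>\<S>. \<exists>L. ((\<lambda>N. real (card (Y S N)) / real N ^ card (fst S)) \<longlonglongrightarrow> L) \<and> (\<forall>N. finite (Y S N)) \<and>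
      (\<forall>w\<in>stratum n S. real j * teval u w < real M * teval h w \<longrightarrow> L > 0)"
  proof
    fix S assume S: "S \<in> \<S>"
    obtain I c \<Psi> where Sc: "S = (I, c, \<Psi>)" by (cases S)
    show "\<exists>L. ((\<lambda>N. real (card (Y S N)) / real N ^ card (fst S)) \<longlonglongrightarrow> L) \<and> (\<forall>N. finite (Y S N)) \<and>
      (\<forall>w\<in>stratum n S. real j * teval u w < real M * teval h w \<longrightarrow> L > 0)"
      unfolding Sc fst_conv
    proof (rule stratum_count[OF S[unfolded Sc] uT hT u, of j M, folded Y_def])
      fix L
      assume "(\<lambda>N. real (card (Y (I, c, \<Psi>) N)) / real N ^ card I) \<longlonglongrightarrow> L" "\<And>N. finite (Y (I, c, \<Psi>) N)"
        "\<And>w. w \<in> stratum n (I, c, \<Psi>) \<Longrightarrow> real j * teval u w < real M * teval h w \<Longrightarrow> L > 0"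
      then show "\<exists>L. ((\<lambda>N. real (card (Y (I, c, \<Psi>) N)) / real N ^ card I) \<longlonglongrightarrow> L) \<and> (\<forall>N. finite (Y (I, c, \<Psi>) N)) \<and>
        (\<forall>w\<in>stratum n (I, c, \<Psi>). real j * teval u w < real M * teval h w \<longrightarrow> L > 0)"
            by (intro exI[of _ L] conjI allI ballI impI)
    qed
  qed
  from bchoice[OF this] obtain l where l: "\<And>S. S \<in> \<S> \<Longrightarrow> (\<lambda>N. real (card (Y S N)) / real N ^ card (fst S)) \<longlonglongrightarrow> l S"
    "\<And>S N. S \<in> \<S> \<Longrightarrow> finite (Y S N)"
    "\<And>S w. S \<in> \<S> \<Longrightarrow> w \<in> stratum n S \<Longrightarrow> real j * teval u w < real M * teval h w \<Longrightarrow> l S > 0" by blast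
  have XY: "X N = (\<Union>S\<in>\<S>. Y S N)" for N
    unfolding X_def Y_def using S_union by auto
  have disj: "Y S N \<inter> Y S' N = {}" if "S \<in> \<S>" "S' \<in> \<S>" "S \<noteq> S'" for S S' N
    using S_disj[OF that] unfolding Y_def by blast
  have card: "card (X N) = (\<Sum>S\<in>\<S>. card (Y S N))" for N
    unfolding XY using S_fin l(2) disj by (intro card_UN_disjoint) auto
  have lim: "(\<lambda>N. real (card (Y S N)) / real N ^ D) \<longlonglongrightarrow> (if card (fst S) = D then l S else 0)" if "S \<in> \<S>" for S
    using tendsto_divide_higher_power[OF l(1)[OF that] card_le_D[OF that]] .
  have "(\<lambda>N. \<Sum>S\<in>\<S>. real (card (Y S N)) / real N ^ D) \<longlonglongrightarrow> (\<Sum>S\<in>\<S>. if card (fst S) = D then l S else 0)"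
    by (intro tendsto_sum lim)
  moreover have "real (card (X N)) / real N ^ D = (\<Sum>S\<in>\<S>. real (card (Y S N)) / real N ^ D)" for N
    unfolding card by (simp add: sum_divide_distrib)
  ultimately have conv: "(\<lambda>N. real (card (X N)) / real N ^ D) \<longlonglongrightarrow> (\<Sum>S\<in>\<S>. if card (fst S) = D then l S else 0)"
    by simp
  show thesis
  proof (rule that[OF conv])
    show "finite (X N)" for N unfolding XY using S_fin l(2) by auto
    show "(\<forall>w i. w \<in> W \<longrightarrow> w i > 0 \<longrightarrow> real j * teval u w < real M * teval h w) \<longrightarrow>
      0 < (\<Sum>S\<in>\<S>. if card (fst S) = D then l S else 0)"
    proof
      assume pos: "\<forall>w i. w \<in> W \<longrightarrow> w i > 0 \<longrightarrow> real j * teval u w < real M * teval h w"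
      obtain I c \<Psi> w i where S: "(I, c, \<Psi>) \<in> \<S>" "card I = D" "w \<in> stratum n (I, c, \<Psi>)" "i \<in> I" "0 < w i"
        by (rule top_stratum)
      have "0 < l (I, c, \<Psi>)" using pos stratum_subset_W[OF S(1,3)] S(5) l(3)[OF S(1,3)] by blast
      moreover have "0 \<le> l S" if "S \<in> \<S>" for S
        by (rule tendsto_lowerbound[OF l(1)[OF that]]) auto
      ultimately show "0 < (\<Sum>S\<in>\<S>. if card (fst S) = D then l S else 0)"
        using S(1,2) S_fin by (intro sum_pos2[where i = "(I, c, \<Psi>)"]) auto
    qed
  qed
qed

text \<open>The superlevel count with \<open>h = u\<close>, \<open>j = 0\<close> and
  \<open>M = 1\<close>: the condition \<open>0 < u\<close> removes just the zero vector.\<close>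

lemma level_count:
  assumes uT: "u \<in> T" and u: "is_unit u k"
  obtains L where "(\<lambda>N. real (card (level u N)) / real N ^ D) \<longlonglongrightarrow> L" "\<And>N. finite (level u N)" "L > 0"
proof -
  have lev: "level u N = {v. (\<lambda>i. real (v i)) \<in> W \<and> neval u v \<le> N \<and> 0 * neval u v < 1 * neval u v}" for N
    unfolding level_def by auto
  show thesis
  proof (rule superlevel_count[OF uT uT u, of 0 1, folded lev])
    fix L assume L: "(\<lambda>N. real (card (level u N)) / real N ^ D) \<longlonglongrightarrow> L" "\<And>N. finite (level u N)"
      "(\<forall>w i. w \<in> W \<longrightarrow> w i > 0 \<longrightarrow> real 0 * teval u w < real 1 * teval u w) \<longrightarrow> L > 0"
    have "L > 0"
    proof (rule L(3)[THEN mp], intro allI impI)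
      fix w i assume "w \<in> W" "w i > 0"
      then show "real 0 * teval u w < real 1 * teval u w" using unit_pos[OF u, of w i] by simp
    qed
    then show thesis using that L by blast
  qed
qed

definition weight_sum :: "hterm \<Rightarrow> hterm \<Rightarrow> nat \<Rightarrow> real" where
  "weight_sum u h N = (\<Sum>v\<in>level u N. real (neval h v) / real (neval u v))"

text \<open>A layer-cake decomposition of the weights reduces weighted sums to counting.\<close>

lemma weight_sum_convergent:
  assumes uT: "u \<in> T" and hT: "h \<in> T" and u: "is_unit u k"
  shows "convergent (\<lambda>N. weight_sum u h N / real N ^ D)"
proof -
  obtain K0 :: nat where K0: "\<And>w b. \<forall>i. 0 \<le> w i \<and> w i \<le> b \<Longrightarrow> teval h w \<le> real K0 * b"
    using teval_bounded[of h] by blast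
  \<comment> \<open>\<open>K0\<close> bounds \<open>h\<close> by the coordinates and
    \<open>k\<close> the coordinates by \<open>u\<close>, so weights are at most \<open>K\<close>,
    and thresholds \<open>j / M\<close> with \<open>j < M * K\<close> suffice.\<close>
  define K where "K = K0 * k"
  have hK: "neval h v \<le> K * neval u v" if "(\<lambda>i. real (v i)) \<in> W" for v
  proof -
    have "\<forall>w\<in>W. \<forall>i. w i \<le> real k * teval u w" using u by (simp add: is_unit_def)
    from bspec[OF this that] have "teval h (\<lambda>i. real (v i)) \<le> real K0 * (real k * teval u (\<lambda>i. real (v i)))"
      by (intro K0) simp
    then have "real (neval h v) \<le> real (K * neval u v)" by (simp add: teval_of_nat K_def mult.assoc)
    then show ?thesis by (simp only: of_nat_le_iff)
  qed
  obtain L where L: "(\<lambda>N. real (card (level u N)) / real N ^ D) \<longlonglongrightarrow> L" "\<And>N. finite (level u N)"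
    using level_count[OF uT u] by blast
  obtain C where C: "\<And>N. \<bar>real (card (level u N)) / real N ^ D\<bar> \<le> C"
    using convergent_imp_Bseq[OF convergentI[OF L(1)]] by (auto simp: Bseq_def)
  define X where "X M j N = {v. (\<lambda>i. real (v i)) \<in> W \<and> neval u v \<le> N \<and> j * neval u v < M * neval h v}" for M j N
  have Xlev: "X M j N = {v \<in> level u N. j * neval u v < M * neval h v}" for M j N
  proof -
    have "1 \<le> neval u v" if "(\<lambda>i. real (v i)) \<in> W" "j * neval u v < M * neval h v" for v
      using hK[OF that(1)] that(2) by (cases "neval u v") auto
    then show ?thesis unfolding X_def level_def by auto
  qed
  \<comment> \<open>Each weight is replaced by \<open>1 / M\<close> times the number of thresholds
    \<open>j / M\<close> below it, an error of at most \<open>1 / M\<close> per vector.\<close>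
  define g where "g M N = (\<Sum>j<M * K. real (card (X M j N))) / real M / real N ^ D" for M N
  show ?thesis
  proof (rule convergent_by_approximation[where g = g and C = C])
    fix M :: nat assume M: "M \<ge> 1"
    have "\<exists>l. (\<lambda>N. real (card (X M j N)) / real N ^ D) \<longlonglongrightarrow> l" for j
      unfolding X_def by (rule superlevel_count[OF uT hT u, of j M]) blast
    then obtain l where l: "\<And>j. (\<lambda>N. real (card (X M j N)) / real N ^ D) \<longlonglongrightarrow> l j" by metis
    have "(\<lambda>N. (\<Sum>j<M * K. real (card (X M j N)) / real N ^ D) / real M) \<longlonglongrightarrow> (\<Sum>j<M * K. l j) / real M"
      using M by (intro tendsto_divide tendsto_sum l tendsto_const) auto
    moreover have "g M = (\<lambda>N. (\<Sum>j<M * K. real (card (X M j N)) / real N ^ D) / real M)"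
      unfolding g_def by (intro ext) (simp add: sum_divide_distrib mult.commute)
    ultimately show "convergent (g M)" by (simp only: convergentI)
    fix N
    have pt: "\<bar>real (neval h v) / real (neval u v) - real (card {j \<in> {..<M * K}. j * neval u v <
        M * neval h v}) / real M\<bar> \<le> 1 / real M"
      if v: "v \<in> level u N" for v
    proof -
      let ?u = "neval u v" and ?h = "neval h v"
      have u1: "?u \<ge> 1" and hle: "?h \<le> K * ?u" using v hK by (auto simp: level_def)
      \<comment> \<open>The quotient of \<open>M * ?h\<close> by \<open>?u\<close> rounded up, which
        is the number of thresholds passed.\<close>
      define J where "J = (M * ?h + ?u - 1) div ?u"
      have iff: "j < J \<longleftrightarrow> j * ?u < M * ?h" for j
      proof -
        have "j < J \<longleftrightarrow> Suc j * ?u \<le> M * ?h + ?u - 1"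
          unfolding J_def Suc_le_eq[symmetric] using u1 by (simp add: less_eq_div_iff_mult_less_eq)
        then show ?thesis using u1 by auto
      qed
      have "{j \<in> {..<M * K}. j * ?u < M * ?h} = {..<J}"
      proof (intro equalityI subsetI)
        fix j assume "j \<in> {..<J}"
        then have lt: "j * ?u < M * ?h" using iff by simp
        also have "\<dots> \<le> M * (K * ?u)" using hle by (rule mult_left_mono) simp
        finally have "j * ?u < M * K * ?u" by (simp add: mult.assoc)
        then have "j < M * K" by simp
        then show "j \<in> {j \<in> {..<M * K}. j * ?u < M * ?h}" using lt by simp
      qed (use iff in auto)
      then have cardJ: "card {j \<in> {..<M * K}. j * ?u < M * ?h} = J" by simp
      have "\<not> J * ?u < M * ?h" using iff[of J] by simp
      then have "real (M * ?h) \<le> real (J * ?u)" by (simp only: of_nat_le_iff not_less)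
      moreover have "real (J * ?u) \<le> real (M * ?h + ?u)"
      proof -
        have "J * ?u \<le> M * ?h + ?u - 1" unfolding J_def by (rule div_times_less_eq_dividend)
        then have "J * ?u \<le> M * ?h + ?u" by linarith
        then show ?thesis by (simp only: of_nat_le_iff)
      qed
      ultimately have "0 \<le> real J * real ?u - real M * real ?h" "real J * real ?u - real M * real ?h \<le> real ?u"
        by simp_all
      then have ab: "\<bar>real M * real ?h - real J * real ?u\<bar> \<le> real ?u" by simp
      have "real ?h / real ?u - real J / real M = (real M * real ?h - real J * real ?u) / (real M * real ?u)"
        using u1 M by (simp add: field_simps)
      then have "\<bar>real ?h / real ?u - real J / real M\<bar> = \<bar>real M * real ?h - real J * real ?u\<bar> / (real M * real ?u)"
        by (simp add: abs_divide abs_mult)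
      also have "\<dots> \<le> real ?u / (real M * real ?u)" using ab by (intro divide_right_mono) auto
      also have "\<dots> = 1 / real M" using u1 by simp
      finally show ?thesis unfolding cardJ .
    qed
    have swap: "(\<Sum>j<M * K. real (card (X M j N))) =
        (\<Sum>v\<in>level u N. real (card {j \<in> {..<M * K}. j * neval u v < M * neval h v}))"
    proof -
      have "(\<Sum>j<M * K. real (card (X M j N))) =
          (\<Sum>j<M * K. \<Sum>v\<in>level u N. if j * neval u v < M * neval h v then 1 else 0)"
        unfolding Xlev using L(2) by (intro sum.cong refl) (simp add: sum.If_cases Int_def)
      also have "\<dots> = (\<Sum>v\<in>level u N. \<Sum>j<M * K. if j * neval u v < M * neval h v then 1 else 0)"
        by (rule sum.swap)
      also have "\<dots> = (\<Sum>v\<in>level u N. real (card {j \<in> {..<M * K}. j * neval u v < M * neval h v}))"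
        by (intro sum.cong refl) (simp add: sum.If_cases Int_def)
      finally show ?thesis .
    qed
    have "\<bar>weight_sum u h N - (\<Sum>j<M * K. real (card (X M j N))) / real M\<bar> \<le> (\<Sum>v\<in>level u N. 1 / real M)"
      unfolding weight_sum_def swap sum_divide_distrib sum_subtractf[symmetric]
      using pt by (intro order_trans[OF sum_abs] sum_mono) blast
    then have "\<bar>weight_sum u h N - (\<Sum>j<M * K. real (card (X M j N))) / real M\<bar> / real N ^ D \<le>
        real (card (level u N)) / real M / real N ^ D"
      by (intro divide_right_mono) auto
    also have "\<dots> = (real (card (level u N)) / real N ^ D) / real M" by (simp add: mult.commute)
    also have "\<dots> \<le> C / real M" using C[of N] by (intro divide_right_mono) auto
    finally show "\<bar>weight_sum u h N / real N ^ D - g M N\<bar> \<le> C / real M"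
      unfolding g_def diff_divide_distrib[symmetric] abs_divide by simp
  qed
qed

lemma prim_level_subset: "is_unit u k \<Longrightarrow> prim_level u N \<subseteq> level u N"
  using Prim_unit_pos[of u k] unfolding prim_level_def level_def Prim_def by auto

lemma Gcd_scaled_image: "Gcd ((\<lambda>i. k * v i) ` S) = k * Gcd (v ` S)" for k :: nat and v :: "nat \<Rightarrow> nat"
proof -
  have "(\<lambda>i. k * v i) ` S = (*) k ` (v ` S)" by auto
  then show ?thesis by (simp add: Gcd_mult)
qed

lemma W_nat_supp: "(\<lambda>i. real (v i)) \<in> W \<Longrightarrow> i \<ge> n \<Longrightarrow> v i = 0"
  using W_D(2)[of "\<lambda>i. real (v i)" i] by simp

text \<open>Every nonzero integral vector of the cone is a unique multiple \<open>l * v\<close> of a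
  primitive one. The weight is homogeneous of degree 0 and so is that of \<open>v\<close>, while the
  bound \<open>N\<close> on the unit becomes \<open>N div l\<close>.\<close>

lemma weight_sum_eq_prim_sums:
  assumes u: "is_unit u k" and fin: "\<And>N. finite (level u N)"
  shows "weight_sum u h N = (\<Sum>l=1..N. prim_sum u h (N div l))"
proof -
  let ?G = "Sigma {1..N} (\<lambda>l. prim_level u (N div l))"
  let ?f = "\<lambda>v. real (neval h v) / real (neval u v)"
  have "(\<Sum>l=1..N. prim_sum u h (N div l)) = (\<Sum>(l, v)\<in>?G. ?f v)"
    unfolding prim_sum_def
    by (rule sum.Sigma) (auto intro: finite_subset[OF prim_level_subset[OF u] fin])
  also have "\<dots> = (\<Sum>v\<in>level u N. ?f v)"
  proof (rule sum.reindex_bij_witness[where j = "\<lambda>(l, v) i. l * v i" and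
        i = "\<lambda>w. (Gcd (w ` {..<n}), \<lambda>i. w i div Gcd (w ` {..<n}))"])
    fix a assume "a \<in> ?G"
    then obtain l v where a: "a = (l, v)" and l: "1 \<le> l" "l \<le> N" and v: "v \<in> Prim" "neval u v \<le> N div l"
      by (auto simp: prim_level_def)
    have G: "Gcd ((\<lambda>i. l * v i) ` {..<n}) = l" unfolding Gcd_scaled_image using v(1) by (simp add: Prim_def)
    show "(\<lambda>w. (Gcd (w ` {..<n}), \<lambda>i. w i div Gcd (w ` {..<n}))) ((\<lambda>(l, v) i. l * v i) a) = a"
      unfolding a prod.case G using l by simp
    have "(\<lambda>i. real (l * v i)) \<in> W"
      using W_scale[of "\<lambda>i. real (v i)" "real l"] v(1) by (simp add: Prim_def)
    moreover have "1 \<le> neval u (\<lambda>i. l * v i)" unfolding neval_scale using l Prim_unit_pos[OF u v(1)] by simp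
    moreover have "neval u (\<lambda>i. l * v i) \<le> N"
      unfolding neval_scale using v(2) l by (simp add: less_eq_div_iff_mult_less_eq mult.commute)
    ultimately show "(\<lambda>(l, v) i. l * v i) a \<in> level u N" unfolding a prod.case level_def by simp
    show "?f ((\<lambda>(l, v) i. l * v i) a) = (case a of (l, v) \<Rightarrow> ?f v)"
      unfolding a prod.case neval_scale using l by simp
  next
    fix w assume w: "w \<in> level u N"
    define g where "g = Gcd (w ` {..<n})"
    define v where "v i = w i div g" for i
    have wW: "(\<lambda>i. real (w i)) \<in> W" and wu: "1 \<le> neval u w" "neval u w \<le> N" using w by (auto simp: level_def)
    have gv: "g * v i = w i" for i
    proof (cases "i < n")
      case True
      then have "g dvd w i" unfolding g_def by (intro Gcd_dvd) auto
      then show ?thesis by (simp add: v_def)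
    next
      case False
      then show ?thesis using W_nat_supp[OF wW, of i] by (simp add: v_def)
    qed
    have wgv: "w = (\<lambda>i. g * v i)" using gv by auto
    have nu: "neval u w = g * neval u v" by (subst wgv) (rule neval_scale)
    then have g1: "1 \<le> g" "1 \<le> neval u v" using wu(1) by (cases g; cases "neval u v"; simp)+
    have "g = g * Gcd (v ` {..<n})" unfolding Gcd_scaled_image[symmetric] gv by (simp add: g_def)
    then have Gv: "Gcd (v ` {..<n}) = 1" using g1(1) by simp
    have "(\<lambda>i. 1 / real g * real (w i)) \<in> W" by (rule W_scale[OF wW]) simp
    moreover have "1 / real g * real (w i) = real (v i)" for i
      using g1(1) by (simp flip: gv)
    ultimately have vP: "v \<in> Prim" using Gv by (simp add: Prim_def)
    have "neval u v \<le> N div g" using wu(2) g1(1) unfolding nu by (simp add: less_eq_div_iff_mult_less_eq mult.commute)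
    moreover have "g \<le> N"
    proof -
      have "g \<le> neval u w" unfolding nu using g1(2) by simp
      then show ?thesis using wu(2) by (rule order_trans)
    qed
    moreover have vdef: "(\<lambda>i. w i div Gcd (w ` {..<n})) = v" by (simp add: v_def g_def fun_eq_iff)
    ultimately show "(\<lambda>w. (Gcd (w ` {..<n}), \<lambda>i. w i div Gcd (w ` {..<n}))) w \<in> ?G"
      using g1(1) vP unfolding vdef g_def[symmetric] prim_level_def by simp
    show "(\<lambda>(l, v) i. l * v i) ((\<lambda>w. (Gcd (w ` {..<n}), \<lambda>i. w i div Gcd (w ` {..<n}))) w) = w"
      unfolding vdef unfolding g_def[symmetric] prod.case by (rule wgv[symmetric])
  qed
  finally show ?thesis by (simp add: weight_sum_def)
qed

text \<open>Both limits come from the same argument, since the count is the weighted sum for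
  \<open>h = u\<close>. The assumption \<open>D \<ge> 2\<close> is where the zeta value has to be
  finite.\<close>

theorem prim_sum_limit:
  assumes uT: "u \<in> T" and hT: "h \<in> T" and u: "is_unit u k" and D2: "D \<ge> 2"
  obtains a b where "(\<lambda>N. prim_sum u h N / real N ^ D) \<longlonglongrightarrow> a"
    "(\<lambda>N. real (card (prim_level u N)) / real N ^ D) \<longlonglongrightarrow> b" "b > 0" "\<And>N. finite (prim_level u N)"
proof -
  obtain L where L: "(\<lambda>N. real (card (level u N)) / real N ^ D) \<longlonglongrightarrow> L" "\<And>N. finite (level u N)" "L > 0"
    using level_count[OF uT u] by blast
  have fin: "finite (prim_level u N)" for N by (rule finite_subset[OF prim_level_subset[OF u] L(2)])
  have nn: "0 \<le> prim_sum u h N" for h N unfolding prim_sum_def by (intro sum_nonneg) simp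
  obtain \<tau> where "(\<lambda>N. weight_sum u h N / real N ^ D) \<longlonglongrightarrow> \<tau>"
    using weight_sum_convergent[OF uT hT u] unfolding convergent_def by blast
  note a = div_sum_asymptotics(1)[OF D2 nn weight_sum_eq_prim_sums[OF u L(2)] this]
  have wu: "weight_sum u u N = real (card (level u N))" for N
  proof -
    have "weight_sum u u N = (\<Sum>v\<in>level u N. 1)"
      unfolding weight_sum_def by (intro sum.cong refl) (auto simp: level_def)
    then show ?thesis by simp
  qed
  have pu: "prim_sum u u N = real (card (prim_level u N))" for N
  proof -
    have "prim_sum u u N = (\<Sum>v\<in>prim_level u N. 1)"
      unfolding prim_sum_def
    proof (intro sum.cong refl)
      fix v assume "v \<in> prim_level u N"
      then have "neval u v \<ge> 1" using Prim_unit_pos[OF u] by (simp add: prim_level_def)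
      then show "real (neval u v) / real (neval u v) = 1" by simp
    qed
    then show ?thesis by simp
  qed
  have "(\<lambda>N. weight_sum u u N / real N ^ D) \<longlonglongrightarrow> L" unfolding wu by (rule L(1))
  note b = div_sum_asymptotics[OF D2 nn weight_sum_eq_prim_sums[OF u L(2)] this]
  show thesis
    by (rule that[OF a b(1)[unfolded pu] _ fin]) (use L(3) b(2) in simp)
qed

text \<open>Every stratum has dimension at most 1. Its nonzero vectors are therefore proportional,
  and at most one of them is primitive.\<close>

lemma finite_Prim:
  assumes D1: "D = 1"
  shows "finite Prim"
proof -
  have "finite {v \<in> Prim. (\<lambda>i. real (v i)) \<in> stratum n S}" if S: "S \<in> \<S>" for S
  proof -
    obtain I c \<Psi> where Sc: "S = (I, c, \<Psi>)" by (cases S)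
    have finI: "finite I" using S_props[OF S[unfolded Sc]] finite_subset by blast
    have cI: "card I \<le> 1" using card_le_D[OF S] D1 Sc by simp
    have eq: "v = v'" if v: "v \<in> Prim" "(\<lambda>i. real (v i)) \<in> stratum n S"
        and v': "v' \<in> Prim" "(\<lambda>i. real (v' i)) \<in> stratum n S" for v v'
    proof -
      have vl: "real (v l) = extend I c (\<lambda>i. real (v i)) l" "real (v' l) = extend I c (\<lambda>i. real (v' i)) l" for l
        using fun_cong[OF stratum_extend[OF v(2)[unfolded Sc]], of l] fun_cong[OF stratum_extend[OF
            v'(2)[unfolded Sc]], of l] by auto
      obtain l where l: "l < n" "v l \<noteq> 0" by (rule Prim_nonzero[OF v(1)])
      have "I \<noteq> {}" using vl(1)[of l] l by (auto simp: extend_def)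
      then have "card I = 1" using cI finI by (simp add: le_Suc_eq)
      then obtain i where i: "I = {i}" by (rule card_1_singletonE)
      have cross: "v' i * v l = v i * v' l" for l
      proof -
        have "real (v' i) * real (v l) = real (v i) * real (v' l)"
          unfolding vl[of l] i extend_def by simp
        then have "real (v' i * v l) = real (v i * v' l)" by simp
        then show ?thesis by (simp only: of_nat_eq_iff)
      qed
      have "v' i * Gcd (v ` {..<n}) = v i * Gcd (v' ` {..<n})"
        unfolding Gcd_scaled_image[symmetric] cross ..
      then have e: "v' i = v i" using v(1) v'(1) by (simp add: Prim_def)
      have "v i \<noteq> 0"
      proof
        assume "v i = 0"
        then have "real (v l) = 0" unfolding vl[of l] i extend_def by simp
        then show False using l by simp
      qed
      then show ?thesis using cross e by (intro ext) simp
    qed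
    show ?thesis
    proof (cases "{v \<in> Prim. (\<lambda>i. real (v i)) \<in> stratum n S} = {}")
      case False
      then obtain v where v: "v \<in> Prim" "(\<lambda>i. real (v i)) \<in> stratum n S" by blast
      have "{v \<in> Prim. (\<lambda>i. real (v i)) \<in> stratum n S} \<subseteq> {v}" using eq[OF _ _ v] by blast
      then show ?thesis by (rule finite_subset) simp
    next
      case True
      show ?thesis unfolding True by simp
    qed
  qed
  moreover have "Prim \<subseteq> (\<Union>S\<in>\<S>. {v \<in> Prim. (\<lambda>i. real (v i)) \<in> stratum n S})"
  proof
    fix v assume v: "v \<in> Prim"
    then have "(\<lambda>i. real (v i)) \<in> \<Union>(stratum n ` \<S>)" unfolding S_union by (simp add: Prim_def)
    then show "v \<in> (\<Union>S\<in>\<S>. {v \<in> Prim. (\<lambda>i. real (v i)) \<in> stratum n S})" using v by blast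
  qed
  ultimately show ?thesis using S_fin finite_subset by (metis (no_types, lifting) finite_UN_I)
qed

end

subsection \<open>Change of unit\<close>

context term_presentation
begin

text \<open>The stratification is chosen afresh for each pair \<open>u\<close>, \<open>h\<close>, so
  that both are linear on the strata. Uniqueness of the topological dimension shows that
  \<open>D\<close> is the same for all of these choices.\<close>

lemma term_dimension:
  obtains D where "D \<ge> 1" "has_topological_dimension (euclidean :: 'x topology) (int (D - 1))"
    "D = 1 \<Longrightarrow> finite Prim"
    "\<And>u h k. D \<ge> 2 \<Longrightarrow> is_unit u k \<Longrightarrow> tvars h \<subseteq> {..<n} \<Longrightarrow>
      \<exists>a b. (\<lambda>N. prim_sum u h N / real N ^ D) \<longlonglongrightarrow> a \<and>
        (\<lambda>N. real (card (prim_level u N)) / real N ^ D) \<longlonglongrightarrow> b \<and> b > 0 \<and> (\<forall>N. finite (prim_level u N))"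
proof -
  obtain \<S> where S: "stratified_presentation n E p {} \<S>" by (rule stratification[of "{}"]) auto
  interpret s: stratified_presentation n E p "{}" \<S> by (rule S)
  show thesis
  proof (rule that[of s.D])
    show "s.D \<ge> 1" by (rule s.D_pos)
    show "has_topological_dimension (euclidean :: 'x topology) (int (s.D - 1))" by (rule s.topological_dimension)
    show "s.D = 1 \<Longrightarrow> finite Prim" by (rule s.finite_Prim)
    fix u h k assume D2: "s.D \<ge> 2" and u: "is_unit u k" and h: "tvars h \<subseteq> {..<n}"
    have T: "finite {u, h}" "\<And>t. t \<in> {u, h} \<Longrightarrow> tvars t \<subseteq> {..<n}" using u h by (auto simp: is_unit_def)
    obtain \<S>' where S': "stratified_presentation n E p {u, h} \<S>'" using stratification[OF T] by blast
    interpret s': stratified_presentation n E p "{u, h}" \<S>' by (rule S')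
    have "int (s'.D - 1) = int (s.D - 1)"
      by (rule has_topological_dimension_unique[OF s'.topological_dimension s.topological_dimension])
    then have D: "s'.D = s.D" using s'.D_pos s.D_pos by linarith
    have uh: "u \<in> {u, h}" "h \<in> {u, h}" by auto
    show "\<exists>a b. (\<lambda>N. prim_sum u h N / real N ^ s.D) \<longlonglongrightarrow> a \<and>
        (\<lambda>N. real (card (prim_level u N)) / real N ^ s.D) \<longlonglongrightarrow> b \<and> b > 0 \<and> (\<forall>N. finite (prim_level u N))"
    proof (rule s'.prim_sum_limit[OF uh u D2[folded D]])
      fix a b assume "(\<lambda>N. prim_sum u h N / real N ^ s'.D) \<longlonglongrightarrow> a"
        "(\<lambda>N. real (card (prim_level u N)) / real N ^ s'.D) \<longlonglongrightarrow> b" "b > 0" "\<And>N. finite (prim_level u N)"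
      then show ?thesis unfolding D by (intro exI[of _ a] exI[of _ b] conjI allI)
    qed
  qed
qed

text \<open>The vector \<open>v\<close> lies on the ray of some point \<open>x\<close> of the space,
  and both sides are homogeneous of degree one, so the inequality at \<open>x\<close> carries
  over.\<close>

lemma Prim_ratio_le:
  assumes v: "v \<in> Prim" and h: "0 < neval h v"
    and le: "\<And>x. 0 < teval h (p x) \<Longrightarrow> teval u (p x) \<le> \<beta> * teval u' (p x)"
  shows "real (neval u v) \<le> \<beta> * real (neval u' v)"
proof -
  have w: "(\<lambda>i. real (v i)) \<in> W" using v by (simp add: Prim_def)
  obtain i where "i < n" "v i \<noteq> 0" by (rule Prim_nonzero[OF v])
  then have "real (v i) \<noteq> 0" by simp
  then obtain x c where c: "c > 0" "(\<lambda>i. real (v i)) = (\<lambda>i. c * p x i)"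
    by (rule W_ray[OF w])
  have val: "real (neval t v) = c * teval t (p x)" for t
    unfolding teval_of_nat[symmetric] c(2) using c(1) by (intro teval_scale) simp
  have "0 < c * teval h (p x)" unfolding val[symmetric] using h by simp
  then have "0 < teval h (p x)" using c(1) by (simp add: zero_less_mult_iff)
  then have "c * teval u (p x) \<le> c * (\<beta> * teval u' (p x))" using c(1) le by (intro mult_left_mono) auto
  then show ?thesis unfolding val by (simp add: algebra_simps)
qed

lemma Prim_weight_le:
  assumes v: "v \<in> Prim" and u: "is_unit u k" and u': "is_unit u' k'" and \<beta>: "0 < \<beta>"
    and le: "\<And>x. 0 < teval h (p x) \<Longrightarrow> teval u (p x) \<le> \<beta> * teval u' (p x)"
  shows "real (neval h v) / real (neval u' v) \<le> \<beta> * (real (neval h v) / real (neval u v))"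
proof (cases "neval h v = 0")
  case False
  have b: "real (neval u v) \<le> \<beta> * real (neval u' v)" by (rule Prim_ratio_le[OF v _ le]) (use False in simp_all)
  have pos: "0 < real (neval u v)" "0 < real (neval u' v)" using Prim_unit_pos[OF u v] Prim_unit_pos[OF u' v]
      by simp_all
  have "real (neval h v) * real (neval u v) \<le> real (neval h v) * (\<beta> * real (neval u' v))"
    using b by (rule mult_left_mono) simp
  then show ?thesis using pos by (simp add: field_simps)
qed simp

text \<open>Vectors with \<open>h = 0\<close> contribute nothing. For the others, the inequality of
  units maps the level \<open>N\<close> of \<open>u'\<close> into the level
  \<open>\<beta> * N\<close> of \<open>u\<close>, and costs a factor \<open>\<beta>\<close> in each
  weight.\<close>

lemma prim_sum_le:
  assumes u: "is_unit u k" and u': "is_unit u' k'" and \<beta>: "0 < \<beta>" and fin: "\<And>N. finite (prim_level u N)"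
    and fin': "\<And>N. finite (prim_level u' N)"
    and le: "\<And>x. 0 < teval h (p x) \<Longrightarrow> teval u (p x) \<le> \<beta> * teval u' (p x)"
  shows "prim_sum u' h N \<le> \<beta> * prim_sum u h (nat \<lfloor>\<beta> * real N\<rfloor>)"
proof -
  let ?S = "{v \<in> prim_level u' N. 0 < neval h v}"
  have "prim_sum u' h N = (\<Sum>v\<in>?S. real (neval h v) / real (neval u' v))"
    unfolding prim_sum_def using fin' by (intro sum.mono_neutral_right) auto
  also have "\<dots> \<le> (\<Sum>v\<in>?S. \<beta> * (real (neval h v) / real (neval u v)))"
    using Prim_weight_le[OF _ u u' \<beta> le] by (intro sum_mono) (auto simp: prim_level_def)
  also have "\<dots> \<le> (\<Sum>v\<in>prim_level u (nat \<lfloor>\<beta> * real N\<rfloor>). \<beta> * (real (neval h v) / real (neval u v)))"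
  proof (rule sum_mono2[OF fin])
    show "?S \<subseteq> prim_level u (nat \<lfloor>\<beta> * real N\<rfloor>)"
    proof
      fix v assume v: "v \<in> ?S"
      then have vP: "v \<in> Prim" "neval u' v \<le> N" "0 < neval h v" by (auto simp: prim_level_def)
      have "real (neval u v) \<le> \<beta> * real (neval u' v)" by (rule Prim_ratio_le[OF vP(1,3) le])
      also have "\<dots> \<le> \<beta> * real N" using vP(2) \<beta> by (intro mult_left_mono) auto
      finally have "neval u v \<le> nat \<lfloor>\<beta> * real N\<rfloor>" by (simp add: le_nat_floor)
      then show "v \<in> prim_level u (nat \<lfloor>\<beta> * real N\<rfloor>)" using vP(1) by (simp add: prim_level_def)
    qed
  qed (use \<beta> in simp)
  also have "\<dots> = \<beta> * prim_sum u h (nat \<lfloor>\<beta> * real N\<rfloor>)" by (simp add: prim_sum_def sum_distrib_left)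
  finally show ?thesis .
qed

text \<open>The density of primitive points transforms by the power \<open>D\<close> of the ratio of the units, and the
  weights by one further power.\<close>

lemma prim_limit_le:
  assumes u: "is_unit u k" and u': "is_unit u' k'" and \<beta>: "0 < \<beta>" and fin: "\<And>N. finite (prim_level u N)"
    and fin': "\<And>N. finite (prim_level u' N)"
    and le: "\<And>x. 0 < teval h (p x) \<Longrightarrow> teval u (p x) \<le> \<beta> * teval u' (p x)"
    and a: "(\<lambda>N. prim_sum u h N / real N ^ D) \<longlonglongrightarrow> a" and a': "(\<lambda>N. prim_sum u' h N / real N ^ D) \<longlonglongrightarrow> a'"
  shows "a' \<le> \<beta> ^ (D + 1) * a"
proof -
  define f where "f N = nat \<lfloor>\<beta> * real N\<rfloor>" for N :: nat
  have f_le: "real (f N) \<le> \<beta> * real N" "\<beta> * real N - 1 \<le> real (f N)" for N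
  proof -
    have "0 \<le> \<beta> * real N" using \<beta> by simp
    then have "real (f N) = of_int \<lfloor>\<beta> * real N\<rfloor>" unfolding f_def by simp
    then show "real (f N) \<le> \<beta> * real N" "\<beta> * real N - 1 \<le> real (f N)" by linarith+
  qed
  have ratio: "(\<lambda>N. real (f N) / real N) \<longlonglongrightarrow> \<beta>"
  proof (rule tendsto_sandwich)
    have "(\<lambda>N. \<beta> - 1 / real N) \<longlonglongrightarrow> \<beta> - 0" by (intro tendsto_diff tendsto_const lim_1_over_n)
    then show "(\<lambda>N. \<beta> - 1 / real N) \<longlonglongrightarrow> \<beta>" by simp
    show "(\<lambda>N. \<beta>) \<longlonglongrightarrow> \<beta>" by simp
    show "\<forall>\<^sub>F N in sequentially. \<beta> - 1 / real N \<le> real (f N) / real N"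
      using eventually_gt_at_top[of 0]
    proof eventually_elim
      case (elim N)
      have "(\<beta> * real N - 1) / real N \<le> real (f N) / real N" by (intro divide_right_mono f_le) simp
      then show ?case using elim by (simp add: diff_divide_distrib)
    qed
    show "\<forall>\<^sub>F N in sequentially. real (f N) / real N \<le> \<beta>"
      using eventually_gt_at_top[of 0] by eventually_elim (simp add: divide_le_eq f_le)
  qed
  have f_top: "filterlim f at_top sequentially"
    unfolding filterlim_at_top
  proof
    fix Z :: nat
    obtain N0 :: nat where N0: "(real Z + 1) / \<beta> \<le> real N0" using real_arch_simple by blast
    show "\<forall>\<^sub>F N in sequentially. Z \<le> f N"
      using eventually_ge_at_top[of N0]
    proof eventually_elim
      case (elim N)
      have "(real Z + 1) / \<beta> \<le> real N" using N0 elim by (simp add: order_trans)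
      then have "real Z + 1 \<le> \<beta> * real N" using \<beta> by (simp add: divide_le_eq mult.commute)
      then have "real Z \<le> real (f N)" using f_le(2)[of N] by linarith
      then show ?case by simp
    qed
  qed
  have f_pos: "\<forall>\<^sub>F N in sequentially. 1 \<le> f N"
    using f_top unfolding filterlim_at_top by blast
  have "(\<lambda>N. prim_sum u h (f N) / real (f N) ^ D) \<longlonglongrightarrow> a" by (rule filterlim_compose[OF a f_top])
  then have "(\<lambda>N. \<beta> * (prim_sum u h (f N) / real (f N) ^ D * (real (f N) / real N) ^ D)) \<longlonglongrightarrow> \<beta> * (a * \<beta> ^ D)"
    by (intro tendsto_mult tendsto_power ratio tendsto_const)
  moreover have "\<forall>\<^sub>F N in sequentially. prim_sum u' h N / real N ^ D \<le>
      \<beta> * (prim_sum u h (f N) / real (f N) ^ D * (real (f N) / real N) ^ D)"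
    using eventually_gt_at_top[of 0] f_pos
  proof eventually_elim
    case (elim N)
    have "prim_sum u' h N / real N ^ D \<le> \<beta> * prim_sum u h (f N) / real N ^ D"
      unfolding f_def by (intro divide_right_mono prim_sum_le[OF u u' \<beta> fin fin' le]) simp_all
    also have "\<dots> = \<beta> * (prim_sum u h (f N) / real (f N) ^ D * (real (f N) / real N) ^ D)"
      using elim by (simp add: power_divide)
    finally show ?case .
  qed
  ultimately have "a' \<le> \<beta> * (a * \<beta> ^ D)"
    using a' by (intro tendsto_le[OF sequentially_bot])
  then show ?thesis by (simp add: mult_ac)
qed

text \<open>The enumeration of states is transported to one of primitive vectors, whose levels by
  denominator are the sets \<open>prim_level\<close>; the ratio of the two limits is then the
  average.\<close>

lemma cesaro_state_infinite:
  assumes u: "is_unit u k" and h: "tvars h \<subseteq> {..<n}" and D: "D \<ge> 1"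
    and a: "(\<lambda>N. prim_sum u h N / real N ^ D) \<longlonglongrightarrow> a"
    and b: "(\<lambda>N. real (card (prim_level u N)) / real N ^ D) \<longlonglongrightarrow> b" "b > 0"
    and fin: "\<And>N. finite (prim_level u N)"
    and e: "denominator_enumeration A (\<lambda>x. teval u (p x)) e"
  shows "cesaro_state A (\<lambda>x. teval u (p x)) e (\<lambda>x. teval h (p x)) = a / b"
proof -
  let ?D = "discrete_states A (\<lambda>x. teval u (p x))"
  note bij = discrete_states_eq[OF u]
  \<comment> \<open>With finitely many primitive vectors the count divided by \<open>N ^ D\<close>
    would tend to 0, contrary to \<open>b > 0\<close>.\<close>
  have "infinite Prim"
  proof
    assume P: "finite Prim"
    have "(\<lambda>N. real (card Prim) / real N) \<longlonglongrightarrow> 0" by (rule lim_const_over_n)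
    moreover have "\<forall>\<^sub>F N in sequentially. real (card (prim_level u N)) / real N ^ D \<le> real (card Prim) / real N"
      using eventually_ge_at_top[of 1]
    proof eventually_elim
      case (elim N)
      have "card (prim_level u N) \<le> card Prim" by (rule card_mono[OF P]) (auto simp: prim_level_def)
      moreover have "real N ^ 1 \<le> real N ^ D" using elim D by (intro power_increasing) auto
      ultimately show ?case using elim by (intro frac_le) auto
    qed
    ultimately have "b \<le> 0" using b(1) by (intro tendsto_le[OF sequentially_bot])
    then show False using b(2) by simp
  qed
  then have inf: "infinite ?D" using bij_betw_finite[OF bij] by simp
  then have idx: "index_set ?D = {1..}" by (simp add: index_set_def)
  have be: "bij_betw e {1..} ?D" and mono: "mono_on {1..} (\<lambda>t. denominator A (e t))"
    using e unfolding denominator_enumeration_def idx by simp_all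
  define V where "V t = the_inv_into Prim (st u) (e t)" for t
  have bV: "bij_betw V {1..} Prim"
    unfolding V_def using bij_betw_trans[OF be bij_betw_the_inv_into[OF bij]] by (simp add: comp_def)
  have stV: "st u (V t) = e t" and VP: "V t \<in> Prim" if "t \<ge> 1" for t
  proof -
    have "e t \<in> ?D" using bij_betwE[OF be] that by auto
    then have "e t \<in> st u ` Prim" using bij by (simp add: bij_betw_def)
    then show "st u (V t) = e t" unfolding V_def by (rule f_the_inv_into_f[OF st_inj[OF u]])
    show "V t \<in> Prim" using bij_betwE[OF bV] that by auto
  qed
  have den: "denominator A (e t) = neval u (V t)" if "t \<ge> 1" for t
    using st_denominator[OF u VP[OF that]] stV[OF that] by simp
  have val: "e t (\<lambda>x. teval h (p x)) = real (neval h (V t)) / real (neval u (V t))" if "t \<ge> 1" for t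
    using st_term[OF VP[OF that] h, of u] stV[OF that] by simp
  have lev: "bij_betw V {t. 1 \<le> t \<and> denominator A (e t) \<le> N} (prim_level u N)" for N
  proof -
    have "V ` {t. 1 \<le> t \<and> denominator A (e t) \<le> N} = prim_level u N"
    proof (intro equalityI subsetI)
      fix v assume "v \<in> V ` {t. 1 \<le> t \<and> denominator A (e t) \<le> N}"
      then obtain t where t: "1 \<le> t" "denominator A (e t) \<le> N" "v = V t" by blast
      then show "v \<in> prim_level u N" using den[OF t(1)] VP[OF t(1)] by (simp add: prim_level_def)
    next
      fix v assume v: "v \<in> prim_level u N"
      then have "v \<in> V ` {1..}" using bV by (simp add: bij_betw_def prim_level_def)
      then obtain t where t: "t \<ge> 1" "v = V t" by auto
      then have "denominator A (e t) \<le> N" using v den[OF t(1)] by (simp add: prim_level_def)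
      then show "v \<in> V ` {t. 1 \<le> t \<and> denominator A (e t) \<le> N}" using t by blast
    qed
    moreover have "inj_on V {t. 1 \<le> t \<and> denominator A (e t) \<le> N}"
      using bV by (auto simp: bij_betw_def intro: inj_on_subset)
    ultimately show ?thesis by (simp add: bij_betw_def)
  qed
  have sumlev: "(\<Sum>t | 1 \<le> t \<and> denominator A (e t) \<le> N. e t (\<lambda>x. teval h (p x))) = prim_sum u h N" for N
    unfolding prim_sum_def sum.reindex_bij_betw[OF lev, symmetric] by (intro sum.cong refl) (simp add: val)
  have "(\<lambda>k. (\<Sum>t=1..k. e t (\<lambda>x. teval h (p x))) / real k) \<longlonglongrightarrow> a / b"
  proof (rule cesaro_by_levels)
    show "0 \<le> e t (\<lambda>x. teval h (p x))" if "t \<ge> 1" for t unfolding val[OF that] by simp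
    show "denominator A (e s) \<le> denominator A (e t)" if "1 \<le> s" "s \<le> t" for s t
      using mono_onD[OF mono, of s t] that by simp
    show "finite {t. 1 \<le> t \<and> denominator A (e t) \<le> N}" for N using bij_betw_finite[OF lev] fin by simp
    show "(\<lambda>N. (\<Sum>t | 1 \<le> t \<and> denominator A (e t) \<le> N. e t (\<lambda>x. teval h (p x))) / real N ^ D) \<longlonglongrightarrow> a"
      unfolding sumlev by (rule a)
    show "(\<lambda>N. real (card {t. 1 \<le> t \<and> denominator A (e t) \<le> N}) / real N ^ D) \<longlonglongrightarrow> b"
      unfolding bij_betw_same_card[OF lev] by (rule b(1))
  qed (rule b(2))
  then show ?thesis unfolding cesaro_state_def using inf by (simp add: limI)
qed

lemma cesaro_state_finite:
  assumes u: "is_unit u k" and h: "tvars h \<subseteq> {..<n}" and P: "finite Prim"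
    and e: "denominator_enumeration A (\<lambda>x. teval u (p x)) e"
  shows "cesaro_state A (\<lambda>x. teval u (p x)) e (\<lambda>x. teval h (p x))
    = (\<Sum>v\<in>Prim. real (neval h v) / real (neval u v)) / real (card Prim)"
proof -
  let ?D = "discrete_states A (\<lambda>x. teval u (p x))"
  note bij = discrete_states_eq[OF u]
  have finD: "finite ?D" using bij_betw_finite[OF bij] P by simp
  have card: "card ?D = card Prim" using bij_betw_same_card[OF bij] by simp
  have be: "bij_betw e {1..card ?D} ?D"
    using e finD by (simp add: denominator_enumeration_def index_set_def)
  have "(\<Sum>t=1..card ?D. e t (\<lambda>x. teval h (p x))) = (\<Sum>m\<in>?D. m (\<lambda>x. teval h (p x)))"
    by (rule sum.reindex_bij_betw[OF be])
  also have "\<dots> = (\<Sum>v\<in>Prim. st u v (\<lambda>x. teval h (p x)))"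
    by (rule sum.reindex_bij_betw[OF bij, symmetric])
  also have "\<dots> = (\<Sum>v\<in>Prim. real (neval h v) / real (neval u v))"
    by (intro sum.cong refl) (simp add: st_term[OF _ h])
  finally show ?thesis using finD by (simp add: cesaro_state_def card)
qed

lemma unit_pos_at: "is_unit u k \<Longrightarrow> 0 < teval u (p x)"
  using p_nonzero[of x] unit_pos[OF _ p_in_W] by blast

lemma separating_hoop:
  assumes "is_unit u k"
  shows "separating_function_hoop funs (\<lambda>x. teval u (p x))"
proof
  show "compact (UNIV :: 'x set)" by (rule compact_space)
  show "continuous_on UNIV f" if "f \<in> funs" for f using that teval_cont by (auto elim!: funsE)
  show "0 \<le> f x" if "f \<in> funs" for f x using that by (auto elim!: funsE intro!: teval_nonneg p_nonneg)
  show "(\<lambda>x. 0) \<in> funs" by (rule funs_zero)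
  show "(\<lambda>x. f x + g x) \<in> funs" "(\<lambda>x. max 0 (f x - g x)) \<in> funs" if "f \<in> funs" "g \<in> funs" for f g
    using ev_ops(3,4)[OF p_in_W that] by auto
  show "\<exists>h\<in>funs. h x = 0 \<and> h y \<noteq> 0" if xy: "x \<noteq> y" for x y
  proof -
    obtain t where "tvars t \<subseteq> {..<n}" "teval t (p x) = 0" "teval t (p y) \<noteq> 0" using p_sep[OF xy] by blast
    then show ?thesis using funsI[of t] by (intro bexI[of _ "\<lambda>x. teval t (p x)"] conjI) simp_all
  qed
  show "(\<lambda>x. teval u (p x)) \<in> funs" using assms funsI by (simp add: is_unit_def)
  show "0 < teval u (p x)" for x by (rule unit_pos_at[OF assms])
qed

theorem cesaro_measures:
  fixes \<mu>1 \<mu>2 :: "'x measure"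
  assumes u1: "is_unit u1 k1" and u2: "is_unit u2 k2"
    and e1: "denominator_enumeration A (\<lambda>x. teval u1 (p x)) e1"
    and e2: "denominator_enumeration A (\<lambda>x. teval u2 (p x)) e2"
    and reg1: "regular_borel_measure \<mu>1" and reg2: "regular_borel_measure \<mu>2"
    and rep1: "\<And>h. h \<in> funs \<Longrightarrow> cesaro_state A (\<lambda>x. teval u1 (p x)) e1 h = (\<integral>x. h x \<partial>\<mu>1)"
    and rep2: "\<And>h. h \<in> funs \<Longrightarrow> cesaro_state A (\<lambda>x. teval u2 (p x)) e2 h = (\<integral>x. h x \<partial>\<mu>2)"
  obtains d :: nat and R where "has_topological_dimension (euclidean :: 'x topology) (int d)"
    "continuous_on UNIV R" "\<And>x. 0 < R x" "\<mu>2 = density \<mu>1 (\<lambda>x. ennreal (R x))"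
    "d = 0 \<Longrightarrow> R = (\<lambda>x. teval u1 (p x) / teval u2 (p x))"
    "d \<ge> 1 \<Longrightarrow> \<exists>C>0. R = (\<lambda>x. C * (teval u1 (p x) / teval u2 (p x)) ^ (d + 2))"
    "d \<ge> 1 \<Longrightarrow> (\<integral>x. teval u2 (p x) \<partial>\<mu>2) = 1"
proof (rule term_dimension)
  fix D assume D1: "D \<ge> 1" and dim: "has_topological_dimension (euclidean :: 'x topology) (int (D - 1))"
    and finP: "D = 1 \<Longrightarrow> finite Prim"
    and lims: "\<And>u h k. D \<ge> 2 \<Longrightarrow> is_unit u k \<Longrightarrow> tvars h \<subseteq> {..<n} \<Longrightarrow>
      \<exists>a b. (\<lambda>N. prim_sum u h N / real N ^ D) \<longlonglongrightarrow> a \<and>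
        (\<lambda>N. real (card (prim_level u N)) / real N ^ D) \<longlonglongrightarrow> b \<and> b > 0 \<and> (\<forall>N. finite (prim_level u N))"
  interpret fh: separating_function_hoop funs "\<lambda>x. teval u1 (p x)" by (rule separating_hoop[OF u1])
  define r where "r x = teval u1 (p x) / teval u2 (p x)" for x
  have pos: "0 < teval u1 (p x)" "0 < teval u2 (p x)" for x
    using unit_pos_at[OF u1] unit_pos_at[OF u2] by auto
  have r_cont: "continuous_on UNIV r"
    unfolding r_def using pos(2) by (intro continuous_on_divide teval_cont) (metis less_irrefl)
  have r_pos: "0 < r x" for x unfolding r_def using pos by simp
  have up: "teval u1 (p x) \<le> \<beta> * teval u2 (p x)" if "r x \<le> \<beta>" for x \<beta>
    using that pos(2)[of x] by (simp add: r_def divide_le_eq)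
  have low: "teval u2 (p x) \<le> 1 / \<alpha> * teval u1 (p x)" if "\<alpha> \<le> r x" "0 < \<alpha>" for x \<alpha>
    using that pos(2)[of x] by (simp add: r_def field_simps)
  show thesis
  proof (cases "D = 1")
    case True
    note P = finP[OF True]
    have int1: "(\<integral>x. teval h (p x) \<partial>\<mu>1) = (\<Sum>v\<in>Prim. real (neval h v) / real (neval u1 v)) / real (card Prim)"
      and int2: "(\<integral>x. teval h (p x) \<partial>\<mu>2) = (\<Sum>v\<in>Prim. real (neval h v) / real (neval u2 v)) / real (card Prim)"
      if "tvars h \<subseteq> {..<n}" for h
      using rep1[OF funsI[OF that]] rep2[OF funsI[OF that]] cesaro_state_finite[OF u1 that P e1]
        cesaro_state_finite[OF u2 that P e2] by simp_all
    have "\<mu>2 = density \<mu>1 (\<lambda>x. ennreal (r x))"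
    proof (rule fh.regular_measure_eq_density[OF reg2 reg1 r_cont r_pos])
      fix h a b assume h: "h \<in> funs" and ab: "0 < (a::real)" "0 < b" and bd: "\<And>x. 0 < h x \<Longrightarrow> a \<le> r x \<and> r x \<le> b"
      obtain t where t: "tvars t \<subseteq> {..<n}" "h = (\<lambda>x. teval t (p x))" using h by (rule funsE)
      have le1: "teval u1 (p x) \<le> b * teval u2 (p x)" if "0 < teval t (p x)" for x
        using bd[of x] that unfolding t(2) by (intro up) blast
      have le2: "teval u2 (p x) \<le> 1 / a * teval u1 (p x)" if "0 < teval t (p x)" for x
        using bd[of x] that ab unfolding t(2) by (intro low) blast+
      have "(\<Sum>v\<in>Prim. real (neval t v) / real (neval u2 v)) \<le> (\<Sum>v\<in>Prim. b * (real (neval t v) / real (neval u1 v)))"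
        by (intro sum_mono Prim_weight_le[OF _ u1 u2 ab(2) le1])
      then have "(\<integral>x. h x \<partial>\<mu>2) \<le> b * (\<integral>x. h x \<partial>\<mu>1)"
        unfolding t(2) int1[OF t(1)] int2[OF t(1)] sum_distrib_left[symmetric]
        using divide_right_mono[of _ _ "real (card Prim)"] by fastforce
      moreover have a': "0 < 1 / a" using ab by simp
      have "(\<Sum>v\<in>Prim. real (neval t v) / real (neval u1 v)) \<le> (\<Sum>v\<in>Prim. 1 / a * (real (neval t v) / real (neval u2 v)))"
        by (intro sum_mono Prim_weight_le[OF _ u2 u1 a' le2])
      then have "(\<integral>x. h x \<partial>\<mu>1) \<le> 1 / a * (\<integral>x. h x \<partial>\<mu>2)"
        unfolding t(2) int1[OF t(1)] int2[OF t(1)] sum_distrib_left[symmetric]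
        using divide_right_mono[of _ _ "real (card Prim)"] by fastforce
      then have "a * (\<integral>x. h x \<partial>\<mu>1) \<le> (\<integral>x. h x \<partial>\<mu>2)" using ab by (simp add: field_simps)
      ultimately show "(\<integral>x. h x \<partial>\<mu>2) \<le> b * (\<integral>x. h x \<partial>\<mu>1) \<and> a * (\<integral>x. h x \<partial>\<mu>1) \<le> (\<integral>x. h x \<partial>\<mu>2)" by blast
    qed
    then show thesis using dim r_cont r_pos True by (intro that[of 0 r]) (simp_all add: r_def[abs_def])
  next
    case False
    then have D2: "D \<ge> 2" using D1 by simp
    have u1v: "tvars u1 \<subseteq> {..<n}" and u2v: "tvars u2 \<subseteq> {..<n}" using u1 u2 by (auto simp: is_unit_def)
    obtain a0 b1 where b1: "(\<lambda>N. real (card (prim_level u1 N))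
        / real N ^ D) \<longlonglongrightarrow> b1" "b1 > 0" "\<And>N. finite (prim_level u1 N)"
      using lims[OF D2 u1 u1v] by blast
    obtain a2 b2 where a2: "(\<lambda>N. prim_sum u2 u2 N / real N ^ D) \<longlonglongrightarrow> a2"
      and b2: "(\<lambda>N. real (card (prim_level u2 N)) / real N ^ D) \<longlonglongrightarrow> b2" "b2 > 0" "\<And>N. finite (prim_level u2 N)"
      using lims[OF D2 u2 u2v] by blast
    \<comment> \<open>All weights of the unit with respect to itself are 1, so weighted sum and
      count agree.\<close>
    have norm: "(\<integral>x. teval u2 (p x) \<partial>\<mu>2) = 1"
    proof -
      have "prim_sum u2 u2 N = real (card (prim_level u2 N))" for N
      proof -
        have "prim_sum u2 u2 N = (\<Sum>v\<in>prim_level u2 N. 1)"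
          unfolding prim_sum_def
        proof (intro sum.cong refl)
          fix v assume "v \<in> prim_level u2 N"
          then have "neval u2 v \<ge> 1" using Prim_unit_pos[OF u2] by (simp add: prim_level_def)
          then show "real (neval u2 v) / real (neval u2 v) = 1" by simp
        qed
        then show ?thesis by simp
      qed
      then have "a2 = b2" using a2 b2(1) LIMSEQ_unique by simp
      then show ?thesis
        using rep2[OF funsI[OF u2v]] cesaro_state_infinite[OF u2 u2v D1 a2 b2 e2] b2(2) by simp
    qed
    \<comment> \<open>The integrals are \<open>c1 / b1\<close> and \<open>c2 / b2\<close>, and
      comparing the sums relates \<open>c2\<close> to \<open>c1\<close> by the power
      \<open>D + 1\<close> of the ratio of units; this quotient is what remains.\<close>
    define \<kappa> where "\<kappa> = b1 / b2"
    have \<kappa>: "0 < \<kappa>" using b1(2) b2(2) by (simp add: \<kappa>_def)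
    define R where "R x = \<kappa> * r x ^ (D + 1)" for x
    have R_cont: "continuous_on UNIV R" unfolding R_def
        by (intro continuous_on_mult continuous_on_power continuous_on_const r_cont)
    have R_pos: "0 < R x" for x unfolding R_def using \<kappa> r_pos[of x] by simp
    have "\<mu>2 = density \<mu>1 (\<lambda>x. ennreal (R x))"
    proof (rule fh.regular_measure_eq_density[OF reg2 reg1 R_cont R_pos])
      fix h a b assume h: "h \<in> funs" and ab: "0 < (a::real)" "0 < b" and bd: "\<And>x. 0 < h x \<Longrightarrow> a \<le> R x \<and> R x \<le> b"
      obtain t where t: "tvars t \<subseteq> {..<n}" "h = (\<lambda>x. teval t (p x))" using h by (rule funsE)
      obtain c1 b1' where c1: "(\<lambda>N. prim_sum u1 t N / real N ^ D) \<longlonglongrightarrow> c1"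
        using lims[OF D2 u1 t(1)] by blast
      obtain c2 b2' where c2: "(\<lambda>N. prim_sum u2 t N / real N ^ D) \<longlonglongrightarrow> c2"
        using lims[OF D2 u2 t(1)] by blast
      have int: "(\<integral>x. h x \<partial>\<mu>1) = c1 / b1" "(\<integral>x. h x \<partial>\<mu>2) = c2 / b2"
        using rep1[OF funsI[OF t(1)]] rep2[OF funsI[OF t(1)]] cesaro_state_infinite[OF u1 t(1) D1 c1 b1 e1]
          cesaro_state_infinite[OF u2 t(1) D1 c2 b2 e2] unfolding t(2) by simp_all
      \<comment> \<open>Translates bounds for the density \<open>R\<close> into bounds for the ratio
        \<open>r\<close> of the units.\<close>
      define \<alpha> \<beta> where "\<alpha> = root (D + 1) (a / \<kappa>)" and "\<beta> = root (D + 1) (b / \<kappa>)"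
      have \<alpha>: "0 < \<alpha>" "\<alpha> ^ (D + 1) = a / \<kappa>" and \<beta>: "0 < \<beta>" "\<beta> ^ (D + 1) = b / \<kappa>"
        unfolding \<alpha>_def \<beta>_def using ab \<kappa> by (simp_all del: power_Suc)
      have rb: "\<alpha> \<le> r x" "r x \<le> \<beta>" if "0 < h x" for x
      proof -
        have "a / \<kappa> \<le> r x ^ (D + 1)" "r x ^ (D + 1) \<le> b / \<kappa>"
          using bd[OF that] \<kappa> unfolding R_def by (simp_all add: divide_le_eq le_divide_eq mult.commute del: power_Suc)
        then have "\<alpha> ^ (D + 1) \<le> r x ^ (D + 1)" "r x ^ (D + 1) \<le> \<beta> ^ (D + 1)" unfolding \<alpha>(2) \<beta>(2) by simp_all
        then show "\<alpha> \<le> r x" "r x \<le> \<beta>"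
          using power_le_imp_le_base[of \<alpha> D "r x"] power_le_imp_le_base[of "r x" D \<beta>] r_pos[of x] \<beta>(1) by simp_all
      qed
      have le1: "teval u1 (p x) \<le> \<beta> * teval u2 (p x)" if "0 < teval t (p x)" for x
        using rb(2)[of x] that unfolding t(2) by (intro up) blast
      have le2: "teval u2 (p x) \<le> 1 / \<alpha> * teval u1 (p x)" if "0 < teval t (p x)" for x
        using rb(1)[of x] that \<alpha>(1) unfolding t(2) by (intro low) blast+
      have "c2 \<le> \<beta> ^ (D + 1) * c1"
        by (rule prim_limit_le[OF u1 u2 \<beta>(1) b1(3) b2(3) le1 c1 c2])
      then have "c2 / b2 \<le> b / \<kappa> * c1 / b2" unfolding \<beta>(2) using b2(2) by (intro divide_right_mono) auto
      also have "\<dots> = b * (c1 / b1)" unfolding \<kappa>_def using b1(2) b2(2) by (simp add: field_simps)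
      finally have 1: "c2 / b2 \<le> b * (c1 / b1)" .
      have \<alpha>': "0 < 1 / \<alpha>" using \<alpha> by simp
      have "c1 \<le> (1 / \<alpha>) ^ (D + 1) * c2"
        by (rule prim_limit_le[OF u2 u1 \<alpha>' b2(3) b1(3) le2 c2 c1])
      also have "(1 / \<alpha>) ^ (D + 1) = \<kappa> / a" unfolding power_one_over \<alpha>(2) by simp
      finally have "a * (c1 / b1) \<le> a * ((\<kappa> / a * c2) / b1)"
        using ab b1(2) by (intro mult_left_mono divide_right_mono) auto
      also have "\<dots> = c2 / b2" unfolding \<kappa>_def using b1(2) b2(2) ab by (simp add: field_simps)
      finally show "(\<integral>x. h x \<partial>\<mu>2) \<le> b * (\<integral>x. h x \<partial>\<mu>1) \<and> a * (\<integral>x. h x \<partial>\<mu>1) \<le> (\<integral>x. h x \<partial>\<mu>2)"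
        unfolding int using 1 by blast
    qed
    moreover have "R = (\<lambda>x. \<kappa> * (teval u1 (p x) / teval u2 (p x)) ^ (D - 1 + 2))"
      unfolding R_def r_def using D1 by (intro ext) simp
    ultimately show thesis using dim R_cont R_pos norm \<kappa> D2 by (intro that[of "D - 1" R]) auto
  qed
qed

end

theorem theorem6p1:
  fixes H :: "('x::t2_space \<Rightarrow> real) set"
    and A :: "('x \<Rightarrow> real) hoop"
    and u1 u2 :: "'x \<Rightarrow> real"
    and e1 e2 :: "nat \<Rightarrow> ('x \<Rightarrow> real) \<Rightarrow> real"
    and \<mu>1 \<mu>2 :: "'x measure"
  defines "A \<equiv> restrict_hoop cont_hoop H"
  assumes compact: "compact (UNIV :: 'x set)"
    and sub: "subhoop H cont_hoop"
    and nonzero: "H \<noteq> {\<lambda>x. 0}"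
    and sep: "separating H"
    and fp: "finitely_presentable A"
    and unit1: "hoop_unit A u1"
    and unit2: "hoop_unit A u2"
    and enum1: "denominator_enumeration A u1 e1"
    and enum2: "denominator_enumeration A u2 e2"
    and reg1: "regular_borel_measure \<mu>1"
    and reg2: "regular_borel_measure \<mu>2"
    and rep1: "\<forall>h\<in>H. cesaro_state A u1 e1 h = (\<integral>x. h x \<partial>\<mu>1)"
    and rep2: "\<forall>h\<in>H. cesaro_state A u2 e2 h = (\<integral>x. h x \<partial>\<mu>2)"
  shows "absolutely_continuous \<mu>1 \<mu>2 \<and> absolutely_continuous \<mu>2 \<mu>1 \<and>
    (\<exists>d::nat. has_topological_dimension (euclidean :: 'x topology) (int d) \<and>
      (d = 0 \<longrightarrow> \<mu>2 = density \<mu>1 (\<lambda>x. ennreal (u1 x / u2 x))) \<and>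
      (d \<ge> 1 \<longrightarrow>
        (let C = inverse (\<integral>x. u1 x ^ (d + 2) / u2 x ^ (d + 1) \<partial>\<mu>1)
         in \<mu>2 = density \<mu>1 (\<lambda>x. ennreal (C * (u1 x / u2 x) ^ (d + 2))))))"
proof (rule finitely_presentable_term_presentation[OF sub fp[unfolded A_def]])
  fix n E and p :: "'x \<Rightarrow> nat \<Rightarrow> real"
  assume E: "finite E" "\<And>s t. (s, t) \<in> E \<Longrightarrow> tvars s \<subseteq> {..<n} \<and> tvars t \<subseteq> {..<n}"
    and p: "\<And>x i. 0 \<le> p x i" "\<And>x i. i \<ge> n \<Longrightarrow> p x i = 0"
    and H: "H = {\<lambda>x. teval t (p x) |t. tvars t \<subseteq> {..<n}}"
    and rel: "\<And>x s t. (s, t) \<in> E \<Longrightarrow> teval s (p x) = teval t (p x)"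
    and complete: "\<And>w s t. (\<And>i. 0 \<le> w i) \<Longrightarrow> (\<And>s t. (s, t) \<in> E \<Longrightarrow> teval s w = teval t w) \<Longrightarrow>
      tvars s \<subseteq> {..<n} \<Longrightarrow> tvars t \<subseteq> {..<n} \<Longrightarrow> (\<And>x. teval s (p x) = teval t (p x)) \<Longrightarrow>
      teval s w = teval t w"
  have sepH: "\<exists>t. tvars t \<subseteq> {..<n} \<and> teval t (p x) = 0 \<and> teval t (p y) \<noteq> 0" if xy: "x \<noteq> y" for x y
  proof -
    obtain h where "h \<in> H" "h x = 0" "h y \<noteq> 0" using sep xy unfolding separating_def by blast
    then show ?thesis unfolding H by blast
  qed
  interpret tp: term_presentation n E p
  proof
    show "continuous_on UNIV (\<lambda>x. p x i)" for i
    proof (cases "i < n")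
      case True
      then have "(\<lambda>x. teval (TVar i) (p x)) \<in> H" unfolding H mem_Collect_eq using True
          by (intro exI[of _ "TVar i"]) simp
      then show ?thesis using sub by (auto simp: subhoop_def cont_hoop_def)
    next
      case False
      then show ?thesis using p(2) by simp
    qed
    show "\<exists>i. p x i \<noteq> 0" for x
    \<comment> \<open>If all generators vanish at \<open>x\<close>, so does every function of
      \<open>H\<close>. Separation then leaves no point other than \<open>x\<close>, and
      \<open>H\<close> is zero.\<close>
    proof (rule ccontr)
      assume "\<not> ?thesis"
      then have px: "p x = (\<lambda>i. 0 * p x i)" by auto
      have tz: "teval t (p x) = 0" for t by (subst px, subst teval_scale) simp_all
      have yx: "y = x" for y
      proof (rule ccontr)
        assume "y \<noteq> x"
        from sepH[OF this] tz show False by simp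
      qed
      have "h = (\<lambda>x. 0)" if h: "h \<in> H" for h
      proof
        fix y
        obtain t where "h = (\<lambda>x. teval t (p x))" using h unfolding H mem_Collect_eq by (elim exE conjE)
        then show "h y = 0" using tz yx[of y] by simp
      qed
      moreover have "(\<lambda>x. 0) \<in> H" using sub by (simp add: subhoop_def cont_hoop_def)
      ultimately have "H = {\<lambda>x. 0}" by blast
      then show False using nonzero by simp
    qed
  qed (fact compact E p rel complete sepH)+
  have funs: "tp.funs = H" unfolding tp.funs_def H ..
  have A: "A = tp.A" unfolding A_def funs ..
  obtain v1 k1 where v1: "u1 = (\<lambda>x. teval v1 (p x))" "tp.is_unit v1 k1"
    using tp.hoop_unit_is_unit[OF unit1[unfolded A]] by blast
  obtain v2 k2 where v2: "u2 = (\<lambda>x. teval v2 (p x))" "tp.is_unit v2 k2"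
    using tp.hoop_unit_is_unit[OF unit2[unfolded A]] by blast
  have sets: "sets \<mu>1 = sets borel" "sets \<mu>2 = sets borel"
    using reg1 reg2 by (auto simp: regular_borel_measure_def)
  have upos: "0 < u1 x" "0 < u2 x" for x
    using tp.unit_pos_at[OF v1(2)] tp.unit_pos_at[OF v2(2)] unfolding v1(1) v2(1) by auto
  have meas: "f \<in> borel_measurable \<mu>1" "f \<in> borel_measurable \<mu>2" if "continuous_on UNIV f" for f :: "'x \<Rightarrow> real"
    using borel_measurable_continuous_onI[OF that] sets by (simp_all cong: measurable_cong_sets)
  show ?thesis
  proof (rule tp.cesaro_measures[OF v1(2) v2(2) enum1[unfolded A v1(1)] enum2[unfolded A v2(1)] reg1 reg2])
    show "cesaro_state tp.A (\<lambda>x. teval v1 (p x)) e1 h = (\<integral>x. h x \<partial>\<mu>1)" if "h \<in> tp.funs" for h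
      using rep1 that unfolding A v1(1) funs by blast
    show "cesaro_state tp.A (\<lambda>x. teval v2 (p x)) e2 h = (\<integral>x. h x \<partial>\<mu>2)" if "h \<in> tp.funs" for h
      using rep2 that unfolding A v2(1) funs by blast
    fix d :: nat and R :: "'x \<Rightarrow> real"
    assume dim: "has_topological_dimension (euclidean :: 'x topology) (int d)"
      and R: "continuous_on UNIV R" "\<And>x. 0 < R x" and dens: "\<mu>2 = density \<mu>1 (\<lambda>x. ennreal (R x))"
      and d0: "d = 0 \<Longrightarrow> R = (\<lambda>x. teval v1 (p x) / teval v2 (p x))"
      and d1: "d \<ge> 1 \<Longrightarrow> \<exists>C>0. R = (\<lambda>x. C * (teval v1 (p x) / teval v2 (p x)) ^ (d + 2))"
      and norm: "d \<ge> 1 \<Longrightarrow> (\<integral>x. teval v2 (p x) \<partial>\<mu>2) = 1"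
    have mR[measurable]: "R \<in> borel_measurable \<mu>1" by (rule meas(1)[OF R(1)])
    have ac1: "absolutely_continuous \<mu>1 \<mu>2"
      unfolding dens by (rule absolutely_continuousI_density) measurable
    \<comment> \<open>As \<open>R\<close> is positive, its inverse is a density in the other
      direction.\<close>
    have "\<mu>1 = density \<mu>1 (\<lambda>x. ennreal (R x) * ennreal (inverse (R x)))"
    proof -
      have "ennreal (R x) * ennreal (inverse (R x)) = 1" for x
        using R(2)[of x] by (simp add: ennreal_mult'[symmetric] less_imp_le less_imp_neq[symmetric])
      then show ?thesis by (simp add: density_1)
    qed
    also have "\<dots> = density \<mu>2 (\<lambda>x. ennreal (inverse (R x)))"
      unfolding dens by (rule density_density_eq[symmetric]) measurable
    finally have inv: "\<mu>1 = density \<mu>2 (\<lambda>x. ennreal (inverse (R x)))" .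
    have [measurable]: "R \<in> borel_measurable \<mu>2" by (rule meas(2)[OF R(1)])
    have ac2: "absolutely_continuous \<mu>2 \<mu>1"
      by (subst inv) (rule absolutely_continuousI_density, measurable)
    have case0: "\<mu>2 = density \<mu>1 (\<lambda>x. ennreal (u1 x / u2 x))" if "d = 0"
      using dens unfolding d0[OF that] v1(1) v2(1) .
    have case1: "\<mu>2 = density \<mu>1 (\<lambda>x. ennreal (inverse (\<integral>x. u1 x ^ (d + 2) / u2 x ^ (d + 1) \<partial>\<mu>1) * (u1 x
        / u2 x) ^ (d + 2)))"
      if pos: "d \<ge> 1"
    proof -
      obtain C where C: "C > 0" "R = (\<lambda>x. C * (u1 x / u2 x) ^ (d + 2))"
        using d1[OF pos] unfolding v1(1) v2(1) by blast
      \<comment> \<open>Integrating \<open>u2\<close> against the density formula determines the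
        constant; the factor \<open>u2\<close> lowers the power in the denominator by one.\<close>
      have "1 = (\<integral>x. u2 x \<partial>\<mu>2)" using norm[OF pos] unfolding v2(1) by simp
      also have "\<dots> = (\<integral>x. R x *\<^sub>R u2 x \<partial>\<mu>1)"
        unfolding dens using meas(1)[OF tp.teval_cont[of v2]] R(2) mR
        by (intro integral_density) (auto simp: v2(1) less_imp_le)
      also have "\<dots> = (\<integral>x. C * (u1 x ^ (d + 2) / u2 x ^ (d + 1)) \<partial>\<mu>1)"
      proof (rule Bochner_Integration.integral_cong[OF refl])
        fix x
        have "u2 x \<noteq> 0" using upos(2)[of x] by simp
        then show "R x *\<^sub>R u2 x = C * (u1 x ^ (d + 2) / u2 x ^ (d + 1))"
          unfolding C(2) by (simp add: power_divide)
      qed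
      also have "\<dots> = C * (\<integral>x. u1 x ^ (d + 2) / u2 x ^ (d + 1) \<partial>\<mu>1)" by (rule integral_mult_right_zero)
      finally have "C = inverse (\<integral>x. u1 x ^ (d + 2) / u2 x ^ (d + 1) \<partial>\<mu>1)"
        by (intro inverse_unique[symmetric]) (simp add: mult.commute)
      then show ?thesis using dens unfolding C(2) by simp
    qed
    show ?thesis unfolding Let_def using ac1 ac2 dim case0 case1 by blast
  qed
qed

end
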